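(* Let $\alpha\in L^\infty(0,1)$ be real-valued with $0\le 2a\le\alpha(x)\le 2b<+\infty$, let $A(\alpha)$ be the damped wave operator with Dirichlet boundary conditions, with eigenvalues $\{\lambda_j\}_{j\in J}$, $J=\mathbb{Z}\setminus\{0\}$, and let $\mathbf{M}_n(\alpha)$ (infinite matrices) and $R_n(\alpha)$ (operators on $L^2(0,1)$) be as defined in the context. Then for $n=1,2,\dots$, $$\mathrm{trace}(\mathbf{M}_n(\alpha))=\mathrm{trace}(R_{n-1}(\alpha))=\sum_{j\in J}\lambda_j^{-n},$$ where for $n=1$ the sum is understood as the regularized sum $\lim_{N\to+\infty}\big(\sum_{j=-N}^{-1}+\sum_{j=1}^{N}\big)\lambda_j^{-1}$.
   Context: $-\Delta_D=T^*T$ (with $T=T_{\min}$) is the Dirichlet Laplacian: $f\mapsto-f''$ on all $f\in L^2(0,1)$ with $f,f'\in AC([0,1])$, $f(0)=f(1)=0$, $f''\in L^2(0,1)$. It has eigenvalues $\mu_\ell=\ell^2\pi^2$ and orthonormal eigenfunctions $\phi_\ell(x)=\sqrt2\sin\ell\pi x$, $\ell\ge1$. The damped wave operator on $L^2(0,1)^2$ is $A(\alpha)=\begin{pmatrix}0& I\\ \Delta_D&-\alpha\end{pmatrix}$ with natural domain $\mathrm{dom}(\Delta_D)\times L^2(0,1)$. Its eigenvalues are the $\lambda\in\mathbb{C}$ for which $y''-\lambda\alpha y-\lambda^2y=0$ has a nonzero solution $y\in\mathrm{dom}(\Delta_D)$. They are counted with algebraic multiplicity and labeled by $J=\mathbb{Z}\setminus\{0\}$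 so that $\cdots\le\mathrm{Im}\,\lambda_{-2}\le\mathrm{Im}\,\lambda_{-1}\le\mathrm{Im}\,\lambda_1\le\mathrm{Im}\,\lambda_2\le\cdots$ and $\mathrm{Im}\,\lambda_{-j}=-\mathrm{Im}\,\lambda_j$, with $\lambda_{-j}=\overline{\lambda_j}$ for non-real eigenvalues. The operators $R_n(\alpha)$ on $L^2(0,1)$ are: $R_0(\alpha)=-\alpha(T^*T)^{-1}$, $R_1(\alpha)=-2(T^*T)^{-1}+\alpha(T^*T)^{-1}\alpha(T^*T)^{-1}$, $R_n(\alpha)=-R_{n-2}(\alpha)(T^*T)^{-1}-R_{n-1}(\alpha)\alpha(T^*T)^{-1}$ for $n\ge2$, where $\alpha$ denotes the multiplication operator; equivalently $R_n(\alpha)=\frac1{n!}R^{(n)}(0)$ with $R(\zeta)=-(2\zeta+\alpha)(T^*T+\zeta^2+\zeta\alpha)^{-1}$. The infinite matrices (operators on $\ell^2$) are $$(\mathbf{M}_1(\alpha))_{ij}=-\mu_j^{-1}\int_0^1\alpha(x)\phi_i(x)\phi_j(x)\,dx\quad(i,j\ge1),\qquad \mathbf{M}_2(\alpha)=2\mathbf{M}_1(1)+\mathbf{M}_1(\alpha)^2,$$ $$\mathbf{M}_n(\alpha)=\mathbf{M}_{n-1}(\alpha)\mathbf{M}_1(\alpha)+\mathbf{M}_{n-2}(\alpha)\mathbf{M}_1(1)\quad(n\ge3),$$ where $\mathbf{M}_1(1)$ is $\mathbf{M}_1$ of the constant function $1$. *)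

theory Defs
  imports "HOL-Analysis.Analysis"
begin

section \<open>Complex L2 spaces, trace class operators and traces\<close>

text \<open>
  Elements of the Hilbert space L2(M) are represented by square integrable functions; two functions
  that agree almost everywhere represent the same element. Sequence spaces are obtained by taking
  a counting measure for M.
\<close>

definition L2 :: "'a measure \<Rightarrow> ('a \<Rightarrow> complex) set" where
  "L2 M = {f \<in> borel_measurable M. integrable M (\<lambda>x. (norm (f x))\<^sup>2)}"

definition l2_inner :: "'a measure \<Rightarrow> ('a \<Rightarrow> complex) \<Rightarrow> ('a \<Rightarrow> complex) \<Rightarrow> complex" where
  "l2_inner M f g = (LINT x|M. f x * cnj (g x))"

definition l2_norm :: "'a measure \<Rightarrow> ('a \<Rightarrow> complex) \<Rightarrow> real" where
  "l2_norm M f = sqrt (LINT x|M. (norm (f x))\<^sup>2)"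

text \<open>
  Orthonormal bases are indexed by the natural numbers, which is adequate for the separable
  infinite-dimensional spaces considered here.
\<close>

definition orthonormal_basis :: "'a measure \<Rightarrow> (nat \<Rightarrow> 'a \<Rightarrow> complex) \<Rightarrow> bool" where
  "orthonormal_basis M e \<longleftrightarrow>
     (\<forall>k. e k \<in> L2 M) \<and>
     (\<forall>j k. l2_inner M (e j) (e k) = (if j = k then 1 else 0)) \<and>
     (\<forall>f\<in>L2 M. (\<forall>k. l2_inner M f (e k) = 0) \<longrightarrow> (AE x in M. f x = 0))"

text \<open>
  Linearity and boundedness together imply that the operator respects equality almost everywhere.
\<close>

definition bounded_operator :: "'a measure \<Rightarrow> (('a \<Rightarrow> complex) \<Rightarrow> 'a \<Rightarrow> complex) \<Rightarrow> bool" where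
  "bounded_operator M T \<longleftrightarrow>
     (\<forall>f\<in>L2 M. T f \<in> L2 M) \<and>
     (\<forall>f\<in>L2 M. \<forall>g\<in>L2 M. \<forall>c. AE x in M. T (\<lambda>x. c * f x + g x) x = c * T f x + T g x) \<and>
     (\<exists>C. \<forall>f\<in>L2 M. l2_norm M (T f) \<le> C * l2_norm M f)"

text \<open>
  On a Hilbert space the trace class operators are the nuclear ones: norm-convergent sums of rank
  one operators with summable norms.
\<close>

definition trace_class :: "'a measure \<Rightarrow> (('a \<Rightarrow> complex) \<Rightarrow> 'a \<Rightarrow> complex) \<Rightarrow> bool" where
  "trace_class M T \<longleftrightarrow> bounded_operator M T \<and>
     (\<exists>u v. (\<forall>k::nat. u k \<in> L2 M \<and> v k \<in> L2 M) \<and>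
        summable (\<lambda>k. l2_norm M (u k) * l2_norm M (v k)) \<and>
        (\<forall>f\<in>L2 M.
           (\<lambda>N. l2_norm M (\<lambda>x. T f x - (\<Sum>k<N. l2_inner M f (u k) * v k x))) \<longlonglongrightarrow> 0))"

definition has_trace :: "'a measure \<Rightarrow> (('a \<Rightarrow> complex) \<Rightarrow> 'a \<Rightarrow> complex) \<Rightarrow> complex \<Rightarrow> bool" where
  "has_trace M T t \<longleftrightarrow> trace_class M T \<and>
     (\<forall>e. orthonormal_basis M e \<longrightarrow> ((\<lambda>k. l2_inner M (T (e k)) (e k)) has_sum t) UNIV)"


section \<open>The Dirichlet Laplacian on the unit interval\<close>

abbreviation unit_lebesgue :: "real measure" where
  "unit_lebesgue \<equiv> lebesgue_on {0<..<1}"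

text \<open>
  Absolute continuity of functions on [0,1]; the library constant \<open>absolutely_continuous\<close>
  concerns measures.
\<close>

definition AC01 :: "(real \<Rightarrow> complex) \<Rightarrow> bool" where
  "AC01 f \<longleftrightarrow> (\<forall>\<epsilon>>0. \<exists>\<delta>>0. \<forall>D S. D division_of S \<and> S \<subseteq> {0..1} \<and> (\<Sum>K\<in>D. Sup K - Inf K) < \<delta> \<longrightarrow>
     (\<Sum>K\<in>D. norm (f (Sup K) - f (Inf K))) < \<epsilon>)"

text \<open>
  The graph of the Laplacian: \<open>f\<close> belongs to its domain and is mapped to \<open>g\<close>. Here \<open>u\<close> is the
  representative of \<open>f\<close> that is absolutely continuous on [0,1], and \<open>u'\<close> is its derivative.
\<close>

definition dirichlet_laplacian_graph :: "(real \<Rightarrow> complex) \<Rightarrow> (real \<Rightarrow> complex) \<Rightarrow> bool" where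
  "dirichlet_laplacian_graph f g \<longleftrightarrow> f \<in> L2 unit_lebesgue \<and> g \<in> L2 unit_lebesgue \<and>
     (\<exists>u u'. (AE x in unit_lebesgue. f x = u x) \<and> AC01 u \<and> AC01 u' \<and> u 0 = 0 \<and> u 1 = 0 \<and>
        (\<forall>x\<in>{0..1}. (u has_vector_derivative u' x) (at x within {0..1})) \<and>
        (AE x in unit_lebesgue. (u' has_vector_derivative g x) (at x)))"

definition dirichlet_dom :: "(real \<Rightarrow> complex) set" where
  "dirichlet_dom = {f. \<exists>g. dirichlet_laplacian_graph f g}"

text \<open>The graph determines the value, and the preimage, up to a null set.\<close>

definition dirichlet_laplacian :: "(real \<Rightarrow> complex) \<Rightarrow> real \<Rightarrow> complex" where
  "dirichlet_laplacian f = (SOME g. dirichlet_laplacian_graph f g)"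

text \<open>The inverse of the negative Laplacian.\<close>

definition neg_laplacian_inv :: "(real \<Rightarrow> complex) \<Rightarrow> real \<Rightarrow> complex" where
  "neg_laplacian_inv g = (SOME f. dirichlet_laplacian_graph f (\<lambda>x. - g x))"

definition mu :: "nat \<Rightarrow> real" where
  "mu l = (real l)\<^sup>2 * pi\<^sup>2"

definition phi :: "nat \<Rightarrow> real \<Rightarrow> real" where
  "phi l x = sqrt 2 * sin (real l * pi * x)"


section \<open>The damped wave operator and its eigenvalues\<close>

type_synonym l2_pair = "(real \<Rightarrow> complex) \<times> (real \<Rightarrow> complex)"

definition damped_wave_dom :: "l2_pair set" where
  "damped_wave_dom = dirichlet_dom \<times> L2 unit_lebesgue"

definition damped_wave :: "(real \<Rightarrow> real) \<Rightarrow> l2_pair \<Rightarrow> l2_pair" where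
  "damped_wave \<alpha> = (\<lambda>(u, v). (v, \<lambda>x. dirichlet_laplacian u x - of_real (\<alpha> x) * v x))"

definition damped_wave_eigenvalue :: "(real \<Rightarrow> real) \<Rightarrow> complex \<Rightarrow> bool" where
  "damped_wave_eigenvalue \<alpha> z \<longleftrightarrow>
     (\<exists>y\<in>dirichlet_dom. \<not> (AE x in unit_lebesgue. y x = 0) \<and>
        (AE x in unit_lebesgue.
           dirichlet_laplacian y x - z * of_real (\<alpha> x) * y x - z\<^sup>2 * y x = 0))"

text \<open>The kernel of the k-th power of \<open>A(\<alpha>) - z\<close>, with the natural domain of that power.\<close>

primrec damped_wave_ker_pow :: "(real \<Rightarrow> real) \<Rightarrow> complex \<Rightarrow> nat \<Rightarrow> l2_pair set" where
  "damped_wave_ker_pow \<alpha> z 0 =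
     {p. fst p \<in> L2 unit_lebesgue \<and> snd p \<in> L2 unit_lebesgue \<and>
         (AE x in unit_lebesgue. fst p x = 0 \<and> snd p x = 0)}"
| "damped_wave_ker_pow \<alpha> z (Suc k) =
     {p \<in> damped_wave_dom.
        ((\<lambda>x. fst (damped_wave \<alpha> p) x - z * fst p x),
         (\<lambda>x. snd (damped_wave \<alpha> p) x - z * snd p x)) \<in> damped_wave_ker_pow \<alpha> z k}"

text \<open>
  Algebraic multiplicity: the dimension of the generalized eigenspace, taken modulo equality almost
  everywhere, as the largest size of a linearly independent family.
\<close>

definition algebraic_multiplicity :: "(real \<Rightarrow> real) \<Rightarrow> complex \<Rightarrow> enat" where
  "algebraic_multiplicity \<alpha> z =
     Sup {enat m | m. \<exists>p :: nat \<Rightarrow> l2_pair.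
        (\<forall>i<m. p i \<in> (\<Union>k. damped_wave_ker_pow \<alpha> z k)) \<and>
        (\<forall>c :: nat \<Rightarrow> complex.
           (AE x in unit_lebesgue.
              (\<Sum>i<m. c i * fst (p i) x) = 0 \<and> (\<Sum>i<m. c i * snd (p i) x) = 0) \<longrightarrow>
           (\<forall>i<m. c i = 0))}"

definition eigenvalue_labelling :: "(real \<Rightarrow> real) \<Rightarrow> (int \<Rightarrow> complex) \<Rightarrow> bool" where
  "eigenvalue_labelling \<alpha> lam \<longleftrightarrow>
     lam ` (UNIV - {0}) = {z. damped_wave_eigenvalue \<alpha> z} \<and>
     (\<forall>z. damped_wave_eigenvalue \<alpha> z \<longrightarrow>
        finite {j. j \<noteq> 0 \<and> lam j = z} \<and>
        enat (card {j. j \<noteq> 0 \<and> lam j = z}) = algebraic_multiplicity \<alpha> z) \<and>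
     (\<forall>j k. j \<noteq> 0 \<and> k \<noteq> 0 \<and> j \<le> k \<longrightarrow> Im (lam j) \<le> Im (lam k)) \<and>
     (\<forall>j. j \<noteq> 0 \<longrightarrow> Im (lam (- j)) = - Im (lam j)) \<and>
     (\<forall>j. j \<noteq> 0 \<and> lam j \<notin> \<real> \<longrightarrow> lam (- j) = cnj (lam j))"


section \<open>The operators and the infinite matrices\<close>

fun R_op :: "(real \<Rightarrow> real) \<Rightarrow> nat \<Rightarrow> (real \<Rightarrow> complex) \<Rightarrow> real \<Rightarrow> complex" where
  "R_op \<alpha> 0 f = (\<lambda>x. - of_real (\<alpha> x) * neg_laplacian_inv f x)"
| "R_op \<alpha> (Suc 0) f =
     (\<lambda>x. - 2 * neg_laplacian_inv f x +
          of_real (\<alpha> x) * neg_laplacian_inv (\<lambda>y. of_real (\<alpha> y) * neg_laplacian_inv f y) x)"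
| "R_op \<alpha> (Suc (Suc n)) f =
     (\<lambda>x. - R_op \<alpha> n (neg_laplacian_inv f) x -
          R_op \<alpha> (Suc n) (\<lambda>y. of_real (\<alpha> y) * neg_laplacian_inv f y) x)"

text \<open>Rows and columns of the infinite matrices are indexed from 1; the values at 0 are unused.\<close>

type_synonym inf_matrix = "nat \<Rightarrow> nat \<Rightarrow> real"

definition inf_matrix_mult :: "inf_matrix \<Rightarrow> inf_matrix \<Rightarrow> inf_matrix" where
  "inf_matrix_mult A B = (\<lambda>i j. \<Sum>\<^sub>\<infinity>k\<in>{1..}. A i k * B k j)"

definition M1_matrix :: "(real \<Rightarrow> real) \<Rightarrow> inf_matrix" where
  "M1_matrix \<alpha> = (\<lambda>i j. - inverse (mu j) * (LINT x|unit_lebesgue. \<alpha> x * phi i x * phi j x))"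

text \<open>The index 0 is deliberately left out.\<close>

fun M_matrix :: "(real \<Rightarrow> real) \<Rightarrow> nat \<Rightarrow> inf_matrix" where
  "M_matrix \<alpha> (Suc 0) = M1_matrix \<alpha>"
| "M_matrix \<alpha> (Suc (Suc 0)) =
     (\<lambda>i j. 2 * M1_matrix (\<lambda>_. 1) i j + inf_matrix_mult (M1_matrix \<alpha>) (M1_matrix \<alpha>) i j)"
| "M_matrix \<alpha> (Suc (Suc (Suc n))) =
     (\<lambda>i j. inf_matrix_mult (M_matrix \<alpha> (Suc (Suc n))) (M1_matrix \<alpha>) i j +
            inf_matrix_mult (M_matrix \<alpha> (Suc n)) (M1_matrix (\<lambda>_. 1)) i j)"

abbreviation ell2_measure :: "nat measure" where
  "ell2_measure \<equiv> count_space {1..}"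

definition matrix_operator :: "inf_matrix \<Rightarrow> (nat \<Rightarrow> complex) \<Rightarrow> nat \<Rightarrow> complex" where
  "matrix_operator A f = (\<lambda>i. \<Sum>\<^sub>\<infinity>j\<in>{1..}. of_real (A i j) * f j)"

end

theory Submission
  imports Defs "HOL-Complex_Analysis.Complex_Analysis"
begin

text \<open>
  Let \<open>y(\<zeta>, \<cdot>)\<close> solve \<open>y'' = (\<zeta>\<^sup>2 + \<zeta> \<alpha>) y\<close>, \<open>y(\<zeta>, 0) = 0\<close>, \<open>y'(\<zeta>, 0) = 1\<close>, and put \<open>D(\<zeta>) = y(\<zeta>, 1)\<close>. This entire
  function of exponential type vanishes exactly at the eigenvalues of \<open>A(\<alpha>)\<close>, and the orders of the
  zeros are the algebraic multiplicities, because the Taylor coefficients of \<open>(y, \<zeta> y)\<close> in \<open>\<zeta>\<close> form Jordan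
  chains. Expressing the Green kernel of \<open>T\<^sup>*T + \<zeta>\<^sup>2 + \<zeta> \<alpha>\<close> by solutions, the trace of \<open>R(\<zeta>)\<close> is \<open>- D'(\<zeta>) / D(\<zeta>)\<close>;
  comparing Taylor coefficients at \<open>0\<close>, and expanding traces in the sine basis for the matrices, it
  remains to show that the coefficients of \<open>- D' / D\<close> are the reciprocal power sums of the zeros. By the
  Borel--Caratheodory inequality this holds for sums over large discs, up to the linear term in the
  exponential factor of the Hadamard product. That term vanishes because \<open>D(-x) \<le> D(x) \<le> D(-x - 2b)\<close>
  for large \<open>x\<close> while all zeros lie in a vertical strip. The strip also makes the sums converge absolutely for
  \<open>n \<ge> 2\<close>, and the pairs \<open>1/\<lambda>\<^sub>j + 1/\<lambda>\<^sub>-\<^sub>j\<close> for \<open>n = 1\<close>.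
\<close>

section \<open>Square integrable functions\<close>

text \<open>The diagonal of a square is a null set, so the trace of an integral operator cannot be
  read from a kernel known up to null sets. Two choices answer this. \<alpha> is replaced by a
  representative \<beta> that is bounded at every point, and every \<open>R_op\<close> is factored
  through the Green operator, whose sine expansion converges everywhere, the diagonal included; this
  gives an explicit nuclear representation. Up to the traces \<zeta> is a formal variable: solutions
  and kernels are power series whose coefficients are bounded measurable functions. No resolvent
  appears as an operator-valued holomorphic function, and analysis in \<zeta> begins only with D.
  The coefficients for n \<ge> 2 do not see a linear exponential factor beside the product over the
  zeros; n = 1 is exactly the question whether that factor is trivial, and no growth estimate
  decides it. The comparison on the real axis settles the real part of the exponent, the pairing of
  the labels j and -j its imaginary part.\<close>

lemma borel_measurable_cnj [measurable (raw)]: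
  "f \<in> borel_measurable M \<Longrightarrow> (\<lambda>x. cnj (f x)) \<in> borel_measurable M"
  by (rule measurable_compose[of f M borel cnj]) (auto intro!: borel_measurable_continuous_onI continuous_intros)

lemma L2_measurable [measurable_dest]: "f \<in> L2 M \<Longrightarrow> f \<in> borel_measurable M"
  by (simp add: L2_def)

lemma L2_sq_integrable: "f \<in> L2 M \<Longrightarrow> integrable M (\<lambda>x. (norm (f x))\<^sup>2)"
  by (simp add: L2_def)

lemma L2_norm_mult_integrable:
  assumes "f \<in> L2 M" "g \<in> L2 M"
  shows "integrable M (\<lambda>x. norm (f x) * norm (g x))"
proof (rule Bochner_Integration.integrable_bound)
  show "integrable M (\<lambda>x. (norm (f x))\<^sup>2 + (norm (g x))\<^sup>2)"
    using assms by (intro Bochner_Integration.integrable_add L2_sq_integrable)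
  show "(\<lambda>x. norm (f x) * norm (g x)) \<in> borel_measurable M"
    using assms by measurable
  have "norm (f x) * norm (g x) \<le> (norm (f x))\<^sup>2 + (norm (g x))\<^sup>2" for x
    using sum_squares_bound[of "norm (f x)" "norm (g x)"] mult_nonneg_nonneg[of "norm (f x)" "norm (g x)"]
      norm_ge_zero[of "f x"] norm_ge_zero[of "g x"] by linarith
  then show "AE x in M. norm (norm (f x) * norm (g x)) \<le> norm ((norm (f x))\<^sup>2 + (norm (g x))\<^sup>2)"
    by auto
qed

lemma L2_mult_integrable:
  assumes "f \<in> L2 M" "g \<in> L2 M"
  shows "integrable M (\<lambda>x. f x * cnj (g x))"
proof (rule Bochner_Integration.integrable_bound[OF L2_norm_mult_integrable[OF assms]])
  show "(\<lambda>x. f x * cnj (g x)) \<in> borel_measurable M"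
    using assms(1) borel_measurable_cnj[of g M] assms(2) by measurable
qed (simp add: norm_mult)

lemma L2_zero [simp]: "(\<lambda>x. 0) \<in> L2 M"
  by (simp add: L2_def)

lemma L2_cmult: "f \<in> L2 M \<Longrightarrow> (\<lambda>x. c * f x) \<in> L2 M"
  by (auto simp: L2_def norm_mult power_mult_distrib)

lemma L2_add:
  assumes "f \<in> L2 M" "g \<in> L2 M"
  shows "(\<lambda>x. f x + g x) \<in> L2 M"
proof -
  have "integrable M (\<lambda>x. (norm (f x + g x))\<^sup>2)"
  proof (rule Bochner_Integration.integrable_bound)
    show "integrable M (\<lambda>x. 2 * (norm (f x))\<^sup>2 + 2 * (norm (g x))\<^sup>2)"
      using assms by (intro Bochner_Integration.integrable_add integrable_mult_right L2_sq_integrable)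
    show "(\<lambda>x. (norm (f x + g x))\<^sup>2) \<in> borel_measurable M"
      using assms by measurable
    have "(norm (f x + g x))\<^sup>2 \<le> 2 * (norm (f x))\<^sup>2 + 2 * (norm (g x))\<^sup>2" for x
    proof -
      have "(norm (f x + g x))\<^sup>2 \<le> (norm (f x) + norm (g x))\<^sup>2"
        by (intro power_mono norm_triangle_ineq) auto
      also have "\<dots> \<le> 2 * (norm (f x))\<^sup>2 + 2 * (norm (g x))\<^sup>2"
        using sum_squares_bound[of "norm (f x)" "norm (g x)"] by (simp add: power2_sum)
      finally show ?thesis .
    qed
    then show "AE x in M. norm ((norm (f x + g x))\<^sup>2) \<le> norm (2 * (norm (f x))\<^sup>2 + 2 * (norm (g x))\<^sup>2)"
      by auto
  qed
  then show ?thesis using assms by (auto simp: L2_def)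
qed

lemma L2_uminus: "f \<in> L2 M \<Longrightarrow> (\<lambda>x. - f x) \<in> L2 M"
  using L2_cmult[of f M "-1"] by simp

lemma L2_diff: "f \<in> L2 M \<Longrightarrow> g \<in> L2 M \<Longrightarrow> (\<lambda>x. f x - g x) \<in> L2 M"
  using L2_add[of f M "\<lambda>x. - g x"] L2_uminus[of g M] by simp

lemma L2_sum: "(\<And>k. k \<in> A \<Longrightarrow> f k \<in> L2 M) \<Longrightarrow> (\<lambda>x. \<Sum>k\<in>A. f k x) \<in> L2 M"
  by (induction A rule: infinite_finite_induct) (auto intro: L2_add)

lemma L2_of_real_norm: "f \<in> L2 M \<Longrightarrow> (\<lambda>x. of_real (norm (f x))) \<in> L2 M"
  by (auto simp: L2_def)

lemma L2_AE_cong: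
  assumes "f \<in> L2 M" "g \<in> borel_measurable M" "AE x in M. f x = g x"
  shows "g \<in> L2 M"
proof -
  have "integrable M (\<lambda>x. (norm (g x))\<^sup>2) \<longleftrightarrow> integrable M (\<lambda>x. (norm (f x))\<^sup>2)"
    using assms by (intro integrable_cong_AE) auto
  then show ?thesis using assms by (auto simp: L2_def)
qed

lemma l2_norm_nonneg [simp]: "0 \<le> l2_norm M f"
  by (simp add: l2_norm_def)

lemma l2_norm_power2: "(l2_norm M f)\<^sup>2 = (LINT x|M. (norm (f x))\<^sup>2)"
  by (simp add: l2_norm_def)

lemma l2_norm_AE_cong:
  assumes "f \<in> borel_measurable M" "g \<in> borel_measurable M" "AE x in M. f x = g x"
  shows "l2_norm M f = l2_norm M g"
  unfolding l2_norm_def using assms by (intro arg_cong[where f=sqrt] integral_cong_AE) auto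

lemma l2_inner_AE_cong:
  assumes "f \<in> borel_measurable M" "f' \<in> borel_measurable M" "AE x in M. f x = f' x"
    and "g \<in> borel_measurable M" "g' \<in> borel_measurable M" "AE x in M. g x = g' x"
  shows "l2_inner M f g = l2_inner M f' g'"
  unfolding l2_inner_def using assms borel_measurable_cnj[of g M] borel_measurable_cnj[of g' M]
  by (intro integral_cong_AE) auto

lemma l2_norm_cmult: "l2_norm M (\<lambda>x. c * f x) = norm c * l2_norm M f"
  by (simp add: l2_norm_def norm_mult power_mult_distrib real_sqrt_mult)

lemma l2_norm_zero [simp]: "l2_norm M (\<lambda>x. 0) = 0"
  by (simp add: l2_norm_def)

lemma l2_inner_self: "l2_inner M f f = of_real ((l2_norm M f)\<^sup>2)"
proof -
  have "l2_inner M f f = (LINT x|M. complex_of_real ((norm (f x))\<^sup>2))"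
    unfolding l2_inner_def by (intro Bochner_Integration.integral_cong) (auto simp: complex_norm_square simp del: of_real_power)
  then show ?thesis by (simp add: l2_norm_power2 del: of_real_power)
qed

lemma l2_inner_commute: "l2_inner M g f = cnj (l2_inner M f g)"
proof -
  have "cnj (l2_inner M f g) = (LINT x|M. cnj (f x * cnj (g x)))"
    unfolding l2_inner_def by (rule Bochner_Integration.integral_cnj[symmetric])
  then show ?thesis by (simp add: l2_inner_def mult.commute)
qed

lemma l2_inner_add_left:
  "f \<in> L2 M \<Longrightarrow> g \<in> L2 M \<Longrightarrow> h \<in> L2 M \<Longrightarrow>
   l2_inner M (\<lambda>x. f x + g x) h = l2_inner M f h + l2_inner M g h"
  by (simp add: l2_inner_def distrib_right L2_mult_integrable)

lemma l2_inner_diff_left: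
  "f \<in> L2 M \<Longrightarrow> g \<in> L2 M \<Longrightarrow> h \<in> L2 M \<Longrightarrow>
   l2_inner M (\<lambda>x. f x - g x) h = l2_inner M f h - l2_inner M g h"
  by (simp add: l2_inner_def left_diff_distrib L2_mult_integrable)

lemma l2_inner_cmult_left: "l2_inner M (\<lambda>x. c * f x) h = c * l2_inner M f h"
  by (simp add: l2_inner_def mult.assoc)

lemma l2_inner_sum_left:
  "(\<And>k. k \<in> A \<Longrightarrow> f k \<in> L2 M) \<Longrightarrow> h \<in> L2 M \<Longrightarrow>
   l2_inner M (\<lambda>x. \<Sum>k\<in>A. f k x) h = (\<Sum>k\<in>A. l2_inner M (f k) h)"
  by (simp add: l2_inner_def sum_distrib_right L2_mult_integrable)

lemma l2_inner_sum_right: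
  "(\<And>k. k \<in> A \<Longrightarrow> f k \<in> L2 M) \<Longrightarrow> h \<in> L2 M \<Longrightarrow>
   l2_inner M h (\<lambda>x. \<Sum>k\<in>A. f k x) = (\<Sum>k\<in>A. l2_inner M h (f k))"
  by (subst (1 2) l2_inner_commute) (simp add: l2_inner_sum_left)

lemma l2_inner_cmult_right: "l2_inner M h (\<lambda>x. c * f x) = cnj c * l2_inner M h f"
  by (subst (1 2) l2_inner_commute) (simp add: l2_inner_cmult_left)

text \<open>Young's inequality with a free weight \<open>t\<close>, optimal at the quotient of the
  two norms. Adding \<open>e\<close> to both norms keeps the quotient meaningful if one of them
  vanishes; then \<open>e\<close> tends to 0.\<close>

lemma L2_norm_mult_le:
  assumes "f \<in> L2 M" "g \<in> L2 M"
  shows "(LINT x|M. norm (f x) * norm (g x)) \<le> l2_norm M f * l2_norm M g"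
proof -
  let ?I = "LINT x|M. norm (f x) * norm (g x)"
  have I: "2 * ?I \<le> t * (l2_norm M f)\<^sup>2 + (l2_norm M g)\<^sup>2 / t" if "t > 0" for t
  proof -
    have "2 * ?I = (LINT x|M. 2 * (norm (f x) * norm (g x)))" by simp
    also have "\<dots> \<le> (LINT x|M. t * (norm (f x))\<^sup>2 + (norm (g x))\<^sup>2 / t)"
    proof (intro integral_mono integrable_mult_right L2_norm_mult_integrable assms
        Bochner_Integration.integrable_add integrable_divide L2_sq_integrable)
      fix x
      have "2 * (sqrt t * norm (f x)) * (norm (g x) / sqrt t) \<le> (sqrt t * norm (f x))\<^sup>2 + (norm (g x) / sqrt t)\<^sup>2"
        by (rule sum_squares_bound)
      then show "2 * (norm (f x) * norm (g x)) \<le> t * (norm (f x))\<^sup>2 + (norm (g x))\<^sup>2 / t"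
        using that by (simp add: power_mult_distrib power_divide)
    qed
    also have "\<dots> = t * (l2_norm M f)\<^sup>2 + (l2_norm M g)\<^sup>2 / t"
      using assms by (simp add: l2_norm_power2 L2_sq_integrable)
    finally show ?thesis .
  qed
  let ?a = "l2_norm M f" and ?b = "l2_norm M g"
  have nn: "?a \<ge> 0" "?b \<ge> 0" by simp_all
  have "?I \<le> (?a + e) * (?b + e)" if "e > 0" for e
  proof -
    let ?t = "(?b + e) / (?a + e)"
    have p: "?a + e > 0" "?b + e > 0" using nn that by linarith+
    have "2 * ?I \<le> ?t * ?a\<^sup>2 + ?b\<^sup>2 / ?t" by (rule I) (use p in simp)
    also have "\<dots> \<le> ?t * (?a + e)\<^sup>2 + (?b + e)\<^sup>2 / ?t"
      using p nn that by (intro add_mono mult_left_mono divide_right_mono power_mono) auto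
    also have "\<dots> = 2 * ((?a + e) * (?b + e))" using p by (simp add: power2_eq_square)
    finally show ?thesis by simp
  qed
  moreover have "((\<lambda>e. (?a + e) * (?b + e)) \<longlongrightarrow> (?a + 0) * (?b + 0)) (at_right 0)"
    by (intro tendsto_intros)
  ultimately have "?I \<le> (?a + 0) * (?b + 0)"
    by (intro tendsto_lowerbound[of "\<lambda>e. (?a + e) * (?b + e)" _ "at_right 0"])
       (auto simp: eventually_at_right_less intro: eventually_at_right_less[THEN eventually_mono])
  then show ?thesis by simp
qed

lemma l2_Cauchy_Schwarz:
  assumes "f \<in> L2 M" "g \<in> L2 M"
  shows "norm (l2_inner M f g) \<le> l2_norm M f * l2_norm M g"
proof -
  have "norm (l2_inner M f g) \<le> (LINT x|M. norm (f x * cnj (g x)))"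
    unfolding l2_inner_def by (rule integral_norm_bound)
  also have "\<dots> = (LINT x|M. norm (f x) * norm (g x))" by (simp add: norm_mult)
  finally show ?thesis using L2_norm_mult_le[OF assms] by simp
qed

lemma l2_norm_add_sq:
  assumes "f \<in> L2 M" "g \<in> L2 M"
  shows "(l2_norm M (\<lambda>x. f x + g x))\<^sup>2 = (l2_norm M f)\<^sup>2 + 2 * Re (l2_inner M f g) + (l2_norm M g)\<^sup>2"
proof -
  have "complex_of_real ((l2_norm M (\<lambda>x. f x + g x))\<^sup>2) =
      l2_inner M f f + l2_inner M f g + l2_inner M g f + l2_inner M g g"
  proof -
    have s: "(\<lambda>x. f x + g x) \<in> L2 M" by (rule L2_add[OF assms])
    have "l2_inner M h (\<lambda>x. f x + g x) = l2_inner M h f + l2_inner M h g" if "h \<in> L2 M" for h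
      using assms that by (subst (1 2 3) l2_inner_commute) (simp add: l2_inner_add_left)
    then show ?thesis
      unfolding l2_inner_self[symmetric] using assms s by (simp add: l2_inner_add_left)
  qed
  also have "l2_inner M f g + l2_inner M g f = of_real (2 * Re (l2_inner M f g))"
    by (simp add: l2_inner_commute[of M g f] complex_add_cnj)
  then have "l2_inner M f f + l2_inner M f g + l2_inner M g f + l2_inner M g g =
     complex_of_real ((l2_norm M f)\<^sup>2 + 2 * Re (l2_inner M f g) + (l2_norm M g)\<^sup>2)"
    by (simp add: l2_inner_self algebra_simps)
  finally show ?thesis using of_real_eq_iff by blast
qed

lemma l2_norm_triangle:
  assumes "f \<in> L2 M" "g \<in> L2 M"
  shows "l2_norm M (\<lambda>x. f x + g x) \<le> l2_norm M f + l2_norm M g"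
proof (rule power2_le_imp_le)
  have "Re (l2_inner M f g) \<le> l2_norm M f * l2_norm M g"
    using l2_Cauchy_Schwarz[OF assms] complex_Re_le_cmod order_trans by blast
  then show "(l2_norm M (\<lambda>x. f x + g x))\<^sup>2 \<le> (l2_norm M f + l2_norm M g)\<^sup>2"
    by (simp add: l2_norm_add_sq[OF assms] power2_sum)
qed simp

lemma l2_norm_sum_le:
  "(\<And>k. k \<in> A \<Longrightarrow> f k \<in> L2 M) \<Longrightarrow> l2_norm M (\<lambda>x. \<Sum>k\<in>A. f k x) \<le> (\<Sum>k\<in>A. l2_norm M (f k))"
proof (induction A rule: infinite_finite_induct)
  case (insert k A)
  then show ?case
    using l2_norm_triangle[of "f k" M "\<lambda>x. \<Sum>k\<in>A. f k x"] L2_sum[of A f M] by force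
qed auto

text \<open>Fatou's lemma for the squared norms. It serves for partial sums of series, whose norms
  are all that is controlled.\<close>

lemma L2_Fatou:
  assumes f: "\<And>n::nat. f n \<in> L2 M" and C: "\<And>n. l2_norm M (f n) \<le> C"
    and g: "g \<in> borel_measurable M" and lim: "AE x in M. (\<lambda>n. f n x) \<longlonglongrightarrow> g x"
  shows "g \<in> L2 M" and "l2_norm M g \<le> C"
proof -
  have C0: "C \<ge> 0" using C[of 0] l2_norm_nonneg order_trans by blast
  have "(\<integral>\<^sup>+x. ennreal ((norm (g x))\<^sup>2) \<partial>M) = (\<integral>\<^sup>+x. liminf (\<lambda>n. ennreal ((norm (f n x))\<^sup>2)) \<partial>M)"
    using lim
  proof (intro nn_integral_cong_AE, eventually_elim)
    case (elim x)
    then have "(\<lambda>n. ennreal ((norm (f n x))\<^sup>2)) \<longlonglongrightarrow> ennreal ((norm (g x))\<^sup>2)"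
      by (intro tendsto_intros)
    then show ?case by (intro lim_imp_Liminf[symmetric]) auto
  qed
  also have "\<dots> \<le> liminf (\<lambda>n. \<integral>\<^sup>+x. ennreal ((norm (f n x))\<^sup>2) \<partial>M)"
    using L2_measurable[OF f] by (intro nn_integral_liminf) auto
  also have "\<dots> \<le> ennreal (C\<^sup>2)"
  proof (rule Liminf_le)
    show "\<forall>\<^sub>F n in sequentially. (\<integral>\<^sup>+x. ennreal ((norm (f n x))\<^sup>2) \<partial>M) \<le> ennreal (C\<^sup>2)"
    proof (intro always_eventually allI)
      fix n
      have "(\<integral>\<^sup>+x. ennreal ((norm (f n x))\<^sup>2) \<partial>M) = ennreal ((l2_norm M (f n))\<^sup>2)"
        by (subst nn_integral_eq_integral) (auto simp: L2_sq_integrable f l2_norm_power2)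
      then show "(\<integral>\<^sup>+x. ennreal ((norm (f n x))\<^sup>2) \<partial>M) \<le> ennreal (C\<^sup>2)"
        using C[of n] by (auto intro!: ennreal_leI power_mono)
    qed
  qed simp
  finally have *: "(\<integral>\<^sup>+x. ennreal ((norm (g x))\<^sup>2) \<partial>M) \<le> ennreal (C\<^sup>2)" .
  have "integrable M (\<lambda>x. (norm (g x))\<^sup>2)"
  proof (rule integrableI_bounded)
    show "(\<integral>\<^sup>+x. ennreal (norm ((norm (g x))\<^sup>2)) \<partial>M) < \<infinity>"
      using le_less_trans[OF * ennreal_less_top] by simp
  qed (use g in measurable)
  then show g2: "g \<in> L2 M" unfolding L2_def using g by simp
  have "ennreal ((l2_norm M g)\<^sup>2) \<le> ennreal (C\<^sup>2)"
    using * by (subst (asm) nn_integral_eq_integral) (auto simp: L2_sq_integrable g2 l2_norm_power2)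
  then show "l2_norm M g \<le> C" using C0 by (simp add: abs_le_square_iff[symmetric])
qed

text \<open>The triangle inequality bounds the partial sums of \<open>norm (g k x)\<close> in norm,
  uniformly. By monotone convergence the supremum of their squares has finite integral, hence is
  finite almost everywhere.\<close>

lemma L2_abs_summable_AE:
  assumes g: "\<And>k::nat. g k \<in> L2 M" and s: "summable (\<lambda>k. l2_norm M (g k))"
  shows "AE x in M. summable (\<lambda>k. norm (g k x))"
proof -
  let ?C = "\<Sum>k. l2_norm M (g k)"
  define H where "H N x = complex_of_real (\<Sum>k<N. norm (g k x))" for N x
  have H2: "H N \<in> L2 M" for N
    unfolding H_def of_real_sum by (intro L2_sum L2_of_real_norm g)
  have HC: "l2_norm M (H N) \<le> ?C" for N
  proof -
    have "l2_norm M (H N) \<le> (\<Sum>k<N. l2_norm M (\<lambda>x. complex_of_real (norm (g k x))))"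
      unfolding H_def of_real_sum by (intro l2_norm_sum_le L2_of_real_norm g)
    also have "\<dots> = (\<Sum>k<N. l2_norm M (g k))" by (simp add: l2_norm_def)
    also have "\<dots> \<le> ?C" using s by (intro sum_le_suminf) auto
    finally show ?thesis .
  qed
  have "(\<integral>\<^sup>+x. (SUP N. ennreal ((norm (H N x))\<^sup>2)) \<partial>M) = (SUP N. \<integral>\<^sup>+x. ennreal ((norm (H N x))\<^sup>2) \<partial>M)"
  proof (rule nn_integral_monotone_convergence_SUP)
    show "incseq (\<lambda>N x. ennreal ((norm (H N x))\<^sup>2))"
      unfolding incseq_def le_fun_def H_def norm_of_real
      by (auto intro!: ennreal_leI power_mono sum_mono2 simp: abs_of_nonneg sum_nonneg)
    show "\<And>N. (\<lambda>x. ennreal ((norm (H N x))\<^sup>2)) \<in> borel_measurable M"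
      using L2_measurable[OF H2] by auto
  qed
  also have "\<dots> \<le> ennreal (?C\<^sup>2)"
  proof (rule SUP_least)
    fix N
    have "(\<integral>\<^sup>+x. ennreal ((norm (H N x))\<^sup>2) \<partial>M) = ennreal ((l2_norm M (H N))\<^sup>2)"
      by (subst nn_integral_eq_integral) (auto simp: L2_sq_integrable H2 l2_norm_power2)
    then show "(\<integral>\<^sup>+x. ennreal ((norm (H N x))\<^sup>2) \<partial>M) \<le> ennreal (?C\<^sup>2)"
      using HC[of N] by (auto intro!: ennreal_leI power_mono)
  qed
  finally have "(\<integral>\<^sup>+x. (SUP N. ennreal ((norm (H N x))\<^sup>2)) \<partial>M) \<noteq> \<infinity>"
    using neq_top_trans[OF ennreal_neq_top] by simp
  then have "AE x in M. (SUP N. ennreal ((norm (H N x))\<^sup>2)) \<noteq> \<infinity>"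
    using L2_measurable[OF H2] by (intro nn_integral_PInf_AE borel_measurable_SUP) auto
  then show ?thesis
  proof eventually_elim
    case (elim x)
    then obtain B where B: "(SUP N. ennreal ((norm (H N x))\<^sup>2)) = ennreal B" "B \<ge> 0"
      by (cases "SUP N. ennreal ((norm (H N x))\<^sup>2)") auto
    have "(\<Sum>k<N. norm (g k x)) \<le> sqrt B" for N
    proof -
      have "ennreal ((norm (H N x))\<^sup>2) \<le> ennreal B"
        unfolding B(1)[symmetric] by (rule SUP_upper) simp
      then have "(norm (H N x))\<^sup>2 \<le> B" using B(2) by simp
      then have "(\<Sum>k<N. norm (g k x))\<^sup>2 \<le> B" unfolding H_def norm_of_real by simp
      then show ?thesis by (rule real_le_rsqrt)
    qed
    then show ?case by (intro summableI_nonneg_bounded[of _ "sqrt B"]) auto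
  qed
qed

text \<open>The Riesz--Fischer argument for series, which is the form in which completeness is used.
  Fatou's lemma is applied to every tail, so that the bound and the convergence come out
  together.\<close>

lemma L2_series:
  assumes g: "\<And>k::nat. g k \<in> L2 M" and s: "summable (\<lambda>k. l2_norm M (g k))"
  defines "G \<equiv> \<lambda>x. \<Sum>k. g k x"
  shows "G \<in> L2 M" and "l2_norm M G \<le> (\<Sum>k. l2_norm M (g k))"
    and "(\<lambda>N. l2_norm M (\<lambda>x. G x - (\<Sum>k<N. g k x))) \<longlonglongrightarrow> 0"
proof -
  have abs: "AE x in M. summable (\<lambda>k. norm (g k x))" by (rule L2_abs_summable_AE[OF g s])
  have tail: "(\<lambda>x. \<Sum>k. g (k + N) x) \<in> L2 M \<and>
      l2_norm M (\<lambda>x. \<Sum>k. g (k + N) x) \<le> (\<Sum>k. l2_norm M (g (k + N)))" for N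
  proof -
    have sN: "summable (\<lambda>k. l2_norm M (g (k + N)))" using s by (rule summable_ignore_initial_segment)
    have *: "(\<lambda>x. \<Sum>k<n. g (k + N) x) \<in> L2 M" for n by (intro L2_sum g)
    have a1: "l2_norm M (\<lambda>x. \<Sum>k<n. g (k + N) x) \<le> (\<Sum>k. l2_norm M (g (k + N)))" for n
    proof -
      have "l2_norm M (\<lambda>x. \<Sum>k<n. g (k + N) x) \<le> (\<Sum>k<n. l2_norm M (g (k + N)))"
        by (intro l2_norm_sum_le g)
      also have "\<dots> \<le> (\<Sum>k. l2_norm M (g (k + N)))" by (intro sum_le_suminf sN) auto
      finally show ?thesis .
    qed
    have a2: "AE x in M. (\<lambda>n. \<Sum>k<n. g (k + N) x) \<longlonglongrightarrow> (\<Sum>k. g (k + N) x)"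
      using abs
    proof eventually_elim
      case (elim x)
      then have "summable (\<lambda>k. g (k + N) x)"
        by (intro summable_ignore_initial_segment) (rule summable_norm_cancel)
      then show ?case by (rule summable_LIMSEQ)
    qed
    have a3: "(\<lambda>x. \<Sum>k. g (k + N) x) \<in> borel_measurable M"
      using L2_measurable[OF g] by (intro borel_measurable_suminf) auto
    show ?thesis by (rule conjI; rule L2_Fatou[OF * a1 a3 a2])
  qed
  show "G \<in> L2 M" "l2_norm M G \<le> (\<Sum>k. l2_norm M (g k))"
    using tail[of 0] unfolding G_def add_0_right by (rule conjunct1, rule conjunct2)
  show "(\<lambda>N. l2_norm M (\<lambda>x. G x - (\<Sum>k<N. g k x))) \<longlonglongrightarrow> 0"
  proof (rule tendsto_sandwich[OF _ _ tendsto_const])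
    show "\<forall>\<^sub>F N in sequentially. 0 \<le> l2_norm M (\<lambda>x. G x - (\<Sum>k<N. g k x))" by simp
    show "\<forall>\<^sub>F N in sequentially. l2_norm M (\<lambda>x. G x - (\<Sum>k<N. g k x)) \<le> (\<Sum>k. l2_norm M (g (k + N)))"
    proof (intro always_eventually allI)
      fix N
      have "AE x in M. G x - (\<Sum>k<N. g k x) = (\<Sum>k. g (k + N) x)"
        using abs
      proof eventually_elim
        case (elim x)
        then have "summable (\<lambda>k. g k x)" by (rule summable_norm_cancel)
        then show ?case using suminf_minus_initial_segment[of "\<lambda>k. g k x" N] by (simp add: G_def)
      qed
      then have "l2_norm M (\<lambda>x. G x - (\<Sum>k<N. g k x)) = l2_norm M (\<lambda>x. \<Sum>k. g (k + N) x)"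
        by (rule l2_norm_AE_cong[rotated 2])
          (rule L2_measurable, rule L2_diff[OF \<open>G \<in> L2 M\<close> L2_sum[OF g]],
           rule L2_measurable, rule conjunct1[OF tail])
      then show "l2_norm M (\<lambda>x. G x - (\<Sum>k<N. g k x)) \<le> (\<Sum>k. l2_norm M (g (k + N)))"
        using tail[of N] by simp
    qed
    show "(\<lambda>N. \<Sum>k. l2_norm M (g (k + N))) \<longlonglongrightarrow> 0"
      using suminf_exist_split2[OF s] by simp
  qed
qed

section \<open>Parseval's identity and nuclear operators\<close>

definition orthonormal :: "'a measure \<Rightarrow> (nat \<Rightarrow> 'a \<Rightarrow> complex) \<Rightarrow> bool" where
  "orthonormal M e \<longleftrightarrow>
     (\<forall>k. e k \<in> L2 M) \<and> (\<forall>j k. l2_inner M (e j) (e k) = (if j = k then 1 else 0))"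

lemma orthonormal_basis_orthonormal: "orthonormal_basis M e \<Longrightarrow> orthonormal M e"
  by (auto simp: orthonormal_basis_def orthonormal_def)

lemma orthonormal_inner_sum:
  assumes e: "orthonormal M e" and A: "finite A"
  shows "l2_inner M (\<lambda>x. \<Sum>k\<in>A. c k * e k x) (e j) = (if j \<in> A then c j else 0)"
proof -
  have "l2_inner M (\<lambda>x. \<Sum>k\<in>A. c k * e k x) (e j) = (\<Sum>k\<in>A. c k * l2_inner M (e k) (e j))"
    using e by (subst l2_inner_sum_left) (auto simp: orthonormal_def l2_inner_cmult_left intro!: L2_cmult)
  also have "\<dots> = (\<Sum>k\<in>A. if k = j then c k else 0)"
    using e by (intro sum.cong) (auto simp: orthonormal_def)
  finally show ?thesis using A by simp
qed

lemma orthonormal_norm_sum: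
  assumes e: "orthonormal M e" and A: "finite A"
  shows "(l2_norm M (\<lambda>x. \<Sum>k\<in>A. c k * e k x))\<^sup>2 = (\<Sum>k\<in>A. (norm (c k))\<^sup>2)"
proof -
  have e2: "e k \<in> L2 M" for k using e by (simp add: orthonormal_def)
  let ?S = "\<lambda>x. \<Sum>k\<in>A. c k * e k x"
  have S: "?S \<in> L2 M" by (intro L2_sum L2_cmult e2)
  have "complex_of_real ((l2_norm M ?S)\<^sup>2) = l2_inner M ?S ?S" by (simp add: l2_inner_self)
  also have "\<dots> = (\<Sum>k\<in>A. cnj (c k) * l2_inner M ?S (e k))"
    by (subst l2_inner_sum_right) (auto simp: S e2 l2_inner_cmult_right intro!: L2_cmult)
  also have "\<dots> = (\<Sum>k\<in>A. complex_of_real ((norm (c k))\<^sup>2))"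
  proof (rule sum.cong)
    fix k assume "k \<in> A"
    then have "l2_inner M ?S (e k) = c k" using orthonormal_inner_sum[OF e A, of c k] by simp
    then show "cnj (c k) * l2_inner M ?S (e k) = complex_of_real ((norm (c k))\<^sup>2)"
      by (simp add: complex_norm_square mult.commute del: of_real_power)
  qed simp
  finally show ?thesis by (simp only: of_real_sum[symmetric] of_real_eq_iff)
qed

lemma Bessel_sum:
  assumes e: "orthonormal M e" and f: "f \<in> L2 M" and A: "finite A"
  shows "(\<Sum>k\<in>A. (norm (l2_inner M f (e k)))\<^sup>2) \<le> (l2_norm M f)\<^sup>2"
proof -
  have e2: "e k \<in> L2 M" for k using e by (simp add: orthonormal_def)
  let ?c = "\<lambda>k. l2_inner M f (e k)"
  let ?S = "\<lambda>x. \<Sum>k\<in>A. - ?c k * e k x"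
  have S: "?S \<in> L2 M" by (intro L2_sum L2_cmult e2)
  have "l2_inner M f ?S = (\<Sum>k\<in>A. cnj (- ?c k) * ?c k)"
    by (subst l2_inner_sum_right[OF L2_cmult[OF e2] f]) (rule sum.cong[OF refl l2_inner_cmult_right])
  also have "\<dots> = complex_of_real (- (\<Sum>k\<in>A. (norm (?c k))\<^sup>2))"
    by (simp add: complex_norm_square mult.commute sum_negf del: of_real_power)
  finally have i: "Re (l2_inner M f ?S) = - (\<Sum>k\<in>A. (norm (?c k))\<^sup>2)" by simp
  have "0 \<le> (l2_norm M (\<lambda>x. f x + ?S x))\<^sup>2" by simp
  also have "\<dots> = (l2_norm M f)\<^sup>2 - (\<Sum>k\<in>A. (norm (?c k))\<^sup>2)"
    unfolding l2_norm_add_sq[OF f S] i orthonormal_norm_sum[OF e A] by simp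
  finally show ?thesis by simp
qed

lemma Bessel_summable:
  assumes e: "orthonormal M e" and f: "f \<in> L2 M"
  shows "summable (\<lambda>k. (norm (l2_inner M f (e k)))\<^sup>2)"
  using Bessel_sum[OF e f] by (intro summableI_nonneg_bounded[of _ "(l2_norm M f)\<^sup>2"]) auto

text \<open>The bound is uniform over finite index sets, which is what unconditional summability and
  the exchange of double sums require.\<close>

lemma Bessel_abs_sum:
  assumes e: "orthonormal M e" and f: "f \<in> L2 M" and g: "g \<in> L2 M" and A: "finite A"
  shows "(\<Sum>k\<in>A. norm (l2_inner M f (e k) * l2_inner M (e k) g)) \<le> l2_norm M f * l2_norm M g"
proof -
  have "(\<Sum>k\<in>A. norm (l2_inner M f (e k) * l2_inner M (e k) g)) =
      (\<Sum>k\<in>A. norm (l2_inner M f (e k)) * norm (l2_inner M g (e k)))"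
    by (intro sum.cong) (auto simp: norm_mult l2_inner_commute[of M g])
  also have "\<dots> \<le> sqrt (\<Sum>k\<in>A. (norm (l2_inner M f (e k)))\<^sup>2) * sqrt (\<Sum>k\<in>A. (norm (l2_inner M g (e k)))\<^sup>2)"
    using L2_set_mult_ineq[where A = A and f = "\<lambda>k. norm (l2_inner M f (e k))" and g = "\<lambda>k. norm (l2_inner M g (e k))"]
    by (simp add: L2_set_def)
  also have "\<dots> \<le> l2_norm M f * l2_norm M g"
    using Bessel_sum[OF e f A] Bessel_sum[OF e g A]
    by (intro mult_mono real_le_lsqrt) (auto simp: sum_nonneg)
  finally show ?thesis .
qed

lemma Bessel_summable_on:
  assumes e: "orthonormal M e" and f: "f \<in> L2 M" and g: "g \<in> L2 M"
  shows "(\<lambda>k. norm (l2_inner M f (e k) * l2_inner M (e k) g)) summable_on UNIV"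
  using Bessel_abs_sum[OF assms] by (intro nonneg_bdd_above_summable_on bdd_aboveI2) auto

text \<open>Square summable coefficients do not make the terms of a Fourier series summable in norm.
  Grouped into blocks between the indices \<open>r i\<close> the series does get summable norms, so
  that \<open>L2_series\<close> applies: sums below \<open>(1/4) ^ i\<close> have square roots below
  \<open>(1/2) ^ i\<close>.\<close>

lemma subsequence_summable_gaps:
  fixes s :: "nat \<Rightarrow> real"
  assumes s: "summable s" and nn: "\<And>k. s k \<ge> 0"
  obtains r :: "nat \<Rightarrow> nat" where "strict_mono r" "summable (\<lambda>i. sqrt (\<Sum>k=r i..<r (Suc i). s k))"
proof -
  have ex: "\<exists>N. \<forall>m\<ge>N. \<forall>n. sum s {m..<n} < (1/4) ^ i" for i :: nat
    using s[unfolded summable_Cauchy] nn by (simp add: sum_nonneg)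
  define N where "N i = (SOME N. \<forall>m\<ge>N. \<forall>n. sum s {m..<n} < (1/4) ^ i)" for i :: nat
  have N: "sum s {m..<n} < (1/4) ^ i" if "m \<ge> N i" for i m n
    using someI_ex[OF ex[of i]] that unfolding N_def by blast
  define r where "r i = (\<Sum>j\<le>i. N j) + i" for i
  have r: "strict_mono r" by (rule strict_monoI_Suc) (simp add: r_def)
  have rN: "r i \<ge> N i" for i
    unfolding r_def using member_le_sum[of i "{..i}" N] by simp
  have "summable (\<lambda>i. sqrt (\<Sum>k=r i..<r (Suc i). s k))"
  proof (rule summable_comparison_test'[of "\<lambda>i. (1/2::real) ^ i" 0])
    show "summable (\<lambda>i. (1/2::real) ^ i)" by (rule summable_geometric) simp
    fix i
    have "sqrt (sum s {r i..<r (Suc i)}) \<le> sqrt ((1/4) ^ i)"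
      using N[OF rN] by (intro real_sqrt_le_mono less_imp_le)
    also have "\<dots> = (1/2) ^ i" by (simp add: real_sqrt_power real_sqrt_divide)
    finally show "norm (sqrt (sum s {r i..<r (Suc i)})) \<le> (1/2) ^ i"
      using nn by (simp add: sum_nonneg)
  qed
  then show thesis using that r by blast
qed

text \<open>
  Completeness of \<open>L\<^sup>2\<close> enters here: a sparse subsequence of the partial sums converges, and totality
  of the basis identifies its limit.
\<close>

lemma Parseval:
  assumes e: "orthonormal_basis M e" and f: "f \<in> L2 M" and g: "g \<in> L2 M"
  shows "((\<lambda>k. l2_inner M f (e k) * l2_inner M (e k) g) has_sum l2_inner M f g) UNIV"
proof -
  note o = orthonormal_basis_orthonormal[OF e]
  have e2: "e k \<in> L2 M" for k using o by (simp add: orthonormal_def)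
  let ?c = "\<lambda>k. l2_inner M f (e k)"
  define S where "S n x = (\<Sum>k<n. ?c k * e k x)" for n x
  have S2: "S n \<in> L2 M" for n unfolding S_def by (intro L2_sum L2_cmult e2)
  obtain r where r: "strict_mono r" "summable (\<lambda>i. sqrt (\<Sum>k=r i..<r (Suc i). (norm (?c k))\<^sup>2))"
    using subsequence_summable_gaps[OF Bessel_summable[OF o f]] by auto
  define h where "h i x = (\<Sum>k=r i..<r (Suc i). ?c k * e k x)" for i x
  have h2: "h i \<in> L2 M" for i unfolding h_def by (intro L2_sum L2_cmult e2)
  have "l2_norm M (h i) = sqrt (\<Sum>k=r i..<r (Suc i). (norm (?c k))\<^sup>2)" for i
    unfolding h_def[abs_def] by (subst orthonormal_norm_sum[symmetric, OF o]) simp_all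
  then have hs: "summable (\<lambda>i. l2_norm M (h i))" using r(2) by simp
  define H where "H x = (\<Sum>i. h i x)" for x
  have H2: "H \<in> L2 M" and lim: "(\<lambda>n. l2_norm M (\<lambda>x. H x - (\<Sum>i<n. h i x))) \<longlonglongrightarrow> 0"
    using L2_series[OF h2 hs] by (simp_all add: H_def[abs_def])
  define G where "G x = H x + S (r 0) x" for x
  have G2: "G \<in> L2 M" unfolding G_def[abs_def] by (intro L2_add H2 S2)
  have part: "S (r n) x = S (r 0) x + (\<Sum>i<n. h i x)" for n x
  proof (induction n)
    case (Suc n)
    have "r n \<le> r (Suc n)" using r(1) by (simp add: strict_mono_leD)
    then have "S (r (Suc n)) x = S (r n) x + h n x"
      unfolding S_def h_def lessThan_atLeast0 by (simp add: sum.atLeastLessThan_concat)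
    then show ?case using Suc by simp
  qed simp
  have "(\<lambda>x. G x - S (r n) x) = (\<lambda>x. H x - (\<Sum>i<n. h i x))" for n
    by (rule ext) (subst part, simp add: G_def)
  with lim have lim: "(\<lambda>n. l2_norm M (\<lambda>x. G x - S (r n) x)) \<longlonglongrightarrow> 0" by simp
  have lim_inner: "(\<lambda>n. l2_inner M (S (r n)) u) \<longlonglongrightarrow> l2_inner M G u" if u: "u \<in> L2 M" for u
  proof -
    have "(\<lambda>n. l2_inner M G u - l2_inner M (S (r n)) u) \<longlonglongrightarrow> 0"
    proof (rule Lim_null_comparison)
      show "\<forall>\<^sub>F n in sequentially. norm (l2_inner M G u - l2_inner M (S (r n)) u) \<le>
          l2_norm M (\<lambda>x. G x - S (r n) x) * l2_norm M u"
      proof (intro always_eventually allI)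
        fix n
        have "l2_inner M G u - l2_inner M (S (r n)) u = l2_inner M (\<lambda>x. G x - S (r n) x) u"
          by (rule l2_inner_diff_left[OF G2 S2 u, symmetric])
        then show "norm (l2_inner M G u - l2_inner M (S (r n)) u) \<le>
          l2_norm M (\<lambda>x. G x - S (r n) x) * l2_norm M u"
          using l2_Cauchy_Schwarz[OF L2_diff[OF G2 S2] u] by simp
      qed
      show "(\<lambda>n. l2_norm M (\<lambda>x. G x - S (r n) x) * l2_norm M u) \<longlonglongrightarrow> 0"
        using tendsto_mult_left_zero[OF lim] by simp
    qed
    then have "(\<lambda>n. l2_inner M G u - (l2_inner M G u - l2_inner M (S (r n)) u)) \<longlonglongrightarrow> l2_inner M G u - 0"
      by (intro tendsto_diff tendsto_const)
    then show ?thesis by simp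
  qed
  have Ge: "l2_inner M G (e j) = ?c j" for j
  proof (rule LIMSEQ_unique[OF lim_inner[OF e2]])
    show "(\<lambda>n. l2_inner M (S (r n)) (e j)) \<longlonglongrightarrow> ?c j"
    proof (rule tendsto_eventually, rule eventually_sequentiallyI)
      fix n assume "Suc j \<le> n"
      then have "j < r n" using seq_suble[OF r(1), of n] by simp
      then show "l2_inner M (S (r n)) (e j) = ?c j"
        unfolding S_def[abs_def] using orthonormal_inner_sum[OF o, of "{..<r n}" ?c j] by simp
    qed
  qed
  have "l2_inner M (\<lambda>x. f x - G x) (e j) = 0" for j
    by (simp add: l2_inner_diff_left f G2 e2 Ge)
  then have "AE x in M. f x - G x = 0"
    using e L2_diff[OF f G2] unfolding orthonormal_basis_def by blast
  then have fG: "l2_inner M G g = l2_inner M f g"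
    using L2_measurable[OF f] L2_measurable[OF g] L2_measurable[OF G2]
    by (intro l2_inner_AE_cong) auto
  \<comment> \<open>Bessel's inequality makes the whole family absolutely summable, so its sum may
    be evaluated along the subsequence \<open>r\<close>.\<close>
  have abs: "(\<lambda>k. ?c k * l2_inner M (e k) g) summable_on UNIV"
    by (rule abs_summable_summable[OF Bessel_summable_on[OF o f g]])
  have "(\<lambda>n. \<Sum>k<n. ?c k * l2_inner M (e k) g) \<longlonglongrightarrow> (\<Sum>\<^sub>\<infinity>k. ?c k * l2_inner M (e k) g)"
    using has_sum_imp_sums[OF has_sum_infsum[OF abs]] by (simp add: sums_def)
  then have "(\<lambda>n. \<Sum>k<r n. ?c k * l2_inner M (e k) g) \<longlonglongrightarrow> (\<Sum>\<^sub>\<infinity>k. ?c k * l2_inner M (e k) g)"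
    using LIMSEQ_subseq_LIMSEQ[OF _ r(1)] by (fastforce simp: o_def)
  moreover have "(\<Sum>k<r n. ?c k * l2_inner M (e k) g) = l2_inner M (S (r n)) g" for n
    unfolding S_def[abs_def]
    by (subst l2_inner_sum_left) (auto simp: e2 g l2_inner_cmult_left intro!: L2_cmult)
  ultimately have "(\<Sum>\<^sub>\<infinity>k. ?c k * l2_inner M (e k) g) = l2_inner M f g"
    using LIMSEQ_unique[OF lim_inner[OF g]] fG by simp
  then show ?thesis using has_sum_infsum[OF abs] by simp
qed


text \<open>For an orthonormal basis e, the double family <v k, e j> <e j, u k> is absolutely
  summable by Bessel's inequality. Summed over j first it gives <v k, u k> by Parseval, summed over
  k first it gives <T e j, e j>; hence every basis yields the same trace. The expansion of
  \<open>T f\<close> is asked for almost everywhere only, because the operators below involve chosen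
  representatives.\<close>

lemma nuclear_has_trace:
  assumes u: "\<And>k::nat. u k \<in> L2 M" and v: "\<And>k. v k \<in> L2 M"
    and s: "summable (\<lambda>k. l2_norm M (u k) * l2_norm M (v k))"
    and Tm: "\<And>f. f \<in> L2 M \<Longrightarrow> T f \<in> borel_measurable M"
    and T: "\<And>f. f \<in> L2 M \<Longrightarrow> AE x in M. T f x = (\<Sum>k. l2_inner M f (u k) * v k x)"
  shows "has_trace M T (\<Sum>k. l2_inner M (v k) (u k))"
proof -
  let ?C = "\<Sum>k. l2_norm M (u k) * l2_norm M (v k)"
  define g where "g f k x = l2_inner M f (u k) * v k x" for f k x
  have g2: "g f k \<in> L2 M" for f k unfolding g_def by (intro L2_cmult v)
  have gn: "l2_norm M (g f k) \<le> l2_norm M f * (l2_norm M (u k) * l2_norm M (v k))" if "f \<in> L2 M" for f k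
    unfolding g_def[abs_def] l2_norm_cmult mult.assoc[symmetric]
    by (intro mult_right_mono l2_Cauchy_Schwarz that u) simp
  have gs: "summable (\<lambda>k. l2_norm M (g f k))" if "f \<in> L2 M" for f
    by (rule summable_comparison_test'[of "\<lambda>k. l2_norm M f * (l2_norm M (u k) * l2_norm M (v k))" 0])
       (use s gn[OF that] in \<open>auto intro: summable_mult\<close>)
  have T': "AE x in M. T f x = (\<Sum>k. g f k x)" if "f \<in> L2 M" for f
    using T[OF that] by (simp add: g_def)
  have T2: "T f \<in> L2 M" if "f \<in> L2 M" for f
    by (rule L2_AE_cong[OF L2_series(1)[OF g2 gs[OF that]] Tm[OF that]])
       (use T'[OF that] in \<open>auto elim: eventually_mono\<close>)
  have Tlim: "(\<lambda>N. l2_norm M (\<lambda>x. T f x - (\<Sum>k<N. g f k x))) \<longlonglongrightarrow> 0" if f: "f \<in> L2 M" for f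
  proof -
    have "l2_norm M (\<lambda>x. T f x - (\<Sum>k<N. g f k x)) = l2_norm M (\<lambda>x. (\<Sum>k. g f k x) - (\<Sum>k<N. g f k x))" for N
    proof (rule l2_norm_AE_cong)
      show "(\<lambda>x. T f x - (\<Sum>k<N. g f k x)) \<in> borel_measurable M"
        by (rule L2_measurable[OF L2_diff[OF T2[OF f] L2_sum[OF g2]]])
      show "(\<lambda>x. (\<Sum>k. g f k x) - (\<Sum>k<N. g f k x)) \<in> borel_measurable M"
        by (rule L2_measurable[OF L2_diff[OF L2_series(1)[OF g2 gs[OF f]] L2_sum[OF g2]]])
    qed (use T'[OF f] in auto)
    then show ?thesis using L2_series(3)[OF g2 gs[OF f]] by simp
  qed
  have bdd: "l2_norm M (T f) \<le> ?C * l2_norm M f" if f: "f \<in> L2 M" for f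
  proof -
    have "l2_norm M (T f) = l2_norm M (\<lambda>x. \<Sum>k. g f k x)"
      by (rule l2_norm_AE_cong[OF Tm[OF f] L2_measurable[OF L2_series(1)[OF g2 gs[OF f]]] T'[OF f]])
    also have "\<dots> \<le> (\<Sum>k. l2_norm M (g f k))" by (rule L2_series(2)[OF g2 gs[OF f]])
    also have "\<dots> \<le> (\<Sum>k. l2_norm M f * (l2_norm M (u k) * l2_norm M (v k)))"
      by (intro suminf_le gn gs f summable_mult s)
    also have "\<dots> = ?C * l2_norm M f" by (simp add: suminf_mult s mult.commute)
    finally show ?thesis .
  qed
  have lin: "AE x in M. T (\<lambda>x. c * f x + h x) x = c * T f x + T h x"
    if f: "f \<in> L2 M" and h: "h \<in> L2 M" for f h c
  proof -
    have cf: "(\<lambda>x. c * f x + h x) \<in> L2 M" by (intro L2_add L2_cmult f h)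
    show ?thesis
      using T'[OF cf] T'[OF f] T'[OF h] L2_abs_summable_AE[OF g2 gs[OF f]] L2_abs_summable_AE[OF g2 gs[OF h]]
    proof eventually_elim
      case (elim x)
      have "g (\<lambda>x. c * f x + h x) k x = c * g f k x + g h k x" for k
        unfolding g_def by (simp add: l2_inner_add_left L2_cmult f h u l2_inner_cmult_left algebra_simps)
      then have "(\<Sum>k. g (\<lambda>x. c * f x + h x) k x) = (\<Sum>k. c * g f k x + g h k x)" by simp
      also have "\<dots> = c * (\<Sum>k. g f k x) + (\<Sum>k. g h k x)"
        using summable_norm_cancel[OF elim(4)] summable_norm_cancel[OF elim(5)]
        by (simp add: suminf_add[symmetric] suminf_mult summable_mult)
      finally show ?case using elim by simp
    qed
  qed
  have bo: "bounded_operator M T"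
    unfolding bounded_operator_def using T2 lin bdd by blast
  have tc: "trace_class M T"
    unfolding trace_class_def using bo u v s Tlim[unfolded g_def]
    by (intro conjI exI[of _ u] exI[of _ v]) auto
  have "((\<lambda>j. l2_inner M (T (e j)) (e j)) has_sum (\<Sum>k. l2_inner M (v k) (u k))) UNIV"
    if e: "orthonormal_basis M e" for e
  proof -
    note o = orthonormal_basis_orthonormal[OF e]
    have e2: "e k \<in> L2 M" for k using o by (simp add: orthonormal_def)
    define F where "F k j = l2_inner M (v k) (e j) * l2_inner M (e j) (u k)" for k j
    have F: "(F k has_sum l2_inner M (v k) (u k)) UNIV" for k
      unfolding F_def[abs_def] by (rule Parseval[OF e v u])
    have Fle: "(\<Sum>\<^sub>\<infinity>j. norm (F k j)) \<le> l2_norm M (u k) * l2_norm M (v k)" for k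
    proof (rule infsum_le_finite_sums)
      show "(\<lambda>j. norm (F k j)) summable_on UNIV" unfolding F_def by (rule Bessel_summable_on[OF o v u])
      show "(\<Sum>j\<in>A. norm (F k j)) \<le> l2_norm M (u k) * l2_norm M (v k)" if "finite A" for A
        using Bessel_abs_sum[OF o v u that] by (simp add: F_def mult.commute)
    qed
    have "(\<lambda>k. \<Sum>\<^sub>\<infinity>j. norm (F k j)) summable_on UNIV"
    proof (rule summable_on_comparison_test)
      show "(\<lambda>k. l2_norm M (u k) * l2_norm M (v k)) summable_on UNIV"
        using s by (subst summable_on_UNIV_nonneg_real_iff) auto
    qed (use Fle in \<open>auto intro: infsum_nonneg\<close>)
    then have "(\<lambda>x. norm ((\<lambda>(k, j). F k j) x)) summable_on UNIV \<times> UNIV"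
      using Bessel_summable_on[OF o v u] unfolding F_def
      by (subst Infinite_Sum.abs_summable_on_Sigma_iff) (auto simp: abs_of_nonneg infsum_nonneg)
    then have sm: "(\<lambda>(k, j). F k j) summable_on UNIV \<times> UNIV"
      by (rule abs_summable_summable)
    have "((\<lambda>k. l2_inner M (v k) (u k)) has_sum (\<Sum>k. l2_inner M (v k) (u k))) UNIV"
    proof (rule norm_summable_imp_has_sum)
      have *: "norm (l2_inner M (v k) (u k)) \<le> l2_norm M (u k) * l2_norm M (v k)" for k
        using l2_Cauchy_Schwarz[OF v u] by (simp add: mult.commute)
      show n: "summable (\<lambda>k. norm (l2_inner M (v k) (u k)))"
        by (rule summable_comparison_test'[OF s]) (simp add: *)
      show "(\<lambda>k. l2_inner M (v k) (u k)) sums (\<Sum>k. l2_inner M (v k) (u k))"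
        by (rule summable_sums[OF summable_norm_cancel[OF n]])
    qed
    then have "((\<lambda>(k, j). F k j) has_sum (\<Sum>k. l2_inner M (v k) (u k))) (UNIV \<times> UNIV)"
      using F sm by (intro has_sum_SigmaI) auto
    then have hs: "((\<lambda>(j, k). F k j) has_sum (\<Sum>k. l2_inner M (v k) (u k))) (UNIV \<times> UNIV)"
      by (subst has_sum_reindex_bij_witness[of "UNIV \<times> UNIV" prod.swap prod.swap "UNIV \<times> UNIV" "\<lambda>(k, j). F k j"]) auto
    show ?thesis
    proof (rule has_sum_SigmaD[OF hs])
      fix j
      have eq: "F k j = l2_inner M (g (e j) k) (e j)" for k
        unfolding F_def g_def l2_inner_cmult_left by (rule mult.commute)
      have n: "summable (\<lambda>k. norm (F k j))"
      proof (rule summable_comparison_test'[OF gs[OF e2[of j]]])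
        have "l2_norm M (e j) = 1"
          using o l2_inner_self[of M "e j"] by (simp add: orthonormal_def abs_square_eq_1 flip: of_real_power)
        then show "norm (norm (F k j)) \<le> l2_norm M (g (e j) k)" for k
          unfolding eq using l2_Cauchy_Schwarz[OF g2 e2, of "e j" k j] by simp
      qed
      have "(\<lambda>N. l2_inner M (T (e j)) (e j) - (\<Sum>k<N. F k j)) \<longlonglongrightarrow> 0"
      proof (rule Lim_null_comparison)
        show "\<forall>\<^sub>F N in sequentially. norm (l2_inner M (T (e j)) (e j) - (\<Sum>k<N. F k j)) \<le>
            l2_norm M (\<lambda>x. T (e j) x - (\<Sum>k<N. g (e j) k x)) * l2_norm M (e j)"
        proof (intro always_eventually allI)
          fix N
          have "l2_inner M (T (e j)) (e j) - (\<Sum>k<N. F k j) = l2_inner M (\<lambda>x. T (e j) x - (\<Sum>k<N. g (e j) k x)) (e j)"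
            by (simp add: l2_inner_diff_left T2 e2 L2_sum g2 l2_inner_sum_left eq)
          then show "norm (l2_inner M (T (e j)) (e j) - (\<Sum>k<N. F k j)) \<le>
            l2_norm M (\<lambda>x. T (e j) x - (\<Sum>k<N. g (e j) k x)) * l2_norm M (e j)"
            using l2_Cauchy_Schwarz[OF L2_diff[OF T2[OF e2] L2_sum[OF g2]] e2] by simp
        qed
        show "(\<lambda>N. l2_norm M (\<lambda>x. T (e j) x - (\<Sum>k<N. g (e j) k x)) * l2_norm M (e j)) \<longlonglongrightarrow> 0"
          by (rule tendsto_mult_left_zero[OF Tlim[OF e2]])
      qed
      then have "(\<lambda>N. l2_inner M (T (e j)) (e j) - (l2_inner M (T (e j)) (e j) - (\<Sum>k<N. F k j))) \<longlonglongrightarrow> l2_inner M (T (e j)) (e j) - 0"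
        by (intro tendsto_diff tendsto_const)
      then have "(\<lambda>k. F k j) sums l2_inner M (T (e j)) (e j)" by (simp add: sums_def)
      then show "((\<lambda>k. (\<lambda>(j, k). F k j) (j, k)) has_sum l2_inner M (T (e j)) (e j)) UNIV"
        using norm_summable_imp_has_sum[OF n] by simp
    qed
  qed
  then show ?thesis unfolding has_trace_def using tc by blast
qed

section \<open>Lebesgue differentiation and absolutely continuous functions\<close>

text \<open>Henstock's lemma bounds the total integration error over a disjoint family of fine
  tagged intervals. An interval from \<open>x\<close> to \<open>y\<close> on which the difference
  quotient is off by \<open>1 / n\<close> contributes at least its length over \<open>n\<close>, so
  disjoint bad intervals have small total length. Vitali's covering lemma selects disjoint ones
  whose fivefold enlargements still cover the bad set.\<close>

lemma negligible_bad_differentiation_set: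
  fixes f :: "real \<Rightarrow> 'a::euclidean_space"
  assumes f: "f integrable_on cbox a b" and n: "n > 0"
  defines "G \<equiv> \<lambda>x. integral (cbox a x) f"
  shows "negligible {x \<in> {a<..<b}. \<forall>d>0. \<exists>y\<in>cbox a b. 0 < \<bar>y - x\<bar> \<and> \<bar>y - x\<bar> < d \<and>
    norm (G y - G x - (y - x) *\<^sub>R f x) > \<bar>y - x\<bar> / n}" (is "negligible ?E")
  unfolding negligible_outer_le
proof (intro allI impI)
  fix e :: real assume e: "e > 0"
  \<comment> \<open>The factor \<open>n\<close> turns errors into lengths; 10 is 5 from the Vitali
    enlargement times 2, the length of a ball over its radius.\<close>
  have e': "e / (10 * n) > 0" using e n by simp
  obtain \<gamma> where g: "gauge \<gamma>"
    and H: "\<And>p. \<lbrakk>p tagged_partial_division_of (cbox a b); \<gamma> fine p\<rbrakk> \<Longrightarrow>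
             sum (\<lambda>(x,k). norm (measure lborel k *\<^sub>R f x - integral k f)) p < e / (10 * n)"
    by (rule Henstock_lemma[OF f e'], erule that)
  define I where "I = {(x, y). x \<in> {a<..<b} \<and> y \<in> cbox a b \<and> 0 < \<bar>y - x\<bar> \<and> cball x \<bar>y - x\<bar> \<subseteq> \<gamma> x \<and>
    norm (G y - G x - (y - x) *\<^sub>R f x) > \<bar>y - x\<bar> / n}"
  define r where "r = (\<lambda>(x, y). \<bar>y - x :: real\<bar>)"
  have cov: "?E \<subseteq> (\<Union>i\<in>I. cball (fst i) (r i))"
  proof
    fix x assume x: "x \<in> ?E"
    obtain d where d: "d > 0" "ball x d \<subseteq> \<gamma> x"
      using g open_contains_ball unfolding gauge_def by blast
    then obtain y where y: "y \<in> cbox a b" "0 < \<bar>y - x\<bar>" "\<bar>y - x\<bar> < d"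
      "norm (G y - G x - (y - x) *\<^sub>R f x) > \<bar>y - x\<bar> / n"
      using x by blast
    have "cball x \<bar>y - x\<bar> \<subseteq> ball x d" using y(3) by auto
    then have "(x, y) \<in> I" using x y d by (auto simp: I_def)
    then show "x \<in> (\<Union>i\<in>I. cball (fst i) (r i))" by (force simp: r_def)
  qed
  have rI: "0 < r i \<and> r i \<le> b - a" if "i \<in> I" for i
    using that by (auto simp: I_def r_def)
  obtain C where C: "countable C" "C \<subseteq> I"
     "pairwise (\<lambda>i j. disjnt (cball (fst i) (r i)) (cball (fst j) (r j))) C"
     "?E \<subseteq> (\<Union>i\<in>C. cball (fst i) (5 * r i))"
    by (rule Vitali_covering_lemma_cballs[OF cov rI])
  have bound: "(\<Sum>i\<in>F. r i) \<le> e / 10" if F: "F \<subseteq> C" "finite F" for F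
  proof -
    \<comment> \<open>The interval between a tag and its partner, on whichever side of the tag the
      partner lies. It sits in the ball around the tag, so disjoint balls give disjoint
      intervals.\<close>
    define K where "K = (\<lambda>(x, y). cbox (min x y) (max x y :: real))"
    define p where "p = (\<lambda>i. (fst i, K i)) ` F"
    have Ksub: "K i \<subseteq> cball (fst i) (r i)" for i
      by (auto simp: K_def r_def dist_real_def split: prod.splits)
    have fstK: "fst i \<in> K i" for i by (auto simp: K_def split: prod.splits)
    have disj: "K i \<inter> K j = {}" if "i \<in> F" "j \<in> F" "i \<noteq> j" for i j
    proof -
      have "i \<in> C" "j \<in> C" using that F by auto
      then have "disjnt (cball (fst i) (r i)) (cball (fst j) (r j))"
        using C(3) \<open>i \<noteq> j\<close> by (auto simp: pairwise_def)
      then show ?thesis using Ksub[of i] Ksub[of j] by (auto simp: disjnt_def)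
    qed
    have inj: "inj_on (\<lambda>i. (fst i, K i)) F"
      unfolding inj_on_def using disj fstK by blast
    have FI: "i \<in> I" if "i \<in> F" for i using that F C by auto
    have "p tagged_partial_division_of (cbox a b)"
      unfolding tagged_partial_division_of_def
    proof (intro conjI allI impI)
      show "finite p" using F by (simp add: p_def)
      fix x k assume "(x, k) \<in> p"
      then obtain i where i: "i \<in> F" "x = fst i" "k = K i" by (auto simp: p_def)
      show "x \<in> k" using i fstK by simp
      show "k \<subseteq> cbox a b" using FI[OF i(1)] unfolding i K_def I_def by (auto split: prod.splits)
      show "\<exists>a b. k = cbox a b" unfolding i K_def by (auto split: prod.splits)
    next
      fix x1 K1 x2 K2 assume *: "(x1, K1) \<in> p \<and> (x2, K2) \<in> p \<and> (x1, K1) \<noteq> (x2, K2)"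
      then obtain i j where "i \<in> F" "j \<in> F" "i \<noteq> j" "K1 = K i" "K2 = K j" by (auto simp: p_def)
      then show "interior K1 \<inter> interior K2 = {}"
        using disj[of i j] interior_subset[of K1] interior_subset[of K2] by blast
    qed
    moreover have "\<gamma> fine p"
    proof (rule fineI)
      fix x k assume "(x, k) \<in> p"
      then obtain i where i: "i \<in> F" "x = fst i" "k = K i" by (auto simp: p_def)
      have "cball (fst i) (r i) \<subseteq> \<gamma> (fst i)"
        using FI[OF i(1)] by (auto simp: I_def r_def)
      then show "k \<subseteq> \<gamma> x" using Ksub[of i] i by auto
    qed
    ultimately have "sum (\<lambda>(x,k). norm (measure lborel k *\<^sub>R f x - integral k f)) p < e / (10 * n)"
      by (rule H)
    also have "sum (\<lambda>(x,k). norm (measure lborel k *\<^sub>R f x - integral k f)) p =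
        (\<Sum>i\<in>F. norm (measure lborel (K i) *\<^sub>R f (fst i) - integral (K i) f))"
      unfolding p_def by (subst sum.reindex[OF inj]) simp
    finally have 1: "(\<Sum>i\<in>F. norm (measure lborel (K i) *\<^sub>R f (fst i) - integral (K i) f)) < e / (10 * n)" .
    have 2: "r i / n \<le> norm (measure lborel (K i) *\<^sub>R f (fst i) - integral (K i) f)" if "i \<in> F" for i
    proof -
      obtain x y where i: "i = (x, y)" by fastforce
      have x: "a < x" "x < b" and y: "a \<le> y" "y \<le> b" and nn: "norm (G y - G x - (y - x) *\<^sub>R f x) > \<bar>y - x\<bar> / n"
        using FI[OF that] by (auto simp: i I_def)
      have G: "G v - G u = integral (cbox u v) f" if "a \<le> u" "u \<le> v" "v \<le> b" for u v
      proof -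
        have "f integrable_on {a..v}"
          using integrable_on_subinterval[OF f, of a v] that by simp
        then have "integral {a..u} f + integral {u..v} f = integral {a..v} f"
          by (rule Henstock_Kurzweil_Integration.integral_combine[OF that(1,2)])
        then show ?thesis by (simp add: G_def algebra_simps)
      qed
      show ?thesis
      proof (cases "x \<le> y")
        case True
        have K: "K i = cbox x y" using True by (simp add: i K_def)
        show ?thesis using nn G[of x y] True x y unfolding K by (simp add: i r_def norm_minus_commute)
      next
        case False
        have K: "K i = cbox y x" using False by (simp add: i K_def)
        have "G y - G x - (y - x) *\<^sub>R f x = (x - y) *\<^sub>R f x - integral (cbox y x) f"
          using G[of y x] False x y by (simp add: algebra_simps)
        then show ?thesis using nn False unfolding K by (simp add: i r_def)
      qed
    qed
    have "(\<Sum>i\<in>F. r i) / n = (\<Sum>i\<in>F. r i / n)" by (rule sum_divide_distrib)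
    also have "\<dots> \<le> e / (10 * n)" using sum_mono[of F "\<lambda>i. r i / n", OF 2] 1 by simp
    finally show ?thesis using n by (simp add: field_simps)
  qed
  have ms: "measure lebesgue (\<Union>i\<in>F. cball (fst i) (5 * r i)) \<le> e" if F: "F \<subseteq> C" "finite F" for F
  proof -
    have "measure lebesgue (\<Union>i\<in>F. cball (fst i) (5 * r i)) \<le> (\<Sum>i\<in>F. measure lebesgue (cball (fst i) (5 * r i)))"
      by (rule measure_UNION_le[OF F(2)]) simp
    also have "\<dots> = (\<Sum>i\<in>F. 10 * r i)"
    proof (rule sum.cong)
      fix i assume "i \<in> F"
      then have "0 < r i" using F C rI by blast
      then show "measure lebesgue (cball (fst i) (5 * r i)) = 10 * r i"
        by (simp add: cball_eq_atLeastAtMost)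
    qed simp
    also have "\<dots> \<le> e" using bound[OF F] by (simp add: sum_distrib_left[symmetric])
    finally show ?thesis .
  qed
  let ?T = "\<Union>i\<in>C. cball (fst i) (5 * r i)"
  show "\<exists>T. ?E \<subseteq> T \<and> T \<in> lmeasurable \<and> measure lebesgue T \<le> e"
  proof (intro exI[of _ ?T] conjI)
    show "?E \<subseteq> ?T" by (rule C(4))
    show "?T \<in> lmeasurable"
      by (rule fmeasurable_UN_bound[OF C(1), where B = e]) (use ms in auto)
    show "measure lebesgue ?T \<le> e"
      by (rule measure_UN_bound[OF C(1), where B = e]) (use ms in auto)
  qed
qed

theorem Lebesgue_differentiation:
  fixes f :: "real \<Rightarrow> 'a::euclidean_space"
  assumes f: "f integrable_on cbox a b"
  shows "negligible {x \<in> {a<..<b}. \<not> ((\<lambda>x. integral (cbox a x) f) has_vector_derivative f x) (at x)}"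
proof -
  define G where "G x = integral (cbox a x) f" for x
  let ?E = "\<lambda>n. {x \<in> {a<..<b}. \<forall>d>0. \<exists>y\<in>cbox a b. 0 < \<bar>y - x\<bar> \<and> \<bar>y - x\<bar> < d \<and>
    norm (G y - G x - (y - x) *\<^sub>R f x) > \<bar>y - x\<bar> / n}"
  have "negligible (\<Union>n. ?E (real (Suc n)))"
    unfolding G_def by (intro negligible_countable_Union countable_image ballI)
      (use negligible_bad_differentiation_set[OF f] in auto)
  moreover have "{x \<in> {a<..<b}. \<not> (G has_vector_derivative f x) (at x)} \<subseteq> (\<Union>n. ?E (real (Suc n)))"
  proof (rule subsetI, rule ccontr)
    fix x assume x: "x \<in> {x \<in> {a<..<b}. \<not> (G has_vector_derivative f x) (at x)}"
      and nx: "x \<notin> (\<Union>n. ?E (real (Suc n)))"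
    have "(G has_derivative (\<lambda>h. h *\<^sub>R f x)) (at x)"
      unfolding has_derivative_at_alt
    proof (intro conjI allI impI)
      show "bounded_linear (\<lambda>h. h *\<^sub>R f x)" by (rule bounded_linear_scaleR_left)
      fix e :: real assume e: "e > 0"
      then obtain n where n: "1 / real (Suc n) < e"
        using nat_approx_posE by blast
      obtain d where d: "d > 0" and dd: "\<And>y. y \<in> cbox a b \<Longrightarrow> 0 < \<bar>y - x\<bar> \<Longrightarrow> \<bar>y - x\<bar> < d \<Longrightarrow>
          norm (G y - G x - (y - x) *\<^sub>R f x) \<le> \<bar>y - x\<bar> / real (Suc n)"
      proof -
        have "x \<notin> ?E (real (Suc n))" using nx by blast
        then obtain d where d: "d > 0" "\<forall>y\<in>cbox a b. \<not> (0 < \<bar>y - x\<bar> \<and> \<bar>y - x\<bar> < d \<and>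
            norm (G y - G x - (y - x) *\<^sub>R f x) > \<bar>y - x\<bar> / real (Suc n))"
          using x by blast
        show thesis
          by (rule that[OF d(1)]) (use d(2) in \<open>meson not_less\<close>)
      qed
      let ?d = "min d (min (x - a) (b - x))"
      show "\<exists>d>0. \<forall>y. norm (y - x) < d \<longrightarrow> norm (G y - G x - (y - x) *\<^sub>R f x) \<le> e * norm (y - x)"
      proof (intro exI[of _ ?d] conjI allI impI)
        show "?d > 0" using d x by simp
        fix y assume y: "norm (y - x) < ?d"
        show "norm (G y - G x - (y - x) *\<^sub>R f x) \<le> e * norm (y - x)"
        proof (cases "y = x")
          case False
          have "norm (G y - G x - (y - x) *\<^sub>R f x) \<le> \<bar>y - x\<bar> / real (Suc n)"
            using y False by (intro dd) auto
          also have "\<dots> = (1 / real (Suc n)) * \<bar>y - x\<bar>" by simp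
          also have "\<dots> \<le> e * \<bar>y - x\<bar>" using n by (intro mult_right_mono) auto
          finally show ?thesis by simp
        qed simp
      qed
    qed
    then show False using x by (simp add: has_vector_derivative_def)
  qed
  ultimately show ?thesis unfolding G_def by (rule negligible_subset)
qed

lemma negligible_open_superset:
  fixes N :: "real set"
  assumes "negligible N" "e > 0"
  obtains U where "open U" "N \<subseteq> U" "U \<in> lmeasurable" "measure lebesgue U < e"
proof -
  have N: "N \<in> lmeasurable" "measure lebesgue N = 0" "N \<in> null_sets lebesgue"
    using assms(1) negligible_imp_measurable negligible_imp_measure0 negligible_iff_null_sets by blast+
  obtain U where U: "open U" "N \<subseteq> U" "U - N \<in> lmeasurable" "emeasure lebesgue (U - N) < ennreal e"
    using sets_lebesgue_outer_open[of N e] N assms(2) fmeasurableD by blast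
  have "U = (U - N) \<union> N" using U(2) by blast
  then have Um: "U \<in> lmeasurable" using fmeasurable.Un[OF U(3) N(1)] by simp
  have "measure lebesgue U = measure lebesgue (U - N)"
    by (rule measure_Diff_null_set[OF fmeasurableD[OF Um] N(3), symmetric])
  also have "\<dots> < e"
    using U(4) assms(2) emeasure_eq_measure2[OF U(3)] by (simp add: ennreal_less_iff)
  finally show thesis using that U(1,2) Um by blast
qed

text \<open>The gauge treats two kinds of tags differently. At a tag outside \<open>N\<close>,
  differentiability makes the increment of \<open>f\<close> nearly linear. The intervals tagged in
  \<open>N\<close> are confined to an open set of measure below \<delta>, where absolute continuity
  bounds the sum of all increments.\<close>

theorem AC01_fundamental_theorem_of_calculus:
  assumes AC: "AC01 f" and N: "negligible N"
    and der: "\<And>x. x \<in> {0..1} - N \<Longrightarrow> (f has_vector_derivative g x) (at x within {0..1})"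
    and c: "0 \<le> c" "c \<le> 1"
  shows "(g has_integral (f c - f 0)) {0..c}"
proof -
  \<comment> \<open>With the value 0 on \<open>N\<close>, the error of a term tagged in
    \<open>N\<close> is the increment of \<open>f\<close> alone.\<close>
  define g' where "g' x = (if x \<in> N then 0 else g x)" for x
  have "(g' has_integral (f c - f 0)) (cbox 0 c)"
    unfolding has_integral
  proof (intro allI impI)
    fix e :: real assume e: "e > 0"
    from AC[unfolded AC01_def, rule_format, OF half_gt_zero[OF e]] obtain \<delta> where \<delta>: "\<delta> > 0"
      and ACd: "\<And>D S. D division_of S \<and> S \<subseteq> {0..1} \<and> (\<Sum>K\<in>D. Sup K - Inf K) < \<delta> \<Longrightarrow>
        (\<Sum>K\<in>D. norm (f (Sup K) - f (Inf K))) < e / 2"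
      by (elim exE conjE) (rule that, assumption, elim allE impE)
    obtain U where U: "open U" "N \<subseteq> U" "U \<in> lmeasurable" "measure lebesgue U < \<delta>"
      by (rule negligible_open_superset[OF N \<delta>])
    have "\<forall>x\<in>{0..1} - N. \<exists>d. d > 0 \<and> (\<forall>y\<in>{0..1}. norm (y - x) < d \<longrightarrow>
        norm (f y - f x - (y - x) *\<^sub>R g x) \<le> e / 4 * norm (y - x))"
    proof
      fix x assume "x \<in> {0..1} - N"
      from der[OF this, unfolded has_vector_derivative_def has_derivative_within_alt, THEN conjunct2, rule_format, of "e / 4"] e
      show "\<exists>d. d > 0 \<and> (\<forall>y\<in>{0..1}. norm (y - x) < d \<longrightarrow>
        norm (f y - f x - (y - x) *\<^sub>R g x) \<le> e / 4 * norm (y - x))" by simp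
    qed
    from bchoice[OF this] obtain d where d: "\<And>x. x \<in> {0..1} - N \<Longrightarrow> d x > 0"
      and dd: "\<And>x y. x \<in> {0..1} - N \<Longrightarrow> y \<in> {0..1} \<Longrightarrow> norm (y - x) < d x \<Longrightarrow>
        norm (f y - f x - (y - x) *\<^sub>R g x) \<le> e / 4 * norm (y - x)"
      by blast
    define \<gamma> where "\<gamma> x = (if x \<in> N then U else if x \<in> {0..1} then ball x (d x) else ball x 1)" for x
    have gauge: "gauge \<gamma>"
      unfolding gauge_def \<gamma>_def using U d by auto
    show "\<exists>\<gamma>. gauge \<gamma> \<and> (\<forall>\<D>. \<D> tagged_division_of cbox 0 c \<and> \<gamma> fine \<D> \<longrightarrow>
        norm ((\<Sum>(x, k)\<in>\<D>. measure lborel k *\<^sub>R g' x) - (f c - f 0)) < e)"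
    proof (intro exI[of _ \<gamma>] conjI gauge allI impI, elim conjE)
      fix p assume p: "p tagged_division_of cbox 0 c" and fine: "\<gamma> fine p"
      have fin: "finite p" by (rule tagged_division_of_finite[OF p])
      have mem: "x \<in> K" "K \<subseteq> {0..c}" "Inf K \<le> x" "x \<le> Sup K" "Inf K \<in> {0..1}" "Sup K \<in> {0..1}"
        "K = {Inf K..Sup K}" "measure lborel K = Sup K - Inf K" "x \<in> {0..1}"
        if xK: "(x, K) \<in> p" for x K
      proof -
        obtain u v where K: "K = {u..v}" using tagged_division_ofD(4)[OF p xK] by auto
        show xk: "x \<in> K" and Kc: "K \<subseteq> {0..c}" using tagged_division_ofD(2,3)[OF p xK] by auto
        then have uv: "u \<le> v" using K by auto
        show "Inf K \<le> x" "x \<le> Sup K" "Inf K \<in> {0..1}" "Sup K \<in> {0..1}"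
          "K = {Inf K..Sup K}" "measure lborel K = Sup K - Inf K" "x \<in> {0..1}"
          using uv xk Kc c by (auto simp: K)
      qed
      define p1 p2 where "p1 = {(x, K) \<in> p. x \<in> N}" and "p2 = {(x, K) \<in> p. x \<notin> N}"
      have p12: "p = p1 \<union> p2" "p1 \<inter> p2 = {}" "finite p1" "finite p2"
        using fin by (auto simp: p1_def p2_def intro: finite_subset[OF _ fin])
      let ?F = "\<lambda>(x, K). measure lborel K *\<^sub>R g' x - (f (Sup K) - f (Inf K))"
      have "(\<Sum>(x, k)\<in>p. measure lborel k *\<^sub>R g' x) - (f c - f 0) = (\<Sum>i\<in>p. ?F i)"
        using additive_tagged_division_1[of 0 c p f] p c
        by (simp add: case_prod_unfold sum_subtractf)
      also have "norm \<dots> \<le> (\<Sum>i\<in>p. norm (?F i))" by (rule norm_sum)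
      also have "\<dots> = (\<Sum>i\<in>p1. norm (?F i)) + (\<Sum>i\<in>p2. norm (?F i))"
        unfolding p12(1) by (rule sum.union_disjoint) (use p12 in auto)
      also have "(\<Sum>i\<in>p2. norm (?F i)) \<le> (\<Sum>i\<in>p2. e / 4 * (Sup (snd i) - Inf (snd i)))"
      proof (rule sum_mono)
        fix i assume i: "i \<in> p2"
        obtain x K where xK: "i = (x, K)" by fastforce
        have ip: "(x, K) \<in> p" and xN: "x \<notin> N" using i by (auto simp: p2_def xK)
        note m = mem[OF ip]
        have "K \<subseteq> ball x (d x)" using fineD[OF fine ip] m xN by (simp add: \<gamma>_def)
        moreover have "Inf K \<in> K" "Sup K \<in> K" using m by (metis atLeastAtMost_iff order.refl order.trans)+
        ultimately have dist: "norm (Inf K - x) < d x" "norm (Sup K - x) < d x"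
          by (auto simp: dist_real_def abs_minus_commute)
        have "norm (f (Sup K) - f x - (Sup K - x) *\<^sub>R g x) \<le> e / 4 * norm (Sup K - x)"
          "norm (f (Inf K) - f x - (Inf K - x) *\<^sub>R g x) \<le> e / 4 * norm (Inf K - x)"
          by (rule dd; use m xN dist in simp)+
        moreover have "?F i = (f (Inf K) - f x - (Inf K - x) *\<^sub>R g x) - (f (Sup K) - f x - (Sup K - x) *\<^sub>R g x)"
          using xN by (simp add: xK g'_def m(8) algebra_simps del: measure_lborel_Icc)
        ultimately have "norm (?F i) \<le> e / 4 * norm (Inf K - x) + e / 4 * norm (Sup K - x)"
          using norm_triangle_ineq4 order_trans add_mono by (smt (verit))
        also have "\<dots> = e / 4 * (Sup K - Inf K)" using m(3,4) by (simp add: field_simps)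
        finally show "norm (?F i) \<le> e / 4 * (Sup (snd i) - Inf (snd i))" by (simp add: xK)
      qed
      also have "(\<Sum>i\<in>p2. e / 4 * (Sup (snd i) - Inf (snd i))) \<le> (\<Sum>i\<in>p. e / 4 * (Sup (snd i) - Inf (snd i)))"
        using mem(3,4) e p12 fin by (intro sum_mono2) force+
      also have "\<dots> = e / 4 * (\<Sum>(x, K)\<in>p. Sup K - Inf K)"
        by (simp add: sum_distrib_left case_prod_unfold)
      also have "(\<Sum>(x, K)\<in>p. Sup K - Inf K) = c"
        using additive_tagged_division_1[of 0 c p "\<lambda>x. x"] p c by simp
      also have "e / 4 * c \<le> e / 4" using c e by simp
      also have "(\<Sum>i\<in>p1. norm (?F i)) < e / 2"
      proof -
        have tp1: "p1 tagged_partial_division_of (cbox 0 c)"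
          using p tagged_partial_division_subset[of p "cbox 0 c" p1] p12
          by (auto simp: tagged_division_of_def)
        note t1 = tagged_partial_division_of_Union_self[OF tp1]
        let ?D = "snd ` p1" and ?S = "\<Union>(snd ` p1)"
        have D: "?D division_of ?S" by (rule division_of_tagged_division[OF t1])
        have K1: "measure lebesgue K = Sup K - Inf K" if K: "K \<in> ?D" for K
        proof -
          obtain x where "(x, K) \<in> p" using K by (auto simp: p1_def)
          from mem(8)[OF this] mem(7)[OF this] show ?thesis
            by (metis measure_completion sets_lborel atLeastAtMost_borel)
        qed
        have S1: "?S \<subseteq> {0..1}" using mem(2) c by (fastforce simp: p1_def)
        have "?S \<subseteq> U" using fine by (fastforce simp: p1_def fine_def \<gamma>_def split: if_splits)
        then have "measure lebesgue ?S \<le> measure lebesgue U"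
          using U(3) by (intro measure_mono_fmeasurable) (auto intro: fmeasurableD lmeasurable_division[OF D])
        then have "(\<Sum>K\<in>?D. Sup K - Inf K) < \<delta>"
          using content_division[OF D] U(4) K1 by simp
        from ACd[OF conjI[OF D conjI[OF S1 this]]] have "(\<Sum>K\<in>?D. norm (f (Sup K) - f (Inf K))) < e / 2" .
        also have "(\<Sum>K\<in>?D. norm (f (Sup K) - f (Inf K))) = (\<Sum>(x, K)\<in>p1. norm (f (Sup K) - f (Inf K)))"
        proof -
          \<comment> \<open>An interval may occur with two tags. Its interior is then empty, so it
            is a single point and carries no increment.\<close>
          have "(\<Sum>K\<in>?D. norm (f (Sup K) - f (Inf K))) = (\<Sum>i\<in>p1. norm (f (Sup (snd i)) - f (Inf (snd i))))"
          proof (subst sum.reindex_nontrivial[OF p12(3)])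
            fix i j assume ij: "i \<in> p1" "j \<in> p1" "i \<noteq> j" "snd i = snd j"
            have ip: "(fst i, snd i) \<in> p" using ij(1) by (auto simp: p1_def)
            have "interior (snd i) = {}"
              using tagged_partial_division_ofD(5)[OF tp1, of "fst i" "snd i" "fst j" "snd j"] ij by (cases i, cases j) simp
            then have "{Inf (snd i)<..<Sup (snd i)} = {}"
              by (subst (asm) mem(7)[OF ip]) simp
            then have "Inf (snd i) = Sup (snd i)" using mem(3,4)[OF ip] by simp
            then show "norm (f (Sup (snd i)) - f (Inf (snd i))) = 0" by simp
          qed simp
          then show ?thesis by (simp add: case_prod_unfold)
        qed
        also have "\<dots> = (\<Sum>i\<in>p1. norm (?F i))"
          by (intro sum.cong) (auto simp: p1_def g'_def norm_minus_commute)
        finally show ?thesis .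
      qed
      finally show "norm ((\<Sum>(x, k)\<in>p. measure lborel k *\<^sub>R g' x) - (f c - f 0)) < e"
        using e by simp
    qed
  qed
  then have "(g' has_integral (f c - f 0)) {0..c}" by simp
  then show ?thesis
    by (rule has_integral_spike[OF N, rotated]) (auto simp: g'_def)
qed

section \<open>The Dirichlet Laplacian as an integral operator\<close>

lemma borel_measurable_unit_lebesgue [measurable]: "(\<lambda>x. x) \<in> measurable unit_lebesgue borel"
  using id_borel_measurable_lebesgue_on by (simp add: id_def)

lemma finite_measure_unit_lebesgue: "finite_measure unit_lebesgue"
  by (rule finite_measure_lebesgue_on) simp

lemma space_unit_lebesgue [simp]: "space unit_lebesgue = {0<..<1}"
  by (simp add: space_restrict_space)

lemma measure_unit_lebesgue:
  assumes "A \<in> sets lebesgue"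
  shows "measure unit_lebesgue (A \<inter> {0<..<1}) = measure lebesgue (A \<inter> {0<..<1})"
  using assms by (subst measure_restrict_space) auto

lemma measure_space_unit_lebesgue: "measure unit_lebesgue {0<..<1} = 1"
  by (subst measure_restrict_space) auto

text \<open>Lebesgue measure is complete: the exceptional set is itself a null set, not merely
  contained in one.\<close>

lemma AE_unit_lebesgue_iff:
  "(AE x in unit_lebesgue. P x) \<longleftrightarrow> negligible {x \<in> {0<..<1}. \<not> P x}"
proof -
  have "(AE x in unit_lebesgue. P x) \<longleftrightarrow> (AE x in lebesgue. x \<in> {0<..<1} \<longrightarrow> P x)"
    by (subst AE_restrict_space_iff) auto
  also have "\<dots> \<longleftrightarrow> {x \<in> {0<..<1}. \<not> P x} \<in> null_sets lebesgue"
  proof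
    assume "AE x in lebesgue. x \<in> {0<..<1} \<longrightarrow> P x"
    then obtain N where "{x. \<not> (x \<in> {0<..<1} \<longrightarrow> P x)} \<subseteq> N" "N \<in> null_sets lebesgue"
      by (auto simp: eventually_ae_filter)
    then show "{x \<in> {0<..<1}. \<not> P x} \<in> null_sets lebesgue"
      by (auto simp: negligible_iff_null_sets[symmetric] elim: negligible_subset)
  next
    assume "{x \<in> {0<..<1}. \<not> P x} \<in> null_sets lebesgue"
    then show "AE x in lebesgue. x \<in> {0<..<1} \<longrightarrow> P x"
      by (rule AE_I') auto
  qed
  finally show ?thesis by (simp add: negligible_iff_null_sets)
qed

lemma bounded_integrable_unit_lebesgue:
  fixes f :: "real \<Rightarrow> 'a::{banach,second_countable_topology}"
  assumes "f \<in> borel_measurable unit_lebesgue" "\<And>x. x \<in> {0<..<1} \<Longrightarrow> norm (f x) \<le> B"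
  shows "integrable unit_lebesgue f"
  by (rule finite_measure.integrable_const_bound[OF finite_measure_unit_lebesgue _ assms(1), of B])
     (use assms(2) in auto)

lemma bounded_L2:
  assumes "f \<in> borel_measurable unit_lebesgue" "\<And>x. x \<in> {0<..<1} \<Longrightarrow> norm (f x) \<le> B"
  shows "f \<in> L2 unit_lebesgue"
proof -
  have "integrable unit_lebesgue (\<lambda>x. (norm (f x))\<^sup>2)"
  proof (rule bounded_integrable_unit_lebesgue[where B = "B\<^sup>2"])
    show "\<And>x. x \<in> {0<..<1} \<Longrightarrow> norm ((norm (f x))\<^sup>2) \<le> B\<^sup>2"
      using assms(2) by (simp add: power_mono)
  qed (use assms(1) in measurable)
  then show ?thesis using assms(1) by (simp add: L2_def)
qed

lemma L2_bounded_mult: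
  assumes h: "h \<in> borel_measurable unit_lebesgue" "\<And>x. x \<in> {0<..<1} \<Longrightarrow> norm (h x) \<le> B"
    and f: "f \<in> L2 unit_lebesgue"
  shows "(\<lambda>x. h x * f x) \<in> L2 unit_lebesgue"
proof -
  have "integrable unit_lebesgue (\<lambda>x. (norm (h x * f x))\<^sup>2)"
  proof (rule Bochner_Integration.integrable_bound[OF integrable_mult_right[OF L2_sq_integrable[OF f], of "B\<^sup>2"]])
    show "(\<lambda>x. (norm (h x * f x))\<^sup>2) \<in> borel_measurable unit_lebesgue"
      using h(1) L2_measurable[OF f] by measurable
    show "AE x in unit_lebesgue. norm ((norm (h x * f x))\<^sup>2) \<le> norm (B\<^sup>2 * (norm (f x))\<^sup>2)"
      using h(2) by (intro AE_I2) (auto simp: norm_mult power_mult_distrib intro!: mult_right_mono power_mono)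
  qed
  then show ?thesis using h(1) L2_measurable[OF f] by (simp add: L2_def)
qed

lemma L2_integrable:
  assumes "f \<in> L2 unit_lebesgue"
  shows "integrable unit_lebesgue f"
proof -
  have "integrable unit_lebesgue (\<lambda>x. f x * cnj ((\<lambda>x. 1) x))"
    by (rule L2_mult_integrable[OF assms bounded_L2[where B = 1]]) auto
  then show ?thesis by simp
qed

lemma bounded_mult_integrable:
  assumes "h \<in> borel_measurable unit_lebesgue" "\<And>x. x \<in> {0<..<1} \<Longrightarrow> norm (h x) \<le> B"
    and "f \<in> L2 unit_lebesgue"
  shows "integrable unit_lebesgue (\<lambda>x. h x * f x)"
  by (rule L2_integrable[OF L2_bounded_mult[OF assms]])

text \<open>Twofold integration from 0. The point \<open>x\<close> sits in the kernel and not in the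
  limits of integration, so that all kernels act on one fixed measure space and estimates in
  \<open>x\<close> become estimates of kernels.\<close>

definition volt :: "(real \<Rightarrow> complex) \<Rightarrow> real \<Rightarrow> complex" where
  "volt g x = (LINT t|unit_lebesgue. of_real (max 0 (x - t)) * g t)"

text \<open>The kernel is the Green function of - f'' with Dirichlet conditions at both
  ends.\<close>

definition green :: "(real \<Rightarrow> complex) \<Rightarrow> real \<Rightarrow> complex" where
  "green g x = (LINT t|unit_lebesgue. of_real (min x t - x * t) * g t)"

definition prim :: "(real \<Rightarrow> complex) \<Rightarrow> real \<Rightarrow> complex" where
  "prim g x = (LINT t|unit_lebesgue. of_real (indicator {..x} t) * g t)"

lemma volt_integrable:
  "g \<in> L2 unit_lebesgue \<Longrightarrow> integrable unit_lebesgue (\<lambda>t. of_real (max 0 (x - t)) * g t)"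
  by (rule bounded_mult_integrable[where B = "\<bar>x\<bar> + 1"]) auto

lemma prim_integrable:
  "g \<in> L2 unit_lebesgue \<Longrightarrow> integrable unit_lebesgue (\<lambda>t. of_real (indicator {..x} t) * g t)"
  by (rule bounded_mult_integrable[where B = 1]) (auto simp: indicator_def)

lemma kernel_diff_bound:
  assumes g: "g \<in> L2 unit_lebesgue"
    and h: "h \<in> borel_measurable unit_lebesgue" "\<And>t. t \<in> {0<..<1} \<Longrightarrow> norm (h t) \<le> C"
  shows "norm (LINT t|unit_lebesgue. h t * g t) \<le> C * (LINT t|unit_lebesgue. norm (g t))"
proof -
  have "norm (LINT t|unit_lebesgue. h t * g t) \<le> (LINT t|unit_lebesgue. norm (h t * g t))"
    by (rule integral_norm_bound)
  also have "\<dots> \<le> (LINT t|unit_lebesgue. C * norm (g t))"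
  proof (rule integral_mono)
    show "integrable unit_lebesgue (\<lambda>t. norm (h t * g t))"
      by (intro integrable_norm bounded_mult_integrable[OF h g])
    show "integrable unit_lebesgue (\<lambda>t. C * norm (g t))"
      using L2_integrable[OF g] by simp
  qed (use h(2) in \<open>auto simp: norm_mult intro!: mult_right_mono\<close>)
  finally show ?thesis by simp
qed

lemma volt_lipschitz:
  assumes g: "g \<in> L2 unit_lebesgue"
  shows "norm (volt g y - volt g x) \<le> \<bar>y - x\<bar> * (LINT t|unit_lebesgue. norm (g t))"
proof -
  have "volt g y - volt g x = (LINT t|unit_lebesgue. of_real (max 0 (y - t) - max 0 (x - t)) * g t)"
    unfolding volt_def by (simp add: volt_integrable[OF g] left_diff_distrib
      flip: Bochner_Integration.integral_diff)
  also have "norm \<dots> \<le> \<bar>y - x\<bar> * (LINT t|unit_lebesgue. norm (g t))"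
    by (rule kernel_diff_bound[OF g]) (auto simp del: of_real_diff)
  finally show ?thesis .
qed

text \<open>Cauchy--Schwarz against an indicator. The square root of the length is what makes
  \<open>volt g\<close> differentiable at every point and \<open>prim g\<close> absolutely
  continuous.\<close>

lemma interval_bound:
  assumes g: "g \<in> L2 unit_lebesgue" and A: "A \<in> sets borel" "A \<subseteq> {0..1}"
  shows "(LINT t|unit_lebesgue. indicator A t * norm (g t)) \<le> sqrt (measure lborel A) * l2_norm unit_lebesgue g"
proof -
  have i: "(\<lambda>t. of_real (indicator A t)) \<in> L2 unit_lebesgue"
    using A by (intro bounded_L2[where B = 1]) (auto simp: indicator_def)
  have "(LINT t|unit_lebesgue. indicator A t * norm (g t)) =
      (LINT t|unit_lebesgue. norm (complex_of_real (indicator A t)) * norm (g t))" by simp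
  also have "\<dots> \<le> l2_norm unit_lebesgue (\<lambda>t. of_real (indicator A t)) * l2_norm unit_lebesgue g"
    by (rule L2_norm_mult_le[OF i g])
  also have "l2_norm unit_lebesgue (\<lambda>t. of_real (indicator A t)) \<le> sqrt (measure lborel A)"
  proof -
    have "(LINT t|unit_lebesgue. (norm (complex_of_real (indicator A t)))\<^sup>2) = (LINT t|unit_lebesgue. indicator A t)"
      by (intro Bochner_Integration.integral_cong) (auto simp: indicator_def)
    also have "\<dots> = measure unit_lebesgue (A \<inter> {0<..<1})"
      by simp
    also have "\<dots> = measure lebesgue (A \<inter> {0<..<1})"
      using A by (intro measure_unit_lebesgue) auto
    also have "\<dots> \<le> measure lebesgue A"
      by (rule measure_mono_fmeasurable) (use A in \<open>auto intro: fmeasurableI2[of "{0..1}"]\<close>)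
    also have "\<dots> = measure lborel A" using A by simp
    finally show ?thesis unfolding l2_norm_def by (rule real_sqrt_le_mono)
  qed
  then have "l2_norm unit_lebesgue (\<lambda>t. of_real (indicator A t)) * l2_norm unit_lebesgue g \<le> sqrt (measure lborel A) * l2_norm unit_lebesgue g"
    by (rule mult_right_mono) simp
  finally show ?thesis .
qed


lemma prim_diff:
  assumes g: "g \<in> L2 unit_lebesgue" and xy: "x \<le> y"
  shows "prim g y - prim g x = (LINT t|unit_lebesgue. of_real (indicator {x<..y} t) * g t)"
proof -
  have "prim g y - prim g x = (LINT t|unit_lebesgue. of_real (indicator {..y} t) * g t - of_real (indicator {..x} t) * g t)"
    unfolding prim_def by (simp add: prim_integrable[OF g])
  also have "\<dots> = (LINT t|unit_lebesgue. of_real (indicator {x<..y} t) * g t)"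
    using xy by (intro Bochner_Integration.integral_cong) (auto simp: indicator_def)
  finally show ?thesis .
qed

lemma prim_diff_bound:
  assumes g: "g \<in> L2 unit_lebesgue" and xy: "x \<le> y"
  shows "norm (prim g y - prim g x) \<le> (LINT t|unit_lebesgue. indicator {x<..y} t * norm (g t))"
proof -
  have "norm (prim g y - prim g x) \<le> (LINT t|unit_lebesgue. norm (of_real (indicator {x<..y} t) * g t))"
    unfolding prim_diff[OF g xy] by (rule integral_norm_bound)
  also have "\<dots> = (LINT t|unit_lebesgue. indicator {x<..y} t * norm (g t))"
    by (intro Bochner_Integration.integral_cong) (auto simp: norm_mult)
  finally show ?thesis .
qed

lemma indicator_norm_integrable:
  assumes g: "g \<in> L2 unit_lebesgue" and A: "A \<in> sets borel"
  shows "integrable unit_lebesgue (\<lambda>t. indicator A t * norm (g t))"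
proof (rule Bochner_Integration.integrable_bound[OF integrable_norm[OF L2_integrable[OF g]]])
  show "(\<lambda>t. indicator A t * norm (g t)) \<in> borel_measurable unit_lebesgue"
    using A L2_measurable[OF g] by measurable
qed (auto simp: indicator_def)

text \<open>The difference of the two kernels, minus its linear part, lives on the interval between
  \<open>x\<close> and \<open>y\<close> and is at most the length of that interval. The error is
  therefore of order 3/2 in \<open>y - x\<close>, at every point and not only almost
  everywhere.\<close>

lemma volt_prim_estimate:
  assumes g: "g \<in> L2 unit_lebesgue" and x: "x \<in> {0..1}" "y \<in> {0..1}"
  shows "norm (volt g y - volt g x - (y - x) *\<^sub>R prim g x) \<le> \<bar>y - x\<bar> * (sqrt \<bar>y - x\<bar> * l2_norm unit_lebesgue g)"
proof -
  define A where "A = {min x y..max x y}"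
  define h where "h t = max 0 (y - t) - max 0 (x - t) - (y - x) * indicator {..x} t" for t
  have h: "\<bar>h t\<bar> \<le> \<bar>y - x\<bar> * indicator A t" for t
    unfolding h_def A_def indicator_def by (auto simp: max_def min_def)
  have ing: "integrable unit_lebesgue (\<lambda>t. norm (g t))" by (rule integrable_norm[OF L2_integrable[OF g]])
  have "volt g y - volt g x - (y - x) *\<^sub>R prim g x =
     (LINT t|unit_lebesgue. of_real (max 0 (y - t)) * g t - of_real (max 0 (x - t)) * g t
        - (y - x) *\<^sub>R (of_real (indicator {..x} t) * g t))"
    unfolding volt_def prim_def using volt_integrable[OF g] prim_integrable[OF g] by simp
  also have "\<dots> = (LINT t|unit_lebesgue. of_real (h t) * g t)"
    by (intro Bochner_Integration.integral_cong refl) (simp add: h_def algebra_simps scaleR_conv_of_real)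
  also have "norm \<dots> \<le> (LINT t|unit_lebesgue. norm (of_real (h t) * g t))"
    by (rule integral_norm_bound)
  also have "\<dots> \<le> (LINT t|unit_lebesgue. \<bar>y - x\<bar> * (indicator A t * norm (g t)))"
  proof (rule integral_mono')
    show "integrable unit_lebesgue (\<lambda>t. \<bar>y - x\<bar> * (indicator A t * norm (g t)))"
      by (intro integrable_mult_right indicator_norm_integrable g) (simp add: A_def)
    show "norm (of_real (h t) * g t) \<le> \<bar>y - x\<bar> * (indicator A t * norm (g t))" for t
      using mult_right_mono[OF h[of t] norm_ge_zero[of "g t"]] by (simp add: norm_mult mult.assoc)
  qed simp
  also have "\<dots> = \<bar>y - x\<bar> * (LINT t|unit_lebesgue. indicator A t * norm (g t))" by simp
  also have "\<dots> \<le> \<bar>y - x\<bar> * (sqrt \<bar>y - x\<bar> * l2_norm unit_lebesgue g)"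
  proof (rule mult_left_mono)
    have "measure lborel A = \<bar>y - x\<bar>" by (auto simp: A_def)
    then show "(LINT t|unit_lebesgue. indicator A t * norm (g t)) \<le> sqrt \<bar>y - x\<bar> * l2_norm unit_lebesgue g"
      using interval_bound[OF g, of A] x by (auto simp: A_def)
  qed simp
  finally show ?thesis .
qed

lemma volt_has_derivative:
  assumes g: "g \<in> L2 unit_lebesgue" and x: "x \<in> {0..1}"
  shows "(volt g has_vector_derivative prim g x) (at x within {0..1})"
  unfolding has_vector_derivative_def has_derivative_within_alt
proof (intro conjI allI impI)
  show "bounded_linear (\<lambda>h. h *\<^sub>R prim g x)" by (rule bounded_linear_scaleR_left)
  fix e :: real assume e: "e > 0"
  define C where "C = l2_norm unit_lebesgue g + 1"
  have C: "C > 0" "l2_norm unit_lebesgue g \<le> C" by (simp_all add: C_def add_nonneg_pos)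
  show "\<exists>d>0. \<forall>y\<in>{0..1}. norm (y - x) < d \<longrightarrow>
      norm (volt g y - volt g x - (y - x) *\<^sub>R prim g x) \<le> e * norm (y - x)"
  proof (intro exI[of _ "(e / C)\<^sup>2"] conjI ballI impI)
    show "(e / C)\<^sup>2 > 0" using e C by simp
    fix y :: real assume y: "y \<in> {0..1}" "norm (y - x) < (e / C)\<^sup>2"
    have "sqrt \<bar>y - x\<bar> \<le> e / C"
      using y(2) e C by (intro real_le_lsqrt) auto
    then have "sqrt \<bar>y - x\<bar> * l2_norm unit_lebesgue g \<le> e / C * C"
      using C e by (intro mult_mono) auto
    then have "sqrt \<bar>y - x\<bar> * l2_norm unit_lebesgue g \<le> e" using C by simp
    then have "\<bar>y - x\<bar> * (sqrt \<bar>y - x\<bar> * l2_norm unit_lebesgue g) \<le> \<bar>y - x\<bar> * e"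
      by (intro mult_left_mono) auto
    then show "norm (volt g y - volt g x - (y - x) *\<^sub>R prim g x) \<le> e * norm (y - x)"
      using volt_prim_estimate[OF g x y(1)] by (simp add: mult.commute)
  qed
qed

section \<open>Absolute continuity of twofold and of simple primitives\<close>

lemma AC01_lipschitz:
  assumes L: "\<And>x y. x \<in> {0..1} \<Longrightarrow> y \<in> {0..1} \<Longrightarrow> norm (f y - f x) \<le> L * \<bar>y - x\<bar>"
  shows "AC01 f"
  unfolding AC01_def
proof (intro allI impI)
  fix e :: real assume e: "e > 0"
  define C where "C = \<bar>L\<bar> + 1"
  have C: "C > 0" "L \<le> C" by (auto simp: C_def)
  show "\<exists>\<delta>>0. \<forall>D S. D division_of S \<and> S \<subseteq> {0..1} \<and> (\<Sum>K\<in>D. Sup K - Inf K) < \<delta> \<longrightarrow>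
     (\<Sum>K\<in>D. norm (f (Sup K) - f (Inf K))) < e"
  proof (intro exI[of _ "e / C"] conjI allI impI; (elim conjE)?)
    show "e / C > 0" using e C by simp
    fix D S assume D: "D division_of S" "S \<subseteq> {0..1}" "(\<Sum>K\<in>D. Sup K - Inf K) < e / C"
    have "(\<Sum>K\<in>D. norm (f (Sup K) - f (Inf K))) \<le> (\<Sum>K\<in>D. C * (Sup K - Inf K))"
    proof (rule sum_mono)
      fix K assume K: "K \<in> D"
      obtain u v where uv: "K = {u..v}" "u \<le> v" "0 \<le> u" "v \<le> 1"
        using division_ofD(2,3,4)[OF D(1) K] D(2) by (fastforce simp: subset_iff)
      have "norm (f v - f u) \<le> L * \<bar>v - u\<bar>" using uv by (intro L) auto
      also have "\<dots> \<le> C * (v - u)" using uv C by (auto intro!: mult_right_mono)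
      finally show "norm (f (Sup K) - f (Inf K)) \<le> C * (Sup K - Inf K)" using uv by simp
    qed
    also have "\<dots> = C * (\<Sum>K\<in>D. Sup K - Inf K)" by (simp add: sum_distrib_left)
    also have "\<dots> < e" using D(3) C by (simp add: field_simps)
    finally show "(\<Sum>K\<in>D. norm (f (Sup K) - f (Inf K))) < e" .
  qed
qed

text \<open>
  Half-open versions of the division intervals are pairwise disjoint, so that the Cauchy--Schwarz
  inequality applies to the indicator of their union.
\<close>

lemma AC01_prim:
  assumes g: "g \<in> L2 unit_lebesgue"
  shows "AC01 (\<lambda>x. c + prim g x)"
  unfolding AC01_def
proof (intro allI impI)
  fix e :: real assume e: "e > 0"
  define C where "C = l2_norm unit_lebesgue g + 1"
  have C: "C > 0" "l2_norm unit_lebesgue g \<le> C" by (simp_all add: C_def add_nonneg_pos)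
  show "\<exists>\<delta>>0. \<forall>D S. D division_of S \<and> S \<subseteq> {0..1} \<and> (\<Sum>K\<in>D. Sup K - Inf K) < \<delta> \<longrightarrow>
     (\<Sum>K\<in>D. norm (c + prim g (Sup K) - (c + prim g (Inf K)))) < e"
  proof (intro exI[of _ "(e / C)\<^sup>2"] conjI allI impI; (elim conjE)?)
    show "(e / C)\<^sup>2 > 0" using e C by simp
    fix D S assume D: "D division_of S" "S \<subseteq> {0..1}" "(\<Sum>K\<in>D. Sup K - Inf K) < (e / C)\<^sup>2"
    have fin: "finite D" using D(1) by blast
    define h where "h K = {Inf K<..Sup K :: real}" for K
    define A where "A = (\<Union>K\<in>D. h K)"
    have KD: "\<exists>u v. K = {u..v} \<and> u \<le> v \<and> 0 \<le> u \<and> v \<le> 1" if K: "K \<in> D" for K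
    proof -
      obtain u v where uv: "K = {u..v}" using division_ofD(4)[OF D(1) K] by auto
      have "K \<noteq> {}" "K \<subseteq> {0..1}" using division_ofD(2,3)[OF D(1) K] D(2) by auto
      then show ?thesis using uv by auto
    qed
    have disj: "disjoint_family_on h D"
      unfolding disjoint_family_on_def
    proof (intro ballI impI)
      fix K L assume KL: "K \<in> D" "L \<in> D" "K \<noteq> L"
      obtain u v where K: "K = {u..v}" "u \<le> v" using KD[OF KL(1)] by blast
      obtain u' v' where L: "L = {u'..v'}" "u' \<le> v'" using KD[OF KL(2)] by blast
      have "{u<..<v} \<inter> {u'<..<v'} = {}" using division_ofD(5)[OF D(1) KL] K L by simp
      then have "{max u u'<..<min v v'} = {}" by auto
      then have "min v v' \<le> max u u'" by (simp only: greaterThanLessThan_empty_iff)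
      then show "h K \<inter> h L = {}" using K L by (auto simp: h_def)
    qed
    have hm: "h K \<in> sets borel" for K by (simp add: h_def)
    have Am: "A \<in> sets borel" unfolding A_def using fin hm by auto
    have "h K \<subseteq> {0..1}" if "K \<in> D" for K using KD[OF that] by (auto simp: h_def)
    then have A1: "A \<subseteq> {0..1}" unfolding A_def by (rule UN_least)
    have ing: "integrable unit_lebesgue (\<lambda>t. norm (g t))" by (rule integrable_norm[OF L2_integrable[OF g]])
    have "(\<Sum>K\<in>D. norm (c + prim g (Sup K) - (c + prim g (Inf K)))) \<le>
        (\<Sum>K\<in>D. LINT t|unit_lebesgue. indicator (h K) t * norm (g t))"
    proof (rule sum_mono)
      fix K assume "K \<in> D"
      then have "Inf K \<le> Sup K" using KD[of K] by auto
      then show "norm (c + prim g (Sup K) - (c + prim g (Inf K))) \<le> (LINT t|unit_lebesgue. indicator (h K) t * norm (g t))"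
        using prim_diff_bound[OF g] by (simp add: h_def)
    qed
    also have "\<dots> = (LINT t|unit_lebesgue. (\<Sum>K\<in>D. indicator (h K) t * norm (g t)))"
    proof (rule Bochner_Integration.integral_sum[symmetric])
      fix K show "integrable unit_lebesgue (\<lambda>t. indicator (h K) t * norm (g t))"
        by (rule indicator_norm_integrable[OF g hm])
    qed
    also have "\<dots> = (LINT t|unit_lebesgue. indicator A t * norm (g t))"
      unfolding A_def by (simp add: indicator_UN_disjoint[OF fin disj] sum_distrib_right)
    also have "\<dots> \<le> sqrt (measure lborel A) * l2_norm unit_lebesgue g" by (rule interval_bound[OF g Am A1])
    also have "\<dots> \<le> sqrt (measure lborel A) * C" using C by (intro mult_left_mono) auto
    also have "measure lborel A \<le> (\<Sum>K\<in>D. measure lborel (h K))"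
      unfolding A_def by (rule measure_UNION_le[OF fin]) (simp add: hm)
    also have "\<dots> = (\<Sum>K\<in>D. Sup K - Inf K)"
    proof (rule sum.cong)
      fix K assume "K \<in> D"
      then have "Inf K \<le> Sup K" using KD[of K] by auto
      then show "measure lborel (h K) = Sup K - Inf K" by (simp add: h_def)
    qed simp
    finally have *: "(\<Sum>K\<in>D. norm (c + prim g (Sup K) - (c + prim g (Inf K)))) \<le> sqrt (\<Sum>K\<in>D. Sup K - Inf K) * C"
      using C by simp
    have "sqrt (\<Sum>K\<in>D. Sup K - Inf K) < sqrt ((e / C)\<^sup>2)" using D(3) by (rule real_sqrt_less_mono)
    then have "sqrt (\<Sum>K\<in>D. Sup K - Inf K) < e / C" using e C by simp
    then have "sqrt (\<Sum>K\<in>D. Sup K - Inf K) * C < e" using C by (simp add: field_simps)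
    then show "(\<Sum>K\<in>D. norm (c + prim g (Sup K) - (c + prim g (Inf K)))) < e" using * by simp
  qed
qed

lemma L2_integrable_on:
  assumes g: "g \<in> L2 unit_lebesgue"
  shows "g integrable_on {0..1}"
proof -
  have "g integrable_on {0<..<1}"
    by (rule integrable_on_lebesgue_on[OF L2_integrable[OF g]]) simp
  then show ?thesis by (simp add: integrable_on_Icc_iff_Ioo)
qed

lemma prim_eq_integral:
  assumes g: "g \<in> L2 unit_lebesgue" and x: "x \<in> {0..1}"
  shows "prim g x = integral {0..x} g"
proof -
  have "prim g x = (LINT t|unit_lebesgue. (if t \<in> {..x} then g t else 0))"
    unfolding prim_def by (intro Bochner_Integration.integral_cong) (auto simp: indicator_def)
  also have "\<dots> = integral {0<..<1} (\<lambda>t. if t \<in> {..x} then g t else 0)"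
  proof (rule lebesgue_integral_eq_integral)
    show "integrable unit_lebesgue (\<lambda>t. if t \<in> {..x} then g t else 0)"
      using prim_integrable[OF g, of x]
      by (rule Bochner_Integration.integrable_cong[THEN iffD1, rotated -1]) (auto simp: indicator_def)
  qed simp
  also have "\<dots> = integral ({..x} \<inter> {0<..<1}) g" by (rule integral_restrict_Int)
  also have "\<dots> = integral {0..x} g"
    by (rule integral_spike_set) (rule negligible_subset[of "{0, 1}"]; use x in auto)+
  finally show ?thesis .
qed


lemma prim_has_derivative_AE:
  assumes g: "g \<in> L2 unit_lebesgue"
  shows "AE x in unit_lebesgue. (prim g has_vector_derivative g x) (at x)"
  unfolding AE_unit_lebesgue_iff
proof (rule negligible_subset[OF Lebesgue_differentiation])
  show "g integrable_on cbox 0 1" using L2_integrable_on[OF g] by simp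
  show "{x \<in> {0<..<1}. \<not> (prim g has_vector_derivative g x) (at x)} \<subseteq>
    {x \<in> {0<..<1}. \<not> ((\<lambda>x. integral (cbox 0 x) g) has_vector_derivative g x) (at x)}"
  proof (intro subsetI, elim CollectE conjE, intro CollectI conjI notI, assumption)
    fix x assume x: "x \<in> {0<..<1}" "\<not> (prim g has_vector_derivative g x) (at x)"
      and d: "((\<lambda>x. integral (cbox 0 x) g) has_vector_derivative g x) (at x)"
    have "(prim g has_vector_derivative g x) (at x)"
      by (rule has_vector_derivative_transform_within_open[OF d open_greaterThanLessThan x(1)])
         (simp add: prim_eq_integral[OF g])
    then show False using x by simp
  qed
qed

text \<open>A nonempty open set is not negligible; the end points follow by closure.\<close>

lemma continuous_AE_zero_imp_zero:
  fixes h :: "real \<Rightarrow> complex"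
  assumes c: "continuous_on {0..1} h" and z: "AE x in unit_lebesgue. h x = 0" and x: "x \<in> {0..1}"
  shows "h x = 0"
proof -
  have int0: "h y = 0" if y: "y \<in> {0<..<1}" for y
  proof (rule ccontr)
    assume ny: "h y \<noteq> 0"
    have c': "continuous_on {0<..<1} h" by (rule continuous_on_subset[OF c]) auto
    have "open ({0<..<1} \<inter> h -` (- {0}))"
      by (rule continuous_open_preimage[OF c']) auto
    moreover have "{0<..<1} \<inter> h -` (- {0}) = {x \<in> {0<..<1}. \<not> h x = 0}" by auto
    ultimately show False
      using open_not_negligible[of "{x \<in> {0<..<1}. \<not> h x = 0}"] z y ny by (auto simp: AE_unit_lebesgue_iff)
  qed
  have "closure {0<..<1::real} \<subseteq> {x \<in> {0..1}. h x = 0}"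
    by (rule closure_minimal) (use int0 continuous_closed_preimage_constant[OF c] in auto)
  then show ?thesis using x by auto
qed

lemma continuous_on_volt: "g \<in> L2 unit_lebesgue \<Longrightarrow> continuous_on {0..1} (volt g)"
  by (rule continuous_on_vector_derivative[OF volt_has_derivative])

lemma continuous_on_affine_volt:
  "g \<in> L2 unit_lebesgue \<Longrightarrow> continuous_on {0..1} (\<lambda>x. c * of_real x + volt g x)"
  by (intro continuous_intros continuous_on_volt)

lemma volt_0: "volt g 0 = 0"
proof -
  have "volt g 0 = (LINT t|unit_lebesgue. 0)"
    unfolding volt_def by (intro Bochner_Integration.integral_cong) auto
  then show ?thesis by simp
qed

lemma prim_0: "prim g 0 = 0"
proof -
  have "prim g 0 = (LINT t|unit_lebesgue. 0)"
    unfolding prim_def by (intro Bochner_Integration.integral_cong) (auto simp: indicator_def)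
  then show ?thesis by simp
qed

lemma affine_volt_has_derivative:
  assumes g: "g \<in> L2 unit_lebesgue" and x: "x \<in> {0..1}"
  shows "((\<lambda>x. c * of_real x + volt g x) has_vector_derivative c + prim g x) (at x within {0..1})"
proof -
  have "((\<lambda>x. x *\<^sub>R c) has_vector_derivative c) (at x within {0..1})"
    unfolding has_vector_derivative_def
    by (rule bounded_linear_imp_has_derivative[OF bounded_linear_scaleR_left])
  then have "((\<lambda>x. c * of_real x) has_vector_derivative c) (at x within {0..1})"
    by (simp add: scaleR_conv_of_real mult.commute)
  then show ?thesis by (intro has_vector_derivative_add volt_has_derivative g x)
qed

text \<open>A function c x + volt g x has slope c at 0 and second derivative g almost everywhere, so
  it determines both. Uniqueness of the Laplacian, totality of the sines and independence of the
  Jordan chains all come down to this.\<close>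

lemma affine_volt_eq_0:
  assumes g: "g \<in> L2 unit_lebesgue" and z: "AE x in unit_lebesgue. c * of_real x + volt g x = 0"
  shows "c = 0" and "AE x in unit_lebesgue. g x = 0"
proof -
  have 0: "c * of_real x + volt g x = 0" if "x \<in> {0..1}" for x
    by (rule continuous_AE_zero_imp_zero[OF continuous_on_affine_volt[OF g] z that])
  have d: "c + prim g x = 0" if x: "x \<in> {0..1}" for x
  proof -
    have "((\<lambda>x. c * of_real x + volt g x) has_vector_derivative c + prim g x) (at x within {0..1})"
      by (rule affine_volt_has_derivative[OF g x])
    moreover have "((\<lambda>x. c * of_real x + volt g x) has_vector_derivative 0) (at x within {0..1})"
      by (rule has_vector_derivative_transform[OF x _ has_vector_derivative_const[of 0]]) (simp add: 0)
    ultimately show ?thesis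
      using vector_derivative_unique_within_closed_interval[of 0 1 x] x by simp
  qed
  show "c = 0" using d[of 0] by (simp add: prim_0)
  have p: "prim g x = 0" if "x \<in> {0..1}" for x using d[OF that] \<open>c = 0\<close> by simp
  have "AE x in unit_lebesgue. x \<in> {0<..<1}" by (rule AE_I2) simp
  with prim_has_derivative_AE[OF g] show "AE x in unit_lebesgue. g x = 0"
  proof eventually_elim
    case (elim x)
    have "((\<lambda>x. 0) has_vector_derivative g x) (at x)"
      by (rule has_vector_derivative_transform_within_open[OF elim(1) open_greaterThanLessThan elim(2)]) (simp add: p)
    then show ?case using vector_derivative_unique_at has_vector_derivative_const by blast
  qed
qed

lemma green_eq_volt:
  assumes g: "g \<in> L2 unit_lebesgue"
  shows "green g x = volt g 1 * of_real x - volt g x"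
proof -
  have "green g x = (LINT t|unit_lebesgue. of_real x * (of_real (max 0 (1 - t)) * g t) - of_real (max 0 (x - t)) * g t)"
    unfolding green_def
    by (intro Bochner_Integration.integral_cong)
       (auto simp: max_def min_def algebra_simps simp flip: of_real_mult)
  also have "\<dots> = volt g 1 * of_real x - volt g x"
    unfolding volt_def using volt_integrable[OF g] by (simp add: mult.commute)
  finally show ?thesis .
qed

lemma L2_affine_volt: "g \<in> L2 unit_lebesgue \<Longrightarrow> (\<lambda>x. c * of_real x + volt g x) \<in> L2 unit_lebesgue"
proof -
  assume g: "g \<in> L2 unit_lebesgue"
  have c: "continuous_on {0..1} (\<lambda>x. c * of_real x + volt g x)" by (rule continuous_on_affine_volt[OF g])
  obtain B where B: "\<forall>x\<in>{0..1}. norm (c * of_real x + volt g x) \<le> B"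
    using compact_imp_bounded[OF compact_continuous_image[OF c compact_Icc]] by (auto simp: bounded_iff)
  show ?thesis
  proof (rule bounded_L2)
    show "(\<lambda>x. c * of_real x + volt g x) \<in> borel_measurable unit_lebesgue"
      by (rule continuous_imp_measurable_on_sets_lebesgue[OF continuous_on_subset[OF c]]) auto
    show "norm (c * of_real x + volt g x) \<le> B" if "x \<in> {0<..<1}" for x
      using B that by simp
  qed
qed

lemma L2_green:
  assumes g: "g \<in> L2 unit_lebesgue"
  shows "green g \<in> L2 unit_lebesgue"
proof -
  have "green g = (\<lambda>x. - (- volt g 1 * of_real x + volt g x))"
    using green_eq_volt[OF g] by auto
  then show ?thesis using L2_uminus[OF L2_affine_volt[OF g, of "- volt g 1"]] by simp
qed

text \<open>Two integrations, the first by the fundamental theorem for absolutely continuous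
  functions, replace derivatives by an integral equation. The free constant \<open>c\<close> is the
  slope at 0; the condition at 0 is built into \<open>volt\<close>, and the condition at 1 is the
  last equation.\<close>

theorem dirichlet_laplacian_graph_iff:
  "dirichlet_laplacian_graph f g \<longleftrightarrow> f \<in> L2 unit_lebesgue \<and> g \<in> L2 unit_lebesgue \<and>
     (\<exists>c. (AE x in unit_lebesgue. f x = c * of_real x + volt g x) \<and> c + volt g 1 = 0)"
proof (intro iffI; (elim conjE exE)?)
  assume G: "dirichlet_laplacian_graph f g"
  then have f: "f \<in> L2 unit_lebesgue" and g: "g \<in> L2 unit_lebesgue"
    by (simp_all add: dirichlet_laplacian_graph_def)
  obtain u u' where u: "AE x in unit_lebesgue. f x = u x" "AC01 u'" "u 0 = 0" "u 1 = 0"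
    "\<And>x. x \<in> {0..1} \<Longrightarrow> (u has_vector_derivative u' x) (at x within {0..1})"
    "AE x in unit_lebesgue. (u' has_vector_derivative g x) (at x)"
    using G by (auto simp: dirichlet_laplacian_graph_def)
  define N where "N = insert 0 (insert 1 {x \<in> {0<..<1}. \<not> (u' has_vector_derivative g x) (at x)})"
  have N: "negligible N" using u(6) by (simp add: N_def AE_unit_lebesgue_iff)
  have u'x: "u' x = u' 0 + prim g x" if x: "x \<in> {0..1}" for x
  proof -
    have "(g has_integral (u' x - u' 0)) {0..x}"
    proof (rule AC01_fundamental_theorem_of_calculus[OF u(2) N])
      fix y assume "y \<in> {0..1} - N"
      then have "(u' has_vector_derivative g y) (at y)" by (auto simp: N_def)
      then show "(u' has_vector_derivative g y) (at y within {0..1})"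
        by (rule has_vector_derivative_at_within)
    qed (use x in auto)
    then show ?thesis using prim_eq_integral[OF g x] by (simp add: integral_unique)
  qed
  have ux: "u x = u' 0 * of_real x + volt g x" if x: "x \<in> {0..1}" for x
  proof -
    have "((\<lambda>x. u x - (u' 0 * of_real x + volt g x)) has_vector_derivative 0) (at y within {0..1})" if y: "y \<in> {0..1}" for y
    proof -
      have "((\<lambda>x. u x - (u' 0 * of_real x + volt g x)) has_vector_derivative u' y - (u' 0 + prim g y)) (at y within {0..1})"
        by (intro has_vector_derivative_diff affine_volt_has_derivative g y u(5))
      then show ?thesis by (simp add: u'x[OF y])
    qed
    then obtain c where c: "\<And>y. y \<in> {0..1} \<Longrightarrow> u y - (u' 0 * of_real y + volt g y) = c"
      using has_vector_derivative_zero_constant[OF convex_real_interval(5), of 0 1 "\<lambda>x. u x - (u' 0 * of_real x + volt g x)"] by blast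
    show ?thesis using c[OF x] c[of 0] u(3) by (simp add: volt_0)
  qed
  have "AE x in unit_lebesgue. f x = u' 0 * of_real x + volt g x"
    using u(1) AE_space by eventually_elim (use ux in auto)
  moreover have "u' 0 + volt g 1 = 0" using ux[of 1] u(4) by simp
  ultimately show "f \<in> L2 unit_lebesgue \<and> g \<in> L2 unit_lebesgue \<and>
     (\<exists>c. (AE x in unit_lebesgue. f x = c * of_real x + volt g x) \<and> c + volt g 1 = 0)"
    using f g by blast
next
  fix c assume f: "f \<in> L2 unit_lebesgue" and g: "g \<in> L2 unit_lebesgue"
    and fc: "AE x in unit_lebesgue. f x = c * of_real x + volt g x" and c: "c + volt g 1 = 0"
  have "AC01 (\<lambda>x. c * of_real x + volt g x)"
  proof (rule AC01_lipschitz)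
    fix x y :: real
    have "norm (c * of_real y + volt g y - (c * of_real x + volt g x)) = norm (c * of_real (y - x) + (volt g y - volt g x))"
      by (simp add: algebra_simps)
    also have "\<dots> \<le> norm (c * of_real (y - x)) + norm (volt g y - volt g x)" by (rule norm_triangle_ineq)
    also have "norm (c * of_real (y - x)) = norm c * \<bar>y - x\<bar>" by (simp only: norm_mult norm_of_real)
    also have "norm c * \<bar>y - x\<bar> + norm (volt g y - volt g x) \<le> norm c * \<bar>y - x\<bar> + \<bar>y - x\<bar> * (LINT t|unit_lebesgue. norm (g t))"
      by (intro add_left_mono volt_lipschitz g)
    finally show "norm (c * of_real y + volt g y - (c * of_real x + volt g x)) \<le> (norm c + (LINT t|unit_lebesgue. norm (g t))) * \<bar>y - x\<bar>"
      by (simp add: algebra_simps)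
  qed
  moreover have "((\<lambda>x. c * of_real x + volt g x) has_vector_derivative c + prim g x) (at x within {0..1})" if "x \<in> {0..1}" for x
    by (rule affine_volt_has_derivative[OF g that])
  moreover have "AE x in unit_lebesgue. ((\<lambda>x. c + prim g x) has_vector_derivative g x) (at x)"
    using prim_has_derivative_AE[OF g]
    by eventually_elim (use has_vector_derivative_add[OF has_vector_derivative_const] in fastforce)
  ultimately show "dirichlet_laplacian_graph f g"
    unfolding dirichlet_laplacian_graph_def using f g fc c AC01_prim[OF g, of c]
    by (intro conjI exI[of _ "\<lambda>x. c * of_real x + volt g x"] exI[of _ "\<lambda>x. c + prim g x"]) (auto simp: volt_0)
qed

lemma dirichlet_laplacian_graph_unique:
  assumes "dirichlet_laplacian_graph f g" "dirichlet_laplacian_graph f h"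
  shows "AE x in unit_lebesgue. g x = h x"
proof -
  obtain c d where g: "g \<in> L2 unit_lebesgue" and h: "h \<in> L2 unit_lebesgue"
    and c: "AE x in unit_lebesgue. f x = c * of_real x + volt g x"
    and d: "AE x in unit_lebesgue. f x = d * of_real x + volt h x"
    using assms by (auto simp: dirichlet_laplacian_graph_iff)
  have gh: "(\<lambda>x. g x - h x) \<in> L2 unit_lebesgue" by (rule L2_diff[OF g h])
  have v: "volt (\<lambda>x. g x - h x) x = volt g x - volt h x" for x
    unfolding volt_def using volt_integrable[OF g] volt_integrable[OF h] by (simp add: right_diff_distrib)
  have "AE x in unit_lebesgue. (c - d) * of_real x + volt (\<lambda>x. g x - h x) x = 0"
    using c d by eventually_elim (simp add: v algebra_simps)
  from affine_volt_eq_0(2)[OF gh this] show ?thesis by simp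
qed

lemma dirichlet_laplacian_graph_dirichlet_laplacian:
  "f \<in> dirichlet_dom \<Longrightarrow> dirichlet_laplacian_graph f (dirichlet_laplacian f)"
  unfolding dirichlet_dom_def dirichlet_laplacian_def mem_Collect_eq
  by (rule someI_ex[of "dirichlet_laplacian_graph f"])

lemma dirichlet_laplacian_AE:
  "dirichlet_laplacian_graph f g \<Longrightarrow> AE x in unit_lebesgue. dirichlet_laplacian f x = g x"
  by (rule dirichlet_laplacian_graph_unique[OF dirichlet_laplacian_graph_dirichlet_laplacian])
     (auto simp: dirichlet_dom_def)

lemma volt_uminus: "volt (\<lambda>x. - g x) x = - volt g x"
  unfolding volt_def by simp

lemma neg_laplacian_inv_green:
  assumes g: "g \<in> L2 unit_lebesgue"
  shows "neg_laplacian_inv g \<in> L2 unit_lebesgue"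
    and "AE x in unit_lebesgue. neg_laplacian_inv g x = green g x"
proof -
  have "dirichlet_laplacian_graph (green g) (\<lambda>x. - g x)"
    unfolding dirichlet_laplacian_graph_iff
    using L2_green[OF g] L2_uminus[OF g]
    by (intro conjI exI[of _ "volt g 1"]) (auto simp: green_eq_volt[OF g] volt_uminus)
  then have "dirichlet_laplacian_graph (neg_laplacian_inv g) (\<lambda>x. - g x)"
    unfolding neg_laplacian_inv_def by (rule someI[where P = "\<lambda>f. dirichlet_laplacian_graph f (\<lambda>x. - g x)"])
  then obtain c where *: "neg_laplacian_inv g \<in> L2 unit_lebesgue"
    "AE x in unit_lebesgue. neg_laplacian_inv g x = c * of_real x - volt g x" "c - volt g 1 = 0"
    by (auto simp: dirichlet_laplacian_graph_iff volt_uminus)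
  show "neg_laplacian_inv g \<in> L2 unit_lebesgue" by (rule *(1))
  show "AE x in unit_lebesgue. neg_laplacian_inv g x = green g x"
    using *(2) by eventually_elim (use *(3) in \<open>simp add: green_eq_volt[OF g]\<close>)
qed

section \<open>The sine basis\<close>

lemma continuous_unit_lebesgue_measurable:
  fixes f :: "real \<Rightarrow> 'a::{second_countable_topology,real_normed_vector}"
  shows "continuous_on {0..1} f \<Longrightarrow> f \<in> borel_measurable unit_lebesgue"
  by (rule continuous_imp_measurable_on_sets_lebesgue[OF continuous_on_subset]) auto

lemma continuous_unit_bounded:
  fixes f :: "real \<Rightarrow> 'a::real_normed_vector"
  assumes "continuous_on {0..1} f"
  obtains B where "\<And>x. x \<in> {0..1} \<Longrightarrow> norm (f x) \<le> B"
proof -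
  have "\<exists>B. \<forall>x\<in>{0..1}. norm (f x) \<le> B"
    using compact_imp_bounded[OF compact_continuous_image[OF assms compact_Icc]] by (auto simp: bounded_iff)
  then show thesis using that by blast
qed

lemma integral_unit_lebesgue_FTC:
  fixes f :: "real \<Rightarrow> 'a::euclidean_space"
  assumes F: "\<And>x. x \<in> {0..1} \<Longrightarrow> (F has_vector_derivative f x) (at x within {0..1})"
    and c: "continuous_on {0..1} f"
  shows "(LINT x|unit_lebesgue. f x) = F 1 - F 0"
proof -
  obtain B where B: "\<And>x. x \<in> {0..1} \<Longrightarrow> norm (f x) \<le> B" using continuous_unit_bounded[OF c] by blast
  have "integrable unit_lebesgue f"
    by (rule bounded_integrable_unit_lebesgue[OF continuous_unit_lebesgue_measurable[OF c], of B]) (use B in auto)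
  then have "(LINT x|unit_lebesgue. f x) = integral {0<..<1} f"
    by (rule lebesgue_integral_eq_integral) simp
  also have "\<dots> = integral {0..1} f" by (simp add: integral_open_interval_real)
  also have "\<dots> = F 1 - F 0"
    by (rule integral_unique[OF fundamental_theorem_of_calculus]) (use F in auto)
  finally show ?thesis .
qed

lemma integral_cos_pi:
  "(LINT x|unit_lebesgue. cos (of_int n * pi * x)) = (if n = 0 then 1 else 0)"
proof (cases "n = 0")
  case True
  then show ?thesis by (simp add: measure_space_unit_lebesgue)
next
  case False
  have "(LINT x|unit_lebesgue. cos (of_int n * pi * x)) = sin (of_int n * pi * 1) / (of_int n * pi) - sin (of_int n * pi * 0) / (of_int n * pi)"
  proof (rule integral_unit_lebesgue_FTC)
    show "((\<lambda>x. sin (of_int n * pi * x) / (of_int n * pi)) has_vector_derivative cos (of_int n * pi * x)) (at x within {0..1})" for x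
      unfolding has_real_derivative_iff_has_vector_derivative[symmetric]
      using False by (auto intro!: derivative_eq_intros)
  qed (intro continuous_intros)
  moreover have "sin (of_int n * pi) = 0" by (simp add: sin_times_pi_eq_0)
  ultimately show ?thesis using False by simp
qed

lemma continuous_on_phi [continuous_intros]: "continuous_on A (phi l)"
  unfolding phi_def by (intro continuous_intros)

lemma abs_phi_le: "\<bar>phi l x\<bar> \<le> sqrt 2"
  unfolding phi_def by (simp add: abs_mult mult_left_le)

lemma phi_measurable [measurable]: "phi l \<in> borel_measurable unit_lebesgue"
  by (intro continuous_unit_lebesgue_measurable continuous_intros)

text \<open>Bases are indexed from 0 and the sines from 1, whence the shift.\<close>

definition sine_basis :: "nat \<Rightarrow> real \<Rightarrow> complex" where
  "sine_basis k x = of_real (phi (Suc k) x)"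

lemma sine_basis_measurable [measurable]: "sine_basis k \<in> borel_measurable unit_lebesgue"
  unfolding sine_basis_def by measurable

lemma norm_sine_basis_le: "norm (sine_basis k x) \<le> sqrt 2"
  unfolding sine_basis_def norm_of_real by (rule abs_phi_le)

lemma sine_basis_L2 [simp]: "sine_basis k \<in> L2 unit_lebesgue"
  by (rule bounded_L2[where B = "sqrt 2"]) (auto simp: norm_sine_basis_le)

lemma integral_phi_phi:
  assumes "i \<ge> 1" "j \<ge> 1"
  shows "(LINT x|unit_lebesgue. phi i x * phi j x) = (if i = j then 1 else 0)"
proof -
  have int: "integrable unit_lebesgue (\<lambda>x. cos (of_int n * pi * x))" for n
    by (rule bounded_integrable_unit_lebesgue[where B = 1]) auto
  have "phi i x * phi j x = cos (of_int (int i - int j) * pi * x) - cos (of_int (int i + int j) * pi * x)" for x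
    by (simp add: phi_def cos_diff cos_add algebra_simps)
  then have "(LINT x|unit_lebesgue. phi i x * phi j x) =
      (LINT x|unit_lebesgue. cos (of_int (int i - int j) * pi * x) - cos (of_int (int i + int j) * pi * x))" by simp
  also have "\<dots> = (if int i - int j = 0 then 1 else 0) - (if int i + int j = 0 then 1 else 0)"
    unfolding Bochner_Integration.integral_diff[OF int int] integral_cos_pi by simp
  finally show ?thesis using assms by auto
qed

lemma orthonormal_sine_basis: "orthonormal unit_lebesgue sine_basis"
  unfolding orthonormal_def
proof (intro conjI allI)
  fix j k
  have "l2_inner unit_lebesgue (sine_basis j) (sine_basis k) = (LINT x|unit_lebesgue. complex_of_real (phi (Suc j) x * phi (Suc k) x))"
    unfolding l2_inner_def sine_basis_def by simp
  also have "\<dots> = of_real (LINT x|unit_lebesgue. phi (Suc j) x * phi (Suc k) x)"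
    by (rule integral_complex_of_real)
  finally show "l2_inner unit_lebesgue (sine_basis j) (sine_basis k) = (if j = k then 1 else 0)"
    by (simp add: integral_phi_phi)
qed simp

text \<open>The identity 2 sin(j t) cos(t) = sin((j+1) t) + sin((j-1) t) lowers the power of the
  cosine at the price of changing \<open>j\<close>, hence an induction for all \<open>j\<close> at
  once; for \<open>j = 0\<close> the integrand is 0.\<close>

lemma sine_moments_zero:
  assumes f: "f \<in> L2 unit_lebesgue" and z: "\<And>k. l2_inner unit_lebesgue f (sine_basis k) = 0"
  shows "(LINT x|unit_lebesgue. of_real (sin (real j * pi * x) * cos (pi * x) ^ m) * f x) = 0"
proof (induction m arbitrary: j)
  case 0
  show ?case
  proof (cases j)
    case (Suc k)
    have "of_real (sin (real j * pi * x) * cos (pi * x) ^ 0) * f x = of_real (1 / sqrt 2) * (f x * cnj (sine_basis k x))" for x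
    proof -
      have "sin (real j * pi * x) = 1 / sqrt 2 * phi (Suc k) x" by (simp add: phi_def Suc)
      then show ?thesis by (simp add: sine_basis_def)
    qed
    then have "(LINT x|unit_lebesgue. of_real (sin (real j * pi * x) * cos (pi * x) ^ 0) * f x) =
        (LINT x|unit_lebesgue. of_real (1 / sqrt 2) * (f x * cnj (sine_basis k x)))" by simp
    also have "\<dots> = of_real (1 / sqrt 2) * l2_inner unit_lebesgue f (sine_basis k)"
      unfolding l2_inner_def by (rule integral_mult_right_zero)
    finally show ?thesis using z by simp
  qed simp
next
  case (Suc m)
  show ?case
  proof (cases j)
    case (Suc k)
    have i: "integrable unit_lebesgue (\<lambda>x. of_real (sin (real j * pi * x) * cos (pi * x) ^ m) * f x)" for j
    proof (rule bounded_mult_integrable[where B = 1, OF _ _ f])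
      fix x :: real
      have "\<bar>sin (real j * pi * x)\<bar> * \<bar>cos (pi * x)\<bar> ^ m \<le> 1 * 1"
        by (intro mult_mono power_le_one) auto
      then show "norm (complex_of_real (sin (real j * pi * x) * cos (pi * x) ^ m)) \<le> 1"
        by (simp only: norm_of_real abs_mult power_abs)
    qed measurable
    have "sin (real j * pi * x) * cos (pi * x) ^ Suc m =
        (1/2) * (sin (real (Suc j) * pi * x) * cos (pi * x) ^ m) + (1/2) * (sin (real k * pi * x) * cos (pi * x) ^ m)" for x
    proof -
      have "sin (real (Suc j) * pi * x) + sin (real k * pi * x) = 2 * sin (real j * pi * x) * cos (pi * x)"
      proof -
        have "real (Suc j) * pi * x = real j * pi * x + pi * x" "real k * pi * x = real j * pi * x - pi * x"
          by (simp_all add: Suc algebra_simps)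
        then show ?thesis by (simp only: sin_add sin_diff)
      qed
      then have "(sin (real (Suc j) * pi * x) + sin (real k * pi * x)) * cos (pi * x) ^ m = 2 * sin (real j * pi * x) * cos (pi * x) * cos (pi * x) ^ m"
        by simp
      then show ?thesis by (simp add: algebra_simps)
    qed
    then have "(LINT x|unit_lebesgue. of_real (sin (real j * pi * x) * cos (pi * x) ^ Suc m) * f x) =
        (LINT x|unit_lebesgue. of_real (1/2) * (of_real (sin (real (Suc j) * pi * x) * cos (pi * x) ^ m) * f x)
           + of_real (1/2) * (of_real (sin (real k * pi * x) * cos (pi * x) ^ m) * f x))"
      by (simp only: of_real_add of_real_mult distrib_right mult.assoc)
    also have "\<dots> = 0"
      unfolding Bochner_Integration.integral_add[OF integrable_mult_right[OF i] integrable_mult_right[OF i]]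
        integral_mult_right_zero Suc.IH by simp
    finally show ?thesis .
  qed simp
qed


text \<open>
  Multiplied by \<open>sin (\<pi> x)\<close>, such a function is orthogonal to all polynomials in \<open>cos (\<pi> x)\<close>, hence
  to all continuous functions, in particular to the kernels of the Volterra operator.
\<close>

lemma sine_basis_total:
  assumes f: "f \<in> L2 unit_lebesgue" and z: "\<And>k. l2_inner unit_lebesgue f (sine_basis k) = 0"
  shows "AE x in unit_lebesgue. f x = 0"
proof -
  define h where "h x = of_real (sin (pi * x)) * f x" for x
  have h: "h \<in> L2 unit_lebesgue"
    unfolding h_def[abs_def] by (rule L2_bounded_mult[where B = 1, OF _ _ f]) auto
  have mom: "(LINT x|unit_lebesgue. of_real (cos (pi * x) ^ m) * h x) = 0" for m
    using sine_moments_zero[OF f z, of 1 m] by (simp add: h_def mult_ac)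
  have cosb: "\<bar>cos (pi * x) ^ m\<bar> \<le> 1" for x m
    unfolding power_abs by (rule power_le_one) auto
  have momi: "integrable unit_lebesgue (\<lambda>x. of_real (cos (pi * x) ^ m) * h x)" for m
    by (rule bounded_mult_integrable[where B = 1, OF _ _ h]) (use cosb in \<open>auto simp: norm_power power_abs\<close>)
  have pol: "(LINT x|unit_lebesgue. of_real (p (cos (pi * x))) * h x) = 0" if "real_polynomial_function p" for p
  proof -
    obtain c n where p: "p = (\<lambda>x. \<Sum>i\<le>n. c i * x ^ i)"
      using \<open>real_polynomial_function p\<close> by (auto simp: real_polynomial_function_iff_sum)
    have "(LINT x|unit_lebesgue. of_real (p (cos (pi * x))) * h x) =
        (LINT x|unit_lebesgue. (\<Sum>i\<le>n. of_real (c i) * (of_real (cos (pi * x) ^ i) * h x)))"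
      unfolding p by (simp add: sum_distrib_right mult.assoc)
    also have "\<dots> = (\<Sum>i\<le>n. LINT x|unit_lebesgue. of_real (c i) * (of_real (cos (pi * x) ^ i) * h x))"
      by (intro Bochner_Integration.integral_sum integrable_mult_right momi)
    also have "\<dots> = 0" by (simp only: integral_mult_right_zero mom mult_zero_right sum.neutral_const)
    finally show ?thesis .
  qed
  have v: "volt h x = 0" for x
  proof -
    \<comment> \<open>The kernel of \<open>volt\<close> in the variable
      \<open>s = cos (pi * t)\<close>, in which the moments against all polynomials are known to
      vanish.\<close>
    define w where "w s = max 0 (x - arccos s / pi)" for s
    have w: "continuous_on {-1..1} w"
      unfolding w_def by (intro continuous_intros) auto
    define C where "C = (LINT t|unit_lebesgue. norm (h t))"
    have "norm (volt h x) \<le> e * C" if e: "e > 0" for e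
    proof -
      obtain p where p: "real_polynomial_function p" "\<And>s. s \<in> {-1..1} \<Longrightarrow> \<bar>w s - p s\<bar> < e"
        using Stone_Weierstrass_real_polynomial_function[OF compact_Icc w e] by blast
      have pc: "continuous_on UNIV p" by (intro continuous_at_imp_continuous_on ballI continuous_real_polymonial_function p(1))
      have pm: "(\<lambda>t. p (cos (pi * t))) \<in> borel_measurable unit_lebesgue"
        by (rule continuous_unit_lebesgue_measurable)
           (intro continuous_on_compose2[OF pc] continuous_intros subset_UNIV)
      have close: "\<bar>max 0 (x - t) - p (cos (pi * t))\<bar> \<le> e" if "t \<in> {0<..<1}" for t
      proof -
        have "arccos (cos (pi * t)) = pi * t" using that by (intro arccos_cos) auto
        then have "w (cos (pi * t)) = max 0 (x - t)" by (simp add: w_def)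
        then show ?thesis using p(2)[of "cos (pi * t)"] by simp
      qed
      have pi1: "integrable unit_lebesgue (\<lambda>t. of_real (p (cos (pi * t))) * h t)"
      proof (rule bounded_mult_integrable[where B = "e + (\<bar>x\<bar> + 1)", OF _ _ h])
        show "norm (complex_of_real (p (cos (pi * t)))) \<le> e + (\<bar>x\<bar> + 1)" if "t \<in> {0<..<1}" for t
          using close[OF that] that by auto
      qed (use pm in measurable)
      have "volt h x = (LINT t|unit_lebesgue. of_real (max 0 (x - t)) * h t) - (LINT t|unit_lebesgue. of_real (p (cos (pi * t))) * h t)"
        unfolding volt_def pol[OF p(1)] by simp
      also have "\<dots> = (LINT t|unit_lebesgue. of_real (max 0 (x - t)) * h t - of_real (p (cos (pi * t))) * h t)"
        by (rule Bochner_Integration.integral_diff[OF volt_integrable[OF h] pi1, symmetric])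
      also have "\<dots> = (LINT t|unit_lebesgue. of_real (max 0 (x - t) - p (cos (pi * t))) * h t)"
        by (simp add: left_diff_distrib)
      also have "norm \<dots> \<le> e * (LINT t|unit_lebesgue. norm (h t))"
      proof (rule kernel_diff_bound[OF h])
        show "(\<lambda>t. complex_of_real (max 0 (x - t) - p (cos (pi * t)))) \<in> borel_measurable unit_lebesgue"
          using pm by measurable
        show "norm (complex_of_real (max 0 (x - t) - p (cos (pi * t)))) \<le> e" if "t \<in> {0<..<1}" for t
          unfolding norm_of_real by (rule close[OF that])
      qed
      finally show ?thesis by (simp add: C_def)
    qed
    then have "norm (volt h x) \<le> 0 * C"
      by (intro tendsto_lowerbound[of "\<lambda>e. e * C" "0 * C" "at_right 0"] tendsto_intros)
         (auto intro: eventually_at_right_less[THEN eventually_mono])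
    then show ?thesis by simp
  qed
  \<comment> \<open>Since \<open>volt h\<close> vanishes identically, so does \<open>h\<close>
    almost everywhere; the factor \<open>sin (pi * x)\<close> has no zero inside the
    interval.\<close>
  have "AE x in unit_lebesgue. h x = 0"
    by (rule affine_volt_eq_0(2)[OF h, of 0]) (simp add: v)
  moreover have "AE x in unit_lebesgue. x \<in> {0<..<1}" by (rule AE_I2) simp
  ultimately show ?thesis
  proof eventually_elim
    case (elim x)
    have "sin (pi * x) > 0" using elim(2) by (intro sin_gt_zero) auto
    then show ?case using elim(1) by (simp add: h_def)
  qed
qed

lemma orthonormal_basis_sine_basis: "orthonormal_basis unit_lebesgue sine_basis"
  using orthonormal_sine_basis sine_basis_total
  by (auto simp: orthonormal_basis_def orthonormal_def)

lemma mu_pos: "l \<ge> 1 \<Longrightarrow> mu l > 0"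
  by (simp add: mu_def)

lemma summable_inverse_mu: "summable (\<lambda>k. inverse (mu (Suc k)))"
proof -
  have "summable (\<lambda>k. inverse (real (Suc k) ^ 2))"
    using inverse_power_summable[of 2, where 'a = real] by (subst summable_Suc_iff) simp
  then have "summable (\<lambda>k. inverse (pi\<^sup>2) * inverse (real (Suc k) ^ 2))" by (rule summable_mult)
  then show ?thesis by (simp add: mu_def mult.commute)
qed

text \<open>The sine solves the twice integrated eigenvalue equation with slope \<open>c\<close> at
  0, because the difference of both sides has derivative zero. Its zero at 1 then expresses
  \<open>c\<close> by the boundary value of \<open>volt\<close>.\<close>

lemma green_sine_basis:
  assumes x: "x \<in> {0..1}"
  shows "green (sine_basis k) x = of_real (inverse (mu (Suc k))) * sine_basis k x"
proof -
  define n where "n = real (Suc k) * pi"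
  have n: "n > 0" by (simp add: n_def)
  have phi: "phi (Suc k) y = sqrt 2 * sin (n * y)" for y by (simp add: phi_def n_def)
  have mun: "mu (Suc k) = n * n" by (simp add: mu_def n_def power2_eq_square)
  define c where "c = complex_of_real (sqrt 2 * n)"
  have d1: "(sine_basis k has_vector_derivative of_real (sqrt 2 * n * cos (n * y))) (at y within A)" for y A
  proof -
    have "((\<lambda>y. phi (Suc k) y) has_real_derivative sqrt 2 * n * cos (n * y)) (at y within A)"
      unfolding phi by (auto intro!: derivative_eq_intros)
    then show ?thesis unfolding sine_basis_def[abs_def] by (rule has_vector_derivative_of_real)
  qed
  have p: "prim (sine_basis k) y = of_real (sqrt 2 * (1 - cos (n * y)) / n)" if y: "y \<in> {0..1}" for y
  proof -
    have "(sine_basis k has_integral of_real (sqrt 2 * (1 - cos (n * y)) / n) - of_real (sqrt 2 * (1 - cos (n * 0)) / n)) {0..y}"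
    proof (rule fundamental_theorem_of_calculus)
      fix t
      have "((\<lambda>y. sqrt 2 * (1 - cos (n * y)) / n) has_real_derivative phi (Suc k) t) (at t within {0..y})"
        unfolding phi using n by (auto intro!: derivative_eq_intros)
      then show "((\<lambda>y. complex_of_real (sqrt 2 * (1 - cos (n * y)) / n)) has_vector_derivative sine_basis k t) (at t within {0..y})"
        unfolding sine_basis_def by (rule has_vector_derivative_of_real)
    qed (use y in auto)
    then show ?thesis using prim_eq_integral[OF sine_basis_L2 y, of k] by (simp add: integral_unique)
  qed
  have key: "sine_basis k y = c * of_real y - of_real (mu (Suc k)) * volt (sine_basis k) y" if y: "y \<in> {0..1}" for y
  proof -
    let ?w = "\<lambda>y. sine_basis k y - (c * of_real y + volt (\<lambda>t. of_real (- mu (Suc k)) * sine_basis k t) y)"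
    have L: "(\<lambda>t. of_real (- mu (Suc k)) * sine_basis k t) \<in> L2 unit_lebesgue" by (intro L2_cmult) simp
    have "(?w has_vector_derivative 0) (at t within {0..1})" if t: "t \<in> {0..1}" for t
    proof -
      have "(?w has_vector_derivative of_real (sqrt 2 * n * cos (n * t)) - (c + prim (\<lambda>t. of_real (- mu (Suc k)) * sine_basis k t) t)) (at t within {0..1})"
        by (intro has_vector_derivative_diff affine_volt_has_derivative L t d1)
      moreover have "prim (\<lambda>t. of_real (- mu (Suc k)) * sine_basis k t) t = of_real (- mu (Suc k)) * prim (sine_basis k) t"
        unfolding prim_def by (simp add: mult.left_commute)
      moreover have "of_real (sqrt 2 * n * cos (n * t)) - (c + of_real (- mu (Suc k)) * of_real (sqrt 2 * (1 - cos (n * t)) / n)) = 0"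
      proof -
        have "- mu (Suc k) * (sqrt 2 * (1 - cos (n * t)) / n) = sqrt 2 * n * cos (n * t) - sqrt 2 * n"
          using n by (simp add: mun field_simps)
        then show ?thesis unfolding of_real_mult[symmetric] c_def by simp
      qed
      ultimately show ?thesis by (simp only: p[OF t])
    qed
    then obtain d where d: "\<And>y. y \<in> {0..1} \<Longrightarrow> ?w y = d"
      using has_vector_derivative_zero_constant[OF convex_real_interval(5), of 0 1 ?w] by blast
    have "?w 0 = 0" by (simp add: volt_0 sine_basis_def phi_def)
    then have "?w y = 0" using d[OF y] d[of 0] by simp
    moreover have "volt (\<lambda>t. of_real (- mu (Suc k)) * sine_basis k t) y = - of_real (mu (Suc k)) * volt (sine_basis k) y"
      unfolding volt_def by (simp add: mult.left_commute)
    ultimately show ?thesis by simp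
  qed
  have m: "complex_of_real (mu (Suc k)) \<noteq> 0" using mu_pos[of "Suc k"] by simp
  have "sine_basis k 1 = 0" unfolding sine_basis_def phi_def
    using sin_npi[of "Suc k"] by simp
  then have "c = of_real (mu (Suc k)) * volt (sine_basis k) 1" using key[of 1] by simp
  then have "of_real (mu (Suc k)) * green (sine_basis k) x = sine_basis k x"
    unfolding green_eq_volt[OF sine_basis_L2] key[OF x] by (simp add: algebra_simps)
  then show ?thesis using m by (simp add: field_simps)
qed

text \<open>For fixed \<open>x\<close> the series converges uniformly in the second variable, with
  majorant \<open>2 * inverse (mu (Suc k))\<close>, and its continuous sum has the Fourier
  coefficients of the Green kernel. Totality gives equality almost everywhere, and continuity gives
  it at every point, in particular on the diagonal, where the traces live.\<close>

lemma green_kernel_expansion: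
  assumes x: "x \<in> {0..1}" and t: "t \<in> {0..1}"
  shows "(\<lambda>k. inverse (mu (Suc k)) * phi (Suc k) x * phi (Suc k) t) sums (min x t - x * t)"
proof -
  define F where "F k s = complex_of_real (inverse (mu (Suc k)) * phi (Suc k) x) * sine_basis k s" for k s
  have Fb: "norm (F k s) \<le> 2 * inverse (mu (Suc k))" for k s
  proof -
    have "norm (F k s) = inverse (mu (Suc k)) * (\<bar>phi (Suc k) x\<bar> * norm (sine_basis k s))"
      unfolding F_def norm_mult norm_of_real abs_mult using mu_pos[of "Suc k"] by simp
    also have "\<dots> \<le> inverse (mu (Suc k)) * (sqrt 2 * sqrt 2)"
      using mu_pos[of "Suc k"] by (intro mult_left_mono mult_mono abs_phi_le norm_sine_basis_le) auto
    finally show ?thesis by simp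
  qed
  have s2: "summable (\<lambda>k. 2 * inverse (mu (Suc k)))" by (intro summable_mult summable_inverse_mu)
  define S where "S s = (\<Sum>k. F k s)" for s
  have Fs: "summable (\<lambda>k. norm (F k s))" for s
    by (rule summable_comparison_test'[OF s2, of 0]) (use Fb in auto)
  have Sc: "continuous_on {0..1} S"
  proof (rule uniform_limit_theorem)
    show "uniform_limit {0..1} (\<lambda>n s. \<Sum>k<n. F k s) S sequentially"
      unfolding S_def by (rule Weierstrass_m_test[OF _ s2]) (use Fb in auto)
    show "\<forall>\<^sub>F n in sequentially. continuous_on {0..1} (\<lambda>s. \<Sum>k<n. F k s)"
      unfolding F_def sine_basis_def by (intro always_eventually allI continuous_intros)
  qed simp
  define G where "G s = complex_of_real (min x s - x * s)" for s
  have Gc: "continuous_on {0..1} G" unfolding G_def by (intro continuous_intros)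
  have Dc: "continuous_on {0..1} (\<lambda>s. S s - G s)" by (intro continuous_intros Sc Gc)
  have cL2: "u \<in> L2 unit_lebesgue" if u: "continuous_on {0..1} u" for u
  proof -
    obtain B where "\<And>x. x \<in> {0..1} \<Longrightarrow> norm (u x) \<le> B" using continuous_unit_bounded[OF u] by blast
    then show ?thesis by (intro bounded_L2[where B = B] continuous_unit_lebesgue_measurable u) auto
  qed
  have "l2_inner unit_lebesgue (\<lambda>s. S s - G s) (sine_basis j) = 0" for j
  proof -
    have "l2_inner unit_lebesgue S (sine_basis j) = (LINT s|unit_lebesgue. (\<Sum>k. F k s * cnj (sine_basis j s)))"
      unfolding l2_inner_def S_def by (simp add: suminf_mult2[OF summable_norm_cancel[OF Fs]])
    also have "\<dots> = (\<Sum>k. LINT s|unit_lebesgue. F k s * cnj (sine_basis j s))"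
    proof (rule integral_suminf)
      have FL: "F k \<in> L2 unit_lebesgue" for k unfolding F_def by (intro L2_cmult sine_basis_L2)
      show i: "integrable unit_lebesgue (\<lambda>s. F k s * cnj (sine_basis j s))" for k
        by (rule L2_mult_integrable[OF FL sine_basis_L2])
      show "AE s in unit_lebesgue. summable (\<lambda>k. norm (F k s * cnj (sine_basis j s)))"
        unfolding norm_mult by (intro AE_I2 summable_mult2 Fs)
      show "summable (\<lambda>k. LINT s|unit_lebesgue. norm (F k s * cnj (sine_basis j s)))"
      proof (rule summable_comparison_test'[OF summable_mult2[OF s2, of "sqrt 2"], of 0])
        fix k
        have "(LINT s|unit_lebesgue. norm (F k s * cnj (sine_basis j s))) \<le> (LINT s|unit_lebesgue. 2 * inverse (mu (Suc k)) * sqrt 2)"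
        proof (rule integral_mono)
          show "integrable unit_lebesgue (\<lambda>s. norm (F k s * cnj (sine_basis j s)))" by (rule integrable_norm[OF i])
          show "norm (F k s * cnj (sine_basis j s)) \<le> 2 * inverse (mu (Suc k)) * sqrt 2" for s
            unfolding norm_mult complex_mod_cnj by (intro mult_mono Fb norm_sine_basis_le) (use mu_pos[of "Suc k"] in auto)
        qed (rule bounded_integrable_unit_lebesgue[where B = "\<bar>2 * inverse (mu (Suc k)) * sqrt 2\<bar>"], auto)
        then show "norm (LINT s|unit_lebesgue. norm (F k s * cnj (sine_basis j s))) \<le> 2 * inverse (mu (Suc k)) * sqrt 2"
          by (simp add: measure_space_unit_lebesgue)
      qed
    qed
    also have "\<dots> = (\<Sum>k. if k = j then complex_of_real (inverse (mu (Suc k)) * phi (Suc k) x) else 0)"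
    proof (rule arg_cong[where f = suminf], rule ext)
      fix k
      have "(LINT s|unit_lebesgue. F k s * cnj (sine_basis j s)) = l2_inner unit_lebesgue (F k) (sine_basis j)"
        by (simp add: l2_inner_def)
      also have "\<dots> = of_real (inverse (mu (Suc k)) * phi (Suc k) x) * l2_inner unit_lebesgue (sine_basis k) (sine_basis j)"
        unfolding F_def by (rule l2_inner_cmult_left)
      finally show "(LINT s|unit_lebesgue. F k s * cnj (sine_basis j s)) = (if k = j then complex_of_real (inverse (mu (Suc k)) * phi (Suc k) x) else 0)"
        using orthonormal_sine_basis by (simp add: orthonormal_def)
    qed
    also have "\<dots> = of_real (inverse (mu (Suc j)) * phi (Suc j) x)"
      by (subst suminf_finite[of "{j}"]) auto
    also have "\<dots> = green (sine_basis j) x" unfolding green_sine_basis[OF x] by (simp add: sine_basis_def)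
    also have "\<dots> = l2_inner unit_lebesgue G (sine_basis j)"
      unfolding green_def l2_inner_def G_def by (simp add: sine_basis_def)
    finally show ?thesis by (simp add: l2_inner_diff_left cL2 Sc Gc)
  qed
  from sine_basis_total[OF cL2[OF Dc] this] have "AE s in unit_lebesgue. S s - G s = 0" .
  then have "S t - G t = 0" by (rule continuous_AE_zero_imp_zero[OF Dc _ t])
  moreover have "(\<lambda>k. F k t) sums S t" unfolding S_def by (rule summable_sums[OF summable_norm_cancel[OF Fs]])
  ultimately have "(\<lambda>k. complex_of_real (inverse (mu (Suc k)) * phi (Suc k) x * phi (Suc k) t)) sums of_real (min x t - x * t)"
    by (simp add: F_def sine_basis_def G_def)
  then show ?thesis by (simp only: sums_of_real_iff)
qed

section \<open>Power series with bounded measurable coefficients\<close>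

abbreviation "UU \<equiv> unit_lebesgue \<Otimes>\<^sub>M unit_lebesgue"

text \<open>Bounded at every point rather than essentially: kernels are going to be restricted to
  sections and to the diagonal, and the class must be closed under that, under products and under
  integration in one variable.\<close>

definition bfun :: "(real \<Rightarrow> real) \<Rightarrow> bool" where
  "bfun f \<longleftrightarrow> f \<in> borel_measurable unit_lebesgue \<and> (\<exists>C. \<forall>x\<in>{0<..<1}. \<bar>f x\<bar> \<le> C)"

definition bfun2 :: "(real \<Rightarrow> real \<Rightarrow> real) \<Rightarrow> bool" where
  "bfun2 k \<longleftrightarrow> (\<lambda>p. k (fst p) (snd p)) \<in> borel_measurable UU \<and>
     (\<exists>C. \<forall>x\<in>{0<..<1}. \<forall>t\<in>{0<..<1}. \<bar>k x t\<bar> \<le> C)"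

lemma sigma_finite_unit_lebesgue: "sigma_finite_measure unit_lebesgue"
  by (rule finite_measure.axioms(1)[OF finite_measure_unit_lebesgue])

lemma pair_sigma_finite_unit_lebesgue: "pair_sigma_finite unit_lebesgue unit_lebesgue"
  unfolding pair_sigma_finite_def by (simp add: sigma_finite_unit_lebesgue)

lemma finite_measure_UU: "finite_measure UU"
  by (rule finite_measure_pair_measure[OF finite_measure_unit_lebesgue finite_measure_unit_lebesgue])

lemma space_UU: "space UU = {0<..<1} \<times> {0<..<1}"
  by (simp add: space_pair_measure)

lemma bfun_measurable [measurable_dest]: "bfun f \<Longrightarrow> f \<in> borel_measurable unit_lebesgue"
  by (simp add: bfun_def)

lemma bfunI: "f \<in> borel_measurable unit_lebesgue \<Longrightarrow> (\<And>x. x \<in> {0<..<1} \<Longrightarrow> \<bar>f x\<bar> \<le> C) \<Longrightarrow> bfun f"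
  unfolding bfun_def by blast

lemma bfunE:
  assumes "bfun f"
  obtains C where "\<And>x. x \<in> {0<..<1} \<Longrightarrow> \<bar>f x\<bar> \<le> C"
  using assms unfolding bfun_def by blast

lemma bfun2I: "(\<lambda>p. k (fst p) (snd p)) \<in> borel_measurable UU \<Longrightarrow>
    (\<And>x t. x \<in> {0<..<1} \<Longrightarrow> t \<in> {0<..<1} \<Longrightarrow> \<bar>k x t\<bar> \<le> C) \<Longrightarrow> bfun2 k"
  unfolding bfun2_def by blast

lemma bfun2E:
  assumes "bfun2 k"
  obtains C where "\<And>x t. x \<in> {0<..<1} \<Longrightarrow> t \<in> {0<..<1} \<Longrightarrow> \<bar>k x t\<bar> \<le> C"
  using assms unfolding bfun2_def by blast

lemma bfun_const [simp, intro]: "bfun (\<lambda>x. c)"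
  by (rule bfunI[where C = "\<bar>c\<bar>"]) auto

lemma bfun_ident [simp, intro]: "bfun (\<lambda>x. x)"
  by (rule bfunI[where C = 1]) auto

lemma bfun_add [intro]:
  assumes f: "bfun f" and g: "bfun g"
  shows "bfun (\<lambda>x. f x + g x)"
proof -
  obtain C1 where C1: "\<And>x. x \<in> {0<..<1} \<Longrightarrow> \<bar>f x\<bar> \<le> C1" using bfunE[OF f] by blast
  obtain C2 where C2: "\<And>x. x \<in> {0<..<1} \<Longrightarrow> \<bar>g x\<bar> \<le> C2" using bfunE[OF g] by blast
  show ?thesis
  proof (rule bfunI[where C = "C1 + C2"])
    show "\<bar>f x + g x\<bar> \<le> C1 + C2" if "x \<in> {0<..<1}" for x
      using C1[OF that] C2[OF that] abs_triangle_ineq[of "f x" "g x"] by linarith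
  qed (use f g in measurable)
qed

lemma bfun_mult [intro]:
  assumes f: "bfun f" and g: "bfun g"
  shows "bfun (\<lambda>x. f x * g x)"
proof -
  obtain C1 where C1: "\<And>x. x \<in> {0<..<1} \<Longrightarrow> \<bar>f x\<bar> \<le> C1" using bfunE[OF f] by blast
  obtain C2 where C2: "\<And>x. x \<in> {0<..<1} \<Longrightarrow> \<bar>g x\<bar> \<le> C2" using bfunE[OF g] by blast
  show ?thesis
  proof (rule bfunI[where C = "C1 * C2"])
    show "\<bar>f x * g x\<bar> \<le> C1 * C2" if "x \<in> {0<..<1}" for x
      unfolding abs_mult using C1[OF that] C2[OF that] by (intro mult_mono) (auto intro: order_trans[OF abs_ge_zero])
  qed (use f g in measurable)
qed

lemma bfun_uminus [intro]: "bfun f \<Longrightarrow> bfun (\<lambda>x. - f x)"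
  using bfun_mult[of "\<lambda>x. -1" f] by auto

lemma bfun_diff [intro]: "bfun f \<Longrightarrow> bfun g \<Longrightarrow> bfun (\<lambda>x. f x - g x)"
  using bfun_add[of f "\<lambda>x. - g x"] bfun_uminus[of g] by auto

lemma bfun_sum [intro]: "(\<And>i. i \<in> A \<Longrightarrow> bfun (f i)) \<Longrightarrow> bfun (\<lambda>x. \<Sum>i\<in>A. f i x)"
  by (induction A rule: infinite_finite_induct) auto

lemma bfun2_add [intro]:
  assumes f: "bfun2 f" and g: "bfun2 g"
  shows "bfun2 (\<lambda>x t. f x t + g x t)"
proof -
  obtain C1 where C1: "\<And>x t. x \<in> {0<..<1} \<Longrightarrow> t \<in> {0<..<1} \<Longrightarrow> \<bar>f x t\<bar> \<le> C1" using bfun2E[OF f] by blast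
  obtain C2 where C2: "\<And>x t. x \<in> {0<..<1} \<Longrightarrow> t \<in> {0<..<1} \<Longrightarrow> \<bar>g x t\<bar> \<le> C2" using bfun2E[OF g] by blast
  show ?thesis
  proof (rule bfun2I[where C = "C1 + C2"])
    show "(\<lambda>p. f (fst p) (snd p) + g (fst p) (snd p)) \<in> borel_measurable UU"
      using f g unfolding bfun2_def by (intro borel_measurable_add) auto
    show "\<bar>f x t + g x t\<bar> \<le> C1 + C2" if "x \<in> {0<..<1}" "t \<in> {0<..<1}" for x t
      using C1[OF that] C2[OF that] abs_triangle_ineq[of "f x t" "g x t"] by linarith
  qed
qed

lemma bfun2_mult [intro]:
  assumes f: "bfun2 f" and g: "bfun2 g"
  shows "bfun2 (\<lambda>x t. f x t * g x t)"
proof -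
  obtain C1 where C1: "\<And>x t. x \<in> {0<..<1} \<Longrightarrow> t \<in> {0<..<1} \<Longrightarrow> \<bar>f x t\<bar> \<le> C1" using bfun2E[OF f] by blast
  obtain C2 where C2: "\<And>x t. x \<in> {0<..<1} \<Longrightarrow> t \<in> {0<..<1} \<Longrightarrow> \<bar>g x t\<bar> \<le> C2" using bfun2E[OF g] by blast
  show ?thesis
  proof (rule bfun2I[where C = "C1 * C2"])
    show "(\<lambda>p. f (fst p) (snd p) * g (fst p) (snd p)) \<in> borel_measurable UU"
      using f g unfolding bfun2_def by (intro borel_measurable_times) auto
    show "\<bar>f x t * g x t\<bar> \<le> C1 * C2" if "x \<in> {0<..<1}" "t \<in> {0<..<1}" for x t
      unfolding abs_mult using C1[OF that] C2[OF that] by (intro mult_mono) (auto intro: order_trans[OF abs_ge_zero])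
  qed
qed

lemma bfun2_fst [intro]: "bfun f \<Longrightarrow> bfun2 (\<lambda>x t. f x)"
  unfolding bfun_def bfun2_def by (auto intro: measurable_compose[OF measurable_fst])

lemma bfun2_snd [intro]: "bfun f \<Longrightarrow> bfun2 (\<lambda>x t. f t)"
  unfolding bfun_def bfun2_def by (auto intro: measurable_compose[OF measurable_snd])

lemma bfun2_uminus [intro]: "bfun2 f \<Longrightarrow> bfun2 (\<lambda>x t. - f x t)"
  using bfun2_mult[of "\<lambda>x t. -1" f] bfun2_fst[OF bfun_const[of "-1"]] by auto

lemma bfun2_sum [intro]: "(\<And>i. i \<in> A \<Longrightarrow> bfun2 (f i)) \<Longrightarrow> bfun2 (\<lambda>x t. \<Sum>i\<in>A. f i x t)"
  by (induction A rule: infinite_finite_induct) (auto intro: bfun2_fst)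

lemma bfun2_swap [intro]:
  assumes "bfun2 k"
  shows "bfun2 (\<lambda>x t. k t x)"
proof -
  have "(\<lambda>p. (snd p, fst p)) \<in> measurable UU UU" by measurable
  from measurable_compose[OF this, of "\<lambda>p. k (fst p) (snd p)" borel] show ?thesis
    using assms by (auto simp: bfun2_def)
qed

lemma bfun2_section [intro]:
  assumes k: "bfun2 k" and x: "x \<in> {0<..<1}"
  shows "bfun (k x)"
proof -
  have "(\<lambda>t. (x, t)) \<in> measurable unit_lebesgue UU" using x by (intro measurable_Pair1') simp
  from measurable_compose[OF this, of "\<lambda>p. k (fst p) (snd p)" borel] have "(\<lambda>t. k x t) \<in> borel_measurable unit_lebesgue"
    using k by (simp add: bfun2_def)
  moreover obtain C where "\<And>x t. x \<in> {0<..<1} \<Longrightarrow> t \<in> {0<..<1} \<Longrightarrow> \<bar>k x t\<bar> \<le> C"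
    using bfun2E[OF k] by blast
  ultimately show ?thesis by (intro bfunI[where C = C]) (use assms in blast)+
qed

lemma bfun2_diag [intro]:
  assumes k: "bfun2 k"
  shows "bfun (\<lambda>x. k x x)"
proof -
  have "(\<lambda>t. (t, t)) \<in> measurable unit_lebesgue UU" by measurable
  from measurable_compose[OF this, of "\<lambda>p. k (fst p) (snd p)" borel] have "(\<lambda>t. k t t) \<in> borel_measurable unit_lebesgue"
    using k by (simp add: bfun2_def)
  moreover obtain C where "\<And>x t. x \<in> {0<..<1} \<Longrightarrow> t \<in> {0<..<1} \<Longrightarrow> \<bar>k x t\<bar> \<le> C"
    using bfun2E[OF k] by blast
  ultimately show ?thesis by (intro bfunI[where C = C]) (use assms in blast)+
qed

lemma bfun_integrable: "bfun f \<Longrightarrow> integrable unit_lebesgue f"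
  unfolding bfun_def using bounded_integrable_unit_lebesgue[of f] by (metis real_norm_def)

lemma bfun2_integrable:
  assumes "bfun2 k"
  shows "integrable UU (\<lambda>p. k (fst p) (snd p))"
proof -
  obtain C where C: "\<And>x t. x \<in> {0<..<1} \<Longrightarrow> t \<in> {0<..<1} \<Longrightarrow> \<bar>k x t\<bar> \<le> C"
    using bfun2E[OF assms] by blast
  show ?thesis
    by (rule finite_measure.integrable_const_bound[OF finite_measure_UU, of _ C])
       (use assms C in \<open>auto simp: bfun2_def space_UU intro!: AE_I2\<close>)
qed

lemma bfun_integral [intro]:
  assumes k: "bfun2 k"
  shows "bfun (\<lambda>x. LINT t|unit_lebesgue. k x t)"
proof -
  obtain C where C: "\<And>x t. x \<in> {0<..<1} \<Longrightarrow> t \<in> {0<..<1} \<Longrightarrow> \<bar>k x t\<bar> \<le> C"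
    using bfun2E[OF k] by blast
  show ?thesis
  proof (rule bfunI[where C = C])
    have "(\<lambda>p. k (fst p) (snd p)) \<in> borel_measurable UU" using k by (simp add: bfun2_def)
    then show "(\<lambda>x. LINT t|unit_lebesgue. k x t) \<in> borel_measurable unit_lebesgue"
      by (intro sigma_finite_measure.borel_measurable_lebesgue_integral[OF sigma_finite_unit_lebesgue])
         (simp add: case_prod_unfold)
    fix x :: real assume x: "x \<in> {0<..<1}"
    have "\<bar>LINT t|unit_lebesgue. k x t\<bar> \<le> (LINT t|unit_lebesgue. \<bar>k x t\<bar>)" by (rule integral_abs_bound)
    also have "\<dots> \<le> (LINT t|unit_lebesgue. C)"
      using bfun_integrable[OF bfun2_section[OF k x]] C[OF x] bfun_integrable[OF bfun_const]
      by (intro integral_mono) auto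
    finally show "\<bar>LINT t|unit_lebesgue. k x t\<bar> \<le> C" by (simp add: measure_space_unit_lebesgue)
  qed
qed

lemma bfun_Fubini:
  assumes k: "bfun2 k"
  shows "(LINT x|unit_lebesgue. LINT t|unit_lebesgue. k x t) = (LINT t|unit_lebesgue. LINT x|unit_lebesgue. k x t)"
  using pair_sigma_finite.Fubini_integral[OF pair_sigma_finite_unit_lebesgue, of k] bfun2_integrable[OF k]
  by (simp add: case_prod_unfold)

lemma bfun2_max_diff [intro]: "bfun2 (\<lambda>x t. max 0 (x - t))"
proof (rule bfun2I[where C = 1])
  have [measurable]: "fst \<in> borel_measurable UU" "snd \<in> borel_measurable UU"
    using measurable_compose[OF measurable_fst borel_measurable_unit_lebesgue]
      measurable_compose[OF measurable_snd borel_measurable_unit_lebesgue] by simp_all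
  show "(\<lambda>p. max 0 (fst p - snd p)) \<in> borel_measurable UU" by measurable
qed auto

text \<open>A condition on single coefficients, with bounds that may depend on \<open>n\<close>:
  these are formal series in \<zeta> without any radius of convergence.\<close>

definition ffun :: "(real \<Rightarrow> real fps) \<Rightarrow> bool" where
  "ffun F \<longleftrightarrow> (\<forall>n. bfun (\<lambda>x. F x $ n))"

definition ffun2 :: "(real \<Rightarrow> real \<Rightarrow> real fps) \<Rightarrow> bool" where
  "ffun2 F \<longleftrightarrow> (\<forall>n. bfun2 (\<lambda>x t. F x t $ n))"

definition fint :: "(real \<Rightarrow> real fps) \<Rightarrow> real fps" where
  "fint F = Abs_fps (\<lambda>n. LINT x|unit_lebesgue. F x $ n)"

lemma ffun_const [simp, intro]: "ffun (\<lambda>x. c)"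
  by (simp add: ffun_def)

lemma ffun_fps_const [intro]: "bfun f \<Longrightarrow> ffun (\<lambda>x. fps_const (f x))"
  unfolding ffun_def
proof
  show "bfun (\<lambda>x. fps_const (f x) $ n)" if "bfun f" for n
    using that by (cases n) auto
qed

lemma ffun_add [intro]: "ffun F \<Longrightarrow> ffun G \<Longrightarrow> ffun (\<lambda>x. F x + G x)"
  by (auto simp: ffun_def)

lemma ffun_diff [intro]: "ffun F \<Longrightarrow> ffun G \<Longrightarrow> ffun (\<lambda>x. F x - G x)"
  by (auto simp: ffun_def)

lemma ffun_mult [intro]: "ffun F \<Longrightarrow> ffun G \<Longrightarrow> ffun (\<lambda>x. F x * G x)"
  unfolding ffun_def fps_mult_nth by (intro allI bfun_sum bfun_mult) auto

lemma ffun_deriv [intro]: "ffun F \<Longrightarrow> ffun (\<lambda>x. fps_deriv (F x))"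
  by (auto simp: ffun_def)

lemma ffun2_mult [intro]: "ffun2 F \<Longrightarrow> ffun2 G \<Longrightarrow> ffun2 (\<lambda>x t. F x t * G x t)"
  unfolding ffun2_def fps_mult_nth by (intro allI bfun2_sum bfun2_mult) auto

lemma ffun2_fst [intro]: "ffun F \<Longrightarrow> ffun2 (\<lambda>x t. F x)"
  by (auto simp: ffun2_def ffun_def)

lemma ffun2_snd [intro]: "ffun F \<Longrightarrow> ffun2 (\<lambda>x t. F t)"
  by (auto simp: ffun2_def ffun_def)

lemma ffun2_fps_const [intro]: "bfun2 k \<Longrightarrow> ffun2 (\<lambda>x t. fps_const (k x t))"
  unfolding ffun2_def
proof
  show "bfun2 (\<lambda>x t. fps_const (k x t) $ n)" if "bfun2 k" for n
    using that by (cases n) (auto intro: bfun2_fst)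
qed

lemma ffun2_section [intro]: "ffun2 F \<Longrightarrow> x \<in> {0<..<1} \<Longrightarrow> ffun (F x)"
  by (auto simp: ffun2_def ffun_def)

lemma ffun2_diag [intro]: "ffun2 F \<Longrightarrow> ffun (\<lambda>x. F x x)"
  by (auto simp: ffun2_def ffun_def)

lemma fint_cong: "(\<And>x. x \<in> {0<..<1} \<Longrightarrow> F x = G x) \<Longrightarrow> fint F = fint G"
  unfolding fint_def by (intro arg_cong[where f = Abs_fps] ext Bochner_Integration.integral_cong) auto

lemma ffun_integrable: "ffun F \<Longrightarrow> integrable unit_lebesgue (\<lambda>x. F x $ n)"
  by (auto simp: ffun_def intro: bfun_integrable)

lemma fint_add: "ffun F \<Longrightarrow> ffun G \<Longrightarrow> fint (\<lambda>x. F x + G x) = fint F + fint G"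
  by (rule fps_ext) (simp add: fint_def ffun_integrable)

lemma fint_diff: "ffun F \<Longrightarrow> ffun G \<Longrightarrow> fint (\<lambda>x. F x - G x) = fint F - fint G"
  by (rule fps_ext) (simp add: fint_def ffun_integrable)

lemma fint_mult_left: "ffun F \<Longrightarrow> fint (\<lambda>x. c * F x) = c * fint F"
  by (rule fps_ext) (simp add: fint_def fps_mult_nth ffun_integrable)

lemma fint_mult_right: "ffun F \<Longrightarrow> fint (\<lambda>x. F x * c) = fint F * c"
  using fint_mult_left[of F c] by (simp add: mult.commute)

lemma fint_uminus: "fint (\<lambda>x. - F x) = - fint F"
  by (rule fps_ext) (simp add: fint_def)

lemma fps_deriv_fint: "fps_deriv (fint F) = fint (\<lambda>x. fps_deriv (F x))"
  by (rule fps_ext) (simp add: fint_def)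

lemma ffun_fint [intro]: "ffun2 F \<Longrightarrow> ffun (\<lambda>x. fint (F x))"
  by (auto simp: ffun2_def ffun_def fint_def)

lemma fint_Fubini: "ffun2 F \<Longrightarrow> fint (\<lambda>x. fint (F x)) = fint (\<lambda>t. fint (\<lambda>x. F x t))"
  by (rule fps_ext) (simp add: fint_def ffun2_def bfun_Fubini)

section \<open>Formal solutions and the Green kernel\<close>

text \<open>
  The coefficients in \<open>\<zeta>\<close> of the formal solution of \<open>u(x) = f(x) + \<integral> k(x,t) (\<zeta> \<beta>(t) + \<zeta>\<^sup>2) u(t) dt\<close>.
\<close>

fun vseq :: "(real \<Rightarrow> real) \<Rightarrow> (real \<Rightarrow> real \<Rightarrow> real) \<Rightarrow> (real \<Rightarrow> real) \<Rightarrow> nat \<Rightarrow> real \<Rightarrow> real" where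
  "vseq \<beta> k f 0 x = f x"
| "vseq \<beta> k f (Suc 0) x = (LINT t|unit_lebesgue. k x t * (\<beta> t * f t))"
| "vseq \<beta> k f (Suc (Suc n)) x =
     (LINT t|unit_lebesgue. k x t * (\<beta> t * vseq \<beta> k f (Suc n) t + vseq \<beta> k f n t))"

text \<open>The potential \<zeta> \<beta> + \<zeta>^2. Its constant term is 0, which lets the formal
  integral equations be solved, and their solutions be compared, degree by degree.\<close>

definition pfps :: "(real \<Rightarrow> real) \<Rightarrow> real \<Rightarrow> real fps" where
  "pfps \<beta> t = fps_const (\<beta> t) * fps_X + fps_X ^ 2"

definition vser :: "(real \<Rightarrow> real) \<Rightarrow> (real \<Rightarrow> real \<Rightarrow> real) \<Rightarrow> (real \<Rightarrow> real) \<Rightarrow> real \<Rightarrow> real fps" where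
  "vser \<beta> k f x = Abs_fps (\<lambda>n. vseq \<beta> k f n x)"

lemma pfps_mult_nth:
  "(pfps \<beta> t * F) $ 0 = 0" "(pfps \<beta> t * F) $ Suc 0 = \<beta> t * F $ 0"
  "(pfps \<beta> t * F) $ Suc (Suc n) = \<beta> t * F $ Suc n + F $ n"
  by (simp_all add: pfps_def distrib_right mult.assoc fps_X_power_mult_nth)

lemma vser_eq:
  "vser \<beta> k f x = fps_const (f x) + fint (\<lambda>t. fps_const (k x t) * (pfps \<beta> t * vser \<beta> k f t))"
proof (rule fps_ext)
  fix n
  show "vser \<beta> k f x $ n = (fps_const (f x) + fint (\<lambda>t. fps_const (k x t) * (pfps \<beta> t * vser \<beta> k f t))) $ n"
  proof (cases n)
    case 0
    then show ?thesis by (simp add: vser_def fint_def pfps_mult_nth del: fps_mult_nth_0 fps_mult_nth_1 fps_mult_nth_1')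
  next
    case (Suc m)
    then show ?thesis by (cases m) (simp_all add: vser_def fint_def pfps_mult_nth del: fps_mult_nth_0 fps_mult_nth_1 fps_mult_nth_1')
  qed
qed

lemma bfun2_integral3:
  assumes k: "bfun2 k" and h: "bfun2 h"
  shows "bfun2 (\<lambda>x y. LINT t|unit_lebesgue. k y t * h x t)"
proof -
  obtain C1 where C1: "\<And>x t. x \<in> {0<..<1} \<Longrightarrow> t \<in> {0<..<1} \<Longrightarrow> \<bar>k x t\<bar> \<le> C1" using bfun2E[OF k] by blast
  obtain C2 where C2: "\<And>x t. x \<in> {0<..<1} \<Longrightarrow> t \<in> {0<..<1} \<Longrightarrow> \<bar>h x t\<bar> \<le> C2" using bfun2E[OF h] by blast
  show ?thesis
  proof (rule bfun2I[where C = "C1 * C2"])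
    have km: "(\<lambda>p. k (fst p) (snd p)) \<in> borel_measurable UU" and hm: "(\<lambda>p. h (fst p) (snd p)) \<in> borel_measurable UU"
      using k h by (simp_all add: bfun2_def)
    have "(\<lambda>q. (snd (fst q), snd q)) \<in> measurable (UU \<Otimes>\<^sub>M unit_lebesgue) UU" by measurable
    from measurable_compose[OF this km]
    have 1: "(\<lambda>q. k (snd (fst q)) (snd q)) \<in> borel_measurable (UU \<Otimes>\<^sub>M unit_lebesgue)" by simp
    have "(\<lambda>q. (fst (fst q), snd q)) \<in> measurable (UU \<Otimes>\<^sub>M unit_lebesgue) UU" by measurable
    from measurable_compose[OF this hm]
    have 2: "(\<lambda>q. h (fst (fst q)) (snd q)) \<in> borel_measurable (UU \<Otimes>\<^sub>M unit_lebesgue)" by simp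
    have "(\<lambda>q. k (snd (fst q)) (snd q) * h (fst (fst q)) (snd q)) \<in> borel_measurable (UU \<Otimes>\<^sub>M unit_lebesgue)"
      by (rule borel_measurable_times[OF 1 2])
    then show "(\<lambda>p. LINT t|unit_lebesgue. k (snd p) t * h (fst p) t) \<in> borel_measurable UU"
      by (intro sigma_finite_measure.borel_measurable_lebesgue_integral[OF sigma_finite_unit_lebesgue])
         (simp add: case_prod_unfold)
    fix x y :: real assume x: "x \<in> {0<..<1}" and y: "y \<in> {0<..<1}"
    have b: "\<bar>k y t * h x t\<bar> \<le> C1 * C2" if "t \<in> {0<..<1}" for t
      unfolding abs_mult using C1[OF y that] C2[OF x that] by (intro mult_mono) (auto intro: order_trans[OF abs_ge_zero])
    have bi: "bfun (\<lambda>t. k y t * h x t)" by (intro bfun_mult bfun2_section k h x y)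
    have "\<bar>LINT t|unit_lebesgue. k y t * h x t\<bar> \<le> (LINT t|unit_lebesgue. \<bar>k y t * h x t\<bar>)" by (rule integral_abs_bound)
    also have "\<dots> \<le> (LINT t|unit_lebesgue. C1 * C2)"
      using bfun_integrable[OF bi] b bfun_integrable[OF bfun_const]
      by (intro integral_mono) auto
    finally show "\<bar>LINT t|unit_lebesgue. k y t * h x t\<bar> \<le> C1 * C2" by (simp add: measure_space_unit_lebesgue)
  qed
qed

lemma bfun2_vseq:
  assumes b: "bfun \<beta>" and k: "bfun2 k" and f: "bfun2 f"
  shows "bfun2 (\<lambda>x. vseq \<beta> k (f x) n)"
proof -
  have "bfun2 (\<lambda>x. vseq \<beta> k (f x) n) \<and> bfun2 (\<lambda>x. vseq \<beta> k (f x) (Suc n))"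
  proof (induction n)
    case 0
    show ?case using f by (simp add: bfun2_integral3[OF k bfun2_mult[OF bfun2_snd[OF b] f]])
  next
    case (Suc n)
    then show ?case using bfun2_integral3[OF k bfun2_add[OF bfun2_mult[OF bfun2_snd[OF b] Suc[THEN conjunct2]] Suc[THEN conjunct1]]]
      by simp
  qed
  then show ?thesis ..
qed

lemma ffun2_vser: "bfun \<beta> \<Longrightarrow> bfun2 k \<Longrightarrow> bfun2 f \<Longrightarrow> ffun2 (\<lambda>x. vser \<beta> k (f x))"
  by (simp add: ffun2_def vser_def bfun2_vseq)

lemma ffun_vser:
  assumes "bfun \<beta>" "bfun2 k" "bfun f"
  shows "ffun (vser \<beta> k f)"
proof -
  \<comment> \<open>A function of one variable is a kernel constant in its first argument;
    \<open>1 / 2\<close> is an arbitrary point of the interval.\<close>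
  have "ffun ((\<lambda>x. vser \<beta> k f) (1 / 2))"
    by (rule ffun2_section[OF ffun2_vser[OF assms(1,2) bfun2_snd[OF assms(3)]], of "1 / 2"]) simp
  then show ?thesis by simp
qed

lemma ffun_pfps [intro]: "bfun \<beta> \<Longrightarrow> ffun (pfps \<beta>)"
  unfolding pfps_def by (intro ffun_add ffun_mult ffun_fps_const ffun_const)

text \<open>
  In the formal variable \<open>\<zeta>\<close>, the series \<open>yl\<close> and \<open>yr\<close> solve \<open>y'' = (\<zeta>\<^sup>2 + \<zeta> \<beta>) y\<close> with the initial data
  \<open>y(0) = 0, y'(0) = 1\<close> and \<open>y(1) = 0, y'(1) = -1\<close>; \<open>gser\<close> is the kernel of \<open>(T\<^sup>*T + \<zeta>\<^sup>2 + \<zeta> \<beta>)\<^sup>-\<^sup>1\<close>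
  and \<open>chard\<close> the characteristic function.
\<close>

definition yl :: "(real \<Rightarrow> real) \<Rightarrow> real \<Rightarrow> real fps" where
  "yl \<beta> = vser \<beta> (\<lambda>x t. max 0 (x - t)) (\<lambda>x. x)"

definition yr :: "(real \<Rightarrow> real) \<Rightarrow> real \<Rightarrow> real fps" where
  "yr \<beta> = vser \<beta> (\<lambda>x t. max 0 (t - x)) (\<lambda>x. 1 - x)"

definition gser :: "(real \<Rightarrow> real) \<Rightarrow> real \<Rightarrow> real \<Rightarrow> real fps" where
  "gser \<beta> x = vser \<beta> (\<lambda>y t. - (min t y - t * y)) (\<lambda>y. min x y - x * y)"

definition chard :: "(real \<Rightarrow> real) \<Rightarrow> real fps" where
  "chard \<beta> = yl \<beta> 1"

lemma yl_eq: "yl \<beta> x = fps_const x + fint (\<lambda>t. fps_const (max 0 (x - t)) * (pfps \<beta> t * yl \<beta> t))"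
  unfolding yl_def by (rule vser_eq)

lemma yr_eq: "yr \<beta> x = fps_const (1 - x) + fint (\<lambda>t. fps_const (max 0 (t - x)) * (pfps \<beta> t * yr \<beta> t))"
  unfolding yr_def by (rule vser_eq)

lemma gser_eq: "gser \<beta> x y = fps_const (min x y - x * y)
    - fint (\<lambda>t. fps_const (min t y - t * y) * (pfps \<beta> t * gser \<beta> x t))"
proof -
  have "gser \<beta> x y = fps_const (min x y - x * y)
      + fint (\<lambda>t. - (fps_const (min t y - t * y) * (pfps \<beta> t * gser \<beta> x t)))"
    unfolding gser_def by (subst vser_eq) (simp only: fps_const_neg[symmetric] minus_mult_left[symmetric])
  then show ?thesis by (simp add: fint_uminus)
qed

lemma bfun2_max_diff' [intro]: "bfun2 (\<lambda>x t. max 0 (t - x))"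
  using bfun2_swap[OF bfun2_max_diff] by simp

lemma bfun2_min [intro]: "bfun2 (\<lambda>x t. min x t)"
proof -
  have "bfun2 (\<lambda>x t. x + - max 0 (x - t))"
    by (intro bfun2_add bfun2_uminus bfun2_fst bfun_ident bfun2_max_diff)
  moreover have "(\<lambda>x t. x + - max 0 (x - t)) = (\<lambda>x t :: real. min x t)" by (auto intro!: ext)
  ultimately show ?thesis by simp
qed

lemma bfun2_green [intro]: "bfun2 (\<lambda>x t. min x t - x * t)"
  using bfun2_add[OF bfun2_min bfun2_uminus[OF bfun2_mult[OF bfun2_fst[OF bfun_ident] bfun2_snd[OF bfun_ident]]]]
  by simp

definition lt_ind :: "real \<Rightarrow> real \<Rightarrow> real fps" where
  "lt_ind x t = (if t < x then 1 else 0)"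

definition ge_ind :: "real \<Rightarrow> real \<Rightarrow> real fps" where
  "ge_ind x t = (if t < x then 0 else 1)"

lemma ffun_lt_ind [intro]: "ffun (lt_ind x)"
proof -
  have "ffun (\<lambda>t. fps_const (if t < x then 1 else 0))"
    by (rule ffun_fps_const[OF bfunI[where C = 1]]) auto
  then show ?thesis by (simp add: lt_ind_def[abs_def] if_distrib cong: if_cong)
qed

lemma ffun_ge_ind [intro]: "ffun (ge_ind x)"
proof -
  have "ffun (\<lambda>t. fps_const (if t < x then 0 else 1))"
    by (rule ffun_fps_const[OF bfunI[where C = 1]]) auto
  then show ?thesis by (simp add: ge_ind_def[abs_def] if_distrib cong: if_cong)
qed

lemma fint_split:
  assumes "ffun F"
  shows "fint F = fint (\<lambda>t. lt_ind x t * F t) + fint (\<lambda>t. ge_ind x t * F t)"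
proof -
  have "fint F = fint (\<lambda>t. lt_ind x t * F t + ge_ind x t * F t)"
    by (intro fint_cong) (simp add: lt_ind_def ge_ind_def)
  also have "\<dots> = fint (\<lambda>t. lt_ind x t * F t) + fint (\<lambda>t. ge_ind x t * F t)"
    by (intro fint_add ffun_mult ffun_lt_ind ffun_ge_ind assms)
  finally show ?thesis .
qed

lemma ffun_ident [intro]: "ffun fps_const"
  by (intro ffun_fps_const bfun_ident)

context
  fixes \<beta> :: "real \<Rightarrow> real"
  assumes b: "bfun \<beta>"
begin

lemma ffun_yl: "ffun (yl \<beta>)"
  unfolding yl_def by (intro ffun_vser b bfun_ident bfun2_max_diff)

lemma ffun_yr: "ffun (yr \<beta>)"
  unfolding yr_def by (intro ffun_vser b bfun_diff bfun_const bfun_ident bfun2_max_diff')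

lemma ffun2_gser: "ffun2 (gser \<beta>)"
  unfolding gser_def using bfun2_uminus[OF bfun2_swap[OF bfun2_green]] b bfun2_green
  by (intro ffun2_vser) (auto simp: mult.commute min.commute)

lemma chard_eq: "chard \<beta> = 1 + fint (\<lambda>t. fps_const (1 - t) * (pfps \<beta> t * yl \<beta> t))"
  unfolding chard_def by (subst yl_eq) (auto intro!: fint_cong)

text \<open>Fubini's theorem. Integrated in \<open>s\<close>, the kernel
  \<open>max 0 (t - s)\<close> belongs to the equation of \<open>yl\<close>; integrated in
  \<open>t\<close>, to that of \<open>yr\<close>. This takes the place of integration by parts
  between the two solutions.\<close>

lemma fint_volterra_duality:
  assumes F: "ffun F" and G: "ffun G"
  shows "fint (\<lambda>t. F t * fint (\<lambda>s. fps_const (max 0 (t - s)) * G s)) =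
         fint (\<lambda>s. G s * fint (\<lambda>t. fps_const (max 0 (t - s)) * F t))"
proof -
  have k: "ffun2 (\<lambda>t s. fps_const (max 0 (t - s)))" by (intro ffun2_fps_const bfun2_max_diff)
  have "fint (\<lambda>t. F t * fint (\<lambda>s. fps_const (max 0 (t - s)) * G s)) =
      fint (\<lambda>t. fint (\<lambda>s. F t * (fps_const (max 0 (t - s)) * G s)))"
    by (intro fint_cong fint_mult_left[symmetric] ffun_mult G ffun2_section[OF k])
  also have "\<dots> = fint (\<lambda>s. fint (\<lambda>t. F t * (fps_const (max 0 (t - s)) * G s)))"
    by (intro fint_Fubini ffun2_mult ffun2_fst ffun2_snd F G k)
  also have "\<dots> = fint (\<lambda>s. fint (\<lambda>t. G s * (fps_const (max 0 (t - s)) * F t)))"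
    by (simp add: mult_ac)
  also have "\<dots> = fint (\<lambda>s. G s * fint (\<lambda>t. fps_const (max 0 (t - s)) * F t))"
  proof (intro fint_cong fint_mult_left ffun_mult F)
    fix s :: real assume "s \<in> {0<..<1}"
    then show "ffun (\<lambda>t. fps_const (max 0 (t - s)))"
      by (intro ffun_fps_const bfun2_section[OF bfun2_max_diff'])
  qed
  finally show ?thesis .
qed

text \<open>The \<zeta>-derivative of the potential is also, up to sign, the numerator 2 \<zeta> +
  \<beta> of R(\<zeta>); this coincidence makes the trace a logarithmic derivative.\<close>

definition pder :: "real \<Rightarrow> real fps" where
  "pder t = fps_const (\<beta> t) + 2 * fps_X"

lemma fps_deriv_pfps: "fps_deriv (pfps \<beta> t) = pder t"
  by (simp add: pfps_def pder_def fps_deriv_power)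

lemma ffun_pder: "ffun pder"
  unfolding pder_def using b by (intro ffun_add ffun_fps_const ffun_const)

text \<open>Differentiating \<open>yl_eq\<close> in \<zeta> gives a Volterra equation for the
  derivative of \<open>yl\<close> with source \<open>pder t * yl \<beta> t\<close>. After pairing
  with \<open>pfps \<beta> t * yr \<beta> t\<close> and moving the kernel over by duality, the terms
  that contain the unknown derivative of \<open>yl\<close> cancel.\<close>

lemma fps_deriv_chard: "fps_deriv (chard \<beta>) = fint (\<lambda>t. pder t * yl \<beta> t * yr \<beta> t)"
proof -
  define Q where "Q t = pder t * yl \<beta> t + pfps \<beta> t * fps_deriv (yl \<beta> t)" for t
  have dP: "fps_deriv (pfps \<beta> t * yl \<beta> t) = Q t" for t
    by (simp add: Q_def fps_deriv_pfps algebra_simps)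
  have Q: "ffun Q" unfolding Q_def by (intro ffun_add ffun_mult ffun_pder ffun_yl ffun_deriv ffun_pfps b)
  have dy: "fps_deriv (yl \<beta> x) = fint (\<lambda>t. fps_const (max 0 (x - t)) * Q t)" for x
    by (subst yl_eq) (simp add: fps_deriv_fint dP del: fps_deriv_mult)
  have dD: "fps_deriv (chard \<beta>) = fint (\<lambda>t. fps_const (1 - t) * Q t)"
    by (subst chard_eq) (simp add: fps_deriv_fint dP del: fps_deriv_mult)
  have PR: "ffun (\<lambda>t. pfps \<beta> t * yr \<beta> t)" by (intro ffun_mult ffun_pfps ffun_yr b)
  have m1: "ffun (\<lambda>s. fps_const (1 - s))" by (intro ffun_fps_const bfun_diff bfun_const bfun_ident)
  have "fint (\<lambda>t. (pfps \<beta> t * yr \<beta> t) * fps_deriv (yl \<beta> t)) =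
      fint (\<lambda>s. Q s * fint (\<lambda>t. fps_const (max 0 (t - s)) * (pfps \<beta> t * yr \<beta> t)))"
    unfolding dy by (rule fint_volterra_duality[OF PR Q])
  also have "\<dots> = fint (\<lambda>s. Q s * yr \<beta> s - fps_const (1 - s) * Q s)"
    by (intro fint_cong) (subst yr_eq[of _ _], simp add: algebra_simps)
  also have "\<dots> = fint (\<lambda>s. Q s * yr \<beta> s) - fps_deriv (chard \<beta>)"
    unfolding dD by (intro fint_diff ffun_mult Q ffun_yr m1)
  also have "fint (\<lambda>s. Q s * yr \<beta> s) = fint (\<lambda>s. pder s * yl \<beta> s * yr \<beta> s + (pfps \<beta> s * yr \<beta> s) * fps_deriv (yl \<beta> s))"
    by (intro fint_cong) (simp add: Q_def algebra_simps)
  also have "\<dots> = fint (\<lambda>s. pder s * yl \<beta> s * yr \<beta> s) + fint (\<lambda>s. (pfps \<beta> s * yr \<beta> s) * fps_deriv (yl \<beta> s))"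
    by (intro fint_add ffun_mult ffun_pder ffun_yl ffun_yr PR ffun_deriv ffun_pfps b)
  finally show ?thesis by (simp add: algebra_simps)
qed

section \<open>The Wronskian of the two formal solutions, without derivatives in x\<close>

abbreviation "Lf \<equiv> \<lambda>t. pfps \<beta> t * yl \<beta> t"
abbreviation "Rf \<equiv> \<lambda>t. pfps \<beta> t * yr \<beta> t"

text \<open>In integrated form, \<open>1 + A0 x\<close> is the derivative of \<open>yl\<close> at
  \<open>x\<close> and \<open>- (1 + B0 x)\<close> that of \<open>yr\<close>; \<open>A1\<close> and
  \<open>B1\<close> are the first moments that complete the formulas for \<open>yl\<close> and
  \<open>yr\<close> themselves.\<close>

definition "A0 x = fint (\<lambda>t. lt_ind x t * Lf t)"
definition "A1 x = fint (\<lambda>t. lt_ind x t * (fps_const t * Lf t))"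
definition "B0 x = fint (\<lambda>t. ge_ind x t * Rf t)"
definition "B1 x = fint (\<lambda>t. ge_ind x t * (fps_const t * Rf t))"

lemma ffun_Lf: "ffun Lf" and ffun_Rf: "ffun Rf"
  by (intro ffun_mult ffun_pfps ffun_yl ffun_yr b)+

lemma lt_part:
  "fint (\<lambda>s. lt_ind x s * (fps_const (t - s) * Lf s)) = fps_const t * A0 x - A1 x"
proof -
  have "fint (\<lambda>s. lt_ind x s * (fps_const (t - s) * Lf s)) =
      fint (\<lambda>s. fps_const t * (lt_ind x s * Lf s) - lt_ind x s * (fps_const s * Lf s))"
    by (intro fint_cong) (simp add: algebra_simps flip: fps_const_sub)
  also have "\<dots> = fps_const t * A0 x - A1 x"
    unfolding A0_def A1_def
    by (subst fint_diff; (subst fint_mult_left)?; (intro ffun_mult ffun_const ffun_lt_ind ffun_Lf ffun_ident)?; simp?)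
  finally show ?thesis .
qed

lemma ge_part:
  "fint (\<lambda>s. ge_ind x s * (fps_const (s - t) * Rf s)) = B1 x - fps_const t * B0 x"
proof -
  have "fint (\<lambda>s. ge_ind x s * (fps_const (s - t) * Rf s)) =
      fint (\<lambda>s. ge_ind x s * (fps_const s * Rf s) - fps_const t * (ge_ind x s * Rf s))"
    by (intro fint_cong) (simp add: algebra_simps flip: fps_const_sub)
  also have "\<dots> = B1 x - fps_const t * B0 x"
    unfolding B0_def B1_def
    by (subst fint_diff; (subst fint_mult_left)?; (intro ffun_mult ffun_const ffun_ge_ind ffun_Rf ffun_ident)?; simp?)
  finally show ?thesis .
qed

lemma yl_eq_A: "yl \<beta> x = fps_const x + fps_const x * A0 x - A1 x"
proof -
  have "fint (\<lambda>t. fps_const (max 0 (x - t)) * Lf t) = fint (\<lambda>s. lt_ind x s * (fps_const (x - s) * Lf s))"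
    by (intro fint_cong) (simp add: lt_ind_def)
  then show ?thesis by (subst yl_eq) (simp add: lt_part)
qed

lemma yr_eq_B: "yr \<beta> x = fps_const (1 - x) + B1 x - fps_const x * B0 x"
proof -
  have "fint (\<lambda>t. fps_const (max 0 (t - x)) * Rf t) = fint (\<lambda>s. ge_ind x s * (fps_const (s - x) * Rf s))"
    by (intro fint_cong) (simp add: ge_ind_def)
  then show ?thesis by (subst yr_eq) (simp add: ge_part)
qed

text \<open>The integral \<open>B\<close> of P yl yr over the points right of \<open>x\<close>, with
  P the potential, is evaluated by expanding \<open>yl\<close> about \<open>x\<close>. This leaves a
  Volterra term \<open>V\<close>, which duality moves onto \<open>yr\<close> and turns into
  \<open>B - W\<close>. The unknown \<open>B\<close> cancels, and the part \<open>W\<close> of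
  \<open>chard\<close> remains.\<close>

lemma Wronskian_aux: "(1 + A0 x) * B1 x - A1 x * B0 x = chard \<beta> - 1 - A0 x + A1 x"
proof -
  define W where "W = fint (\<lambda>s. ge_ind x s * (fps_const (1 - s) * Lf s))"
  have m1: "ffun (\<lambda>s. fps_const (1 - s))" by (intro ffun_fps_const bfun_diff bfun_const bfun_ident)
  have D: "chard \<beta> = 1 + (A0 x - A1 x) + W"
    using fint_split[OF ffun_mult[OF m1 ffun_Lf], of x] lt_part[of x 1]
    by (subst chard_eq) (simp add: W_def)
  have yl_ge: "yl \<beta> t = fps_const t + (fps_const t * A0 x - A1 x) + fint (\<lambda>s. fps_const (max 0 (t - s)) * (ge_ind x s * Lf s))"
    if t: "ge_ind x t \<noteq> 0" for t
  proof -
    have xt: "x \<le> t" using t by (auto simp: ge_ind_def split: if_splits)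
    have k: "ffun (\<lambda>s. fps_const (max 0 (t - s)))"
      by (intro ffun_fps_const bfunI[where C = "\<bar>t\<bar> + 1"]) auto
    have "fint (\<lambda>s. fps_const (max 0 (t - s)) * Lf s) =
        fint (\<lambda>s. lt_ind x s * (fps_const (t - s) * Lf s)) + fint (\<lambda>s. fps_const (max 0 (t - s)) * (ge_ind x s * Lf s))"
      using xt unfolding fint_split[OF ffun_mult[OF k ffun_Lf], of x]
      by (intro arg_cong2[where f = "(+)"] fint_cong) (auto simp: lt_ind_def ge_ind_def)
    then show ?thesis by (subst yl_eq) (simp add: lt_part)
  qed
  have R: "ffun (\<lambda>t. ge_ind x t * Rf t)" and L: "ffun (\<lambda>t. ge_ind x t * Lf t)"
    by (intro ffun_mult ffun_ge_ind ffun_Rf ffun_Lf)+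
  have Rt: "ffun (\<lambda>t. ge_ind x t * (fps_const t * Rf t))"
    by (intro ffun_mult ffun_ge_ind ffun_Rf ffun_ident)
  have k2: "ffun2 (\<lambda>t s. fps_const (max 0 (t - s)))" by (intro ffun2_fps_const bfun2_max_diff)
  define V where "V t = fint (\<lambda>s. fps_const (max 0 (t - s)) * (ge_ind x s * Lf s))" for t
  have V: "ffun V" unfolding V_def by (intro ffun_fint ffun2_mult k2 ffun2_snd L)
  define B where "B = fint (\<lambda>t. ge_ind x t * (pfps \<beta> t * yl \<beta> t * yr \<beta> t))"
  have "B = fint (\<lambda>t. ((ge_ind x t * (fps_const t * Rf t)) + (A0 x * (ge_ind x t * (fps_const t * Rf t)) - A1 x * (ge_ind x t * Rf t)))
      + (ge_ind x t * Rf t) * V t)"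
    unfolding B_def
  proof (rule fint_cong)
    fix t
    show "ge_ind x t * (pfps \<beta> t * yl \<beta> t * yr \<beta> t) =
      ((ge_ind x t * (fps_const t * Rf t)) + (A0 x * (ge_ind x t * (fps_const t * Rf t)) - A1 x * (ge_ind x t * Rf t))) + (ge_ind x t * Rf t) * V t"
    proof (cases "ge_ind x t = 0")
      case False
      show ?thesis unfolding yl_ge[OF False] V_def by (simp add: algebra_simps)
    qed simp
  qed
  also have "\<dots> = fint (\<lambda>t. (ge_ind x t * (fps_const t * Rf t)) + (A0 x * (ge_ind x t * (fps_const t * Rf t)) - A1 x * (ge_ind x t * Rf t)))
      + fint (\<lambda>t. (ge_ind x t * Rf t) * V t)"
    by (intro fint_add ffun_add ffun_diff ffun_mult[OF ffun_const] ffun_mult[OF R V] R Rt)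
  also have "fint (\<lambda>t. (ge_ind x t * (fps_const t * Rf t)) + (A0 x * (ge_ind x t * (fps_const t * Rf t)) - A1 x * (ge_ind x t * Rf t)))
      = B1 x + (A0 x * B1 x - A1 x * B0 x)"
    unfolding fint_add[OF Rt ffun_diff[OF ffun_mult[OF ffun_const Rt] ffun_mult[OF ffun_const R]]]
      fint_diff[OF ffun_mult[OF ffun_const Rt] ffun_mult[OF ffun_const R]] fint_mult_left[OF Rt] fint_mult_left[OF R]
    by (simp add: B0_def B1_def)
  also have "fint (\<lambda>t. (ge_ind x t * Rf t) * V t) =
      fint (\<lambda>s. (ge_ind x s * Lf s) * fint (\<lambda>t. fps_const (max 0 (t - s)) * (ge_ind x t * Rf t)))"
    unfolding V_def by (rule fint_volterra_duality[OF R L])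
  also have "\<dots> = fint (\<lambda>s. ge_ind x s * (pfps \<beta> s * yl \<beta> s * yr \<beta> s) - ge_ind x s * (fps_const (1 - s) * Lf s))"
  proof (rule fint_cong)
    fix s
    show "(ge_ind x s * Lf s) * fint (\<lambda>t. fps_const (max 0 (t - s)) * (ge_ind x t * Rf t)) =
        ge_ind x s * (pfps \<beta> s * yl \<beta> s * yr \<beta> s) - ge_ind x s * (fps_const (1 - s) * Lf s)"
    proof (cases "ge_ind x s = 0")
      case False
      then have "x \<le> s" by (auto simp: ge_ind_def split: if_splits)
      then have "fint (\<lambda>t. fps_const (max 0 (t - s)) * (ge_ind x t * Rf t)) = fint (\<lambda>t. fps_const (max 0 (t - s)) * Rf t)"
        by (intro fint_cong) (auto simp: ge_ind_def)
      also have "\<dots> = yr \<beta> s - fps_const (1 - s)" by (subst yr_eq) simp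
      finally have *: "fint (\<lambda>t. fps_const (max 0 (t - s)) * (ge_ind x t * Rf t)) = yr \<beta> s - fps_const (1 - s)" .
      show ?thesis unfolding * by (simp add: algebra_simps)
    qed simp
  qed
  also have "\<dots> = B - W"
    unfolding B_def W_def
    by (intro fint_diff ffun_mult ffun_ge_ind ffun_pfps b ffun_yl ffun_yr m1)
  finally show ?thesis using D by (simp add: algebra_simps)
qed

lemma fps_const_one_minus: "fps_const (1 - x) = 1 - fps_const (x :: real)"
  by (simp flip: fps_const_sub)

text \<open>With \<open>A0\<close> and \<open>B0\<close> read as derivatives, the right-hand side is
  yl' yr - yl yr' at \<open>x\<close>; it does not depend on \<open>x\<close>.\<close>

lemma Wronskian: "chard \<beta> = (1 + A0 x) * yr \<beta> x + (1 + B0 x) * yl \<beta> x"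
proof -
  have "(1 + A0 x) * yr \<beta> x + (1 + B0 x) * yl \<beta> x = 1 + A0 x - A1 x + ((1 + A0 x) * B1 x - A1 x * B0 x)"
    unfolding yl_eq_A yr_eq_B fps_const_one_minus by (simp add: algebra_simps)
  then show ?thesis unfolding Wronskian_aux by simp
qed

text \<open>The Green function of the perturbed problem times the characteristic function, which
  keeps the identities free of division.\<close>

definition qser :: "real \<Rightarrow> real \<Rightarrow> real fps" where
  "qser t x = (if t < x then yl \<beta> t * yr \<beta> x else yl \<beta> x * yr \<beta> t)"

lemma qser_commute: "qser t x = qser x t"
  by (auto simp: qser_def mult.commute)

lemma qser_split: "pfps \<beta> t * qser t x = lt_ind x t * Lf t * yr \<beta> x + ge_ind x t * Rf t * yl \<beta> x"
  by (auto simp: qser_def lt_ind_def ge_ind_def algebra_simps)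

lemma ffun_qser: "ffun (\<lambda>t. pfps \<beta> t * qser t x)"
  unfolding qser_split by (intro ffun_add ffun_mult ffun_const ffun_lt_ind ffun_ge_ind ffun_pfps ffun_yl ffun_yr b)

lemma fint_qser:
  assumes f: "bfun f"
  shows "fint (\<lambda>t. fps_const (f t) * (pfps \<beta> t * qser t x)) =
    fint (\<lambda>t. lt_ind x t * (fps_const (f t) * Lf t)) * yr \<beta> x + fint (\<lambda>t. ge_ind x t * (fps_const (f t) * Rf t)) * yl \<beta> x"
proof -
  have 1: "ffun (\<lambda>t. lt_ind x t * (fps_const (f t) * Lf t))" and 2: "ffun (\<lambda>t. ge_ind x t * (fps_const (f t) * Rf t))"
    by (intro ffun_mult ffun_lt_ind ffun_ge_ind ffun_fps_const f ffun_pfps ffun_yl ffun_yr b)+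
  have "fint (\<lambda>t. fps_const (f t) * (pfps \<beta> t * qser t x)) =
    fint (\<lambda>t. lt_ind x t * (fps_const (f t) * Lf t) * yr \<beta> x + ge_ind x t * (fps_const (f t) * Rf t) * yl \<beta> x)"
    unfolding qser_split by (intro fint_cong) (simp add: algebra_simps)
  also have "\<dots> = fint (\<lambda>t. lt_ind x t * (fps_const (f t) * Lf t)) * yr \<beta> x + fint (\<lambda>t. ge_ind x t * (fps_const (f t) * Rf t)) * yl \<beta> x"
    unfolding fint_add[OF ffun_mult[OF 1 ffun_const] ffun_mult[OF 2 ffun_const]] fint_mult_right[OF 1] fint_mult_right[OF 2] ..
  finally show ?thesis .
qed

text \<open>A resolvent identity G P q = D G - q, with G the unperturbed Green kernel, P the
  potential and D the characteristic function. The integrals over the two sides of \<open>x\<close>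
  produce the moments \<open>A0\<close>, \<open>A1\<close>, \<open>B0\<close>, \<open>B1\<close>,
  and the Wronskian combines them.\<close>

lemma green_qser:
  assumes z: "z \<in> {0<..<1}" and x: "x \<in> {0<..<1}"
  shows "fint (\<lambda>t. fps_const (min z t - z * t) * (pfps \<beta> t * qser t x)) =
    chard \<beta> * fps_const (min z x - z * x) - qser z x"
proof (cases "z \<le> x")
  case True
  have k: "bfun (\<lambda>t. max 0 (z - t))" by (intro bfun2_section[OF bfun2_max_diff] z)
  have k1: "bfun (\<lambda>t. 1 - t)" by (intro bfun_diff bfun_const bfun_ident)
  \<comment> \<open>Writing the kernel as \<open>z * (1 - t) - max 0 (z - t)\<close> confines the
    second part to \<open>t < z\<close>, left of \<open>x\<close>, where \<open>qser t x\<close> is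
    \<open>yl\<close> at \<open>t\<close> times a fixed factor.\<close>
  have "fint (\<lambda>t. fps_const (min z t - z * t) * (pfps \<beta> t * qser t x)) =
      fint (\<lambda>t. fps_const z * (fps_const (1 - t) * (pfps \<beta> t * qser t x)) - fps_const (max 0 (z - t)) * (pfps \<beta> t * qser t x))"
  proof (rule fint_cong)
    fix t
    have "fps_const (min z t - z * t) = fps_const (z * (1 - t) - max 0 (z - t))"
      by (rule arg_cong[where f = fps_const]) (auto simp: algebra_simps min_def max_def)
    then show "fps_const (min z t - z * t) * (pfps \<beta> t * qser t x) =
      fps_const z * (fps_const (1 - t) * (pfps \<beta> t * qser t x)) - fps_const (max 0 (z - t)) * (pfps \<beta> t * qser t x)"
      by (simp only: fps_const_sub[symmetric] fps_const_mult[symmetric] left_diff_distrib mult.assoc)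
  qed
  also have "\<dots> = fps_const z * fint (\<lambda>t. fps_const (1 - t) * (pfps \<beta> t * qser t x)) - fint (\<lambda>t. fps_const (max 0 (z - t)) * (pfps \<beta> t * qser t x))"
    by (subst fint_diff; (subst fint_mult_left)?; (intro ffun_mult[OF ffun_fps_const[OF k1] ffun_qser] ffun_mult[OF ffun_fps_const[OF k] ffun_qser] ffun_mult[OF ffun_const])?; simp?)
  also have "fint (\<lambda>t. fps_const (1 - t) * (pfps \<beta> t * qser t x)) = (A0 x - A1 x) * yr \<beta> x + (B0 x - B1 x) * yl \<beta> x"
  proof -
    have "fint (\<lambda>t. ge_ind x t * (fps_const (1 - t) * Rf t)) = fint (\<lambda>t. - (ge_ind x t * (fps_const (t - 1) * Rf t)))"
      by (intro fint_cong) (simp add: algebra_simps flip: fps_const_sub)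
    then have "fint (\<lambda>t. ge_ind x t * (fps_const (1 - t) * Rf t)) = B0 x - B1 x"
      using ge_part[of x 1] by (simp add: fint_uminus)
    then show ?thesis unfolding fint_qser[OF k1] lt_part by simp
  qed
  also have "fint (\<lambda>t. fps_const (max 0 (z - t)) * (pfps \<beta> t * qser t x)) = (yl \<beta> z - fps_const z) * yr \<beta> x"
  proof -
    have "fint (\<lambda>t. fps_const (max 0 (z - t)) * (pfps \<beta> t * qser t x)) = fint (\<lambda>t. (fps_const (max 0 (z - t)) * Lf t) * yr \<beta> x)"
      using True by (intro fint_cong) (auto simp: qser_def algebra_simps)
    also have "\<dots> = fint (\<lambda>t. fps_const (max 0 (z - t)) * Lf t) * yr \<beta> x"
      by (intro fint_mult_right ffun_mult[OF ffun_fps_const[OF k] ffun_Lf])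
    also have "fint (\<lambda>t. fps_const (max 0 (z - t)) * Lf t) = yl \<beta> z - fps_const z" by (subst yl_eq) simp
    finally show ?thesis .
  qed
  also have "fps_const z * ((A0 x - A1 x) * yr \<beta> x + (B0 x - B1 x) * yl \<beta> x) - (yl \<beta> z - fps_const z) * yr \<beta> x =
      chard \<beta> * fps_const (min z x - z * x) - qser z x"
  proof -
    have c: "(A0 x - A1 x) * yr \<beta> x + (B0 x - B1 x) * yl \<beta> x = chard \<beta> * (1 - fps_const x) - yr \<beta> x"
    proof -
      have 1: "A0 x - A1 x = (1 + A0 x) * (1 - fps_const x) - 1 + yl \<beta> x"
        unfolding yl_eq_A by (simp add: algebra_simps)
      have 2: "B0 x - B1 x = (1 + B0 x) * (1 - fps_const x) - yr \<beta> x"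
        unfolding yr_eq_B fps_const_one_minus by (simp add: algebra_simps)
      show ?thesis unfolding 1 2 Wronskian[of x] by (simp add: algebra_simps)
    qed
    have q: "qser z x = yl \<beta> z * yr \<beta> x" using True by (auto simp: qser_def)
    have m: "fps_const (min z x - z * x) = fps_const z * (1 - fps_const x)"
    proof -
      have "min z x - z * x = z * (1 - x)" using True by (simp add: algebra_simps)
      then show ?thesis by (simp only: fps_const_mult[symmetric] fps_const_one_minus)
    qed
    show ?thesis unfolding c q m by (simp add: algebra_simps del: fps_const_mult fps_const_sub)
  qed
  finally show ?thesis .
next
  case False
  have k: "bfun (\<lambda>t. max 0 (t - z))" by (intro bfun2_section[OF bfun2_max_diff'] z)
  \<comment> \<open>Here \<open>z\<close> lies right of \<open>x\<close>; the mirror image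
    \<open>(1 - z) * t - max 0 (t - z)\<close> confines the second part to
    \<open>t > z\<close>.\<close>
  have "fint (\<lambda>t. fps_const (min z t - z * t) * (pfps \<beta> t * qser t x)) =
      fint (\<lambda>t. fps_const (1 - z) * (fps_const t * (pfps \<beta> t * qser t x)) - fps_const (max 0 (t - z)) * (pfps \<beta> t * qser t x))"
  proof (rule fint_cong)
    fix t
    have "fps_const (min z t - z * t) = fps_const ((1 - z) * t - max 0 (t - z))"
      by (rule arg_cong[where f = fps_const]) (auto simp: algebra_simps min_def max_def)
    then show "fps_const (min z t - z * t) * (pfps \<beta> t * qser t x) =
      fps_const (1 - z) * (fps_const t * (pfps \<beta> t * qser t x)) - fps_const (max 0 (t - z)) * (pfps \<beta> t * qser t x)"
      by (simp only: fps_const_sub[symmetric] fps_const_mult[symmetric] left_diff_distrib mult.assoc)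
  qed
  also have "\<dots> = fps_const (1 - z) * fint (\<lambda>t. fps_const t * (pfps \<beta> t * qser t x)) - fint (\<lambda>t. fps_const (max 0 (t - z)) * (pfps \<beta> t * qser t x))"
    by (subst fint_diff; (subst fint_mult_left)?; (intro ffun_mult[OF ffun_ident ffun_qser] ffun_mult[OF ffun_fps_const[OF k] ffun_qser] ffun_mult[OF ffun_const])?; simp?)
  also have "fint (\<lambda>t. fps_const t * (pfps \<beta> t * qser t x)) = A1 x * yr \<beta> x + B1 x * yl \<beta> x"
    unfolding fint_qser[OF bfun_ident] A1_def B1_def ..
  also have "fint (\<lambda>t. fps_const (max 0 (t - z)) * (pfps \<beta> t * qser t x)) = (yr \<beta> z - fps_const (1 - z)) * yl \<beta> x"
  proof -
    have "fint (\<lambda>t. fps_const (max 0 (t - z)) * (pfps \<beta> t * qser t x)) = fint (\<lambda>t. (fps_const (max 0 (t - z)) * Rf t) * yl \<beta> x)"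
      using False by (intro fint_cong) (auto simp: qser_def algebra_simps)
    also have "\<dots> = fint (\<lambda>t. fps_const (max 0 (t - z)) * Rf t) * yl \<beta> x"
      by (intro fint_mult_right ffun_mult[OF ffun_fps_const[OF k] ffun_Rf])
    also have "fint (\<lambda>t. fps_const (max 0 (t - z)) * Rf t) = yr \<beta> z - fps_const (1 - z)" by (subst yr_eq) simp
    finally show ?thesis .
  qed
  also have "fps_const (1 - z) * (A1 x * yr \<beta> x + B1 x * yl \<beta> x) - (yr \<beta> z - fps_const (1 - z)) * yl \<beta> x =
      chard \<beta> * fps_const (min z x - z * x) - qser z x"
  proof -
    have c: "A1 x * yr \<beta> x + B1 x * yl \<beta> x + yl \<beta> x = chard \<beta> * fps_const x"
    proof -
      have 1: "A1 x = fps_const x * (1 + A0 x) - yl \<beta> x" unfolding yl_eq_A by (simp add: algebra_simps)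
      have 2: "B1 x = fps_const x * (1 + B0 x) + yr \<beta> x - 1"
        unfolding yr_eq_B fps_const_one_minus by (simp add: algebra_simps)
      show ?thesis unfolding 1 2 Wronskian[of x] by (simp add: algebra_simps)
    qed
    have "qser z x = yl \<beta> x * yr \<beta> z" using False by (auto simp: qser_def)
    moreover have "fps_const (min z x - z * x) = fps_const (1 - z) * fps_const x"
      using False by (simp add: algebra_simps min_def)
    moreover have "fps_const (1 - z) * (A1 x * yr \<beta> x + B1 x * yl \<beta> x) - (yr \<beta> z - fps_const (1 - z)) * yl \<beta> x =
        fps_const (1 - z) * (A1 x * yr \<beta> x + B1 x * yl \<beta> x + yl \<beta> x) - yr \<beta> z * yl \<beta> x"
      by (simp add: algebra_simps)
    ultimately show ?thesis unfolding c by (simp add: algebra_simps)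
  qed
  finally show ?thesis .
qed

text \<open>Both sides solve the same Green integral equation, so their difference \<open>e\<close>
  solves the homogeneous one. The potential starts in degree 1, hence each coefficient of
  \<open>e\<close> is an integral of lower ones, and all vanish by induction.\<close>

lemma chard_gser:
  assumes x: "x \<in> {0<..<1}" and y: "y \<in> {0<..<1}"
  shows "chard \<beta> * gser \<beta> x y = qser x y"
proof -
  define e where "e y = chard \<beta> * gser \<beta> x y - qser x y" for y
  have eq: "e y = - fint (\<lambda>t. fps_const (min t y - t * y) * (pfps \<beta> t * e t))" if y: "y \<in> {0<..<1}" for y
  proof -
    have k: "bfun (\<lambda>t. min t y - t * y)" by (intro bfun2_section[OF bfun2_swap[OF bfun2_green]] y)
    have G: "ffun (\<lambda>t. fps_const (min t y - t * y) * (pfps \<beta> t * gser \<beta> x t))"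
      by (intro ffun_mult ffun_fps_const k ffun_pfps b ffun2_section[OF ffun2_gser] x)
    have Q: "ffun (\<lambda>t. fps_const (min t y - t * y) * (pfps \<beta> t * qser t x))"
      by (rule ffun_mult[OF ffun_fps_const[OF k] ffun_qser])
    have "fint (\<lambda>t. fps_const (min t y - t * y) * (pfps \<beta> t * e t)) =
        fint (\<lambda>t. chard \<beta> * (fps_const (min t y - t * y) * (pfps \<beta> t * gser \<beta> x t)) - fps_const (min t y - t * y) * (pfps \<beta> t * qser t x))"
      unfolding e_def by (intro fint_cong) (simp add: algebra_simps qser_commute[of x])
    also have "\<dots> = chard \<beta> * fint (\<lambda>t. fps_const (min t y - t * y) * (pfps \<beta> t * gser \<beta> x t))
        - fint (\<lambda>t. fps_const (min t y - t * y) * (pfps \<beta> t * qser t x))"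
      unfolding fint_diff[OF ffun_mult[OF ffun_const G] Q] fint_mult_left[OF G] ..
    also have "fint (\<lambda>t. fps_const (min t y - t * y) * (pfps \<beta> t * qser t x)) = chard \<beta> * fps_const (min x y - x * y) - qser x y"
      using green_qser[OF y x] by (simp add: min.commute mult.commute qser_commute[of x])
    also have "fint (\<lambda>t. fps_const (min t y - t * y) * (pfps \<beta> t * gser \<beta> x t)) = fps_const (min x y - x * y) - gser \<beta> x y"
      by (subst (2) gser_eq) simp
    finally show ?thesis by (simp add: e_def algebra_simps)
  qed
  have "\<forall>y\<in>{0<..<1}. e y $ n = 0" for n
  proof (induction n rule: less_induct)
    case (less n)
    show ?case
    proof
      fix y :: real assume y: "y \<in> {0<..<1}"
      have "(pfps \<beta> t * e t) $ n = 0" if "t \<in> {0<..<1}" for t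
      proof (cases n)
        case 0 then show ?thesis by (simp add: pfps_mult_nth del: fps_mult_nth_0)
      next
        case (Suc m)
        then show ?thesis using less that by (cases m) (simp_all add: pfps_mult_nth del: fps_mult_nth_1 fps_mult_nth_1')
      qed
      then have "(LINT t|unit_lebesgue. (min t y - t * y) * (pfps \<beta> t * e t) $ n) = (LINT t|unit_lebesgue. 0)"
        by (intro Bochner_Integration.integral_cong) auto
      then show "e y $ n = 0" by (subst eq[OF y]) (simp add: fint_def)
    qed
  qed
  then have "e y = 0" using y by (intro fps_ext) auto
  then show ?thesis by (simp add: e_def)
qed

text \<open>The formal kernel of R(\<zeta>); its coefficients turn out to be the kernels of the
  operators \<open>R_op\<close>.\<close>

definition rser :: "real \<Rightarrow> real \<Rightarrow> real fps" where
  "rser x y = - (pder x * gser \<beta> x y)"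

definition tser :: "real fps" where
  "tser = fint (\<lambda>x. rser x x)"

lemma ffun2_rser: "ffun2 rser"
proof -
  have "ffun2 (\<lambda>x y. -1 * (pder x * gser \<beta> x y))"
    by (intro ffun2_mult ffun2_fst ffun_const ffun_pder ffun2_gser)
  then show ?thesis by (simp add: rser_def[abs_def])
qed

text \<open>On the diagonal, \<open>chard\<close> times the Green function is \<open>yl\<close>
  times \<open>yr\<close>, so that the trace integral becomes the one in
  \<open>fps_deriv_chard\<close>.\<close>

theorem chard_mult_tser: "chard \<beta> * tser = - fps_deriv (chard \<beta>)"
proof -
  have "chard \<beta> * tser = fint (\<lambda>x. chard \<beta> * rser x x)"
    unfolding tser_def by (rule fint_mult_left[symmetric, OF ffun2_diag[OF ffun2_rser]])
  also have "\<dots> = fint (\<lambda>x. - (pder x * yl \<beta> x * yr \<beta> x))"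
  proof (rule fint_cong)
    fix x :: real assume x: "x \<in> {0<..<1}"
    have "chard \<beta> * rser x x = - (pder x * (chard \<beta> * gser \<beta> x x))" by (simp add: rser_def algebra_simps)
    then show "chard \<beta> * rser x x = - (pder x * yl \<beta> x * yr \<beta> x)"
      unfolding chard_gser[OF x x] by (simp add: qser_def algebra_simps)
  qed
  finally show ?thesis unfolding fint_uminus fps_deriv_chard .
qed

text \<open>In operator terms R = - p G - R P G with p = \<beta> + 2 \<zeta>. The equation is taken
  in the second variable because the recursion for \<open>R_op\<close> puts new factors on the
  right; its coefficients are that recursion.\<close>

lemma rser_eq:
  assumes x: "x \<in> {0<..<1}" and y: "y \<in> {0<..<1}"
  shows "rser x y = - (pder x * fps_const (min x y - x * y)) - fint (\<lambda>t. fps_const (min t y - t * y) * (pfps \<beta> t * rser x t))"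
proof -
  have k: "bfun (\<lambda>t. min t y - t * y)" by (intro bfun2_section[OF bfun2_swap[OF bfun2_green]] y)
  have G: "ffun (\<lambda>t. fps_const (min t y - t * y) * (pfps \<beta> t * gser \<beta> x t))"
    by (intro ffun_mult ffun_fps_const k ffun_pfps b ffun2_section[OF ffun2_gser] x)
  have "rser x y = - (pder x * fps_const (min x y - x * y)) + pder x * fint (\<lambda>t. fps_const (min t y - t * y) * (pfps \<beta> t * gser \<beta> x t))"
    unfolding rser_def by (subst gser_eq) (simp add: algebra_simps)
  also have "pder x * fint (\<lambda>t. fps_const (min t y - t * y) * (pfps \<beta> t * gser \<beta> x t)) =
      fint (\<lambda>t. - (fps_const (min t y - t * y) * (pfps \<beta> t * rser x t)))"
    unfolding fint_mult_left[symmetric, OF G] by (intro fint_cong) (simp add: rser_def algebra_simps)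
  finally show ?thesis by (simp add: fint_uminus)
qed

end

section \<open>Traces of the operators \<open>R\<^sub>n\<close>\<close>

lemma sums_integral_bounded:
  fixes w :: "nat \<Rightarrow> real \<Rightarrow> complex" and h :: "real \<Rightarrow> complex"
  assumes h: "h \<in> L2 unit_lebesgue"
    and w: "\<And>k. w k \<in> borel_measurable unit_lebesgue"
    and b: "\<And>k t. t \<in> {0<..<1} \<Longrightarrow> norm (w k t) \<le> b k" and s: "summable b"
    and W: "\<And>t. t \<in> {0<..<1} \<Longrightarrow> (\<lambda>k. w k t) sums W t"
  shows "(\<lambda>k. LINT t|unit_lebesgue. w k t * h t) sums (LINT t|unit_lebesgue. W t * h t)"
proof -
  have i: "integrable unit_lebesgue (\<lambda>t. w k t * h t)" for k
    by (rule bounded_mult_integrable[where B = "b k", OF _ _ h]) (use w b in auto)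
  have ih: "integrable unit_lebesgue (\<lambda>t. norm (h t))" by (rule integrable_norm[OF L2_integrable[OF h]])
  have ae: "AE t in unit_lebesgue. summable (\<lambda>k. norm (w k t * h t))"
  proof (rule AE_I2)
    fix t assume "t \<in> space unit_lebesgue"
    then have "t \<in> {0<..<1}" by simp
    then have "summable (\<lambda>k. norm (w k t))" by (intro summable_comparison_test'[OF s, of 0]) (simp add: b)
    then show "summable (\<lambda>k. norm (w k t * h t))"
      by (simp add: norm_mult summable_mult2)
  qed
  have sn: "summable (\<lambda>k. LINT t|unit_lebesgue. norm (w k t * h t))"
  proof (rule summable_comparison_test'[OF summable_mult2[OF s, of "LINT t|unit_lebesgue. norm (h t)"], of 0])
    fix k
    have "(LINT t|unit_lebesgue. norm (w k t * h t)) \<le> (LINT t|unit_lebesgue. b k * norm (h t))"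
    proof (rule integral_mono)
      show "integrable unit_lebesgue (\<lambda>t. norm (w k t * h t))" by (rule integrable_norm[OF i])
      show "integrable unit_lebesgue (\<lambda>t. b k * norm (h t))" using ih by simp
      show "norm (w k t * h t) \<le> b k * norm (h t)" if "t \<in> space unit_lebesgue" for t
        unfolding norm_mult using that by (intro mult_right_mono b) auto
    qed
    then show "norm (LINT t|unit_lebesgue. norm (w k t * h t)) \<le> b k * (LINT t|unit_lebesgue. norm (h t))"
      by simp
  qed
  have "(\<lambda>k. LINT t|unit_lebesgue. w k t * h t) sums (LINT t|unit_lebesgue. (\<Sum>k. w k t * h t))"
    by (rule sums_integral[OF i ae sn])
  also have "(LINT t|unit_lebesgue. (\<Sum>k. w k t * h t)) = (LINT t|unit_lebesgue. W t * h t)"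
  proof (rule Bochner_Integration.integral_cong)
    fix t assume "t \<in> space unit_lebesgue"
    then have "(\<lambda>k. w k t) sums W t" using W by simp
    then show "(\<Sum>k. w k t * h t) = W t * h t"
      by (intro sums_unique[symmetric] sums_mult2)
  qed simp
  finally show ?thesis .
qed

lemma bfun_L2: "bfun f \<Longrightarrow> (\<lambda>x. complex_of_real (f x)) \<in> L2 unit_lebesgue"
proof -
  assume f: "bfun f"
  obtain C where "\<And>x. x \<in> {0<..<1} \<Longrightarrow> \<bar>f x\<bar> \<le> C" using bfunE[OF f] by blast
  then show ?thesis using bfun_measurable[OF f] by (intro bounded_L2[where B = C]) auto
qed

lemma sums_integral_bounded_real:
  fixes w :: "nat \<Rightarrow> real \<Rightarrow> real"
  assumes h: "bfun h"
    and w: "\<And>k. w k \<in> borel_measurable unit_lebesgue"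
    and b: "\<And>k t. t \<in> {0<..<1} \<Longrightarrow> \<bar>w k t\<bar> \<le> b k" and s: "summable b"
    and W: "\<And>t. t \<in> {0<..<1} \<Longrightarrow> (\<lambda>k. w k t) sums W t"
  shows "(\<lambda>k. LINT t|unit_lebesgue. w k t * h t) sums (LINT t|unit_lebesgue. W t * h t)"
  using sums_integral_bounded[OF bfun_L2[OF h], of "\<lambda>k t. of_real (w k t)" b "\<lambda>t. of_real (W t)"] w b s W
  by (simp add: sums_of_real_iff flip: of_real_mult)

definition kint :: "(real \<Rightarrow> real \<Rightarrow> real) \<Rightarrow> (real \<Rightarrow> complex) \<Rightarrow> real \<Rightarrow> complex" where
  "kint k f x = (LINT t|unit_lebesgue. of_real (k x t) * f t)"

lemma green_eq_kint: "green = kint (\<lambda>x t. min x t - x * t)"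
  by (auto simp: green_def kint_def fun_eq_iff)

lemma kint_cong_AE:
  assumes "f \<in> borel_measurable unit_lebesgue" "g \<in> borel_measurable unit_lebesgue"
    and "AE t in unit_lebesgue. f t = g t" and k: "bfun2 k" "x \<in> {0<..<1}"
  shows "kint k f x = kint k g x"
proof -
  have "k x \<in> borel_measurable unit_lebesgue" using bfun2_section[OF k] by (rule bfun_measurable)
  then show ?thesis unfolding kint_def using assms(1,2,3) by (intro integral_cong_AE) auto
qed

lemma kint_mult_integrable:
  assumes k: "bfun2 k" and f: "f \<in> L2 unit_lebesgue" and x: "x \<in> {0<..<1}"
  shows "integrable unit_lebesgue (\<lambda>t. of_real (k x t) * f t)"
proof -
  have kx: "bfun (k x)" by (rule bfun2_section[OF k x])
  then obtain C where "\<And>t. t \<in> {0<..<1} \<Longrightarrow> \<bar>k x t\<bar> \<le> C" using bfunE by blast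
  then show ?thesis
    using bfun_measurable[OF kx] by (intro bounded_mult_integrable[where B = C, OF _ _ f]) auto
qed

lemma kernel_integrable_UU:
  assumes k: "bfun2 k" and f: "f \<in> L2 unit_lebesgue"
  shows "integrable UU (\<lambda>p. of_real (k (fst p) (snd p)) * f (snd p))"
proof -
  obtain C where C: "\<And>x t. x \<in> {0<..<1} \<Longrightarrow> t \<in> {0<..<1} \<Longrightarrow> \<bar>k x t\<bar> \<le> C" using bfun2E[OF k] by blast
  have C0: "C \<ge> 0" using C[of "1/2" "1/2"] by (auto intro: order_trans[OF abs_ge_zero])
  have km: "(\<lambda>p. k (fst p) (snd p)) \<in> borel_measurable UU" using k by (simp add: bfun2_def)
  have fm: "(\<lambda>p. f (snd p)) \<in> borel_measurable UU"
    by (rule measurable_compose[OF measurable_snd L2_measurable[OF f]])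
  have fi: "integrable UU (\<lambda>p. f (snd p))"
  proof (rule pair_sigma_finite.Fubini_integrable[OF pair_sigma_finite_unit_lebesgue fm])
    show "integrable unit_lebesgue (\<lambda>x. LINT y|unit_lebesgue. norm (f (snd (x, y))))"
      by (rule bounded_integrable_unit_lebesgue[where B = "\<bar>LINT y|unit_lebesgue. norm (f y)\<bar>"]) auto
    show "AE x in unit_lebesgue. integrable unit_lebesgue (\<lambda>y. f (snd (x, y)))"
      using L2_integrable[OF f] by simp
  qed
  show ?thesis
  proof (rule Bochner_Integration.integrable_bound[OF integrable_mult_right[OF integrable_norm[OF fi], of C]])
    show "(\<lambda>p. complex_of_real (k (fst p) (snd p)) * f (snd p)) \<in> borel_measurable UU"
      using km fm by measurable
    show "AE p in UU. norm (complex_of_real (k (fst p) (snd p)) * f (snd p)) \<le> norm (C * norm (f (snd p)))"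
      using C C0 by (intro AE_I2) (auto simp: space_UU norm_mult intro!: mult_right_mono)
  qed
qed

lemma kint_kint:
  assumes k: "bfun2 k" and h: "bfun2 h" and f: "f \<in> L2 unit_lebesgue" and x: "x \<in> {0<..<1}"
  shows "kint k (kint h f) x = kint (\<lambda>x y. LINT t|unit_lebesgue. k x t * h t y) f x"
proof -
  have kh: "bfun2 (\<lambda>t y. k x t * h t y)" by (intro bfun2_mult bfun2_fst bfun2_section[OF k x] h)
  have "kint k (kint h f) x = (LINT t|unit_lebesgue. LINT y|unit_lebesgue. of_real (k x t * h t y) * f y)"
    unfolding kint_def by (simp add: mult.assoc)
  also have "\<dots> = (LINT y|unit_lebesgue. LINT t|unit_lebesgue. of_real (k x t * h t y) * f y)"
    using kernel_integrable_UU[OF kh f]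
    by (intro pair_sigma_finite.Fubini_integral[OF pair_sigma_finite_unit_lebesgue, symmetric]) (simp add: case_prod_unfold)
  also have "\<dots> = kint (\<lambda>x y. LINT t|unit_lebesgue. k x t * h t y) f x"
    unfolding kint_def
  proof (rule Bochner_Integration.integral_cong)
    fix y
    show "(LINT t|unit_lebesgue. of_real (k x t * h t y) * f y) = of_real (LINT t|unit_lebesgue. k x t * h t y) * f y"
      unfolding integral_mult_left_zero integral_complex_of_real ..
  qed simp
  finally show ?thesis .
qed

lemma kint_add:
  assumes "bfun2 k" "bfun2 h" "f \<in> L2 unit_lebesgue" "x \<in> {0<..<1}"
  shows "kint (\<lambda>x t. k x t + h x t) f x = kint k f x + kint h f x"
  unfolding kint_def using kint_mult_integrable[OF assms(1,3,4)] kint_mult_integrable[OF assms(2,3,4)]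
  by (simp add: distrib_right)

lemma kint_uminus: "kint (\<lambda>x t. - k x t) f x = - kint k f x"
  by (simp add: kint_def)

lemma kint_mult_right: "kint k (\<lambda>t. of_real (\<beta> t) * f t) x = kint (\<lambda>x t. k x t * \<beta> t) f x"
  by (simp add: kint_def mult.assoc)

lemma kint_cmult_left: "kint (\<lambda>x t. c x * k x t) f x = of_real (c x) * kint k f x"
  by (simp add: kint_def mult.assoc)

text \<open>The Mercer-type expansion of the Green kernel makes every operator that factors through it nuclear.\<close>

lemma kernel_operator_has_trace:
  assumes c: "bfun c" and s: "bfun2 s"
    and r: "\<And>x y. x \<in> {0<..<1} \<Longrightarrow> y \<in> {0<..<1} \<Longrightarrow>
      r x y = c x * (min x y - x * y) + (LINT t|unit_lebesgue. s x t * (min t y - t * y))"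
    and Tm: "\<And>f. f \<in> L2 unit_lebesgue \<Longrightarrow> T f \<in> borel_measurable unit_lebesgue"
    and T: "\<And>f. f \<in> L2 unit_lebesgue \<Longrightarrow> AE x in unit_lebesgue. T f x = kint r f x"
  shows "has_trace unit_lebesgue T (of_real (LINT x|unit_lebesgue. r x x))"
proof -
  obtain C1 where C1: "\<And>x. x \<in> {0<..<1} \<Longrightarrow> \<bar>c x\<bar> \<le> C1" using bfunE[OF c] by blast
  obtain C2 where C2: "\<And>x t. x \<in> {0<..<1} \<Longrightarrow> t \<in> {0<..<1} \<Longrightarrow> \<bar>s x t\<bar> \<le> C2" using bfun2E[OF s] by blast
  have C0: "C1 \<ge> 0" "C2 \<ge> 0" using C1[of "1/2"] C2[of "1/2" "1/2"] by (auto intro: order_trans[OF abs_ge_zero])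
  define m where "m k = inverse (mu (Suc k))" for k
  have m: "m k > 0" for k using mu_pos[of "Suc k"] by (simp add: m_def)
  have ms: "summable m" unfolding m_def by (rule summable_inverse_mu)
  define p where "p k = phi (Suc k)" for k
  have pb: "bfun (p k)" for k
    unfolding p_def by (rule bfunI[where C = "sqrt 2"]) (auto simp: abs_phi_le)
  have ple: "\<bar>p k x\<bar> \<le> sqrt 2" for k x by (simp add: p_def abs_phi_le)
  have exp: "(\<lambda>k. m k * p k x * p k y) sums (min x y - x * y)" if "x \<in> {0<..<1}" "y \<in> {0<..<1}" for x y
    unfolding m_def p_def by (rule green_kernel_expansion) (use that in auto)
  \<comment> \<open>The operator without its factor G, applied to the k-th eigenfunction and divided
    by the eigenvalue. Inserting the expansion of the Green kernel writes \<open>T\<close> as the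
    sum of the rank one operators built from \<open>sine_basis k\<close> and
    \<open>v k\<close>.\<close>
  define v where "v k x = m k * (c x * p k x + (LINT t|unit_lebesgue. s x t * p k t))" for k x
  have vb: "bfun (v k)" for k
    unfolding v_def by (intro bfun_mult bfun_const bfun_add c pb bfun_integral bfun2_mult s bfun2_snd)
  define C where "C = (C1 + C2) * sqrt 2"
  have C: "C \<ge> 0" using C0 by (simp add: C_def)
  have vle: "\<bar>v k x\<bar> \<le> m k * C" if x: "x \<in> {0<..<1}" for k x
  proof -
    have "\<bar>LINT t|unit_lebesgue. s x t * p k t\<bar> \<le> (LINT t|unit_lebesgue. \<bar>s x t * p k t\<bar>)" by (rule integral_abs_bound)
    also have "\<dots> \<le> (LINT t|unit_lebesgue. C2 * sqrt 2)"
    proof (rule integral_mono)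
      show "integrable unit_lebesgue (\<lambda>t. \<bar>s x t * p k t\<bar>)"
        by (rule integrable_abs[OF bfun_integrable[OF bfun_mult[OF bfun2_section[OF s x] pb]]])
      show "\<bar>s x t * p k t\<bar> \<le> C2 * sqrt 2" if "t \<in> space unit_lebesgue" for t
        unfolding abs_mult using C2[OF x] C0 ple that by (intro mult_mono) auto
    qed (rule bfun_integrable[OF bfun_const])
    finally have "\<bar>LINT t|unit_lebesgue. s x t * p k t\<bar> \<le> C2 * sqrt 2" by (simp add: measure_space_unit_lebesgue)
    moreover have "\<bar>c x * p k x\<bar> \<le> C1 * sqrt 2" unfolding abs_mult using C1[OF x] ple C0 by (intro mult_mono) auto
    ultimately have "\<bar>c x * p k x + (LINT t|unit_lebesgue. s x t * p k t)\<bar> \<le> C"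
      unfolding C_def distrib_right by linarith
    then show ?thesis unfolding v_def abs_mult using m[of k] by (intro mult_mono) auto
  qed
  have rexp: "(\<lambda>k. v k x * p k y) sums r x y" if x: "x \<in> {0<..<1}" and y: "y \<in> {0<..<1}" for x y
  proof -
    have "(\<lambda>k. LINT t|unit_lebesgue. (m k * p k t * p k y) * s x t) sums (LINT t|unit_lebesgue. (min t y - t * y) * s x t)"
    proof (rule sums_integral_bounded_real[OF bfun2_section[OF s x]])
      show "(\<lambda>t. m k * p k t * p k y) \<in> borel_measurable unit_lebesgue" for k
        using bfun_measurable[OF pb] by measurable
      show "\<bar>m k * p k t * p k y\<bar> \<le> m k * (sqrt 2 * sqrt 2)" for k t
        unfolding abs_mult mult.assoc using m[of k] ple by (intro mult_mono) auto
      show "summable (\<lambda>k. m k * (sqrt 2 * sqrt 2))" by (intro summable_mult2 ms)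
    qed (use exp y in auto)
    moreover have "(LINT t|unit_lebesgue. (m k * p k t * p k y) * s x t) = m k * (LINT t|unit_lebesgue. s x t * p k t) * p k y" for k
    proof -
      have "(LINT t|unit_lebesgue. (m k * p k t * p k y) * s x t) = (LINT t|unit_lebesgue. m k * p k y * (s x t * p k t))"
        by (simp add: mult_ac)
      then show ?thesis by simp
    qed
    ultimately have "(\<lambda>k. m k * (LINT t|unit_lebesgue. s x t * p k t) * p k y) sums (LINT t|unit_lebesgue. s x t * (min t y - t * y))"
      by (simp add: mult.commute)
    from sums_add[OF sums_mult[OF exp[OF x y], of "c x"] this] show ?thesis
      unfolding r[OF x y] v_def by (simp add: algebra_simps)
  qed
  have vp: "\<bar>v k x * p k y\<bar> \<le> m k * C * sqrt 2" if x: "x \<in> {0<..<1}" for k x y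
    unfolding abs_mult using vle[OF x] ple C m[of k] by (intro mult_mono) auto
  have sC: "summable (\<lambda>k. m k * C * sqrt 2)" by (intro summable_mult2 ms)
  have u2: "sine_basis k = (\<lambda>x. of_real (p k x))" for k by (auto simp: sine_basis_def p_def)
  have "has_trace unit_lebesgue T (\<Sum>k. l2_inner unit_lebesgue (\<lambda>x. of_real (v k x)) (sine_basis k))"
  proof (rule nuclear_has_trace[OF sine_basis_L2 bfun_L2[OF vb] _ Tm])
    show "summable (\<lambda>k. l2_norm unit_lebesgue (sine_basis k) * l2_norm unit_lebesgue (\<lambda>x. of_real (v k x)))"
    proof (rule summable_comparison_test'[OF summable_mult2[OF ms, of C], of 0])
      fix k
      have "l2_norm unit_lebesgue (sine_basis k) = 1"
        using orthonormal_sine_basis l2_inner_self[of unit_lebesgue "sine_basis k"]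
        by (simp add: orthonormal_def abs_square_eq_1 flip: of_real_power)
      moreover have "l2_norm unit_lebesgue (\<lambda>x. of_real (v k x)) \<le> m k * C"
      proof -
        have "(LINT x|unit_lebesgue. (norm (complex_of_real (v k x)))\<^sup>2) \<le> (LINT x|unit_lebesgue. (m k * C)\<^sup>2)"
        proof (rule integral_mono)
          show "integrable unit_lebesgue (\<lambda>x. (norm (complex_of_real (v k x)))\<^sup>2)" by (rule L2_sq_integrable[OF bfun_L2[OF vb]])
          show "integrable unit_lebesgue (\<lambda>x. (m k * C)\<^sup>2)" by (rule bfun_integrable[OF bfun_const])
          show "(norm (complex_of_real (v k x)))\<^sup>2 \<le> (m k * C)\<^sup>2" if "x \<in> space unit_lebesgue" for x
            using vle[of x k] that unfolding norm_of_real by (intro power_mono) auto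
        qed
        then show ?thesis unfolding l2_norm_def using C m[of k]
          by (intro real_le_lsqrt) (auto simp: measure_space_unit_lebesgue)
      qed
      ultimately show "norm (l2_norm unit_lebesgue (sine_basis k) * l2_norm unit_lebesgue (\<lambda>x. of_real (v k x))) \<le> m k * C"
        by simp
    qed
    fix f assume f: "f \<in> L2 unit_lebesgue"
    have "AE x in unit_lebesgue. x \<in> {0<..<1}" by (rule AE_I2) simp
    then show "AE x in unit_lebesgue. T f x = (\<Sum>k. l2_inner unit_lebesgue f (sine_basis k) * of_real (v k x))"
      using T[OF f]
    proof eventually_elim
      case (elim x)
      have "(\<lambda>k. LINT t|unit_lebesgue. of_real (v k x * p k t) * f t) sums (LINT t|unit_lebesgue. of_real (r x t) * f t)"
      proof (rule sums_integral_bounded[OF f _ _ sC])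
        show "(\<lambda>t. complex_of_real (v k x * p k t)) \<in> borel_measurable unit_lebesgue" for k
          using bfun_measurable[OF pb] by measurable
        show "norm (complex_of_real (v k x * p k t)) \<le> m k * C * sqrt 2" for k t
          unfolding norm_of_real by (rule vp[OF elim(1)])
        show "(\<lambda>k. complex_of_real (v k x * p k t)) sums of_real (r x t)" if "t \<in> {0<..<1}" for t
          unfolding sums_of_real_iff by (rule rexp[OF elim(1) that])
      qed
      moreover have "(LINT t|unit_lebesgue. of_real (v k x * p k t) * f t) = l2_inner unit_lebesgue f (sine_basis k) * of_real (v k x)" for k
      proof -
        have "(LINT t|unit_lebesgue. of_real (v k x * p k t) * f t) = (LINT t|unit_lebesgue. f t * cnj (sine_basis k t) * of_real (v k x))"
          by (simp add: u2 mult_ac)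
        then show ?thesis by (simp add: l2_inner_def)
      qed
      ultimately have "(\<lambda>k. l2_inner unit_lebesgue f (sine_basis k) * of_real (v k x)) sums kint r f x"
        by (simp add: kint_def)
      then show ?case using elim(2) by (simp add: sums_iff)
    qed
  qed
  \<comment> \<open>The expansion \<open>rexp\<close> holds at every point and may therefore be put
    on the diagonal.\<close>
  moreover have "(\<lambda>k. l2_inner unit_lebesgue (\<lambda>x. of_real (v k x)) (sine_basis k)) sums of_real (LINT x|unit_lebesgue. r x x)"
  proof -
    have "(\<lambda>k. LINT x|unit_lebesgue. (v k x * p k x) * 1) sums (LINT x|unit_lebesgue. r x x * 1)"
      by (rule sums_integral_bounded_real[OF bfun_const _ vp sC rexp]) (use bfun_measurable[OF pb] bfun_measurable[OF vb] in measurable)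
    moreover have "l2_inner unit_lebesgue (\<lambda>x. of_real (v k x)) (sine_basis k) = of_real (LINT x|unit_lebesgue. v k x * p k x)" for k
      unfolding l2_inner_def u2 by (simp flip: of_real_mult)
    ultimately show ?thesis by (simp add: sums_of_real_iff)
  qed
  ultimately show ?thesis by (simp add: sums_iff)
qed

lemma pder_nth: "bfun \<beta> \<Longrightarrow> pder \<beta> x $ 0 = \<beta> x" "bfun \<beta> \<Longrightarrow> pder \<beta> x $ Suc 0 = 2"
  "bfun \<beta> \<Longrightarrow> pder \<beta> x $ Suc (Suc n) = 0"
  by (simp_all add: pder_def numeral_fps_const)

definition rk :: "(real \<Rightarrow> real) \<Rightarrow> nat \<Rightarrow> real \<Rightarrow> real \<Rightarrow> real" where
  "rk \<beta> n x y = rser \<beta> x y $ n"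

text \<open>
  The operator \<open>R\<^sub>n\<close> is \<open>(rc n + rs n) (T\<^sup>*T)\<^sup>-\<^sup>1\<close> with the multiplication operator \<open>rc n\<close> and the
  integral operator with kernel \<open>rs n\<close>.
\<close>

fun rc :: "(real \<Rightarrow> real) \<Rightarrow> nat \<Rightarrow> real \<Rightarrow> real" where
  "rc \<beta> 0 x = - \<beta> x"
| "rc \<beta> (Suc 0) x = -2"
| "rc \<beta> (Suc (Suc n)) x = 0"

fun rs :: "(real \<Rightarrow> real) \<Rightarrow> nat \<Rightarrow> real \<Rightarrow> real \<Rightarrow> real" where
  "rs \<beta> 0 x t = 0"
| "rs \<beta> (Suc 0) x t = - (rk \<beta> 0 x t * \<beta> t)"
| "rs \<beta> (Suc (Suc n)) x t = - (rk \<beta> (Suc n) x t * \<beta> t + rk \<beta> n x t)"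

context
  fixes \<beta> :: "real \<Rightarrow> real"
  assumes b: "bfun \<beta>"
begin

lemma bfun2_rk: "bfun2 (rk \<beta> n)"
  using ffun2_rser[OF b] by (simp add: ffun2_def rk_def[abs_def])

lemma bfun_rc: "bfun (rc \<beta> n)"
proof -
  consider "n = 0" | "n = Suc 0" | m where "n = Suc (Suc m)" by (metis not0_implies_Suc)
  then show ?thesis
    by cases (simp_all add: rc.simps[abs_def] bfun_uminus[OF b])
qed

lemma bfun2_rs: "bfun2 (rs \<beta> n)"
proof -
  consider "n = 0" | "n = Suc 0" | m where "n = Suc (Suc m)" by (metis not0_implies_Suc)
  then show ?thesis
  proof cases
    case 1 then show ?thesis by (simp add: rs.simps[abs_def] bfun2_fst)
  next
    case 2 then show ?thesis
      by (simp add: rs.simps[abs_def] bfun2_uminus[OF bfun2_mult[OF bfun2_rk bfun2_snd[OF b]]])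
  next
    case 3 then show ?thesis
      by (simp only: rs.simps[abs_def] bfun2_uminus[OF bfun2_add[OF bfun2_mult[OF bfun2_rk bfun2_snd[OF b]] bfun2_rk]])
  qed
qed

lemma rk_eq:
  assumes x: "x \<in> {0<..<1}" and y: "y \<in> {0<..<1}"
  shows "rk \<beta> n x y = rc \<beta> n x * (min x y - x * y) + (LINT t|unit_lebesgue. rs \<beta> n x t * (min t y - t * y))"
proof -
  have eq: "rk \<beta> n x y = - (pder \<beta> x $ n) * (min x y - x * y)
      - (LINT t|unit_lebesgue. (min t y - t * y) * (pfps \<beta> t * rser \<beta> x t) $ n)"
    unfolding rk_def by (subst rser_eq[OF b x y]) (simp add: fint_def)
  consider "n = 0" | "n = Suc 0" | m where "n = Suc (Suc m)" by (metis not0_implies_Suc)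
  then have "rc \<beta> n x = - (pder \<beta> x $ n) \<and> rs \<beta> n x t = - ((pfps \<beta> t * rser \<beta> x t) $ n)" for t
    by cases (simp_all add: pder_nth[OF b] pfps_mult_nth rk_def mult.commute
        del: fps_mult_nth_0 fps_mult_nth_1 fps_mult_nth_1')
  then show ?thesis unfolding eq by (simp add: mult.commute)
qed

lemma has_trace_rk:
  assumes "\<And>f. f \<in> L2 unit_lebesgue \<Longrightarrow> T f \<in> borel_measurable unit_lebesgue"
    and "\<And>f. f \<in> L2 unit_lebesgue \<Longrightarrow> AE x in unit_lebesgue. T f x = kint (rk \<beta> n) f x"
  shows "has_trace unit_lebesgue T (of_real (tser \<beta> $ n))"
proof -
  have "has_trace unit_lebesgue T (of_real (LINT x|unit_lebesgue. rk \<beta> n x x))"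
    by (rule kernel_operator_has_trace[OF bfun_rc bfun2_rs rk_eq]) (use assms in auto)
  then show ?thesis by (simp add: tser_def[OF b] fint_def rk_def)
qed

lemma kint_rk:
  assumes f: "f \<in> L2 unit_lebesgue" and x: "x \<in> {0<..<1}"
  shows "kint (rk \<beta> n) f x = of_real (rc \<beta> n x) * green f x + kint (rs \<beta> n) (green f) x"
proof -
  have c: "bfun2 (\<lambda>x y. rc \<beta> n x * (min x y - x * y))" by (intro bfun2_mult bfun2_fst bfun_rc bfun2_green)
  have s: "bfun2 (\<lambda>x y. LINT t|unit_lebesgue. rs \<beta> n x t * (min t y - t * y))"
    using bfun2_integral3[OF bfun2_swap[OF bfun2_green] bfun2_rs] by (simp add: mult.commute)
  have "kint (rk \<beta> n) f x = kint (\<lambda>x y. rc \<beta> n x * (min x y - x * y) + (LINT t|unit_lebesgue. rs \<beta> n x t * (min t y - t * y))) f x"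
    unfolding kint_def using x by (intro Bochner_Integration.integral_cong) (auto simp: rk_eq)
  also have "\<dots> = of_real (rc \<beta> n x) * green f x + kint (rs \<beta> n) (green f) x"
    unfolding kint_add[OF c s f x] kint_cmult_left green_eq_kint kint_kint[OF bfun2_rs bfun2_green f x] ..
  finally show ?thesis .
qed

context
  fixes \<alpha> :: "real \<Rightarrow> real"
  assumes am: "\<alpha> \<in> borel_measurable unit_lebesgue" and ab: "AE x in unit_lebesgue. \<alpha> x = \<beta> x"
begin

lemma L2_beta_mult: "f \<in> L2 unit_lebesgue \<Longrightarrow> (\<lambda>x. of_real (\<beta> x) * f x) \<in> L2 unit_lebesgue"
proof -
  assume f: "f \<in> L2 unit_lebesgue"
  obtain C where "\<And>x. x \<in> {0<..<1} \<Longrightarrow> \<bar>\<beta> x\<bar> \<le> C" using bfunE[OF b] by blast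
  then show ?thesis using bfun_measurable[OF b] by (intro L2_bounded_mult[where B = C, OF _ _ f]) auto
qed

lemma L2_alpha_mult:
  assumes f: "f \<in> L2 unit_lebesgue"
  shows "(\<lambda>x. of_real (\<alpha> x) * f x) \<in> L2 unit_lebesgue"
proof (rule L2_AE_cong[OF L2_beta_mult[OF f]])
  show "(\<lambda>x. of_real (\<alpha> x) * f x) \<in> borel_measurable unit_lebesgue"
    using am L2_measurable[OF f] by measurable
  show "AE x in unit_lebesgue. of_real (\<beta> x) * f x = of_real (\<alpha> x) * f x"
    using ab by eventually_elim simp
qed

lemma kint_alpha_inv:
  assumes k: "bfun2 k" and f: "f \<in> L2 unit_lebesgue" and x: "x \<in> {0<..<1}"
  shows "kint k (\<lambda>y. of_real (\<alpha> y) * neg_laplacian_inv f y) x = kint (\<lambda>x t. k x t * \<beta> t) (green f) x"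
proof -
  have "kint k (\<lambda>y. of_real (\<alpha> y) * neg_laplacian_inv f y) x = kint k (\<lambda>y. of_real (\<beta> y) * green f y) x"
  proof (rule kint_cong_AE[OF _ _ _ k x])
    show "(\<lambda>y. of_real (\<alpha> y) * neg_laplacian_inv f y) \<in> borel_measurable unit_lebesgue"
      by (rule L2_measurable[OF L2_alpha_mult[OF neg_laplacian_inv_green(1)[OF f]]])
    show "(\<lambda>y. of_real (\<beta> y) * green f y) \<in> borel_measurable unit_lebesgue"
      by (rule L2_measurable[OF L2_beta_mult[OF L2_green[OF f]]])
    show "AE t in unit_lebesgue. of_real (\<alpha> t) * neg_laplacian_inv f t = of_real (\<beta> t) * green f t"
      using ab neg_laplacian_inv_green(2)[OF f] by eventually_elim simp
  qed
  then show ?thesis by (simp add: kint_mult_right)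
qed

lemma kint_inv:
  assumes k: "bfun2 k" and f: "f \<in> L2 unit_lebesgue" and x: "x \<in> {0<..<1}"
  shows "kint k (neg_laplacian_inv f) x = kint k (green f) x"
  by (rule kint_cong_AE[OF L2_measurable[OF neg_laplacian_inv_green(1)[OF f]] L2_measurable[OF L2_green[OF f]]
      neg_laplacian_inv_green(2)[OF f] k x])

text \<open>Induction for all \<open>f\<close> at once, since the recursion applies earlier
  operators to the inverse Laplacian of \<open>f\<close> and to \<alpha> times it. Replacing
  \<alpha> by \<beta> and \<open>neg_laplacian_inv\<close> by \<open>green\<close> costs null sets,
  which disappear under the kernels of the induction hypothesis.\<close>

lemma R_op_kernel:
  assumes f: "f \<in> L2 unit_lebesgue"
  shows "R_op \<alpha> n f \<in> borel_measurable unit_lebesgue" (is ?m)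
    and "AE x in unit_lebesgue. R_op \<alpha> n f x = kint (rk \<beta> n) f x" (is ?e)
proof -
  have x01: "AE x in unit_lebesgue. x \<in> {0<..<1}" by (rule AE_I2) simp
  have "R_op \<alpha> n f \<in> borel_measurable unit_lebesgue \<and> (AE x in unit_lebesgue. R_op \<alpha> n f x = kint (rk \<beta> n) f x)"
    using f
  proof (induction n arbitrary: f rule: less_induct)
    case (less n)
    note f = \<open>f \<in> L2 unit_lebesgue\<close>
    let ?N = "neg_laplacian_inv f" and ?aN = "\<lambda>y. of_real (\<alpha> y) * neg_laplacian_inv f y"
    have N: "?N \<in> L2 unit_lebesgue" by (rule neg_laplacian_inv_green(1)[OF f])
    have aN: "?aN \<in> L2 unit_lebesgue" by (rule L2_alpha_mult[OF N])
    consider "n = 0" | "n = Suc 0" | m where "n = Suc (Suc m)" by (metis not0_implies_Suc)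
    then show ?case
    proof cases
      case 1
      have "AE x in unit_lebesgue. R_op \<alpha> n f x = kint (rk \<beta> n) f x"
        using x01 ab neg_laplacian_inv_green(2)[OF f]
      proof eventually_elim
        case (elim x)
        have "rs \<beta> 0 = (\<lambda>x t. 0)" by (simp add: fun_eq_iff)
        then show ?case using elim(2,3) kint_rk[OF f elim(1), of 0] by (simp add: 1 kint_def)
      qed
      moreover have "R_op \<alpha> n f \<in> borel_measurable unit_lebesgue"
        using L2_measurable[OF aN] by (simp add: 1)
      ultimately show ?thesis by blast
    next
      case 2
      have "AE x in unit_lebesgue. R_op \<alpha> n f x = kint (rk \<beta> n) f x"
        using x01 ab neg_laplacian_inv_green(2)[OF f] neg_laplacian_inv_green(2)[OF aN]
      proof eventually_elim
        case (elim x)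
        have rb: "bfun2 (\<lambda>x t. rk \<beta> 0 x t * \<beta> t)" by (intro bfun2_mult bfun2_rk bfun2_snd b)
        have "kint (rs \<beta> (Suc 0)) (green f) x = - kint (\<lambda>x t. rk \<beta> 0 x t * \<beta> t) (green f) x"
          by (simp add: rs.simps(2)[abs_def] kint_uminus)
        also have "kint (\<lambda>x t. rk \<beta> 0 x t * \<beta> t) (green f) x = kint (rk \<beta> 0) ?aN x"
          by (rule kint_alpha_inv[OF bfun2_rk f elim(1), symmetric])
        also have "\<dots> = - of_real (\<beta> x) * green ?aN x"
        proof -
          have "rs \<beta> 0 = (\<lambda>x t. 0)" by (simp add: fun_eq_iff)
          then show ?thesis using kint_rk[OF aN elim(1), of 0] by (simp add: kint_def)
        qed
        finally show ?case using elim(2,3,4) kint_rk[OF f elim(1), of "Suc 0"]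
          by (simp add: 2 rs.simps(2)[abs_def])
      qed
      moreover have "R_op \<alpha> n f \<in> borel_measurable unit_lebesgue"
        using L2_measurable[OF N] L2_measurable[OF L2_alpha_mult[OF neg_laplacian_inv_green(1)[OF aN]]]
        by (simp add: 2)
      ultimately show ?thesis by blast
    next
      case (3 m)
      have IH1: "R_op \<alpha> m ?N \<in> borel_measurable unit_lebesgue" "AE x in unit_lebesgue. R_op \<alpha> m ?N x = kint (rk \<beta> m) ?N x"
        using less.IH[of m ?N] N 3 by auto
      have IH2: "R_op \<alpha> (Suc m) ?aN \<in> borel_measurable unit_lebesgue" "AE x in unit_lebesgue. R_op \<alpha> (Suc m) ?aN x = kint (rk \<beta> (Suc m)) ?aN x"
        using less.IH[of "Suc m" ?aN] aN 3 by auto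
      have "AE x in unit_lebesgue. R_op \<alpha> n f x = kint (rk \<beta> n) f x"
        using x01 IH1(2) IH2(2)
      proof eventually_elim
        case (elim x)
        have g: "green f \<in> L2 unit_lebesgue" by (rule L2_green[OF f])
        have "kint (rs \<beta> n) (green f) x = - kint (\<lambda>x t. rk \<beta> (Suc m) x t * \<beta> t + rk \<beta> m x t) (green f) x"
          unfolding 3 rs.simps(3)[abs_def] kint_uminus ..
        also have "kint (\<lambda>x t. rk \<beta> (Suc m) x t * \<beta> t + rk \<beta> m x t) (green f) x =
            kint (\<lambda>x t. rk \<beta> (Suc m) x t * \<beta> t) (green f) x + kint (rk \<beta> m) (green f) x"
          by (rule kint_add[OF bfun2_mult[OF bfun2_rk bfun2_snd[OF b]] bfun2_rk g elim(1)])
        also have "kint (\<lambda>x t. rk \<beta> (Suc m) x t * \<beta> t) (green f) x = kint (rk \<beta> (Suc m)) ?aN x"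
          by (rule kint_alpha_inv[OF bfun2_rk f elim(1), symmetric])
        also have "kint (rk \<beta> m) (green f) x = kint (rk \<beta> m) ?N x"
          by (rule kint_inv[OF bfun2_rk f elim(1), symmetric])
        finally show ?case using elim(2,3) kint_rk[OF f elim(1), of n]
          by (simp add: 3 rs.simps(3)[abs_def])
      qed
      moreover have "R_op \<alpha> n f \<in> borel_measurable unit_lebesgue"
        using IH1(1) IH2(1) by (simp add: 3)
      ultimately show ?thesis by blast
    qed
  qed
  then show ?m ?e by blast+
qed

lemma has_trace_R_op: "has_trace unit_lebesgue (R_op \<alpha> n) (of_real (tser \<beta> $ n))"
  by (rule has_trace_rk) (use R_op_kernel in auto)

end

end

section \<open>Traces of the matrices \<open>M\<^sub>n\<close>\<close>

lemma bfun_phi: "bfun (phi l)"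
  by (rule bfunI[where C = "sqrt 2"]) (auto simp: abs_phi_le)

lemma phi_0 [simp]: "phi 0 = (\<lambda>x. 0)"
  by (simp add: phi_def fun_eq_iff)

lemma Parseval_phi:
  assumes g: "bfun g" and h: "bfun h"
  shows "((\<lambda>k. (LINT x|unit_lebesgue. phi k x * g x) * (LINT x|unit_lebesgue. phi k x * h x)) has_sum
    (LINT x|unit_lebesgue. g x * h x)) {1..}"
proof -
  let ?g = "\<lambda>x. complex_of_real (g x)" and ?h = "\<lambda>x. complex_of_real (h x)"
  let ?t = "\<lambda>k. (LINT x|unit_lebesgue. phi k x * g x) * (LINT x|unit_lebesgue. phi k x * h x)"
  have "((\<lambda>k. l2_inner unit_lebesgue ?g (sine_basis k) * l2_inner unit_lebesgue (sine_basis k) ?h) has_sum l2_inner unit_lebesgue ?g ?h) UNIV"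
    by (rule Parseval[OF orthonormal_basis_sine_basis bfun_L2[OF g] bfun_L2[OF h]])
  moreover have "l2_inner unit_lebesgue ?g ?h = of_real (LINT x|unit_lebesgue. g x * h x)"
    by (simp add: l2_inner_def flip: of_real_mult)
  moreover have "l2_inner unit_lebesgue ?g (sine_basis k) * l2_inner unit_lebesgue (sine_basis k) ?h = of_real (?t (Suc k))" for k
    by (simp add: l2_inner_def sine_basis_def mult.commute flip: of_real_mult)
  ultimately have "((\<lambda>k. complex_of_real (?t (Suc k))) has_sum of_real (LINT x|unit_lebesgue. g x * h x)) UNIV" by simp
  then have "((\<lambda>k. ?t (Suc k)) has_sum (LINT x|unit_lebesgue. g x * h x)) UNIV" by (simp only: has_sum_of_real_iff)
  moreover have "bij_betw Suc UNIV {1..}"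
    by (auto simp: bij_betw_def image_iff Suc_le_eq gr0_conv_Suc)
  ultimately show ?thesis using has_sum_reindex_bij_betw[of Suc UNIV "{1..}" ?t] by blast
qed

section \<open>Square summable sequences with indices from 1\<close>

lemma bij_betw_Suc_atLeast_1: "bij_betw Suc UNIV {1..}"
  by (auto simp: bij_betw_def image_iff Suc_le_eq gr0_conv_Suc)

lemma ell2_integrable_iff:
  fixes f :: "nat \<Rightarrow> 'a::{banach,second_countable_topology}"
  shows "integrable ell2_measure f \<longleftrightarrow> summable (\<lambda>k. norm (f (Suc k)))"
  using integrable_bij_count_space[OF bij_betw_Suc_atLeast_1, of f]
  by (simp add: integrable_count_space_nat_iff)

lemma ell2_integral:
  fixes f :: "nat \<Rightarrow> 'a::{banach,second_countable_topology}"
  assumes "summable (\<lambda>k. norm (f (Suc k)))"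
  shows "(LINT k|ell2_measure. f k) = (\<Sum>k. f (Suc k))"
  using integral_bij_count_space[OF bij_betw_Suc_atLeast_1, of f] integral_count_space_nat[of "\<lambda>k. f (Suc k)"] assms
  by (simp add: integrable_count_space_nat_iff)

lemma L2_ell2_iff: "f \<in> L2 ell2_measure \<longleftrightarrow> summable (\<lambda>k. (norm (f (Suc k)))\<^sup>2)"
  by (simp add: L2_def ell2_integrable_iff del: One_nat_def)

lemma l2_norm_ell2:
  "f \<in> L2 ell2_measure \<Longrightarrow> l2_norm ell2_measure f = sqrt (\<Sum>k. (norm (f (Suc k)))\<^sup>2)"
  by (simp add: l2_norm_def ell2_integral L2_ell2_iff del: One_nat_def)

definition ell2_unit :: "nat \<Rightarrow> nat \<Rightarrow> complex" where
  "ell2_unit k i = (if i = Suc k then 1 else 0)"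

lemma ell2_unit_L2: "ell2_unit k \<in> L2 ell2_measure"
  unfolding L2_ell2_iff by (rule summable_finite[of "{k}"]) (auto simp: ell2_unit_def)

lemma l2_norm_ell2_unit: "l2_norm ell2_measure (ell2_unit k) = 1"
proof -
  have "(\<Sum>j. (norm (ell2_unit k (Suc j)))\<^sup>2) = (\<Sum>j\<in>{k}. (norm (ell2_unit k (Suc j)))\<^sup>2)"
    by (rule suminf_finite) (auto simp: ell2_unit_def)
  then show ?thesis by (simp add: l2_norm_ell2[OF ell2_unit_L2] ell2_unit_def del: One_nat_def)
qed

lemma l2_inner_ell2_unit: "l2_inner ell2_measure f (ell2_unit k) = f (Suc k)"
proof -
  have s: "summable (\<lambda>j. norm (f (Suc j) * cnj (ell2_unit k (Suc j))))"
    by (rule summable_finite[of "{k}"]) (auto simp: ell2_unit_def)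
  have "l2_inner ell2_measure f (ell2_unit k) = (\<Sum>j. f (Suc j) * cnj (ell2_unit k (Suc j)))"
    unfolding l2_inner_def by (rule ell2_integral[OF s])
  also have "\<dots> = (\<Sum>j\<in>{k}. f (Suc j) * cnj (ell2_unit k (Suc j)))"
    by (rule suminf_finite) (auto simp: ell2_unit_def)
  finally show ?thesis by (simp add: ell2_unit_def)
qed

lemma ell2_bounded: "f \<in> L2 ell2_measure \<Longrightarrow> norm (f (Suc k)) \<le> l2_norm ell2_measure f"
  using l2_Cauchy_Schwarz[OF _ ell2_unit_L2, of f k] by (simp add: l2_inner_ell2_unit l2_norm_ell2_unit del: One_nat_def)

text \<open>Each coordinate functional times the corresponding column is a rank one term, and the
  columns are summable in norm. The bound along the rows makes the sum in
  \<open>matrix_operator\<close> converge absolutely.\<close>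

lemma matrix_operator_has_trace:
  assumes m: "summable m" and row: "\<And>i k. norm (A i (Suc k)) \<le> m k"
    and col: "\<And>k. (\<lambda>i. complex_of_real (A i (Suc k))) \<in> L2 ell2_measure"
      "\<And>k. l2_norm ell2_measure (\<lambda>i. complex_of_real (A i (Suc k))) \<le> m k"
  shows "has_trace ell2_measure (matrix_operator A) (\<Sum>k. of_real (A (Suc k) (Suc k)))"
proof -
  have "has_trace ell2_measure (matrix_operator A)
      (\<Sum>k. l2_inner ell2_measure (\<lambda>i. complex_of_real (A i (Suc k))) (ell2_unit k))"
  proof (rule nuclear_has_trace[OF ell2_unit_L2 col(1)])
    show "summable (\<lambda>k. l2_norm ell2_measure (ell2_unit k) * l2_norm ell2_measure (\<lambda>i. complex_of_real (A i (Suc k))))"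
      by (rule summable_comparison_test'[OF m, of 0]) (use col(2) in \<open>simp add: l2_norm_ell2_unit del: One_nat_def\<close>)
    fix f assume f: "f \<in> L2 ell2_measure"
    show "AE i in ell2_measure. matrix_operator A f i =
        (\<Sum>k. l2_inner ell2_measure f (ell2_unit k) * of_real (A i (Suc k)))"
    proof (rule AE_I2)
      fix i
      have n: "summable (\<lambda>k. norm (of_real (A i (Suc k)) * f (Suc k)))"
      proof (rule summable_comparison_test'[OF summable_mult2[OF m, of "l2_norm ell2_measure f"], of 0])
        fix k
        show "norm (norm (of_real (A i (Suc k)) * f (Suc k))) \<le> m k * l2_norm ell2_measure f"
          using mult_mono[OF row[of i k] ell2_bounded[OF f, of k]] order_trans[OF norm_ge_zero row[of i k]]
          by (simp add: norm_mult)
      qed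
      have "((\<lambda>k. of_real (A i (Suc k)) * f (Suc k)) has_sum (\<Sum>k. of_real (A i (Suc k)) * f (Suc k))) UNIV"
        by (rule norm_summable_imp_has_sum[OF n summable_sums[OF summable_norm_cancel[OF n]]])
      then have "((\<lambda>j. of_real (A i j) * f j) has_sum (\<Sum>k. of_real (A i (Suc k)) * f (Suc k))) {1..}"
        using has_sum_reindex_bij_betw[OF bij_betw_Suc_atLeast_1, of "\<lambda>j. of_real (A i j) * f j"] by blast
      then show "matrix_operator A f i = (\<Sum>k. l2_inner ell2_measure f (ell2_unit k) * of_real (A i (Suc k)))"
        unfolding matrix_operator_def l2_inner_ell2_unit by (simp add: infsumI mult.commute)
    qed
  qed simp
  then show ?thesis by (simp add: l2_inner_ell2_unit del: One_nat_def)
qed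

text \<open>\<open>rho \<beta> n j\<close> is the function R_n phi_j, and \<open>rmat\<close> below
  is the matrix of R_n in the sine basis.\<close>

definition rho :: "(real \<Rightarrow> real) \<Rightarrow> nat \<Rightarrow> nat \<Rightarrow> real \<Rightarrow> real" where
  "rho \<beta> n j x = (LINT y|unit_lebesgue. rk \<beta> n x y * phi j y)"

definition rmat :: "(real \<Rightarrow> real) \<Rightarrow> nat \<Rightarrow> inf_matrix" where
  "rmat \<beta> n i j = (LINT x|unit_lebesgue. phi i x * rho \<beta> n j x)"

context
  fixes \<beta> :: "real \<Rightarrow> real"
  assumes b: "bfun \<beta>"
begin

lemma bfun_rho: "bfun (rho \<beta> n j)"
  unfolding rho_def[abs_def] by (intro bfun_integral bfun2_mult bfun2_rk b bfun2_snd bfun_phi)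

lemma rho_kint: "of_real (rho \<beta> n (Suc k) x) = kint (rk \<beta> n) (sine_basis k) x"
  by (simp add: rho_def kint_def sine_basis_def flip: of_real_mult)

text \<open>The rightmost factor G of R_n acts on its eigenfunction \<open>phi j\<close>. The
  resulting \<open>inverse (mu j)\<close> is what makes the columns of the matrices summable in
  norm.\<close>

lemma rho_eq:
  assumes x: "x \<in> {0<..<1}"
  shows "rho \<beta> n j x = inverse (mu j) * (rc \<beta> n x * phi j x + (LINT t|unit_lebesgue. rs \<beta> n x t * phi j t))"
proof (cases j)
  case 0
  then show ?thesis by (simp add: rho_def)
next
  case (Suc k)
  have "complex_of_real (rho \<beta> n j x) = of_real (rc \<beta> n x) * green (sine_basis k) x + kint (rs \<beta> n) (green (sine_basis k)) x"
    unfolding Suc rho_kint by (rule kint_rk[OF b sine_basis_L2 x])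
  also have "kint (rs \<beta> n) (green (sine_basis k)) x = (LINT t|unit_lebesgue. of_real (inverse (mu j)) * of_real (rs \<beta> n x t * phi j t))"
    unfolding kint_def using Suc
    by (intro Bochner_Integration.integral_cong) (auto simp: green_sine_basis sine_basis_def)
  also have "\<dots> = of_real (inverse (mu j)) * of_real (LINT t|unit_lebesgue. rs \<beta> n x t * phi j t)"
    by (simp only: integral_mult_right_zero integral_complex_of_real)
  also have "green (sine_basis k) x = of_real (inverse (mu j) * phi j x)"
    using x Suc by (subst green_sine_basis) (auto simp: sine_basis_def)
  finally have "complex_of_real (rho \<beta> n j x) =
      of_real (inverse (mu j) * (rc \<beta> n x * phi j x + (LINT t|unit_lebesgue. rs \<beta> n x t * phi j t)))"
    by (simp add: algebra_simps)
  then show ?thesis by (simp only: of_real_eq_iff)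
qed

text \<open>Fubini's theorem exhibits row \<open>i\<close> as the sine coefficients of a function
  \<open>h\<close>, and the sum is Parseval's identity for \<open>h\<close> and \<open>g\<close>. In
  this way products of matrices become compositions of operators.\<close>

lemma rmat_infsum:
  assumes g: "bfun g"
  shows "(\<Sum>\<^sub>\<infinity>k\<in>{1..}. rmat \<beta> n i k * (LINT x|unit_lebesgue. phi k x * g x)) =
    (LINT x|unit_lebesgue. phi i x * (LINT y|unit_lebesgue. rk \<beta> n x y * g y))"
proof -
  have F: "(LINT x|unit_lebesgue. phi i x * (LINT y|unit_lebesgue. rk \<beta> n x y * u y)) =
      (LINT y|unit_lebesgue. u y * (LINT x|unit_lebesgue. phi i x * rk \<beta> n x y))" if u: "bfun u" for u
  proof -
    have "(LINT x|unit_lebesgue. phi i x * (LINT y|unit_lebesgue. rk \<beta> n x y * u y)) =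
        (LINT x|unit_lebesgue. LINT y|unit_lebesgue. phi i x * (rk \<beta> n x y * u y))"
      by simp
    also have "\<dots> = (LINT y|unit_lebesgue. LINT x|unit_lebesgue. phi i x * (rk \<beta> n x y * u y))"
      by (intro bfun_Fubini bfun2_mult bfun2_fst bfun2_snd bfun_phi u bfun2_rk b)
    also have "\<dots> = (LINT y|unit_lebesgue. LINT x|unit_lebesgue. u y * (phi i x * rk \<beta> n x y))"
      by (simp add: mult_ac)
    finally show ?thesis by simp
  qed
  define h where "h y = (LINT x|unit_lebesgue. phi i x * rk \<beta> n x y)" for y
  have h: "bfun h" unfolding h_def[abs_def]
    by (intro bfun_integral bfun2_mult bfun2_snd bfun_phi bfun2_swap[OF bfun2_rk[OF b]])
  have "rmat \<beta> n i k = (LINT y|unit_lebesgue. phi k y * h y)" for k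
    unfolding rmat_def rho_def h_def by (rule F[OF bfun_phi])
  then have "(\<Sum>\<^sub>\<infinity>k\<in>{1..}. rmat \<beta> n i k * (LINT x|unit_lebesgue. phi k x * g x)) = (LINT y|unit_lebesgue. h y * g y)"
    using infsumI[OF Parseval_phi[OF h g]] by simp
  also have "\<dots> = (LINT x|unit_lebesgue. phi i x * (LINT y|unit_lebesgue. rk \<beta> n x y * g y))"
    unfolding F[OF g] h_def by (simp add: mult.commute)
  finally show ?thesis .
qed

context
  fixes \<alpha> :: "real \<Rightarrow> real"
  assumes am: "\<alpha> \<in> borel_measurable unit_lebesgue" and ab: "AE x in unit_lebesgue. \<alpha> x = \<beta> x"
begin

text \<open>The sine coefficients of \<open>rho0 j\<close> and \<open>rho1 j\<close> are the j-th
  columns of \<open>M1_matrix\<close> for \<alpha> and for the constant 1.\<close>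

definition "rho0 j x = - inverse (mu j) * (\<beta> x * phi j x)"
definition "rho1 j x = - inverse (mu j) * phi j x"

lemma bfun_rho0: "bfun (rho0 j)" and bfun_rho1: "bfun (rho1 j)"
  unfolding rho0_def[abs_def] rho1_def[abs_def] by (intro bfun_mult bfun_const b bfun_phi)+

lemma rho_0: "x \<in> {0<..<1} \<Longrightarrow> rho \<beta> 0 j x = rho0 j x"
  by (simp add: rho_eq rho0_def)

lemma M1_alpha: "M1_matrix \<alpha> k j = (LINT x|unit_lebesgue. phi k x * rho0 j x)"
proof -
  have "(LINT x|unit_lebesgue. \<alpha> x * phi k x * phi j x) = (LINT x|unit_lebesgue. \<beta> x * phi k x * phi j x)"
  proof (rule integral_cong_AE)
    show "AE x in unit_lebesgue. \<alpha> x * phi k x * phi j x = \<beta> x * phi k x * phi j x"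
      using ab by eventually_elim simp
  qed (use am bfun_measurable[OF b] in measurable)
  then have "M1_matrix \<alpha> k j = (LINT x|unit_lebesgue. - inverse (mu j) * (\<beta> x * phi k x * phi j x))"
    by (simp add: M1_matrix_def)
  then show ?thesis by (simp add: rho0_def mult_ac)
qed

lemma M1_one: "M1_matrix (\<lambda>_. 1) k j = (LINT x|unit_lebesgue. phi k x * rho1 j x)"
proof -
  have "M1_matrix (\<lambda>_. 1) k j = (LINT x|unit_lebesgue. - inverse (mu j) * (1 * phi k x * phi j x))"
    by (simp add: M1_matrix_def)
  then show ?thesis by (simp add: rho1_def mult_ac)
qed

lemma rho_1: "x \<in> {0<..<1} \<Longrightarrow> rho \<beta> (Suc 0) j x = 2 * rho1 j x + (LINT y|unit_lebesgue. rk \<beta> 0 x y * rho0 j y)"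
proof -
  assume x: "x \<in> {0<..<1}"
  have "(LINT y|unit_lebesgue. rk \<beta> 0 x y * rho0 j y) = (LINT t|unit_lebesgue. inverse (mu j) * (rs \<beta> (Suc 0) x t * phi j t))"
    by (intro Bochner_Integration.integral_cong) (auto simp: rho0_def)
  also have "\<dots> = inverse (mu j) * (LINT t|unit_lebesgue. rs \<beta> (Suc 0) x t * phi j t)"
    by (rule integral_mult_right_zero)
  finally have *: "(LINT y|unit_lebesgue. rk \<beta> 0 x y * rho0 j y) = inverse (mu j) * (LINT t|unit_lebesgue. rs \<beta> (Suc 0) x t * phi j t)" .
  show ?thesis unfolding rho_eq[OF x] * rho1_def rc.simps distrib_left by simp
qed

lemma rho_Suc_Suc:
  "x \<in> {0<..<1} \<Longrightarrow> rho \<beta> (Suc (Suc n)) j x =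
    (LINT y|unit_lebesgue. rk \<beta> (Suc n) x y * rho0 j y) + (LINT y|unit_lebesgue. rk \<beta> n x y * rho1 j y)"
proof -
  assume x: "x \<in> {0<..<1}"
  have i: "integrable unit_lebesgue (\<lambda>y. rk \<beta> n x y * g y)" if "bfun g" for g n
    by (intro bfun_integrable bfun_mult bfun2_section[OF bfun2_rk] b x that)
  have "(LINT y|unit_lebesgue. rk \<beta> (Suc n) x y * rho0 j y) + (LINT y|unit_lebesgue. rk \<beta> n x y * rho1 j y) =
      (LINT y|unit_lebesgue. rk \<beta> (Suc n) x y * rho0 j y + rk \<beta> n x y * rho1 j y)"
    by (rule Bochner_Integration.integral_add[OF i[OF bfun_rho0] i[OF bfun_rho1], symmetric])
  also have "\<dots> = (LINT t|unit_lebesgue. inverse (mu j) * (rs \<beta> (Suc (Suc n)) x t * phi j t))"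
    by (intro Bochner_Integration.integral_cong) (auto simp: rho0_def rho1_def algebra_simps)
  finally show ?thesis unfolding rho_eq[OF x] by simp
qed

lemma rmat_cong: "(\<And>x. x \<in> {0<..<1} \<Longrightarrow> rho \<beta> n j x = g x) \<Longrightarrow> rmat \<beta> n i j = (LINT x|unit_lebesgue. phi i x * g x)"
  unfolding rmat_def by (intro Bochner_Integration.integral_cong) auto

text \<open>Both recursions multiply on the right, by - \<beta> G and by - G, so they agree step by
  step with the index moved by one. The extra 2 in the second matrix comes from the value -2 of
  \<open>rc\<close> at \<open>Suc 0\<close>.\<close>

lemma M_matrix_eq_rmat: "M_matrix \<alpha> (Suc n) = rmat \<beta> n"
proof (induction n rule: less_induct)
  case (less n)
  have i: "integrable unit_lebesgue (\<lambda>x. phi i x * (c * rho1 j x))" for i j c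
    by (intro bfun_integrable bfun_mult bfun_phi bfun_rho1 bfun_const)
  have j: "integrable unit_lebesgue (\<lambda>x. phi i x * (LINT y|unit_lebesgue. rk \<beta> m x y * g y))" if "bfun g" for i g m
    by (intro bfun_integrable bfun_mult bfun_phi bfun_integral bfun2_mult bfun2_rk b bfun2_snd that)
  have 0: "M1_matrix \<alpha> = rmat \<beta> 0"
    by (intro ext) (simp only: M1_alpha rmat_cong[OF rho_0])
  have mult0: "inf_matrix_mult (rmat \<beta> m) (M1_matrix \<alpha>) i j = (LINT x|unit_lebesgue. phi i x * (LINT y|unit_lebesgue. rk \<beta> m x y * rho0 j y))" for m i j
    unfolding inf_matrix_mult_def M1_alpha by (rule rmat_infsum[OF bfun_rho0])
  have mult1: "inf_matrix_mult (rmat \<beta> m) (M1_matrix (\<lambda>_. 1)) i j = (LINT x|unit_lebesgue. phi i x * (LINT y|unit_lebesgue. rk \<beta> m x y * rho1 j y))" for m i j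
    unfolding inf_matrix_mult_def M1_one by (rule rmat_infsum[OF bfun_rho1])
  consider "n = 0" | "n = Suc 0" | m where "n = Suc (Suc m)" by (metis not0_implies_Suc)
  then show ?case
  proof cases
    case 1
    then show ?thesis using 0 by simp
  next
    case 2
    show ?thesis
    proof (intro ext)
      fix i k
      have "M_matrix \<alpha> (Suc n) i k = (LINT x|unit_lebesgue. phi i x * (2 * rho1 k x)) + (LINT x|unit_lebesgue. phi i x * (LINT y|unit_lebesgue. rk \<beta> 0 x y * rho0 k y))"
      proof -
        have "M_matrix \<alpha> (Suc n) i k = 2 * M1_matrix (\<lambda>_. 1) i k + inf_matrix_mult (rmat \<beta> 0) (M1_matrix \<alpha>) i k"
          by (simp add: 2 0)
        moreover have "2 * M1_matrix (\<lambda>_. 1) i k = (LINT x|unit_lebesgue. phi i x * (2 * rho1 k x))"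
          unfolding M1_one integral_mult_right_zero[symmetric] by (simp only: mult.left_commute)
        ultimately show ?thesis by (simp only: mult0)
      qed
      also have "\<dots> = (LINT x|unit_lebesgue. phi i x * (2 * rho1 k x + (LINT y|unit_lebesgue. rk \<beta> 0 x y * rho0 k y)))"
        unfolding distrib_left by (rule Bochner_Integration.integral_add[OF i j[OF bfun_rho0], symmetric])
      also have "\<dots> = rmat \<beta> n i k" unfolding 2 by (rule rmat_cong[OF rho_1, symmetric])
      finally show "M_matrix \<alpha> (Suc n) i k = rmat \<beta> n i k" .
    qed
  next
    case (3 m)
    show ?thesis
    proof (intro ext)
      fix i k
      have "M_matrix \<alpha> (Suc n) i k = (LINT x|unit_lebesgue. phi i x * (LINT y|unit_lebesgue. rk \<beta> (Suc m) x y * rho0 k y)) + (LINT x|unit_lebesgue. phi i x * (LINT y|unit_lebesgue. rk \<beta> m x y * rho1 k y))"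
        using mult0[of "Suc m" i k] mult1[of m i k] less[of m] less[of "Suc m"] by (simp add: 3)
      also have "\<dots> = (LINT x|unit_lebesgue. phi i x * ((LINT y|unit_lebesgue. rk \<beta> (Suc m) x y * rho0 k y) + (LINT y|unit_lebesgue. rk \<beta> m x y * rho1 k y)))"
        unfolding distrib_left by (rule Bochner_Integration.integral_add[OF j[OF bfun_rho0] j[OF bfun_rho1], symmetric])
      also have "\<dots> = rmat \<beta> n i k" unfolding 3 by (rule rmat_cong[OF rho_Suc_Suc, symmetric])
      finally show "M_matrix \<alpha> (Suc n) i k = rmat \<beta> n i k" .
    qed
  qed
qed

lemma rmat_inner:
  "complex_of_real (rmat \<beta> n (Suc j) (Suc k)) = l2_inner unit_lebesgue (\<lambda>x. of_real (rho \<beta> n (Suc k) x)) (sine_basis j)"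
  by (simp add: rmat_def l2_inner_def sine_basis_def mult.commute flip: of_real_mult)

lemma rho_bound: "\<exists>C\<ge>0. \<forall>k. \<forall>x\<in>{0<..<1}. \<bar>rho \<beta> n (Suc k) x\<bar> \<le> inverse (mu (Suc k)) * C"
proof -
  obtain C1 where C1: "\<And>x. x \<in> {0<..<1} \<Longrightarrow> \<bar>rc \<beta> n x\<bar> \<le> C1" using bfunE[OF bfun_rc[OF b]] by blast
  obtain C2 where C2: "\<And>x t. x \<in> {0<..<1} \<Longrightarrow> t \<in> {0<..<1} \<Longrightarrow> \<bar>rs \<beta> n x t\<bar> \<le> C2" using bfun2E[OF bfun2_rs[OF b]] by blast
  have C0: "C1 \<ge> 0" "C2 \<ge> 0" using C1[of "1/2"] C2[of "1/2" "1/2"] by (auto intro: order_trans[OF abs_ge_zero])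
  show ?thesis
  proof (intro exI[of _ "(C1 + C2) * sqrt 2"] conjI allI ballI)
    show "0 \<le> (C1 + C2) * sqrt 2" using C0 by simp
    fix k and x :: real assume x: "x \<in> {0<..<1}"
    let ?p = "phi (Suc k)"
    have "\<bar>LINT t|unit_lebesgue. rs \<beta> n x t * ?p t\<bar> \<le> (LINT t|unit_lebesgue. \<bar>rs \<beta> n x t * ?p t\<bar>)" by (rule integral_abs_bound)
    also have "\<dots> \<le> (LINT t|unit_lebesgue. C2 * sqrt 2)"
    proof (rule integral_mono)
      show "integrable unit_lebesgue (\<lambda>t. \<bar>rs \<beta> n x t * ?p t\<bar>)"
        by (intro integrable_abs bfun_integrable bfun_mult bfun2_section[OF bfun2_rs[OF b] x] bfun_phi)
      show "\<bar>rs \<beta> n x t * ?p t\<bar> \<le> C2 * sqrt 2" if "t \<in> space unit_lebesgue" for t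
        unfolding abs_mult using C2[OF x] C0 abs_phi_le that by (intro mult_mono) auto
    qed (rule bfun_integrable[OF bfun_const])
    finally have "\<bar>LINT t|unit_lebesgue. rs \<beta> n x t * ?p t\<bar> \<le> C2 * sqrt 2" by (simp add: measure_space_unit_lebesgue)
    moreover have "\<bar>rc \<beta> n x * ?p x\<bar> \<le> C1 * sqrt 2" unfolding abs_mult using C1[OF x] abs_phi_le C0 by (intro mult_mono) auto
    ultimately have "\<bar>rc \<beta> n x * ?p x + (LINT t|unit_lebesgue. rs \<beta> n x t * ?p t)\<bar> \<le> (C1 + C2) * sqrt 2"
      unfolding distrib_right by linarith
    then show "\<bar>rho \<beta> n (Suc k) x\<bar> \<le> inverse (mu (Suc k)) * ((C1 + C2) * sqrt 2)"
      unfolding rho_eq[OF x] abs_mult using mu_pos[of "Suc k"] by (intro mult_mono) auto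
  qed
qed

text \<open>Bessel's inequality bounds each column of \<open>rmat\<close> by the norm of
  \<open>rho\<close>, hence by a summable sequence. The value of the trace is not computed again:
  the diagonal entries are the numbers <R_n e, e> for the sine basis, whose sum is known from
  \<open>has_trace_R_op\<close>.\<close>

lemma has_trace_M_matrix: "has_trace ell2_measure (matrix_operator (M_matrix \<alpha> (Suc n))) (of_real (tser \<beta> $ n))"
proof -
  obtain C where C: "C \<ge> 0" "\<And>k x. x \<in> {0<..<1} \<Longrightarrow> \<bar>rho \<beta> n (Suc k) x\<bar> \<le> inverse (mu (Suc k)) * C"
    using rho_bound[of n] by blast
  define m where "m k = inverse (mu (Suc k)) * C" for k
  have m0: "m k \<ge> 0" for k using C(1) mu_pos[of "Suc k"] by (simp add: m_def)
  have rm: "\<bar>rho \<beta> n (Suc k) x\<bar> \<le> m k" if "x \<in> {0<..<1}" for k x using C(2)[OF that] by (simp add: m_def)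
  have r2: "(\<lambda>x. complex_of_real (rho \<beta> n (Suc k) x)) \<in> L2 unit_lebesgue" for k by (rule bfun_L2[OF bfun_rho])
  have rn: "(l2_norm unit_lebesgue (\<lambda>x. of_real (rho \<beta> n (Suc k) x)))\<^sup>2 \<le> (m k)\<^sup>2" for k
  proof -
    have "(LINT x|unit_lebesgue. (norm (complex_of_real (rho \<beta> n (Suc k) x)))\<^sup>2) \<le> (LINT x|unit_lebesgue. (m k)\<^sup>2)"
    proof (rule integral_mono)
      show "(norm (complex_of_real (rho \<beta> n (Suc k) x)))\<^sup>2 \<le> (m k)\<^sup>2" if "x \<in> space unit_lebesgue" for x
        using rm[of x k] that unfolding norm_of_real by (intro power_mono) auto
    qed (rule L2_sq_integrable[OF r2], rule bfun_integrable[OF bfun_const])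
    then show ?thesis by (simp add: l2_norm_power2 measure_space_unit_lebesgue)
  qed
  have e1: "l2_norm unit_lebesgue (sine_basis j) = 1" for j
    using orthonormal_sine_basis l2_inner_self[of unit_lebesgue "sine_basis j"]
    by (simp add: orthonormal_def abs_square_eq_1 flip: of_real_power)
  have row: "norm (rmat \<beta> n i (Suc k)) \<le> m k" for i k
  proof (cases i)
    case 0 then show ?thesis using m0 by (simp add: rmat_def)
  next
    case (Suc j)
    have "norm (rmat \<beta> n (Suc j) (Suc k)) = norm (complex_of_real (rmat \<beta> n (Suc j) (Suc k)))" by simp
    also have "\<dots> \<le> l2_norm unit_lebesgue (\<lambda>x. of_real (rho \<beta> n (Suc k) x)) * l2_norm unit_lebesgue (sine_basis j)"
      unfolding rmat_inner by (rule l2_Cauchy_Schwarz[OF r2 sine_basis_L2])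
    also have "\<dots> \<le> m k" unfolding e1 using power2_le_imp_le[OF rn m0] by simp
    finally show ?thesis by (simp add: Suc)
  qed
  have sq: "(norm (complex_of_real (rmat \<beta> n (Suc j) (Suc k))))\<^sup>2 = (norm (l2_inner unit_lebesgue (\<lambda>x. of_real (rho \<beta> n (Suc k) x)) (sine_basis j)))\<^sup>2" for j k
    by (simp only: rmat_inner)
  have col: "(\<lambda>i. complex_of_real (rmat \<beta> n i (Suc k))) \<in> L2 ell2_measure" for k
    unfolding L2_ell2_iff sq by (rule Bessel_summable[OF orthonormal_sine_basis r2])
  have coln: "l2_norm ell2_measure (\<lambda>i. complex_of_real (rmat \<beta> n i (Suc k))) \<le> m k" for k
  proof -
    have "(\<Sum>j. (norm (complex_of_real (rmat \<beta> n (Suc j) (Suc k))))\<^sup>2) \<le> (m k)\<^sup>2"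
    proof (rule suminf_le_const)
      show "summable (\<lambda>j. (norm (complex_of_real (rmat \<beta> n (Suc j) (Suc k))))\<^sup>2)"
        unfolding sq by (rule Bessel_summable[OF orthonormal_sine_basis r2])
      show "(\<Sum>j<N. (norm (complex_of_real (rmat \<beta> n (Suc j) (Suc k))))\<^sup>2) \<le> (m k)\<^sup>2" for N
        unfolding sq by (rule order_trans[OF Bessel_sum[OF orthonormal_sine_basis r2] rn]) simp
    qed
    then show ?thesis unfolding l2_norm_ell2[OF col] using m0 by (intro real_le_lsqrt) (auto intro: suminf_nonneg)
  qed
  have ms: "summable m" unfolding m_def by (intro summable_mult2 summable_inverse_mu)
  have "has_trace ell2_measure (matrix_operator (rmat \<beta> n)) (\<Sum>k. of_real (rmat \<beta> n (Suc k) (Suc k)))"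
    by (rule matrix_operator_has_trace[OF ms row col coln])
  moreover have "(\<Sum>k. complex_of_real (rmat \<beta> n (Suc k) (Suc k))) = of_real (tser \<beta> $ n)"
  proof -
    have "((\<lambda>k. l2_inner unit_lebesgue (R_op \<alpha> n (sine_basis k)) (sine_basis k)) has_sum of_real (tser \<beta> $ n)) UNIV"
      using has_trace_R_op[OF b am ab, of n] orthonormal_basis_sine_basis unfolding has_trace_def by blast
    moreover have "l2_inner unit_lebesgue (R_op \<alpha> n (sine_basis k)) (sine_basis k) = of_real (rmat \<beta> n (Suc k) (Suc k))" for k
      unfolding rmat_inner
    proof (rule l2_inner_AE_cong)
      show "R_op \<alpha> n (sine_basis k) \<in> borel_measurable unit_lebesgue"
        by (rule R_op_kernel(1)[OF b am ab sine_basis_L2])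
      show "AE x in unit_lebesgue. R_op \<alpha> n (sine_basis k) x = of_real (rho \<beta> n (Suc k) x)"
        unfolding rho_kint by (rule R_op_kernel(2)[OF b am ab sine_basis_L2])
    qed (use r2 in \<open>auto dest: L2_measurable\<close>)
    ultimately have "((\<lambda>k. complex_of_real (rmat \<beta> n (Suc k) (Suc k))) has_sum of_real (tser \<beta> $ n)) UNIV" by simp
    then show ?thesis by (simp add: has_sum_imp_sums sums_unique[symmetric])
  qed
  ultimately show ?thesis by (simp add: M_matrix_eq_rmat)
qed

end

end

section \<open>Entire functions of exponential type\<close>

text \<open>Factorial decay with explicit constants yields exponential type \<open>K\<close> and
  passes to derivatives with the same \<open>K\<close>.\<close>

definition power_coeff_bound :: "(nat \<Rightarrow> complex) \<Rightarrow> real \<Rightarrow> real \<Rightarrow> bool" where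
  "power_coeff_bound a A K \<longleftrightarrow> A \<ge> 0 \<and> K \<ge> 0 \<and> (\<forall>n. norm (a n) \<le> A * K ^ n / fact n)"

definition entire_of :: "(nat \<Rightarrow> complex) \<Rightarrow> complex \<Rightarrow> complex" where
  "entire_of a z = (\<Sum>n. a n * z ^ n)"

text \<open>The Taylor coefficient at \<open>z\<close>, written as a series in the coefficients at
  0, so that measurability in \<open>x\<close> and the integral equations pass to it term by
  term.\<close>

definition taylor_coeff :: "(nat \<Rightarrow> complex) \<Rightarrow> complex \<Rightarrow> nat \<Rightarrow> complex" where
  "taylor_coeff a z k = (\<Sum>n. of_nat ((n + k) choose k) * z ^ n * a (n + k))"

lemma power_coeff_bound_summable:
  assumes "power_coeff_bound a A K"
  shows "summable (\<lambda>n. norm (a n * z ^ n))" and "(\<Sum>n. norm (a n * z ^ n)) \<le> A * exp (K * norm z)"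
proof -
  have b: "norm (a n * z ^ n) \<le> A * ((K * norm z) ^ n /\<^sub>R fact n)" for n
  proof -
    have "norm (a n * z ^ n) \<le> (A * K ^ n / fact n) * norm z ^ n"
      unfolding norm_mult norm_power using assms by (intro mult_right_mono) (auto simp: power_coeff_bound_def)
    then show ?thesis by (simp add: power_mult_distrib divide_inverse mult_ac)
  qed
  have s: "summable (\<lambda>n. A * ((K * norm z) ^ n /\<^sub>R fact n))" by (intro summable_mult summable_exp_generic)
  show n: "summable (\<lambda>n. norm (a n * z ^ n))" by (rule summable_comparison_test'[OF s, of 0]) (use b in auto)
  have "(\<Sum>n. norm (a n * z ^ n)) \<le> (\<Sum>n. A * ((K * norm z) ^ n /\<^sub>R fact n))"
    by (rule suminf_le[OF b n s])
  also have "\<dots> = A * exp (K * norm z)" unfolding exp_def by (rule suminf_mult[OF summable_exp_generic])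
  finally show "(\<Sum>n. norm (a n * z ^ n)) \<le> A * exp (K * norm z)" .
qed

lemma entire_of_sums: "power_coeff_bound a A K \<Longrightarrow> (\<lambda>n. a n * z ^ n) sums entire_of a z"
  unfolding entire_of_def by (rule summable_sums[OF summable_norm_cancel[OF power_coeff_bound_summable(1)]])

lemma norm_entire_of_le: "power_coeff_bound a A K \<Longrightarrow> norm (entire_of a z) \<le> A * exp (K * norm z)"
  unfolding entire_of_def
  by (rule order_trans[OF summable_norm[OF power_coeff_bound_summable(1)] power_coeff_bound_summable(2)])

lemma holomorphic_entire_of: "power_coeff_bound a A K \<Longrightarrow> entire_of a holomorphic_on UNIV"
proof -
  assume a: "power_coeff_bound a A K"
  have "entire_of a holomorphic_on ball 0 r" for r
    by (rule power_series_holomorphic[where a = a and z = 0]) (use entire_of_sums[OF a] in auto)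
  then show ?thesis
    by (meson UNIV_I holomorphic_on_def centre_in_ball field_differentiable_at_within holomorphic_on_imp_differentiable_at
        open_ball mem_ball_0 gt_ex)
qed

lemma deriv_entire_of:
  assumes a: "power_coeff_bound a A K"
  shows "deriv (entire_of a) = entire_of (diffs a)" and "power_coeff_bound (diffs a) (A * K) K"
proof
  fix z
  have "(entire_of a has_field_derivative (\<Sum>n. diffs a n * z ^ n)) (at z)"
    unfolding entire_of_def[abs_def]
    by (rule termdiffs_strong_converges_everywhere) (use sums_summable[OF entire_of_sums[OF a]] in auto)
  then show "deriv (entire_of a) z = entire_of (diffs a) z"
    unfolding entire_of_def by (rule DERIV_imp_deriv)
next
  show "power_coeff_bound (diffs a) (A * K) K"
    unfolding power_coeff_bound_def
  proof (intro conjI allI)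
    show "A * K \<ge> 0" "K \<ge> 0" using a by (auto simp: power_coeff_bound_def)
    fix n
    have "norm (a (Suc n)) \<le> A * K ^ Suc n / fact (Suc n)" using a unfolding power_coeff_bound_def by blast
    then have "real (Suc n) * norm (a (Suc n)) \<le> real (Suc n) * (A * K ^ Suc n / fact (Suc n))"
      by (intro mult_left_mono) auto
    also have "\<dots> = A * K * K ^ n / fact n"
      by (simp add: field_simps fact_Suc del: of_nat_Suc)
    finally show "norm (diffs a n) \<le> A * K * K ^ n / fact n"
      unfolding diffs_def norm_mult norm_of_nat .
  qed
qed

lemma diffs_funpow: "(diffs ^^ k) a n = fact (n + k) / fact n * (a (n + k) :: complex)"
proof (induction k arbitrary: n)
  case (Suc k)
  have "(diffs ^^ Suc k) a n = of_nat (Suc n) * (fact (Suc n + k) / fact (Suc n) * a (Suc n + k))"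
    by (simp add: diffs_def Suc.IH)
  also have "\<dots> = fact (n + Suc k) / fact n * a (n + Suc k)"
    by (simp only: fact_Suc[of n] add_Suc add_Suc_right of_nat_mult) (simp del: of_nat_Suc fact_Suc)
  finally show ?case .
qed simp

lemma higher_deriv_entire_of:
  assumes a: "power_coeff_bound a A K"
  shows "(deriv ^^ k) (entire_of a) = entire_of ((diffs ^^ k) a) \<and> (\<exists>A. power_coeff_bound ((diffs ^^ k) a) A K)"
proof (induction k)
  case (Suc k)
  then obtain A' where "power_coeff_bound ((diffs ^^ k) a) A' K" by blast
  from deriv_entire_of[OF this] Suc show ?case by auto
qed (use a in auto)

lemma taylor_coeff_eq:
  assumes a: "power_coeff_bound a A K"
  shows "taylor_coeff a z k = (deriv ^^ k) (entire_of a) z / fact k"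
    and "summable (\<lambda>n. norm (of_nat ((n + k) choose k) * z ^ n * a (n + k)))"
proof -
  obtain A' where A': "power_coeff_bound ((diffs ^^ k) a) A' K" using higher_deriv_entire_of[OF a] by blast
  have eq: "(diffs ^^ k) a n * z ^ n / fact k = of_nat ((n + k) choose k) * z ^ n * a (n + k)" for n
  proof -
    have "(fact (n + k) :: complex) / fact n / fact k = of_nat ((n + k) choose k)"
      by (subst binomial_fact) (auto simp: mult.commute)
    then show ?thesis by (simp add: diffs_funpow field_simps)
  qed
  have "(\<lambda>n. (diffs ^^ k) a n * z ^ n / fact k) sums ((deriv ^^ k) (entire_of a) z / fact k)"
    using sums_divide[OF entire_of_sums[OF A']] higher_deriv_entire_of[OF a, of k] by simp
  then show "taylor_coeff a z k = (deriv ^^ k) (entire_of a) z / fact k"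
    unfolding taylor_coeff_def eq by (rule sums_unique[symmetric])
  have "summable (\<lambda>n. norm ((diffs ^^ k) a n * z ^ n) / fact k)"
    by (intro summable_divide power_coeff_bound_summable[OF A'])
  then have "summable (\<lambda>n. norm ((diffs ^^ k) a n * z ^ n / fact k))" by (simp add: norm_divide)
  then show "summable (\<lambda>n. norm (of_nat ((n + k) choose k) * z ^ n * a (n + k)))" unfolding eq .
qed

lemma taylor_coeff_fps_expansion:
  assumes a: "power_coeff_bound a A K"
  shows "(\<lambda>w. entire_of a (z + w)) has_fps_expansion Abs_fps (taylor_coeff a z)"
proof -
  have "(\<lambda>w. entire_of a (z + w)) has_fps_expansion fps_expansion (entire_of a) z"
    by (rule analytic_at_imp_has_fps_expansion)
       (use holomorphic_entire_of[OF a] analytic_on_open holomorphic_on_imp_analytic_at in blast)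
  also have "fps_expansion (entire_of a) z = Abs_fps (taylor_coeff a z)"
    by (rule fps_ext) (simp add: fps_expansion_def taylor_coeff_eq[OF a])
  finally show ?thesis .
qed

text \<open>The majorant sees \<open>a\<close> only through \<open>A\<close> and \<open>K\<close>;
  for the coefficients of the solution it is therefore uniform in \<open>x\<close>.\<close>

lemma norm_taylor_coeff_le:
  assumes a: "power_coeff_bound a A K"
  shows "norm (taylor_coeff a z k) \<le> (\<Sum>n. real ((n + k) choose k) * norm z ^ n * (A * K ^ (n + k) / fact (n + k)))"
    and "summable (\<lambda>n. real ((n + k) choose k) * norm z ^ n * (A * K ^ (n + k) / fact (n + k)))"
proof -
  define c where "c n = complex_of_real (A * K ^ n / fact n)" for n
  have c: "power_coeff_bound c A K" using a by (auto simp: power_coeff_bound_def c_def norm_divide norm_mult norm_power)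
  have A: "A \<ge> 0" "K \<ge> 0" and an: "\<And>n. norm (a n) \<le> A * K ^ n / fact n" using a by (auto simp: power_coeff_bound_def)
  have "summable (\<lambda>n. norm (of_nat ((n + k) choose k) * of_real (norm z) ^ n * c (n + k)))"
    by (rule taylor_coeff_eq(2)[OF c])
  then show s: "summable (\<lambda>n. real ((n + k) choose k) * norm z ^ n * (A * K ^ (n + k) / fact (n + k)))"
    using A by (simp add: norm_mult norm_power norm_divide c_def)
  have "norm (taylor_coeff a z k) \<le> (\<Sum>n. norm (of_nat ((n + k) choose k) * z ^ n * a (n + k)))"
    unfolding taylor_coeff_def by (rule summable_norm[OF taylor_coeff_eq(2)[OF a]])
  also have "\<dots> \<le> (\<Sum>n. real ((n + k) choose k) * norm z ^ n * (A * K ^ (n + k) / fact (n + k)))"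
  proof (rule suminf_le[OF _ taylor_coeff_eq(2)[OF a] s])
    fix n
    show "norm (of_nat ((n + k) choose k) * z ^ n * a (n + k)) \<le> real ((n + k) choose k) * norm z ^ n * (A * K ^ (n + k) / fact (n + k))"
      unfolding norm_mult norm_power norm_of_nat by (rule mult_left_mono[OF an]) simp
  qed
  finally show "norm (taylor_coeff a z k) \<le> (\<Sum>n. real ((n + k) choose k) * norm z ^ n * (A * K ^ (n + k) / fact (n + k)))" .
qed

section \<open>The Volterra kernel on powers\<close>

lemma volt_power:
  assumes x: "x \<in> {0..1}"
  shows "volt (\<lambda>t. of_real (t ^ k)) x = of_real (x ^ (k + 2) / (real (k + 1) * real (k + 2)))"
proof -
  let ?g = "\<lambda>t. complex_of_real (t ^ k)"
  let ?F = "\<lambda>x. x ^ (k + 2) / (real (k + 1) * real (k + 2))"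
  let ?G = "\<lambda>x. x ^ (k + 1) / real (k + 1)"
  have g: "?g \<in> L2 unit_lebesgue"
    by (rule bounded_L2[where B = 1]) (auto simp: norm_power abs_le_iff intro!: power_le_one)
  have dG: "(?G has_real_derivative t ^ k) (at t within A)" for t A
    using DERIV_cdivide[OF DERIV_pow[of "k + 1"], of "real (k + 1)"] by (simp del: of_nat_add of_nat_Suc)
  have dF: "(?F has_real_derivative ?G t) (at t within A)" for t A
    using DERIV_cdivide[OF DERIV_pow[of "k + 2"], of "real (k + 1) * real (k + 2)"]
    by (simp del: of_nat_add of_nat_Suc)
  have p: "prim ?g y = of_real (?G y)" if y: "y \<in> {0..1}" for y
  proof -
    have "(?g has_integral of_real (?G y) - of_real (?G 0)) {0..y}"
      by (rule fundamental_theorem_of_calculus[OF _ has_vector_derivative_of_real[OF dG]]) (use y in auto)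
    then show ?thesis using prim_eq_integral[OF g y] by (simp add: integral_unique)
  qed
  have "((\<lambda>y. of_real (?F y) - volt ?g y) has_vector_derivative 0) (at y within {0..1})" if y: "y \<in> {0..1}" for y
    using has_vector_derivative_diff[OF has_vector_derivative_of_real[OF dF] volt_has_derivative[OF g y]] by (simp only: p[OF y] diff_self)
  then obtain d where d: "\<And>y. y \<in> {0..1} \<Longrightarrow> of_real (?F y) - volt ?g y = d"
    using has_vector_derivative_zero_constant[OF convex_real_interval(5), of 0 1 "\<lambda>y. of_real (?F y) - volt ?g y"] by blast
  show ?thesis using d[OF x] d[of 0] by (simp add: volt_0)
qed

lemma integral_max_diff_power:
  assumes x: "x \<in> {0..1}"
  shows "(LINT t|unit_lebesgue. max 0 (x - t) * t ^ k) = x ^ (k + 2) / (real (k + 1) * real (k + 2))"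
proof -
  have "complex_of_real (LINT t|unit_lebesgue. max 0 (x - t) * t ^ k) = volt (\<lambda>t. of_real (t ^ k)) x"
    unfolding volt_def integral_complex_of_real[symmetric] by (simp flip: of_real_mult of_real_power)
  then show ?thesis unfolding volt_power[OF x] of_real_eq_iff .
qed

lemma bfun_max_diff: "bfun (\<lambda>t. max 0 (x - t))"
  by (rule bfunI[where C = "\<bar>x\<bar> + 1"]) auto

text \<open>One Volterra integration turns \<open>t ^ k / fact k\<close> into
  \<open>x ^ (k + 2) / fact (k + 2)\<close>. Iteration gives the factorial decay behind the
  coefficient bounds, the uniqueness and the positivity results below.\<close>

lemma volterra_step:
  assumes x: "x \<in> {0..1}" and h: "h \<in> borel_measurable unit_lebesgue"
    and b: "\<And>t. t \<in> {0<..<1} \<Longrightarrow> \<bar>h t\<bar> \<le> A * t ^ k / fact k"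
  shows "\<bar>LINT t|unit_lebesgue. max 0 (x - t) * h t\<bar> \<le> A * x ^ (k + 2) / fact (k + 2)"
proof -
  have A: "A * t ^ k / fact k \<le> \<bar>A\<bar>" if t: "t \<in> {0<..<1}" for t
  proof -
    have "t ^ k \<le> fact k" using t by (intro order_trans[OF power_le_one fact_ge_1]) auto
    then have "t ^ k / fact k \<le> 1" by simp
    then have "\<bar>A\<bar> * (t ^ k / fact k) \<le> \<bar>A\<bar>" by (rule mult_left_le) simp
    moreover have "A * (t ^ k / fact k) \<le> \<bar>A\<bar> * (t ^ k / fact k)" using t by (intro mult_right_mono) auto
    ultimately show ?thesis by simp
  qed
  have hb: "bfun h"
  proof (rule bfunI[OF h, of "\<bar>A\<bar>"])
    fix t :: real assume t: "t \<in> {0<..<1}"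
    show "\<bar>h t\<bar> \<le> \<bar>A\<bar>" by (rule order_trans[OF b[OF t] A[OF t]])
  qed
  have tb: "bfun (\<lambda>t. max 0 (x - t) * t ^ k)"
    by (intro bfun_mult bfun_max_diff bfunI[where C = 1]) (auto simp: abs_le_iff power_abs intro!: power_le_one)
  have "\<bar>LINT t|unit_lebesgue. max 0 (x - t) * h t\<bar> \<le> (LINT t|unit_lebesgue. \<bar>max 0 (x - t) * h t\<bar>)"
    by (rule integral_abs_bound)
  also have "\<dots> \<le> (LINT t|unit_lebesgue. A / fact k * (max 0 (x - t) * t ^ k))"
  proof (rule integral_mono)
    show "integrable unit_lebesgue (\<lambda>t. \<bar>max 0 (x - t) * h t\<bar>)"
      by (intro integrable_abs bfun_integrable bfun_mult bfun_max_diff hb)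
    show "integrable unit_lebesgue (\<lambda>t. A / fact k * (max 0 (x - t) * t ^ k))"
      by (intro bfun_integrable bfun_mult[OF bfun_const tb])
    show "\<bar>max 0 (x - t) * h t\<bar> \<le> A / fact k * (max 0 (x - t) * t ^ k)" if "t \<in> space unit_lebesgue" for t
    proof -
      have "\<bar>max 0 (x - t)\<bar> * \<bar>h t\<bar> \<le> max 0 (x - t) * (A * t ^ k / fact k)"
        using b[of t] that by (intro mult_mono) auto
      then show ?thesis by (simp add: abs_mult mult_ac)
    qed
  qed
  also have "\<dots> = A / fact k * (x ^ (k + 2) / (real (k + 1) * real (k + 2)))"
    using integral_max_diff_power[OF x, of k] by (simp del: of_nat_add)
  also have "\<dots> = A * x ^ (k + 2) / fact (k + 2)"
    by (simp add: fact_reduce[of "k + 2"] field_simps)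
  finally show ?thesis .
qed

section \<open>The characteristic function\<close>

definition psi :: "(real \<Rightarrow> real) \<Rightarrow> nat \<Rightarrow> real \<Rightarrow> real" where
  "psi \<beta> n x = yl \<beta> x $ n"

definition pseq :: "(real \<Rightarrow> real) \<Rightarrow> nat \<Rightarrow> real \<Rightarrow> real" where
  "pseq \<beta> n t = (pfps \<beta> t * yl \<beta> t) $ n"

lemma pseq_simps: "pseq \<beta> 0 t = 0" "pseq \<beta> (Suc 0) t = \<beta> t * psi \<beta> 0 t"
  "pseq \<beta> (Suc (Suc n)) t = \<beta> t * psi \<beta> (Suc n) t + psi \<beta> n t"
  by (simp_all add: pseq_def psi_def pfps_mult_nth del: fps_mult_nth_0 fps_mult_nth_1 fps_mult_nth_1')

lemma psi_eq: "psi \<beta> n x = (if n = 0 then x else 0) + (LINT t|unit_lebesgue. max 0 (x - t) * pseq \<beta> n t)"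
  unfolding psi_def by (subst yl_eq) (simp add: fint_def pseq_def)

text \<open>
  The \<open>j\<close>-th Taylor coefficient at \<open>z\<close> of the solution \<open>y(\<zeta>, x)\<close> has index \<open>j + 2\<close>: with two zeros in front
  of the sequence, one Volterra equation holds for all coefficients.
\<close>

definition ycoeff :: "(real \<Rightarrow> real) \<Rightarrow> nat \<Rightarrow> complex \<Rightarrow> real \<Rightarrow> complex" where
  "ycoeff \<beta> j z x = (if j < 2 then 0 else taylor_coeff (\<lambda>n. of_real (psi \<beta> n x)) z (j - 2))"

definition qcoeff :: "(real \<Rightarrow> real) \<Rightarrow> nat \<Rightarrow> complex \<Rightarrow> real \<Rightarrow> complex" where
  "qcoeff \<beta> j z t = (z\<^sup>2 + z * of_real (\<beta> t)) * ycoeff \<beta> (j + 2) z t + (of_real (\<beta> t) + 2 * z) * ycoeff \<beta> (j + 1) z t + ycoeff \<beta> j z t"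

locale bounded_damping =
  fixes \<beta> :: "real \<Rightarrow> real" and B :: real
  assumes b: "bfun \<beta>" and \<beta>_le: "\<And>t. t \<in> {0<..<1} \<Longrightarrow> \<bar>\<beta> t\<bar> \<le> B" and B0: "B \<ge> 0"
begin

lemma bfun_psi: "bfun (psi \<beta> n)"
  using ffun_yl[OF b] by (simp add: ffun_def psi_def[abs_def])

lemma bfun_pseq: "bfun (pseq \<beta> n)"
  using ffun_mult[OF ffun_pfps[OF b] ffun_yl[OF b]] by (simp add: ffun_def pseq_def[abs_def])

text \<open>The two terms of the recursion gain different powers of \<open>x\<close>; the surplus
  power in the \<beta> term is given away to bring both to order \<open>n\<close>.\<close>

lemma psi_bound: "x \<in> {0..1} \<Longrightarrow> \<bar>psi \<beta> n x\<bar> \<le> (B + 1) ^ n * x ^ n / fact n"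
proof (induction n arbitrary: x rule: less_induct)
  case (less n)
  let ?C = "B + 1"
  have C: "?C \<ge> 1" using B0 by simp
  consider "n = 0" | "n = Suc 0" | m where "n = Suc (Suc m)" by (metis not0_implies_Suc)
  then show ?case
  proof cases
    case 1
    then show ?thesis using less.prems by (simp add: psi_eq pseq_simps)
  next
    case 2
    have "\<bar>LINT t|unit_lebesgue. max 0 (x - t) * pseq \<beta> 1 t\<bar> \<le> B * x ^ (0 + 2) / fact (0 + 2)"
    proof (rule volterra_step[OF less.prems bfun_measurable[OF bfun_pseq]])
      fix t :: real assume t: "t \<in> {0<..<1}"
      have "\<bar>\<beta> t\<bar> * \<bar>psi \<beta> 0 t\<bar> \<le> B * 1"
        using \<beta>_le[OF t] less.IH[of 0 t] t B0 2 by (intro mult_mono) auto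
      then show "\<bar>pseq \<beta> 1 t\<bar> \<le> B * t ^ 0 / fact 0" by (simp add: pseq_simps abs_mult)
    qed
    also have "\<dots> \<le> ?C * x"
    proof -
      have "x * x \<le> x * 1" using less.prems by (intro mult_left_mono) auto
      then have "B * (x * x) \<le> B * x" using B0 by (intro mult_left_mono) auto
      then have "B * (x * x) \<le> 2 * (?C * x)" using less.prems B0 by (auto simp: algebra_simps intro: order_trans add_increasing2)
      then show ?thesis by (simp add: power2_eq_square)
    qed
    finally show ?thesis by (simp add: 2 psi_eq)
  next
    case (3 m)
    have i1: "\<bar>LINT t|unit_lebesgue. max 0 (x - t) * (\<beta> t * psi \<beta> (Suc m) t)\<bar> \<le> (B * ?C ^ Suc m) * x ^ (Suc m + 2) / fact (Suc m + 2)"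
    proof (rule volterra_step[OF less.prems bfun_measurable[OF bfun_mult[OF b bfun_psi]]])
      fix t :: real assume t: "t \<in> {0<..<1}"
      have "\<bar>\<beta> t\<bar> * \<bar>psi \<beta> (Suc m) t\<bar> \<le> B * (?C ^ Suc m * t ^ Suc m / fact (Suc m))"
        using \<beta>_le[OF t] less.IH[of "Suc m" t] t B0 3 by (intro mult_mono) auto
      then show "\<bar>\<beta> t * psi \<beta> (Suc m) t\<bar> \<le> (B * ?C ^ Suc m) * t ^ Suc m / fact (Suc m)"
        by (simp add: abs_mult mult.assoc)
    qed
    have i2: "\<bar>LINT t|unit_lebesgue. max 0 (x - t) * psi \<beta> m t\<bar> \<le> ?C ^ m * x ^ (m + 2) / fact (m + 2)"
      by (rule volterra_step[OF less.prems bfun_measurable[OF bfun_psi]]) (use less.IH[of m] 3 in auto)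
    have "psi \<beta> n x = (LINT t|unit_lebesgue. max 0 (x - t) * (\<beta> t * psi \<beta> (Suc m) t) + max 0 (x - t) * psi \<beta> m t)"
      by (subst psi_eq) (simp add: 3 pseq_simps distrib_left)
    also have "\<dots> = (LINT t|unit_lebesgue. max 0 (x - t) * (\<beta> t * psi \<beta> (Suc m) t)) + (LINT t|unit_lebesgue. max 0 (x - t) * psi \<beta> m t)"
      by (intro Bochner_Integration.integral_add bfun_integrable bfun_mult bfun_max_diff b bfun_psi)
    finally have "\<bar>psi \<beta> n x\<bar> \<le> (B * ?C ^ Suc m) * x ^ (Suc m + 2) / fact (Suc m + 2) + ?C ^ m * x ^ (m + 2) / fact (m + 2)"
      using i1 i2 by linarith
    also have "\<dots> \<le> (B * ?C ^ Suc m) * (x ^ (m + 2) / fact (m + 2)) + ?C ^ m * (x ^ (m + 2) / fact (m + 2))"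
    proof -
      have "x ^ (Suc m + 2) / fact (Suc m + 2) \<le> x ^ (m + 2) / fact (m + 2)"
        using less.prems by (intro frac_le power_decreasing fact_mono) auto
      then have "(B * ?C ^ Suc m) * (x ^ (Suc m + 2) / fact (Suc m + 2)) \<le> (B * ?C ^ Suc m) * (x ^ (m + 2) / fact (m + 2))"
        using B0 by (intro mult_left_mono) auto
      then show ?thesis by simp
    qed
    also have "\<dots> = (B * ?C + 1) * ?C ^ m * (x ^ (m + 2) / fact (m + 2))"
    proof -
      have "(B * (c * p)) * E + p * E = (B * c + 1) * p * E" for c p E :: real by (simp add: algebra_simps)
      then show ?thesis unfolding power_Suc .
    qed
    \<comment> \<open>The base C = B + 1 is chosen for this inequality: B C + 1 \<le> C^2.\<close>
    also have "\<dots> \<le> ?C ^ 2 * ?C ^ m * (x ^ (m + 2) / fact (m + 2))"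
      using B0 less.prems by (intro mult_right_mono) (auto simp: power2_eq_square algebra_simps)
    finally show ?thesis by (simp add: 3 power2_eq_square mult_ac)
  qed
qed

text \<open>\<open>pseq\<close> lags two indices behind \<open>psi\<close>; the inequality
  \<open>(m + 2) * (m + 1) \<le> 4 ^ (m + 2)\<close> absorbs the quotient of the factorials.\<close>

definition "Kp = 4 * (B + 1)"

lemma Kp: "Kp \<ge> 1" using B0 by (simp add: Kp_def)

lemma pseq_bound:
  assumes t: "t \<in> {0<..<1}"
  shows "\<bar>pseq \<beta> n t\<bar> \<le> 2 * Kp ^ n / fact n"
proof -
  let ?C = "B + 1"
  have C: "?C \<ge> 1" using B0 by simp
  have p: "\<bar>psi \<beta> k t\<bar> \<le> ?C ^ k / fact k" for k
  proof -
    have "\<bar>psi \<beta> k t\<bar> \<le> ?C ^ k * t ^ k / fact k" by (rule psi_bound) (use t in auto)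
    also have "\<dots> \<le> ?C ^ k * 1 / fact k"
      using t C by (intro divide_right_mono mult_left_mono power_le_one) auto
    finally show ?thesis by simp
  qed
  consider "n = 0" | "n = Suc 0" | m where "n = Suc (Suc m)" by (metis not0_implies_Suc)
  then show ?thesis
  proof cases
    case 1 then show ?thesis by (simp add: pseq_simps)
  next
    case 2
    have "\<bar>\<beta> t\<bar> * \<bar>psi \<beta> 0 t\<bar> \<le> B * (?C ^ 0 / fact 0)"
      using \<beta>_le[OF t] p[of 0] B0 by (intro mult_mono) auto
    then show ?thesis using B0 by (simp add: 2 pseq_simps abs_mult Kp_def)
  next
    case (3 m)
    have "\<bar>\<beta> t\<bar> * \<bar>psi \<beta> (Suc m) t\<bar> \<le> ?C * (?C ^ Suc m / fact (Suc m))"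
      using \<beta>_le[OF t] p[of "Suc m"] B0 by (intro mult_mono) auto
    also have "\<dots> \<le> ?C ^ (m + 2) / fact m"
      using C by (auto simp: intro!: divide_left_mono mult_pos_pos fact_mono)
    finally have 1: "\<bar>\<beta> t\<bar> * \<bar>psi \<beta> (Suc m) t\<bar> \<le> ?C ^ (m + 2) / fact m" .
    have "\<bar>psi \<beta> m t\<bar> \<le> ?C ^ m / fact m" by (rule p)
    also have "\<dots> \<le> ?C ^ (m + 2) / fact m" using C by (intro divide_right_mono power_increasing) auto
    finally have 2: "\<bar>psi \<beta> m t\<bar> \<le> ?C ^ (m + 2) / fact m" .
    have "\<bar>pseq \<beta> n t\<bar> \<le> 2 * ?C ^ (m + 2) / fact m"
      using 1 2 abs_triangle_ineq[of "\<beta> t * psi \<beta> (Suc m) t" "psi \<beta> m t"] by (simp add: 3 pseq_simps abs_mult)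
    also have "\<dots> \<le> 2 * Kp ^ (m + 2) / fact (m + 2)"
    proof -
      have "(m + 2) * (m + 1) \<le> 2 ^ (m + 2) * 2 ^ (m + 2)"
        using less_exp[of "m + 2"] by (intro mult_le_mono) auto
      also have "\<dots> = (4::nat) ^ (m + 2)" by (simp flip: power_mult_distrib)
      finally have "real ((m + 2) * (m + 1)) \<le> real (4 ^ (m + 2))" by (simp only: of_nat_le_iff)
      then have "real ((m + 2) * (m + 1)) * (2 * ?C ^ (m + 2)) \<le> 4 ^ (m + 2) * (2 * ?C ^ (m + 2))"
        using C by (intro mult_right_mono) auto
      then have "real ((m + 2) * (m + 1)) * (2 * ?C ^ (m + 2)) \<le> 2 * Kp ^ (m + 2)"
        unfolding Kp_def power_mult_distrib by (simp only: mult_ac)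
      then have "real ((m + 2) * (m + 1)) * (2 * ?C ^ (m + 2)) / fact (m + 2) \<le> 2 * Kp ^ (m + 2) / fact (m + 2)"
        by (intro divide_right_mono) auto
      moreover have "real ((m + 2) * (m + 1)) * (2 * ?C ^ (m + 2)) / fact (m + 2) = 2 * ?C ^ (m + 2) / fact m"
      proof -
        have "(fact (m + 2) :: real) = real ((m + 2) * (m + 1)) * fact m" by (simp add: algebra_simps)
        moreover have "real ((m + 2) * (m + 1)) \<noteq> 0" unfolding of_nat_eq_0_iff by simp
        moreover have "a * c / (a * d) = c / d" if "a \<noteq> 0" for a c d :: real using that by simp
        ultimately show ?thesis by presburger
      qed
      ultimately show ?thesis by simp
    qed
    finally show ?thesis by (simp add: 3)
  qed
qed

lemma psi_coeff_bound: "x \<in> {0..1} \<Longrightarrow> power_coeff_bound (\<lambda>n. of_real (psi \<beta> n x)) 1 (B + 1)"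
  unfolding power_coeff_bound_def
proof (intro conjI allI)
  fix n assume x: "x \<in> {0..1}"
  have "\<bar>psi \<beta> n x\<bar> \<le> (B + 1) ^ n * x ^ n / fact n" by (rule psi_bound[OF x])
  also have "\<dots> \<le> (B + 1) ^ n * 1 / fact n"
    using x B0 by (intro divide_right_mono mult_left_mono power_le_one) auto
  finally show "norm (complex_of_real (psi \<beta> n x)) \<le> 1 * (B + 1) ^ n / fact n" by simp
qed (use B0 in auto)

lemma pseq_coeff_bound: "t \<in> {0<..<1} \<Longrightarrow> power_coeff_bound (\<lambda>n. of_real (pseq \<beta> n t)) 2 Kp"
  using pseq_bound Kp by (auto simp: power_coeff_bound_def)

text \<open>The numbers \<open>pseq\<close> are the coefficients of potential times solution. About
  \<open>z\<close> the potential is a quadratic polynomial in the increment, namely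
  \<open>Q\<close>, and its three coefficients are those in \<open>qcoeff\<close>.\<close>

lemma taylor_pseq:
  assumes t: "t \<in> {0<..<1}"
  shows "taylor_coeff (\<lambda>n. of_real (pseq \<beta> n t)) z j = qcoeff \<beta> j z t"
proof -
  let ?s = "\<lambda>n. complex_of_real (psi \<beta> n t)" and ?p = "\<lambda>n. complex_of_real (pseq \<beta> n t)"
  have sb: "power_coeff_bound ?s 1 (B + 1)" by (rule psi_coeff_bound) (use t in auto)
  have pb: "power_coeff_bound ?p 2 Kp" by (rule pseq_coeff_bound[OF t])
  have e: "entire_of ?p w = (of_real (\<beta> t) * w + w\<^sup>2) * entire_of ?s w" for w
  proof -
    have s0: "(\<lambda>n. ?s n * w ^ n) sums entire_of ?s w" by (rule entire_of_sums[OF sb])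
    define c where "c n = (case n of 0 \<Rightarrow> 0 | Suc m \<Rightarrow> ?s m * w ^ m)" for n
    have c: "c sums entire_of ?s w" using s0 sums_Suc_iff[of c] by (simp add: c_def)
    define d where "d n = (case n of 0 \<Rightarrow> 0 | Suc m \<Rightarrow> c m)" for n
    have d: "d sums entire_of ?s w" using c sums_Suc_iff[of d] by (simp add: d_def)
    have "?p n * w ^ n = of_real (\<beta> t) * w * c n + w\<^sup>2 * d n" for n
    proof -
      consider "n = 0" | "n = Suc 0" | m where "n = Suc (Suc m)" by (metis not0_implies_Suc)
      then show ?thesis by cases (simp_all add: c_def d_def pseq_simps power2_eq_square algebra_simps)
    qed
    then have "(\<lambda>n. ?p n * w ^ n) sums (of_real (\<beta> t) * w * entire_of ?s w + w\<^sup>2 * entire_of ?s w)"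
      using sums_add[OF sums_mult[OF c, of "of_real (\<beta> t) * w"] sums_mult[OF d, of "w\<^sup>2"]] by simp
    then show ?thesis using entire_of_sums[OF pb, of w] sums_unique2 by (fastforce simp: distrib_right)
  qed
  define Q where "Q = fps_const (z\<^sup>2 + z * of_real (\<beta> t)) + fps_const (of_real (\<beta> t) + 2 * z) * fps_X + fps_X ^ 2"
  have Q: "(\<lambda>w. of_real (\<beta> t) * (z + w) + (z + w)\<^sup>2) has_fps_expansion Q"
  proof -
    have "(\<lambda>w. (z\<^sup>2 + z * of_real (\<beta> t)) + (of_real (\<beta> t) + 2 * z) * w + w ^ 2) has_fps_expansion Q"
      unfolding Q_def by (intro fps_expansion_intros)
    moreover have "(z\<^sup>2 + z * of_real (\<beta> t)) + (of_real (\<beta> t) + 2 * z) * w + w ^ 2 = of_real (\<beta> t) * (z + w) + (z + w)\<^sup>2" for w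
      by (simp add: power2_eq_square algebra_simps)
    ultimately show ?thesis by simp
  qed
  have "(\<lambda>w. entire_of ?p (z + w)) has_fps_expansion Q * Abs_fps (taylor_coeff ?s z)"
    unfolding e by (intro has_fps_expansion_mult Q taylor_coeff_fps_expansion[OF sb])
  then have "Abs_fps (taylor_coeff ?p z) = Q * Abs_fps (taylor_coeff ?s z)"
    using fps_expansion_unique_complex taylor_coeff_fps_expansion[OF pb] by blast
  then have "taylor_coeff ?p z j = (Q * Abs_fps (taylor_coeff ?s z)) $ j"
    by (metis fps_nth_Abs_fps)
  also have "\<dots> = qcoeff \<beta> j z t"
  proof -
    consider "j = 0" | "j = Suc 0" | m where "j = Suc (Suc m)" by (metis not0_implies_Suc)
    then show ?thesis
      by cases (simp_all add: Q_def qcoeff_def ycoeff_def distrib_right mult.assoc fps_X_power_mult_nth fps_mult_nth_0 numeral_2_eq_2)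
  qed
  finally show ?thesis .
qed

lemma ycoeff_bounded: "\<exists>C\<ge>0. \<forall>x\<in>{0..1}. norm (ycoeff \<beta> j z x) \<le> C"
proof (cases "j < 2")
  case True then show ?thesis by (auto simp: ycoeff_def)
next
  case False
  let ?S = "\<Sum>n. real ((n + (j - 2)) choose (j - 2)) * norm z ^ n * (1 * (B + 1) ^ (n + (j - 2)) / fact (n + (j - 2)))"
  have "norm (ycoeff \<beta> j z x) \<le> ?S" if "x \<in> {0..1}" for x
    using norm_taylor_coeff_le(1)[OF psi_coeff_bound[OF that], of z "j - 2"] False by (simp add: ycoeff_def)
  then have "norm (ycoeff \<beta> j z x) \<le> \<bar>?S\<bar>" if "x \<in> {0..1}" for x
    using that abs_ge_self order_trans by blast
  then show ?thesis by (intro exI[of _ "\<bar>?S\<bar>"]) simp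
qed

lemma ycoeff_measurable [measurable]: "ycoeff \<beta> j z \<in> borel_measurable unit_lebesgue"
proof (cases "j < 2")
  case True then show ?thesis by (simp add: ycoeff_def[abs_def])
next
  case False
  have "(\<lambda>x. taylor_coeff (\<lambda>n. of_real (psi \<beta> n x)) z (j - 2)) \<in> borel_measurable unit_lebesgue"
  proof -
    have [measurable]: "psi \<beta> n \<in> borel_measurable unit_lebesgue" for n by (rule bfun_measurable[OF bfun_psi])
    show ?thesis unfolding taylor_coeff_def by measurable
  qed
  then show ?thesis using False by (simp add: ycoeff_def[abs_def])
qed

lemma ycoeff_L2: "ycoeff \<beta> j z \<in> L2 unit_lebesgue"
proof -
  obtain C where "C \<ge> 0" and C: "\<forall>x\<in>{0..1}. norm (ycoeff \<beta> j z x) \<le> C" using ycoeff_bounded by blast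
  show ?thesis by (rule bounded_L2[where B = C]) (use C in auto)
qed

lemma L2_beta_mult': "f \<in> L2 unit_lebesgue \<Longrightarrow> (\<lambda>x. (c + d * of_real (\<beta> x)) * f x) \<in> L2 unit_lebesgue"
proof (rule L2_bounded_mult[where B = "norm c + norm d * B"])
  show "(\<lambda>x. c + d * of_real (\<beta> x)) \<in> borel_measurable unit_lebesgue"
    using bfun_measurable[OF b] by measurable
  fix x :: real assume x: "x \<in> {0<..<1}"
  have "norm (c + d * of_real (\<beta> x)) \<le> norm c + norm d * \<bar>\<beta> x\<bar>"
    using norm_triangle_ineq[of c "d * of_real (\<beta> x)"] by (simp add: norm_mult)
  also have "\<dots> \<le> norm c + norm d * B" by (intro add_left_mono mult_left_mono \<beta>_le x) auto
  finally show "norm (c + d * of_real (\<beta> x)) \<le> norm c + norm d * B" .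
qed

lemma qcoeff_L2: "qcoeff \<beta> j z \<in> L2 unit_lebesgue"
proof -
  have "(\<lambda>t. (z\<^sup>2 + z * of_real (\<beta> t)) * ycoeff \<beta> (j + 2) z t + (2 * z + 1 * of_real (\<beta> t)) * ycoeff \<beta> (j + 1) z t + ycoeff \<beta> j z t) \<in> L2 unit_lebesgue"
    by (intro L2_add L2_beta_mult' ycoeff_L2)
  then show ?thesis by (simp add: qcoeff_def[abs_def] add.commute)
qed

text \<open>The equation \<open>psi_eq\<close> is summed over \<open>n\<close> with the weights of
  the Taylor coefficient; the uniform majorant permits the exchange with the integral. The
  inhomogeneity \<open>x\<close> does not depend on \<zeta>, so it survives for \<open>j = 0\<close>
  only.\<close>

theorem ycoeff_eq:
  assumes x: "x \<in> {0..1}"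
  shows "ycoeff \<beta> (j + 2) z x = (if j = 0 then of_real x else 0) + volt (qcoeff \<beta> j z) x"
proof -
  let ?c = "\<lambda>n. complex_of_nat ((n + j) choose j) * z ^ n"
  let ?V = "\<lambda>n. LINT t|unit_lebesgue. max 0 (x - t) * pseq \<beta> n t"
  have y: "(\<lambda>n. ?c n * of_real (psi \<beta> (n + j) x)) sums ycoeff \<beta> (j + 2) z x"
    unfolding ycoeff_def taylor_coeff_def
    using summable_sums[OF summable_norm_cancel[OF taylor_coeff_eq(2)[OF psi_coeff_bound[OF x], where k = j and z = z]]] by simp
  have "(\<lambda>n. LINT t|unit_lebesgue. (?c n * of_real (pseq \<beta> (n + j) t)) * of_real (max 0 (x - t))) sums
      (LINT t|unit_lebesgue. qcoeff \<beta> j z t * of_real (max 0 (x - t)))"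
  proof (rule sums_integral_bounded[OF bfun_L2[OF bfun_max_diff]])
    let ?b = "\<lambda>n. real ((n + j) choose j) * norm z ^ n * (2 * Kp ^ (n + j) / fact (n + j))"
    show "(\<lambda>t. ?c n * of_real (pseq \<beta> (n + j) t)) \<in> borel_measurable unit_lebesgue" for n
      using bfun_measurable[OF bfun_pseq] by measurable
    show "norm (?c n * of_real (pseq \<beta> (n + j) t)) \<le> ?b n" if "t \<in> {0<..<1}" for n t
      unfolding norm_mult norm_power norm_of_nat norm_of_real using pseq_bound[OF that] by (intro mult_left_mono) auto
    show "summable ?b"
      using norm_taylor_coeff_le(2)[OF pseq_coeff_bound[of "1/2"]] by simp
    show "(\<lambda>n. ?c n * of_real (pseq \<beta> (n + j) t)) sums qcoeff \<beta> j z t" if t: "t \<in> {0<..<1}" for t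
      unfolding taylor_pseq[OF t, symmetric] taylor_coeff_def
      using summable_sums[OF summable_norm_cancel[OF taylor_coeff_eq(2)[OF pseq_coeff_bound[OF t], where k = j and z = z]]] by simp
  qed
  moreover have "(LINT t|unit_lebesgue. (?c n * of_real (pseq \<beta> (n + j) t)) * of_real (max 0 (x - t))) = ?c n * of_real (?V (n + j))" for n
  proof -
    have "(LINT t|unit_lebesgue. (?c n * of_real (pseq \<beta> (n + j) t)) * of_real (max 0 (x - t))) =
        (LINT t|unit_lebesgue. ?c n * of_real (max 0 (x - t) * pseq \<beta> (n + j) t))" by (simp add: mult_ac)
    then show ?thesis by (simp only: integral_mult_right_zero integral_complex_of_real)
  qed
  ultimately have v: "(\<lambda>n. ?c n * of_real (?V (n + j))) sums volt (qcoeff \<beta> j z) x"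
    by (simp add: volt_def mult.commute)
  have i: "(\<lambda>n. if n + j = 0 then complex_of_real x else 0) sums (if j = 0 then of_real x else 0)"
  proof (cases "j = 0")
    case True then show ?thesis using sums_single[of 0 "\<lambda>n. complex_of_real x"] by simp
  qed simp
  have "?c n * of_real (psi \<beta> (n + j) x) = (if n + j = 0 then complex_of_real x else 0) + ?c n * of_real (?V (n + j))" for n
    by (subst psi_eq) (simp add: distrib_left)
  then have "(\<lambda>n. ?c n * of_real (psi \<beta> (n + j) x)) sums ((if j = 0 then of_real x else 0) + volt (qcoeff \<beta> j z) x)"
    using sums_add[OF i v] by simp
  with y show ?thesis by (rule sums_unique2)
qed

definition chfun :: "complex \<Rightarrow> complex" where
  "chfun = entire_of (\<lambda>n. of_real (psi \<beta> n 1))"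

lemma chfun_bound: "power_coeff_bound (\<lambda>n. of_real (psi \<beta> n 1)) 1 (B + 1)"
  by (rule psi_coeff_bound) simp

lemma holomorphic_chfun: "chfun holomorphic_on UNIV"
  unfolding chfun_def by (rule holomorphic_entire_of[OF chfun_bound])

lemma norm_chfun_le: "norm (chfun z) \<le> exp ((B + 1) * norm z)"
  using norm_entire_of_le[OF chfun_bound, of z] by (simp add: chfun_def)

lemma chfun_0: "chfun 0 = 1"
  using entire_of_sums[OF chfun_bound, of 0] psi_eq[of \<beta> 0 1] powser_sums_zero_iff[of "\<lambda>n. complex_of_real (psi \<beta> n 1)"]
  by (simp add: chfun_def pseq_simps)

text \<open>The link between chains and zeros: the boundary values at 1 are the Taylor coefficients
  of \<open>chfun\<close>, so the first nonzero one marks the order of the zero.\<close>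

lemma ycoeff_1: "ycoeff \<beta> (j + 2) z 1 = (deriv ^^ j) chfun z / fact j"
  using taylor_coeff_eq(1)[OF chfun_bound, of z j] by (simp add: ycoeff_def chfun_def)

lemma chfun_fps: "chfun has_fps_expansion Abs_fps (\<lambda>n. of_real (chard \<beta> $ n))"
proof -
  have "taylor_coeff (\<lambda>n. of_real (psi \<beta> n 1)) 0 k = of_real (psi \<beta> k 1)" for k
  proof -
    have "(\<lambda>n. complex_of_nat ((n + k) choose k) * 0 ^ n * of_real (psi \<beta> (n + k) 1)) sums of_real (psi \<beta> k 1)"
      using powser_sums_zero[of "\<lambda>n. complex_of_nat ((n + k) choose k) * of_real (psi \<beta> (n + k) 1)"]
      by (simp add: mult_ac)
    then show ?thesis unfolding taylor_coeff_def by (rule sums_unique[symmetric])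
  qed
  then have "taylor_coeff (\<lambda>n. of_real (psi \<beta> n 1)) 0 = (\<lambda>n. of_real (chard \<beta> $ n))"
    by (simp add: fun_eq_iff psi_def chard_def)
  then show ?thesis
    using taylor_coeff_fps_expansion[OF chfun_bound, of 0] by (simp add: chfun_def)
qed

end

section \<open>Eigenvalues and algebraic multiplicities\<close>

text \<open>Gaussian elimination, one equation at a time: a pivot \<open>l0\<close> is removed and
  its coefficient recovered from the eliminated equation. This is all the dimension theory that the
  multiplicities need.\<close>

lemma underdetermined_system:
  fixes C :: "'i \<Rightarrow> nat \<Rightarrow> complex"
  assumes "finite S" "card S > m"
  shows "\<exists>c. (\<exists>l\<in>S. c l \<noteq> 0) \<and> (\<forall>i<m. (\<Sum>l\<in>S. c l * C l i) = 0)"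
  using assms
proof (induction m arbitrary: S C)
  case 0
  then obtain l where "l \<in> S" by fastforce
  then show ?case by (intro exI[of _ "\<lambda>_. 1"]) auto
next
  case (Suc m)
  show ?case
  proof (cases "\<forall>l\<in>S. C l m = 0")
    case True
    obtain c where c: "\<exists>l\<in>S. c l \<noteq> 0" "\<forall>i<m. (\<Sum>l\<in>S. c l * C l i) = 0"
      using Suc.IH[OF Suc.prems(1), of C] Suc.prems(2) by auto
    then show ?thesis using True by (intro exI[of _ c]) (auto simp: less_Suc_eq)
  next
    case False
    then obtain l0 where l0: "l0 \<in> S" "C l0 m \<noteq> 0" by blast
    define S' where "S' = S - {l0}"
    define C' where "C' l i = C l i - C l m / C l0 m * C l0 i" for l i
    have S': "finite S'" "card S' > m" using Suc.prems l0 by (auto simp: S'_def)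
    obtain c where c: "\<exists>l\<in>S'. c l \<noteq> 0" "\<forall>i<m. (\<Sum>l\<in>S'. c l * C' l i) = 0"
      using Suc.IH[OF S', of C'] by blast
    define d where "d l = (if l = l0 then - (\<Sum>l\<in>S'. c l * C l m) / C l0 m else c l)" for l
    have sum: "(\<Sum>l\<in>S. d l * C l i) = (\<Sum>l\<in>S'. c l * C' l i)" for i
    proof -
      have "(\<Sum>l\<in>S. d l * C l i) = d l0 * C l0 i + (\<Sum>l\<in>S'. d l * C l i)"
        unfolding S'_def by (rule sum.remove[OF Suc.prems(1) l0(1)])
      also have "(\<Sum>l\<in>S'. d l * C l i) = (\<Sum>l\<in>S'. c l * C l i)"
        by (intro sum.cong) (auto simp: d_def S'_def)
      also have "d l0 * C l0 i = - (\<Sum>l\<in>S'. c l * (C l m / C l0 m * C l0 i))"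
        unfolding d_def by (simp add: sum_distrib_right sum_divide_distrib sum_negf) (simp add: sum_distrib_left mult_ac)
      finally show ?thesis by (simp add: C'_def right_diff_distrib sum_subtractf)
    qed
    have "C' l m = 0" for l using l0 by (simp add: C'_def)
    then have "\<forall>i<Suc m. (\<Sum>l\<in>S. d l * C l i) = 0"
      unfolding sum using c(2) by (auto simp: less_Suc_eq)
    moreover have "\<exists>l\<in>S. d l \<noteq> 0" using c(1) by (auto simp: d_def S'_def)
    ultimately show ?thesis by blast
  qed
qed

lemma volt_add: "f \<in> L2 unit_lebesgue \<Longrightarrow> g \<in> L2 unit_lebesgue \<Longrightarrow> volt (\<lambda>t. f t + g t) x = volt f x + volt g x"
  unfolding volt_def using volt_integrable[of f x] volt_integrable[of g x] by (simp add: distrib_left)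

lemma volt_diff: "f \<in> L2 unit_lebesgue \<Longrightarrow> g \<in> L2 unit_lebesgue \<Longrightarrow> volt (\<lambda>t. f t - g t) x = volt f x - volt g x"
  unfolding volt_def using volt_integrable[of f x] volt_integrable[of g x] by (simp add: right_diff_distrib)

lemma volt_cmult: "volt (\<lambda>t. c * f t) x = c * volt f x"
  unfolding volt_def by (simp add: mult.left_commute)

lemma volt_zero: "volt (\<lambda>t. 0) x = 0"
  by (simp add: volt_def)

lemma volt_sum:
  "(\<And>i. i \<in> A \<Longrightarrow> f i \<in> L2 unit_lebesgue) \<Longrightarrow> volt (\<lambda>t. \<Sum>i\<in>A. f i t) x = (\<Sum>i\<in>A. volt (f i) x)"
  by (induction A rule: infinite_finite_induct) (auto simp: volt_zero volt_add L2_sum)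

lemma volt_cong_AE:
  assumes "f \<in> L2 unit_lebesgue" "g \<in> L2 unit_lebesgue" "AE t in unit_lebesgue. f t = g t"
  shows "volt f x = volt g x"
  unfolding volt_def using L2_measurable[OF assms(1)] L2_measurable[OF assms(2)] assms(3)
  by (intro integral_cong_AE) auto

lemma dirichlet_graph_cong_AE:
  assumes "dirichlet_laplacian_graph f g" "f' \<in> L2 unit_lebesgue" "AE x in unit_lebesgue. f x = f' x"
  shows "dirichlet_laplacian_graph f' g"
proof -
  obtain c where c: "g \<in> L2 unit_lebesgue" "AE x in unit_lebesgue. f x = c * of_real x + volt g x" "c + volt g 1 = 0"
    using assms(1) unfolding dirichlet_laplacian_graph_iff by blast
  have "AE x in unit_lebesgue. f' x = c * of_real x + volt g x"
    using c(2) assms(3) by eventually_elim simp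
  then show ?thesis unfolding dirichlet_laplacian_graph_iff using c assms(2) by blast
qed

lemma AE_finite_sum_zero:
  fixes c :: "'i \<Rightarrow> complex"
  assumes "finite S" "\<And>l. l \<in> S \<Longrightarrow> AE x in M. f l x = g l x"
  shows "AE x in M. (\<Sum>l\<in>S. c l * f l x) = (\<Sum>l\<in>S. c l * g l x)"
proof -
  have "AE x in M. \<forall>l\<in>S. f l x = g l x" using assms by (simp add: AE_finite_all)
  then show ?thesis by eventually_elim (auto intro: sum.cong)
qed

context bounded_damping
begin

text \<open>\<open>u\<close> agrees almost everywhere with a continuous \<open>w\<close>, for which
  pointwise estimates make sense; iterating the equation bounds \<open>w\<close> by
  \<open>N * Q ^ j / fact (2 * j)\<close> for every \<open>j\<close>.\<close>

lemma volterra_unique: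
  assumes u: "u \<in> L2 unit_lebesgue"
    and eq: "AE x in unit_lebesgue. u x = volt (\<lambda>t. (c + d * of_real (\<beta> t)) * u t) x"
  shows "AE x in unit_lebesgue. u x = 0"
proof -
  define q where "q t = c + d * complex_of_real (\<beta> t)" for t
  define Q where "Q = norm c + norm d * B"
  have Q0: "Q \<ge> 0" using B0 by (simp add: Q_def)
  have qQ: "norm (q t) \<le> Q" if t: "t \<in> {0<..<1}" for t
  proof -
    have "norm (q t) \<le> norm c + norm d * \<bar>\<beta> t\<bar>"
      using norm_triangle_ineq[of c "d * of_real (\<beta> t)"] by (simp add: norm_mult q_def)
    also have "\<dots> \<le> Q" unfolding Q_def by (intro add_left_mono mult_left_mono \<beta>_le t) auto
    finally show ?thesis .
  qed
  have qm: "q \<in> borel_measurable unit_lebesgue" unfolding q_def using bfun_measurable[OF b] by measurable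
  have qu: "(\<lambda>t. q t * u t) \<in> L2 unit_lebesgue" by (rule L2_bounded_mult[OF qm qQ u])
  define w where "w = volt (\<lambda>t. q t * u t)"
  have uw: "AE x in unit_lebesgue. u x = w x" using eq by (simp add: w_def q_def)
  have wc: "continuous_on {0..1} w" unfolding w_def by (rule continuous_on_volt[OF qu])
  obtain N where N: "\<And>x. x \<in> {0..1} \<Longrightarrow> norm (w x) \<le> N" using continuous_unit_bounded[OF wc] by blast
  have N0: "N \<ge> 0" using N[of 0] by (auto intro: order_trans[OF norm_ge_zero])
  have wm: "w \<in> borel_measurable unit_lebesgue" by (rule continuous_unit_lebesgue_measurable[OF wc])
  have w2: "w \<in> L2 unit_lebesgue" by (rule bounded_L2[OF wm, of N]) (use N in auto)
  have qw: "(\<lambda>t. q t * w t) \<in> L2 unit_lebesgue" by (rule L2_bounded_mult[OF qm qQ w2])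
  have weq: "w x = volt (\<lambda>t. q t * w t) x" for x
    unfolding w_def[THEN fun_cong]
    by (rule volt_cong_AE[OF qu]) (use qw uw in \<open>auto simp: w_def elim: eventually_mono\<close>)
  have bound: "norm (w x) \<le> N * Q ^ j * x ^ (2 * j) / fact (2 * j)" if "x \<in> {0..1}" for x j
    using that
  proof (induction j arbitrary: x)
    case 0 then show ?case using N by simp
  next
    case (Suc j)
    have "norm (w x) \<le> (LINT t|unit_lebesgue. norm (of_real (max 0 (x - t)) * (q t * w t)))"
      by (subst weq) (unfold volt_def, rule integral_norm_bound)
    also have "\<dots> = (LINT t|unit_lebesgue. max 0 (x - t) * norm (q t * w t))"
      by (simp add: norm_mult)
    also have "\<dots> \<le> (N * Q ^ Suc j) * x ^ (2 * j + 2) / fact (2 * j + 2)"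
    proof (rule order_trans[OF abs_ge_self volterra_step[OF Suc.prems]])
      show "(\<lambda>t. norm (q t * w t)) \<in> borel_measurable unit_lebesgue" using qm wm by measurable
      fix t :: real assume t: "t \<in> {0<..<1}"
      have "norm (q t) * norm (w t) \<le> Q * (N * Q ^ j * t ^ (2 * j) / fact (2 * j))"
        using qQ[OF t] Suc.IH[of t] t Q0 by (intro mult_mono) auto
      then show "\<bar>norm (q t * w t)\<bar> \<le> N * Q ^ Suc j * t ^ (2 * j) / fact (2 * j)"
        by (simp add: norm_mult mult_ac)
    qed
    finally show ?case by simp
  qed
  have "w x = 0" if x: "x \<in> {0..1}" for x
  proof -
    have le: "norm (w x) \<le> N * (Q ^ j /\<^sub>R fact j)" for j
    proof -
      have "N * Q ^ j * x ^ (2 * j) / fact (2 * j) \<le> N * Q ^ j * 1 / fact j"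
        using x N0 Q0 by (intro frac_le mult_left_mono power_le_one fact_mono mult_nonneg_nonneg) auto
      then show ?thesis using bound[OF x, of j] by (simp add: divide_inverse mult_ac)
    qed
    have "(\<lambda>j. N * (Q ^ j /\<^sub>R fact j)) \<longlonglongrightarrow> N * 0"
      by (intro tendsto_mult tendsto_const summable_LIMSEQ_zero summable_exp_generic)
    then have "norm (w x) \<le> N * 0" by (rule LIMSEQ_le_const) (use le in auto)
    then show ?thesis by simp
  qed
  then have "AE x in unit_lebesgue. w x = 0" by (intro AE_I2) auto
  with uw show ?thesis by eventually_elim simp
qed

section \<open>The initial value problem at 0 and the boundary condition at 1\<close>

lemma qcoeff_0: "qcoeff \<beta> 0 z t = (z\<^sup>2 + z * of_real (\<beta> t)) * ycoeff \<beta> 2 z t"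
  by (simp add: qcoeff_def ycoeff_def)

lemma ycoeff_2:
  "x \<in> {0..1} \<Longrightarrow> ycoeff \<beta> 2 z x = of_real x + volt (qcoeff \<beta> 0 z) x"
  using ycoeff_eq[of x 0 z] unfolding add_0 by (simp only: if_True refl)

lemma ycoeff_less_2: "ycoeff \<beta> 0 z x = 0" "ycoeff \<beta> (Suc 0) z x = 0"
  by (simp_all add: ycoeff_def)

lemma ycoeff_2_1: "ycoeff \<beta> 2 z 1 = chfun z"
  using ycoeff_1[of 0 z] unfolding add_0 by simp

text \<open>The hypothesis is the initial value problem with value 0 and slope \<open>c\<close> at
  0, which \<open>c * ycoeff \<beta> 2 z x\<close> solves as well; the difference falls under
  \<open>volterra_unique\<close>.\<close>

lemma volterra_solution:
  assumes f: "f \<in> L2 unit_lebesgue"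
    and eq: "AE x in unit_lebesgue. f x = c * of_real x + volt (\<lambda>t. (z\<^sup>2 + z * of_real (\<beta> t)) * f t) x"
  shows "AE x in unit_lebesgue. f x = c * ycoeff \<beta> 2 z x"
proof -
  let ?q = "\<lambda>t. z\<^sup>2 + z * complex_of_real (\<beta> t)"
  have y: "ycoeff \<beta> 2 z \<in> L2 unit_lebesgue" by (rule ycoeff_L2)
  have u: "(\<lambda>x. f x - c * ycoeff \<beta> 2 z x) \<in> L2 unit_lebesgue" by (intro L2_diff L2_cmult f y)
  have x01: "AE x in unit_lebesgue. x \<in> {0<..<1}" by (rule AE_I2) simp
  have "AE x in unit_lebesgue. f x - c * ycoeff \<beta> 2 z x = volt (\<lambda>t. ?q t * (f t - c * ycoeff \<beta> 2 z t)) x"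
    using eq x01
  proof eventually_elim
    case (elim x)
    have "volt (\<lambda>t. ?q t * (f t - c * ycoeff \<beta> 2 z t)) x = volt (\<lambda>t. ?q t * f t - c * (?q t * ycoeff \<beta> 2 z t)) x"
      by (simp add: algebra_simps)
    also have "\<dots> = volt (\<lambda>t. ?q t * f t) x - c * volt (\<lambda>t. ?q t * ycoeff \<beta> 2 z t) x"
      unfolding volt_cmult[symmetric] by (intro volt_diff L2_cmult L2_beta_mult' f y)
    also have "volt (\<lambda>t. ?q t * ycoeff \<beta> 2 z t) x = ycoeff \<beta> 2 z x - of_real x"
      using ycoeff_2[of x z] elim(2) by (simp add: qcoeff_0[abs_def])
    finally show ?case using elim(1) by (simp add: algebra_simps)
  qed
  from volterra_unique[OF u this] show ?thesis by simp
qed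

text \<open>The differential equation and the value 0 at 0 are contained in
  \<open>ycoeff_eq\<close>; the boundary value at 1 is the only obstruction.\<close>

lemma ycoeff_graph:
  assumes "ycoeff \<beta> (j + 2) z 1 = 0"
  shows "dirichlet_laplacian_graph (ycoeff \<beta> (j + 2) z) (qcoeff \<beta> j z)"
  unfolding dirichlet_laplacian_graph_iff
proof (intro conjI ycoeff_L2 qcoeff_L2 exI[of _ "if j = 0 then 1 else 0"])
  show "AE x in unit_lebesgue. ycoeff \<beta> (j + 2) z x = (if j = 0 then 1 else 0) * of_real x + volt (qcoeff \<beta> j z) x"
    by (rule AE_I2) (simp only: ycoeff_eq space_unit_lebesgue greaterThanLessThan_iff, subst ycoeff_eq, auto)
  show "(if j = 0 then 1 else 0) + volt (qcoeff \<beta> j z) 1 = 0"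
    using ycoeff_eq[of 1 j z] assms by auto
qed

lemma ycoeff_2_nonzero: "\<not> (AE x in unit_lebesgue. ycoeff \<beta> 2 z x = 0)"
proof
  assume z: "AE x in unit_lebesgue. ycoeff \<beta> 2 z x = 0"
  have x01: "AE x in unit_lebesgue. x \<in> {0<..<1}" by (rule AE_I2) simp
  have "AE x in unit_lebesgue. 1 * of_real x + volt (qcoeff \<beta> 0 z) x = 0"
    using z x01 by eventually_elim (use ycoeff_2[of _ z] in auto)
  from affine_volt_eq_0(1)[OF qcoeff_L2 this] show False by simp
qed

context
  fixes \<alpha> :: "real \<Rightarrow> real"
  assumes am: "\<alpha> \<in> borel_measurable unit_lebesgue" and ab: "AE x in unit_lebesgue. \<alpha> x = \<beta> x"
begin

lemma damped_wave_eigenvalue_iff: "damped_wave_eigenvalue \<alpha> z \<longleftrightarrow> chfun z = 0"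
proof
  assume "chfun z = 0"
  then have y1: "ycoeff \<beta> (0 + 2) z 1 = 0" by (simp only: ycoeff_1) simp
  have g: "dirichlet_laplacian_graph (ycoeff \<beta> 2 z) (qcoeff \<beta> 0 z)" using ycoeff_graph[OF y1] unfolding add_0 .
  have "AE x in unit_lebesgue. dirichlet_laplacian (ycoeff \<beta> 2 z) x - z * of_real (\<alpha> x) * ycoeff \<beta> 2 z x - z\<^sup>2 * ycoeff \<beta> 2 z x = 0"
    using dirichlet_laplacian_AE[OF g] ab by eventually_elim (simp add: qcoeff_0 algebra_simps)
  moreover have "ycoeff \<beta> 2 z \<in> dirichlet_dom" using g by (auto simp: dirichlet_dom_def)
  ultimately show "damped_wave_eigenvalue \<alpha> z"
    unfolding damped_wave_eigenvalue_def using ycoeff_2_nonzero by blast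
next
  assume "damped_wave_eigenvalue \<alpha> z"
  then obtain y where y: "y \<in> dirichlet_dom" "\<not> (AE x in unit_lebesgue. y x = 0)"
    and eq: "AE x in unit_lebesgue. dirichlet_laplacian y x - z * of_real (\<alpha> x) * y x - z\<^sup>2 * y x = 0"
    by (auto simp: damped_wave_eigenvalue_def)
  define g where "g = dirichlet_laplacian y"
  have G: "dirichlet_laplacian_graph y g" unfolding g_def by (rule dirichlet_laplacian_graph_dirichlet_laplacian[OF y(1)])
  then obtain c where y2: "y \<in> L2 unit_lebesgue" and g2: "g \<in> L2 unit_lebesgue"
    and yc: "AE x in unit_lebesgue. y x = c * of_real x + volt g x" and c: "c + volt g 1 = 0"
    unfolding dirichlet_laplacian_graph_iff by blast
  let ?q = "\<lambda>t. z\<^sup>2 + z * complex_of_real (\<beta> t)"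
  have gq: "AE t in unit_lebesgue. g t = ?q t * y t"
    using eq ab by eventually_elim (simp add: g_def algebra_simps)
  have v: "volt g x = volt (\<lambda>t. ?q t * y t) x" for x
    by (rule volt_cong_AE[OF g2 L2_beta_mult'[OF y2] gq])
  have ys: "AE x in unit_lebesgue. y x = c * ycoeff \<beta> 2 z x"
    by (rule volterra_solution[OF y2]) (use yc v in simp)
  have "volt g 1 = volt (\<lambda>t. c * (?q t * ycoeff \<beta> 2 z t)) 1"
    unfolding v
  proof (rule volt_cong_AE[OF L2_beta_mult'[OF y2] L2_cmult[OF L2_beta_mult'[OF ycoeff_L2]]])
    show "AE t in unit_lebesgue. ?q t * y t = c * (?q t * ycoeff \<beta> 2 z t)"
      using ys by eventually_elim simp
  qed
  also have "\<dots> = c * (ycoeff \<beta> 2 z 1 - 1)"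
    using ycoeff_2[of 1 z] unfolding volt_cmult by (simp add: qcoeff_0[abs_def])
  finally have "c * ycoeff \<beta> 2 z 1 = 0" using c by (simp add: algebra_simps)
  moreover have "c \<noteq> 0" using ys y(2) by auto
  ultimately show "chfun z = 0" using ycoeff_2_1[of z] by simp
qed

text \<open>The second component is the Taylor coefficient of \<zeta> y, with \<zeta> split as z +
  (\<zeta> - z). For \<open>j = 0\<close> the predecessor is one of the padding zeros of
  \<open>ycoeff\<close>.\<close>

definition jchain :: "complex \<Rightarrow> nat \<Rightarrow> l2_pair" where
  "jchain z j = (ycoeff \<beta> (j + 2) z, \<lambda>x. z * ycoeff \<beta> (j + 2) z x + ycoeff \<beta> (j + 1) z x)"

definition wshift :: "complex \<Rightarrow> l2_pair \<Rightarrow> l2_pair" where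
  "wshift z p = ((\<lambda>x. fst (damped_wave \<alpha> p) x - z * fst p x), (\<lambda>x. snd (damped_wave \<alpha> p) x - z * snd p x))"

lemma ker_pow_Suc: "p \<in> damped_wave_ker_pow \<alpha> z (Suc k) \<longleftrightarrow> p \<in> damped_wave_dom \<and> wshift z p \<in> damped_wave_ker_pow \<alpha> z k"
  by (simp add: wshift_def)

lemma wshift_simps:
  "fst (wshift z p) = (\<lambda>x. snd p x - z * fst p x)"
  "snd (wshift z p) = (\<lambda>x. dirichlet_laplacian (fst p) x - of_real (\<alpha> x) * snd p x - z * snd p x)"
  by (simp_all add: wshift_def damped_wave_def case_prod_unfold)

lemma dirichlet_dom_L2: "f \<in> dirichlet_dom \<Longrightarrow> f \<in> L2 unit_lebesgue \<and> dirichlet_laplacian f \<in> L2 unit_lebesgue"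
  using dirichlet_laplacian_graph_dirichlet_laplacian unfolding dirichlet_laplacian_graph_iff by blast

lemma damped_wave_dom_iff: "p \<in> damped_wave_dom \<longleftrightarrow> fst p \<in> dirichlet_dom \<and> snd p \<in> L2 unit_lebesgue"
  by (cases p) (auto simp: damped_wave_dom_def)

lemma wshift_L2:
  assumes p: "p \<in> damped_wave_dom"
  shows "fst (wshift z p) \<in> L2 unit_lebesgue" "snd (wshift z p) \<in> L2 unit_lebesgue"
  using assms dirichlet_dom_L2 L2_alpha_mult[OF b am ab] unfolding damped_wave_dom_iff wshift_simps
  by (auto intro!: L2_diff L2_cmult)

text \<open>The Laplacian is a chosen representative and the kernels consist of functions, so
  compatibility with equality almost everywhere has to be carried through every power.\<close>

lemma ker_pow_cong:
  assumes "p \<in> damped_wave_ker_pow \<alpha> z k" "fst q \<in> L2 unit_lebesgue" "snd q \<in> L2 unit_lebesgue"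
    and "AE x in unit_lebesgue. fst p x = fst q x" "AE x in unit_lebesgue. snd p x = snd q x"
  shows "q \<in> damped_wave_ker_pow \<alpha> z k"
  using assms
proof (induction k arbitrary: p q)
  case 0
  have "AE x in unit_lebesgue. fst q x = 0 \<and> snd q x = 0"
  proof -
    have "AE x in unit_lebesgue. fst p x = 0 \<and> snd p x = 0" using 0(1) by simp
    then show ?thesis using 0(4,5) by eventually_elim auto
  qed
  then show ?case using 0 by simp
next
  case (Suc k)
  have p: "p \<in> damped_wave_dom" "wshift z p \<in> damped_wave_ker_pow \<alpha> z k" using Suc.prems(1) unfolding ker_pow_Suc by auto
  have G: "dirichlet_laplacian_graph (fst p) (dirichlet_laplacian (fst p))"
    using p(1) dirichlet_laplacian_graph_dirichlet_laplacian by (auto simp: damped_wave_dom_iff)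
  have G': "dirichlet_laplacian_graph (fst q) (dirichlet_laplacian (fst p))"
    by (rule dirichlet_graph_cong_AE[OF G Suc.prems(2,4)])
  have q: "q \<in> damped_wave_dom" using G' Suc.prems(3) by (auto simp: damped_wave_dom_iff dirichlet_dom_def)
  have "wshift z q \<in> damped_wave_ker_pow \<alpha> z k"
  proof (rule Suc.IH[OF p(2) wshift_L2[OF q]])
    show "AE x in unit_lebesgue. fst (wshift z p) x = fst (wshift z q) x"
      using Suc.prems(4,5) unfolding wshift_simps by eventually_elim simp
    show "AE x in unit_lebesgue. snd (wshift z p) x = snd (wshift z q) x"
      using Suc.prems(5) dirichlet_laplacian_AE[OF G'] unfolding wshift_simps by eventually_elim simp
  qed
  then show ?case using q unfolding ker_pow_Suc by simp
qed

lemma jchain_L2: "fst (jchain z j) \<in> L2 unit_lebesgue" "snd (jchain z j) \<in> L2 unit_lebesgue"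
  by (auto simp: jchain_def intro!: L2_add L2_cmult ycoeff_L2)

text \<open>Formally, A - \<zeta> kills (y, \<zeta> y). Comparing powers of \<zeta> - z shows that A
  - z sends each member of the chain to its predecessor and the first one to 0.\<close>

lemma jchain_in_ker_pow:
  "(\<And>i. i \<le> j \<Longrightarrow> ycoeff \<beta> (i + 2) z 1 = 0) \<Longrightarrow> jchain z j \<in> damped_wave_ker_pow \<alpha> z (Suc j)"
proof (induction j)
  case (Suc j)
  have G: "dirichlet_laplacian_graph (ycoeff \<beta> (Suc j + 2) z) (qcoeff \<beta> (Suc j) z)" by (rule ycoeff_graph) (use Suc.prems in auto)
  have d: "jchain z (Suc j) \<in> damped_wave_dom"
    using G jchain_L2(2)[of z "Suc j"] by (auto simp: damped_wave_dom_iff dirichlet_dom_def jchain_def)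
  have "wshift z (jchain z (Suc j)) \<in> damped_wave_ker_pow \<alpha> z (Suc j)"
  proof (rule ker_pow_cong[OF _ wshift_L2[OF d]])
    show "jchain z j \<in> damped_wave_ker_pow \<alpha> z (Suc j)" by (rule Suc.IH) (use Suc.prems in auto)
    show "AE x in unit_lebesgue. fst (jchain z j) x = fst (wshift z (jchain z (Suc j))) x"
      unfolding wshift_simps by (simp add: jchain_def)
    show "AE x in unit_lebesgue. snd (jchain z j) x = snd (wshift z (jchain z (Suc j))) x"
      using dirichlet_laplacian_AE[OF G] ab unfolding wshift_simps jchain_def fst_conv snd_conv
      by eventually_elim (simp add: qcoeff_def power2_eq_square algebra_simps)
  qed
  then show ?case using d unfolding ker_pow_Suc[of _ _ "Suc j"] by simp
next
  case 0
  have G: "dirichlet_laplacian_graph (ycoeff \<beta> (0 + 2) z) (qcoeff \<beta> 0 z)" by (rule ycoeff_graph) (use 0 in auto)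
  have d: "jchain z 0 \<in> damped_wave_dom"
    using G jchain_L2(2)[of z 0] by (auto simp: damped_wave_dom_iff dirichlet_dom_def jchain_def)
  have y1: "ycoeff \<beta> 1 z x = 0" for x by (simp add: ycoeff_def)
  have "AE x in unit_lebesgue. fst (wshift z (jchain z 0)) x = 0 \<and> snd (wshift z (jchain z 0)) x = 0"
    using dirichlet_laplacian_AE[OF G] ab unfolding wshift_simps jchain_def fst_conv snd_conv
    by eventually_elim (simp add: qcoeff_0 y1 ycoeff_less_2 numeral_2_eq_2[symmetric] power2_eq_square algebra_simps)
  then show ?case using d wshift_L2[OF d] unfolding ker_pow_Suc[of _ _ 0] by simp
qed

text \<open>Induction on the power: (A - z) p is a combination of chain members with coefficients
  \<open>c\<close>. Moving these one place up the chain and subtracting leaves a solution of the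
  initial value problem, that is, a multiple \<open>c'\<close> of the solution y. The result has m +
  1 terms, and the condition at 1 removes the last, the only one with a nonzero boundary
  value.\<close>

lemma ker_pow_span:
  assumes m: "\<And>i. i < m \<Longrightarrow> ycoeff \<beta> (i + 2) z 1 = 0" "ycoeff \<beta> (m + 2) z 1 \<noteq> 0"
  shows "p \<in> damped_wave_ker_pow \<alpha> z k \<Longrightarrow> \<exists>c. (AE x in unit_lebesgue. fst p x = (\<Sum>i<m. c i * fst (jchain z i) x)) \<and>
    (AE x in unit_lebesgue. snd p x = (\<Sum>i<m. c i * snd (jchain z i) x))"
proof (induction k arbitrary: p)
  case 0
  then have "AE x in unit_lebesgue. fst p x = 0 \<and> snd p x = 0" by simp
  then show ?case by (intro exI[of _ "\<lambda>_. 0"]) (auto elim: eventually_mono)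
next
  case (Suc k)
  let ?Y = "\<lambda>i. ycoeff \<beta> i z"
  define f h where "f = fst p" and "h = snd p"
  have p: "p \<in> damped_wave_dom" "wshift z p \<in> damped_wave_ker_pow \<alpha> z k" using Suc.prems unfolding ker_pow_Suc by auto
  define g where "g = dirichlet_laplacian f"
  have G: "dirichlet_laplacian_graph f g"
    using p(1) dirichlet_laplacian_graph_dirichlet_laplacian by (auto simp: damped_wave_dom_iff f_def g_def)
  then obtain c' where f2: "f \<in> L2 unit_lebesgue" and g2: "g \<in> L2 unit_lebesgue"
    and fc: "AE x in unit_lebesgue. f x = c' * of_real x + volt g x" and c': "c' + volt g 1 = 0"
    unfolding dirichlet_laplacian_graph_iff by blast
  obtain c where c: "AE x in unit_lebesgue. h x - z * f x = (\<Sum>i<m. c i * ?Y (i + 2) x)"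
    "AE x in unit_lebesgue. g x - of_real (\<alpha> x) * h x - z * h x = (\<Sum>i<m. c i * (z * ?Y (i + 2) x + ?Y (i + 1) x))"
    using Suc.IH[OF p(2)] unfolding wshift_simps by (auto simp: f_def h_def g_def jchain_def)
  let ?q = "\<lambda>t. z\<^sup>2 + z * complex_of_real (\<beta> t)"
  \<comment> \<open>Index \<open>i + 3\<close> belongs to the chain successor of the member with
    first component \<open>?Y (i + 2)\<close>; what is left should be a multiple of
    \<open>?Y 2\<close>.\<close>
  define w where "w x = f x - (\<Sum>i<m. c i * ?Y (i + 3) x)" for x
  have w2: "w \<in> L2 unit_lebesgue" unfolding w_def by (intro L2_diff f2 L2_sum L2_cmult ycoeff_L2)
  have gw: "AE t in unit_lebesgue. g t = ?q t * w t + (\<Sum>i<m. c i * qcoeff \<beta> (i + 1) z t)"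
    using c ab
  proof eventually_elim
    case (elim x)
    have h: "h x = z * f x + (\<Sum>i<m. c i * ?Y (i + 2) x)" using elim(1) by (simp add: algebra_simps)
    have "g x = (of_real (\<beta> x) + z) * h x + (\<Sum>i<m. c i * (z * ?Y (i + 2) x + ?Y (i + 1) x))"
      using elim(2,3) by (simp add: algebra_simps)
    also have "\<dots> = ?q x * f x + (\<Sum>i<m. c i * ((of_real (\<beta> x) + 2 * z) * ?Y (i + 2) x + ?Y (i + 1) x))"
      unfolding h by (simp add: algebra_simps sum.distrib sum_distrib_left power2_eq_square)
    also have "\<dots> = ?q x * w x + (\<Sum>i<m. c i * qcoeff \<beta> (i + 1) z x)"
      unfolding w_def qcoeff_def
      by (simp add: algebra_simps sum.distrib sum_distrib_left numeral_eq_Suc)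
    finally show ?case .
  qed
  have vg: "volt g x = volt (\<lambda>t. ?q t * w t) x + (\<Sum>i<m. c i * volt (qcoeff \<beta> (i + 1) z) x)" for x
  proof -
    have s2: "(\<lambda>t. \<Sum>i<m. c i * qcoeff \<beta> (i + 1) z t) \<in> L2 unit_lebesgue" by (intro L2_sum L2_cmult qcoeff_L2)
    have "volt g x = volt (\<lambda>t. ?q t * w t + (\<Sum>i<m. c i * qcoeff \<beta> (i + 1) z t)) x"
      by (rule volt_cong_AE[OF g2 L2_add[OF L2_beta_mult'[OF w2] s2] gw])
    also have "\<dots> = volt (\<lambda>t. ?q t * w t) x + volt (\<lambda>t. \<Sum>i<m. c i * qcoeff \<beta> (i + 1) z t) x"
      by (rule volt_add[OF L2_beta_mult'[OF w2] s2])
    also have "volt (\<lambda>t. \<Sum>i<m. c i * qcoeff \<beta> (i + 1) z t) x = (\<Sum>i<m. c i * volt (qcoeff \<beta> (i + 1) z) x)"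
      by (subst volt_sum) (auto intro: L2_cmult qcoeff_L2 simp: volt_cmult)
    finally show ?thesis .
  qed
  have Y3: "?Y (i + 3) x = volt (qcoeff \<beta> (i + 1) z) x" if "x \<in> {0..1}" for i x
    using ycoeff_eq[OF that, of "i + 1" z] by (simp add: numeral_eq_Suc)
  have x01: "AE x in unit_lebesgue. x \<in> {0<..<1}" by (rule AE_I2) simp
  have "AE x in unit_lebesgue. w x = c' * of_real x + volt (\<lambda>t. ?q t * w t) x"
    using fc x01
  proof eventually_elim
    case (elim x)
    then show ?case using Y3[of x] by (simp add: w_def[of x] vg)
  qed
  then have ws: "AE x in unit_lebesgue. w x = c' * ?Y 2 x" by (rule volterra_solution[OF w2])
  define e where "e i = (case i of 0 \<Rightarrow> c' | Suc i \<Rightarrow> c i)" for i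
  have shift: "(\<Sum>i<Suc m. e i * F i) = c' * F 0 + (\<Sum>i<m. c i * F (Suc i))" for F
    unfolding sum.lessThan_Suc_shift by (simp add: e_def)
  have "(\<Sum>i<Suc m. e i * ?Y (i + 2) 1) = 0"
  proof -
    have "volt (\<lambda>t. ?q t * w t) 1 = volt (\<lambda>t. c' * qcoeff \<beta> 0 z t) 1"
    proof (rule volt_cong_AE[OF L2_beta_mult'[OF w2] L2_cmult[OF qcoeff_L2]])
      show "AE t in unit_lebesgue. ?q t * w t = c' * qcoeff \<beta> 0 z t"
        using ws by eventually_elim (simp add: qcoeff_0)
    qed
    also have "\<dots> = c' * (?Y 2 1 - 1)" using ycoeff_2[of 1 z] unfolding volt_cmult by simp
    finally have v1: "volt (\<lambda>t. ?q t * w t) 1 = c' * (?Y 2 1 - 1)" .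
    have "c' * ?Y 2 1 + (\<Sum>i<m. c i * ?Y (i + 3) 1) = 0"
      using c' Y3[of 1] unfolding vg[of 1] v1 by (simp only: right_diff_distrib) (simp add: Y3)
    then show ?thesis unfolding shift by (simp add: numeral_eq_Suc)
  qed
  moreover have "(\<Sum>i<m. e i * ?Y (i + 2) 1) = 0" using m(1) by simp
  ultimately have em: "e m = 0" using m(2) by simp
  have drop: "(\<Sum>i<m. e i * F i) = (\<Sum>i<Suc m. e i * F i)" for F using em by simp
  have fe: "AE x in unit_lebesgue. f x = (\<Sum>i<m. e i * ?Y (i + 2) x)"
    using ws
  proof eventually_elim
    case (elim x)
    then show ?case unfolding drop shift by (simp add: w_def numeral_eq_Suc algebra_simps)
  qed
  have "AE x in unit_lebesgue. h x = (\<Sum>i<m. e i * (z * ?Y (i + 2) x + ?Y (i + 1) x))"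
    using fe c(1)
  proof eventually_elim
    case (elim x)
    have "(\<Sum>i<m. e i * ?Y (i + 1) x) = (\<Sum>i<m. c i * ?Y (i + 2) x)"
      unfolding drop shift by (simp add: ycoeff_less_2 numeral_eq_Suc)
    then have "h x = z * (\<Sum>i<m. e i * ?Y (i + 2) x) + (\<Sum>i<m. e i * ?Y (i + 1) x)"
      using elim by (simp add: algebra_simps)
    then show ?case by (simp add: sum_distrib_left sum.distrib algebra_simps)
  qed
  then show ?case using fe by (intro exI[of _ e]) (simp add: jchain_def f_def h_def)
qed

text \<open>Applying A - z to the relation j times gives the first component \<open>F j\<close>. If
  \<open>F j\<close> and \<open>F (Suc j)\<close> vanish, the Volterra equation of
  \<open>F j\<close> reduces to the linear term with slope \<open>c j\<close> plus the twofold
  integral of \<open>F (Suc (Suc j))\<close>, and both must vanish.\<close>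

lemma jchain_independent:
  assumes z0: "AE x in unit_lebesgue. (\<Sum>i<m. c i * fst (jchain z i) x) = 0"
    and z1: "AE x in unit_lebesgue. (\<Sum>i<m. c i * snd (jchain z i) x) = 0"
    and j: "j < m"
  shows "c j = 0"
proof -
  let ?Y = "\<lambda>i. ycoeff \<beta> i z"
  \<comment> \<open>Truncated subtraction is harmless here, since \<open>ycoeff\<close> is 0 for all
    indices below 2.\<close>
  define F where "F j x = (\<Sum>i<m. c i * ?Y (i + 2 - j) x)" for j x
  have F2: "F j \<in> L2 unit_lebesgue" for j unfolding F_def by (intro L2_sum L2_cmult ycoeff_L2)
  have Feq: "F j x = (if j < m then c j else 0) * of_real x +
      volt (\<lambda>t. (z\<^sup>2 + z * of_real (\<beta> t)) * F j t + (of_real (\<beta> t) + 2 * z) * F (Suc j) t + F (Suc (Suc j)) t) x"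
    if x: "x \<in> {0..1}" for j x
  proof -
    define q where "q i t = (z\<^sup>2 + z * of_real (\<beta> t)) * ?Y (i + 2 - j) t + (of_real (\<beta> t) + 2 * z) * ?Y (i + 2 - Suc j) t + ?Y (i + 2 - Suc (Suc j)) t" for i t
    have q: "q i = (if i < j then (\<lambda>t. 0) else qcoeff \<beta> (i - j) z)" for i
    proof (cases "i < j")
      case True
      then have "i + 2 - j < 2" "i + 2 - Suc j < 2" "i + 2 - Suc (Suc j) < 2" by auto
      then show ?thesis using True by (auto simp: q_def[abs_def] ycoeff_def)
    next
      case False
      then have "i + 2 - j = i - j + 2" "i + 2 - Suc j = i - j + 1" "i + 2 - Suc (Suc j) = i - j" by auto
      then show ?thesis using False by (simp add: q_def[abs_def] qcoeff_def[abs_def])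
    qed
    have q2: "q i \<in> L2 unit_lebesgue" for i unfolding q by (simp add: qcoeff_L2)
    have Y: "?Y (i + 2 - j) x = (if i = j then of_real x else 0) + volt (q i) x" for i
    proof (cases "i < j")
      case True then show ?thesis by (simp add: q volt_zero ycoeff_def)
    next
      case False
      then have "i + 2 - j = i - j + 2" by simp
      then show ?thesis using False ycoeff_eq[OF x, of "i - j" z] by (auto simp: q)
    qed
    have "F j x = (\<Sum>i<m. c i * (if i = j then of_real x else 0)) + (\<Sum>i<m. c i * volt (q i) x)"
      unfolding F_def Y by (simp add: distrib_left sum.distrib)
    also have "(\<Sum>i<m. c i * (if i = j then of_real x else 0)) = (if j < m then c j else 0) * of_real x"
      by (simp add: if_distrib cong: if_cong)
    also have "(\<Sum>i<m. c i * volt (q i) x) = volt (\<lambda>t. \<Sum>i<m. c i * q i t) x"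
      by (subst volt_sum) (auto intro: L2_cmult q2 simp: volt_cmult)
    also have "(\<lambda>t. \<Sum>i<m. c i * q i t) = (\<lambda>t. (z\<^sup>2 + z * of_real (\<beta> t)) * F j t + (of_real (\<beta> t) + 2 * z) * F (Suc j) t + F (Suc (Suc j)) t)"
      unfolding q_def F_def by (simp add: fun_eq_iff sum_distrib_left sum.distrib algebra_simps)
    finally show ?thesis .
  qed
  have step: "(if j < m then c j else 0) = 0 \<and> (AE x in unit_lebesgue. F (Suc (Suc j)) x = 0)"
    if F0: "AE x in unit_lebesgue. F j x = 0" and F1: "AE x in unit_lebesgue. F (Suc j) x = 0" for j
  proof -
    have v: "volt (\<lambda>t. (z\<^sup>2 + z * of_real (\<beta> t)) * F j t + (of_real (\<beta> t) + 2 * z) * F (Suc j) t + F (Suc (Suc j)) t) x = volt (F (Suc (Suc j))) x" for x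
    proof (rule volt_cong_AE[OF _ F2])
      have "(\<lambda>t. (z\<^sup>2 + z * of_real (\<beta> t)) * F j t + (2 * z + 1 * of_real (\<beta> t)) * F (Suc j) t + F (Suc (Suc j)) t) \<in> L2 unit_lebesgue"
        by (intro L2_add L2_beta_mult' F2)
      then show "(\<lambda>t. (z\<^sup>2 + z * of_real (\<beta> t)) * F j t + (of_real (\<beta> t) + 2 * z) * F (Suc j) t + F (Suc (Suc j)) t) \<in> L2 unit_lebesgue"
        by (simp add: add.commute)
      show "AE t in unit_lebesgue. (z\<^sup>2 + z * of_real (\<beta> t)) * F j t + (of_real (\<beta> t) + 2 * z) * F (Suc j) t + F (Suc (Suc j)) t = F (Suc (Suc j)) t"
        using F0 F1 by eventually_elim simp
    qed
    have x01: "AE x in unit_lebesgue. x \<in> {0<..<1}" by (rule AE_I2) simp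
    have "AE x in unit_lebesgue. (if j < m then c j else 0) * of_real x + volt (F (Suc (Suc j))) x = 0"
      using F0 x01 by eventually_elim (use Feq[of _ j] v in auto)
    from affine_volt_eq_0[OF F2 this] show ?thesis by blast
  qed
  have F0: "AE x in unit_lebesgue. F 0 x = 0" using z0 by (simp add: F_def jchain_def)
  have F1: "AE x in unit_lebesgue. F 1 x = 0"
    using F0 z1
  proof eventually_elim
    case (elim x)
    have "(\<Sum>i<m. c i * snd (jchain z i) x) = z * F 0 x + F 1 x"
      by (simp add: F_def jchain_def sum_distrib_left sum.distrib algebra_simps)
    then show ?case using elim by simp
  qed
  have "(AE x in unit_lebesgue. F j x = 0) \<and> (AE x in unit_lebesgue. F (Suc j) x = 0)" for j
    by (induction j) (use F0 F1 step in auto)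
  then show ?thesis using step[of j] j by simp
qed

text \<open>
  The chain consists of generalized eigenvectors as long as the boundary values at \<open>1\<close> vanish; the first
  nonzero one stops every longer chain.
\<close>

theorem algebraic_multiplicity_eq:
  assumes m: "\<And>i. i < m \<Longrightarrow> (deriv ^^ i) chfun z = 0" "(deriv ^^ m) chfun z \<noteq> 0"
  shows "algebraic_multiplicity \<alpha> z = enat m"
proof -
  have y: "\<And>i. i < m \<Longrightarrow> ycoeff \<beta> (i + 2) z 1 = 0" "ycoeff \<beta> (m + 2) z 1 \<noteq> 0"
    using m by (simp_all only: ycoeff_1) auto
  let ?P = "\<lambda>M p. (\<forall>i<M. p i \<in> (\<Union>k. damped_wave_ker_pow \<alpha> z k)) \<and>
        (\<forall>c :: nat \<Rightarrow> complex.
           (AE x in unit_lebesgue. (\<Sum>i<M. c i * fst (p i) x) = 0 \<and> (\<Sum>i<M. c i * snd (p i) x) = 0) \<longrightarrow>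
           (\<forall>i<M. c i = 0))"
  have "?P m (jchain z)"
  proof (intro conjI allI impI)
    fix i assume "i < m"
    then have "jchain z i \<in> damped_wave_ker_pow \<alpha> z (Suc i)" by (intro jchain_in_ker_pow y) auto
    then show "jchain z i \<in> (\<Union>k. damped_wave_ker_pow \<alpha> z k)" by blast
  next
    fix c :: "nat \<Rightarrow> complex" and i
    assume ae: "AE x in unit_lebesgue. (\<Sum>i<m. c i * fst (jchain z i) x) = 0 \<and> (\<Sum>i<m. c i * snd (jchain z i) x) = 0"
      and i: "i < m"
    show "c i = 0" by (rule jchain_independent[OF _ _ i]) (use ae in \<open>auto elim: eventually_mono\<close>)
  qed
  then have mem: "enat m \<in> {enat M | M. \<exists>p. ?P M p}" by blast
  have le: "M \<le> m" if P: "?P M p" for M p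
  proof (rule ccontr)
    assume "\<not> M \<le> m"
    then have "card {..<M} > m" by simp
    have "\<forall>l\<in>{..<M}. \<exists>c. (AE x in unit_lebesgue. fst (p l) x = (\<Sum>i<m. c i * fst (jchain z i) x)) \<and>
       (AE x in unit_lebesgue. snd (p l) x = (\<Sum>i<m. c i * snd (jchain z i) x))"
    proof
      fix l assume "l \<in> {..<M}"
      then obtain k where "p l \<in> damped_wave_ker_pow \<alpha> z k" using P by blast
      from ker_pow_span[OF y this] show "\<exists>c. (AE x in unit_lebesgue. fst (p l) x = (\<Sum>i<m. c i * fst (jchain z i) x)) \<and>
       (AE x in unit_lebesgue. snd (p l) x = (\<Sum>i<m. c i * snd (jchain z i) x))" by blast
    qed
    from bchoice[OF this] obtain C where C: "\<And>l. l < M \<Longrightarrow> AE x in unit_lebesgue. fst (p l) x = (\<Sum>i<m. C l i * fst (jchain z i) x)"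
      "\<And>l. l < M \<Longrightarrow> AE x in unit_lebesgue. snd (p l) x = (\<Sum>i<m. C l i * snd (jchain z i) x)" by auto
    \<comment> \<open>More than \<open>m\<close> combinations of \<open>m\<close> chain members
      satisfy a nontrivial linear relation.\<close>
    obtain c where c: "\<exists>l\<in>{..<M}. c l \<noteq> 0" "\<forall>i<m. (\<Sum>l<M. c l * C l i) = 0"
      using underdetermined_system[of "{..<M}" m C] \<open>card {..<M} > m\<close> by auto
    have swap: "(\<Sum>l<M. c l * (\<Sum>i<m. C l i * F i)) = 0" for F :: "nat \<Rightarrow> complex"
    proof -
      have "(\<Sum>l<M. c l * (\<Sum>i<m. C l i * F i)) = (\<Sum>l<M. \<Sum>i<m. c l * C l i * F i)"
        by (simp add: sum_distrib_left mult.assoc)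
      also have "\<dots> = (\<Sum>i<m. \<Sum>l<M. c l * C l i * F i)" by (rule sum.swap)
      also have "\<dots> = (\<Sum>i<m. (\<Sum>l<M. c l * C l i) * F i)" by (simp add: sum_distrib_right)
      finally show ?thesis using c(2) by simp
    qed
    have "AE x in unit_lebesgue. (\<Sum>l<M. c l * fst (p l) x) = 0 \<and> (\<Sum>l<M. c l * snd (p l) x) = 0"
    proof -
      have "AE x in unit_lebesgue. (\<Sum>l<M. c l * fst (p l) x) = (\<Sum>l<M. c l * (\<Sum>i<m. C l i * fst (jchain z i) x))"
        by (rule AE_finite_sum_zero) (use C in auto)
      moreover have "AE x in unit_lebesgue. (\<Sum>l<M. c l * snd (p l) x) = (\<Sum>l<M. c l * (\<Sum>i<m. C l i * snd (jchain z i) x))"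
        by (rule AE_finite_sum_zero) (use C in auto)
      ultimately show ?thesis by eventually_elim (simp add: swap)
    qed
    then have "\<forall>i<M. c i = 0" using P by blast
    then show False using c(1) by auto
  qed
  have "Sup {enat M | M. \<exists>p. ?P M p} = enat m"
  proof (rule antisym)
    show "Sup {enat M | M. \<exists>p. ?P M p} \<le> enat m" by (rule Sup_least) (use le in auto)
    show "enat m \<le> Sup {enat M | M. \<exists>p. ?P M p}" by (rule Sup_upper[OF mem])
  qed
  then show ?thesis unfolding algebraic_multiplicity_def .
qed

end

end

section \<open>Location of the eigenvalues\<close>

lemma green_symmetric:
  assumes p: "bfun p" and r: "bfun r"
  shows "(LINT x|unit_lebesgue. (LINT t|unit_lebesgue. (min x t - x * t) * p t) * r x) =
    (LINT x|unit_lebesgue. p x * (LINT t|unit_lebesgue. (min x t - x * t) * r t))"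
proof -
  have k: "bfun2 (\<lambda>x t. (min x t - x * t) * p t * r x)"
    by (intro bfun2_mult bfun2_green bfun2_fst[OF r] bfun2_snd[OF p])
  have "(LINT x|unit_lebesgue. (LINT t|unit_lebesgue. (min x t - x * t) * p t) * r x) =
      (LINT x|unit_lebesgue. LINT t|unit_lebesgue. (min x t - x * t) * p t * r x)" by simp
  also have "\<dots> = (LINT t|unit_lebesgue. LINT x|unit_lebesgue. (min x t - x * t) * p t * r x)"
    by (rule bfun_Fubini[OF k])
  also have "\<dots> = (LINT t|unit_lebesgue. LINT x|unit_lebesgue. p t * ((min t x - t * x) * r x))"
    by (simp add: mult_ac min.commute)
  finally show ?thesis by simp
qed

text \<open>Kernel, potential and source are nonnegative, so the negative part \<open>v\<close> of
  \<open>u\<close> is at most its own Volterra integral with potential \<open>P\<close>; factorial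
  decay forces it to vanish.\<close>

lemma volterra_nonneg:
  assumes u: "bfun u" and P: "bfun P" and P0: "\<And>t. t \<in> {0<..<1} \<Longrightarrow> 0 \<le> P t"
    and w: "\<And>x. x \<in> {0..1} \<Longrightarrow> 0 \<le> w x"
    and eq: "\<And>x. x \<in> {0..1} \<Longrightarrow> u x = w x + (LINT t|unit_lebesgue. max 0 (x - t) * (P t * u t))"
    and x: "x \<in> {0..1}"
  shows "0 \<le> u x"
proof -
  obtain N where N: "\<And>t. t \<in> {0<..<1} \<Longrightarrow> \<bar>u t\<bar> \<le> N" using bfunE[OF u] by blast
  obtain Q where Q: "\<And>t. t \<in> {0<..<1} \<Longrightarrow> \<bar>P t\<bar> \<le> Q" using bfunE[OF P] by blast
  have N0: "N \<ge> 0" and Q0: "Q \<ge> 0" using N[of "1/2"] Q[of "1/2"] by auto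
  define v where "v t = max 0 (- u t)" for t
  have vm: "v \<in> borel_measurable unit_lebesgue" unfolding v_def using bfun_measurable[OF u] by measurable
  have v: "bfun v" by (rule bfunI[OF vm, of N]) (use N N0 in \<open>fastforce simp: v_def\<close>)
  have step: "u x \<ge> - (N * Q ^ Suc j) * x ^ (2 * j + 2) / fact (2 * j + 2)"
    if vj: "\<And>t. t \<in> {0<..<1} \<Longrightarrow> v t \<le> N * Q ^ j * t ^ (2 * j) / fact (2 * j)" and x: "x \<in> {0..1}" for j x
  proof -
    have "\<bar>LINT t|unit_lebesgue. max 0 (x - t) * (P t * v t)\<bar> \<le> (N * Q ^ Suc j) * x ^ (2 * j + 2) / fact (2 * j + 2)"
    proof (rule volterra_step[OF x bfun_measurable[OF bfun_mult[OF P v]]])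
      fix t :: real assume t: "t \<in> {0<..<1}"
      have "\<bar>P t\<bar> * \<bar>v t\<bar> \<le> Q * (N * Q ^ j * t ^ (2 * j) / fact (2 * j))"
        using Q[OF t] vj[OF t] Q0 by (intro mult_mono) (auto simp: v_def)
      then show "\<bar>P t * v t\<bar> \<le> N * Q ^ Suc j * t ^ (2 * j) / fact (2 * j)" by (simp add: abs_mult mult_ac)
    qed
    moreover have "(LINT t|unit_lebesgue. - (max 0 (x - t) * (P t * v t))) \<le> (LINT t|unit_lebesgue. max 0 (x - t) * (P t * u t))"
    proof (rule integral_mono)
      show "integrable unit_lebesgue (\<lambda>t. - (max 0 (x - t) * (P t * v t)))"
        "integrable unit_lebesgue (\<lambda>t. max 0 (x - t) * (P t * u t))"
        by (intro bfun_integrable bfun_uminus bfun_mult bfun_max_diff P u v)+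
      fix t assume "t \<in> space unit_lebesgue"
      then have "0 \<le> max 0 (x - t) * P t" using P0[of t] by simp
      moreover have "- v t \<le> u t" by (simp add: v_def)
      ultimately have "(max 0 (x - t) * P t) * - v t \<le> (max 0 (x - t) * P t) * u t" by (rule mult_left_mono[rotated])
      then show "- (max 0 (x - t) * (P t * v t)) \<le> max 0 (x - t) * (P t * u t)" by (simp add: mult_ac)
    qed
    ultimately show ?thesis using eq[OF x] w[OF x] by (simp add: abs_le_iff)
  qed
  have vj: "v t \<le> N * Q ^ j * t ^ (2 * j) / fact (2 * j)" if t: "t \<in> {0<..<1}" for t j
    using t
  proof (induction j arbitrary: t)
    case 0 then show ?case using N N0 by (fastforce simp: v_def)
  next
    case (Suc j)
    have "u t \<ge> - (N * Q ^ Suc j) * t ^ (2 * j + 2) / fact (2 * j + 2)" by (rule step[OF Suc.IH]) (use Suc.prems in auto)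
    moreover have "0 \<le> N * Q ^ Suc j * t ^ (2 * j + 2) / fact (2 * j + 2)" using Suc.prems N0 Q0 by simp
    ultimately have "v t \<le> N * Q ^ Suc j * t ^ (2 * j + 2) / fact (2 * j + 2)" by (simp add: v_def)
    then show ?case by simp
  qed
  have le: "- u x \<le> N * Q * (Q ^ j /\<^sub>R fact j)" for j
  proof -
    have "N * Q ^ Suc j * x ^ (2 * j + 2) / fact (2 * j + 2) \<le> N * Q ^ Suc j * 1 / fact j"
      using x N0 Q0 by (intro frac_le mult_left_mono power_le_one fact_mono mult_nonneg_nonneg) auto
    then show ?thesis using step[OF vj x, of j] by (simp add: divide_inverse mult_ac)
  qed
  have "(\<lambda>j. N * Q * (Q ^ j /\<^sub>R fact j)) \<longlonglongrightarrow> N * Q * 0"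
    by (intro tendsto_mult tendsto_const summable_LIMSEQ_zero summable_exp_generic)
  then have "- u x \<le> N * Q * 0" by (rule LIMSEQ_le_const) (use le in auto)
  then show ?thesis by simp
qed

context bounded_damping
begin

lemma ycoeff_cnj: "x \<in> {0..1} \<Longrightarrow> cnj (ycoeff \<beta> 2 z x) = ycoeff \<beta> 2 (cnj z) x"
proof -
  assume x: "x \<in> {0..1}"
  have s: "(\<lambda>n. of_real (psi \<beta> n x) * z ^ n) sums entire_of (\<lambda>n. of_real (psi \<beta> n x)) z" for z :: complex
    by (rule entire_of_sums[OF psi_coeff_bound[OF x]])
  have e: "ycoeff \<beta> 2 z x = entire_of (\<lambda>n. of_real (psi \<beta> n x)) z" for z
    by (simp add: ycoeff_def taylor_coeff_def entire_of_def mult.commute)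
  have "(\<lambda>n. of_real (psi \<beta> n x) * cnj z ^ n) sums cnj (entire_of (\<lambda>n. of_real (psi \<beta> n x)) z)"
    using sums_cnj[THEN iffD2, OF s[of z]] by simp
  with s[of "cnj z"] show ?thesis unfolding e by (rule sums_unique2[symmetric])
qed

lemma bfun_ycoeff: "bfun (\<lambda>x. Re (ycoeff \<beta> j z x))" "bfun (\<lambda>x. Im (ycoeff \<beta> j z x))"
proof -
  obtain C where C: "\<And>x. x \<in> {0..1} \<Longrightarrow> norm (ycoeff \<beta> j z x) \<le> C" using ycoeff_bounded by blast
  show "bfun (\<lambda>x. Re (ycoeff \<beta> j z x))"
    by (rule bfunI[where C = C]) (auto intro!: order_trans[OF abs_Re_le_cmod C])
  show "bfun (\<lambda>x. Im (ycoeff \<beta> j z x))"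
    by (rule bfunI[where C = C]) (auto intro!: order_trans[OF abs_Im_le_cmod C])
qed

text \<open>
  Pair the eigenvalue equation \<open>y = - G (z\<^sup>2 + z \<beta>) y\<close> with \<open>(z\<^sup>2 + z \<beta>) y\<close> and use that the Green operator \<open>G\<close> is
  symmetric; the integral below is the imaginary part divided by \<open>Im z\<close>.
\<close>

lemma chfun_zero_nonreal:
  assumes z: "chfun z = 0" and im: "Im z \<noteq> 0"
  shows "(LINT x|unit_lebesgue. (2 * Re z + \<beta> x) * (norm (ycoeff \<beta> 2 z x))\<^sup>2) = 0"
proof -
  let ?y = "ycoeff \<beta> 2 z" and ?q = "\<lambda>t. z\<^sup>2 + z * complex_of_real (\<beta> t)"
  let ?G = "\<lambda>p x. LINT t|unit_lebesgue. (min x t - x * t) * p t"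
  define p r where "p t = Re (?q t * ?y t)" and "r t = Im (?q t * ?y t)" for t
  have p: "bfun p" and r: "bfun r" unfolding p_def r_def
    by (auto intro!: bfun_add bfun_mult bfun_diff bfun_ycoeff b)
  have y1: "volt (qcoeff \<beta> 0 z) 1 = - 1" using ycoeff_2[of 1 z] z by (simp add: ycoeff_2_1 eq_neg_iff_add_eq_0 add.commute)
  have yg: "?y x = - green (qcoeff \<beta> 0 z) x" if x: "x \<in> {0<..<1}" for x
    using ycoeff_2[of x z] x unfolding green_eq_volt[OF qcoeff_L2] y1 by simp
  have gq: "green (qcoeff \<beta> 0 z) x = Complex (?G p x) (?G r x)" if x: "x \<in> {0<..<1}" for x
  proof -
    have "integrable unit_lebesgue (\<lambda>t. of_real ((min x t - x * t)) * qcoeff \<beta> 0 z t)"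
    proof -
      have k: "bfun (\<lambda>t. min x t - x * t)" by (rule bfun2_section[OF bfun2_green x])
      obtain C where C: "\<And>t. t \<in> {0<..<1} \<Longrightarrow> \<bar>min x t - x * t\<bar> \<le> C" using bfunE[OF k] by blast
      show ?thesis
      proof (rule bounded_mult_integrable[OF _ _ qcoeff_L2])
        show "(\<lambda>t. complex_of_real (min x t - x * t)) \<in> borel_measurable unit_lebesgue"
          by (intro measurable_compose[OF bfun_measurable[OF k]] borel_measurable_of_real)
        show "norm (complex_of_real (min x t - x * t)) \<le> C" if "t \<in> {0<..<1}" for t
          unfolding norm_of_real by (rule C[OF that])
      qed
    qed
    then have "Re (green (qcoeff \<beta> 0 z) x) = ?G p x" "Im (green (qcoeff \<beta> 0 z) x) = ?G r x"
      unfolding green_def by (simp_all add: p_def r_def qcoeff_0 flip: integral_Re integral_Im)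
    then show ?thesis by (simp add: complex_eq_iff)
  qed
  have uv: "Re (?y x) = - ?G p x" "Im (?y x) = - ?G r x" if "x \<in> {0<..<1}" for x
    using yg[OF that] unfolding gq[OF that] by (simp_all add: complex_eq_iff)
  have "(LINT x|unit_lebesgue. r x * Re (?y x) - p x * Im (?y x)) =
     (LINT x|unit_lebesgue. r x * Re (?y x)) - (LINT x|unit_lebesgue. p x * Im (?y x))"
    by (intro Bochner_Integration.integral_diff bfun_integrable bfun_mult p r bfun_ycoeff)
  also have "(LINT x|unit_lebesgue. r x * Re (?y x)) = (LINT x|unit_lebesgue. - (?G p x * r x))"
    by (intro Bochner_Integration.integral_cong) (simp_all add: uv)
  also have "(LINT x|unit_lebesgue. p x * Im (?y x)) = (LINT x|unit_lebesgue. - (p x * ?G r x))"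
    by (intro Bochner_Integration.integral_cong) (simp_all add: uv)
  finally have "(LINT x|unit_lebesgue. r x * Re (?y x) - p x * Im (?y x)) = 0"
    using green_symmetric[OF p r] by simp
  moreover have "r x * Re (?y x) - p x * Im (?y x) = Im z * ((2 * Re z + \<beta> x) * (norm (?y x))\<^sup>2)" for x
    unfolding p_def r_def cmod_power2 by (simp add: power2_eq_square algebra_simps)
  ultimately show ?thesis using im by simp
qed

end

locale nonneg_damping = bounded_damping +
  assumes \<beta>_ge: "\<And>t. t \<in> {0<..<1} \<Longrightarrow> 0 \<le> \<beta> t"
begin

lemma \<beta>_bounds: "t \<in> {0<..<1} \<Longrightarrow> 0 \<le> \<beta> t \<and> \<beta> t \<le> B"
  using \<beta>_le[of t] \<beta>_ge[of t] by auto

text \<open>By \<open>chfun_zero_nonreal\<close>, \<open>- 2 * Re z\<close> is the mean of \<beta>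
  weighted with the squared modulus of the eigenfunction. The lower bound is stated with
  \<open>B\<close> and not with its half, which is the strip that also holds for real zeros.\<close>

lemma chfun_zero_nonreal_Re:
  assumes z: "chfun z = 0" and im: "Im z \<noteq> 0"
  shows "- B \<le> Re z \<and> Re z \<le> 0"
proof -
  let ?y = "ycoeff \<beta> 2 z"
  let ?f = "\<lambda>x. (2 * Re z + \<beta> x) * (norm (?y x))\<^sup>2"
  have f: "bfun ?f" unfolding cmod_power2 unfolding power2_eq_square by (intro bfun_mult bfun_add bfun_const b bfun_ycoeff)
  have I: "(LINT x|unit_lebesgue. ?f x) = 0" by (rule chfun_zero_nonreal[OF z im])
  have no: "2 * Re z + \<beta> x = 0" if "x \<in> {0<..<1}" "?y x \<noteq> 0" "?f x = 0" for x using that by simp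
  have ae: "\<not> (AE x in unit_lebesgue. ?f x = 0)" if "\<And>x. x \<in> {0<..<1} \<Longrightarrow> 2 * Re z + \<beta> x \<noteq> 0"
  proof
    assume a: "AE x in unit_lebesgue. ?f x = 0"
    have "AE x in unit_lebesgue. x \<in> {0<..<1}" by (rule AE_I2) simp
    with a have "AE x in unit_lebesgue. ?y x = 0" by eventually_elim (use that in auto)
    then show False using ycoeff_2_nonzero by blast
  qed
  have "Re z \<le> 0"
  proof (rule ccontr)
    assume *: "\<not> Re z \<le> 0"
    have pos: "2 * Re z + \<beta> x > 0" if "x \<in> {0<..<1}" for x using \<beta>_bounds[OF that] * by auto
    have "AE x in unit_lebesgue. ?f x = 0"
    proof (rule integral_nonneg_eq_0_iff_AE[THEN iffD1, OF bfun_integrable[OF f] _ I])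
      show "AE x in unit_lebesgue. 0 \<le> ?f x"
        by (rule AE_I2) (simp add: less_imp_le[OF pos])
    qed
    then show False using ae pos by (metis less_irrefl)
  qed
  moreover have "- B \<le> Re z"
  proof (rule ccontr)
    assume *: "\<not> - B \<le> Re z"
    have pos: "2 * Re z + \<beta> x < 0" if "x \<in> {0<..<1}" for x using \<beta>_bounds[OF that] * B0 by auto
    have g: "bfun (\<lambda>x. - ?f x)" by (rule bfun_uminus[OF f])
    have "AE x in unit_lebesgue. - ?f x = 0"
    proof (rule integral_nonneg_eq_0_iff_AE[THEN iffD1, OF bfun_integrable[OF g]])
      show "AE x in unit_lebesgue. 0 \<le> - ?f x"
        by (rule AE_I2) (simp add: less_imp_le[OF pos] mult_nonpos_nonneg)
      show "(LINT x|unit_lebesgue. - ?f x) = 0" using I by simp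
    qed
    then have "AE x in unit_lebesgue. ?f x = 0" by (simp only: neg_equal_0_iff_equal)
    then show False using ae pos by (metis less_irrefl)
  qed
  ultimately show ?thesis by simp
qed

section \<open>Comparison of solutions on the real axis\<close>

definition yreal :: "real \<Rightarrow> real \<Rightarrow> real" where
  "yreal s x = Re (ycoeff \<beta> 2 (of_real s) x)"

lemma ycoeff_of_real: "x \<in> {0..1} \<Longrightarrow> ycoeff \<beta> 2 (of_real s) x = of_real (yreal s x)"
  using ycoeff_cnj[of x "of_real s"] by (simp add: yreal_def complex_eq_iff)

lemma bfun_yreal: "bfun (yreal s)"
  unfolding yreal_def by (rule bfun_ycoeff)

lemma yreal_eq:
  assumes x: "x \<in> {0..1}"
  shows "yreal s x = x + (LINT t|unit_lebesgue. max 0 (x - t) * ((s\<^sup>2 + s * \<beta> t) * yreal s t))"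
proof -
  have "volt (qcoeff \<beta> 0 (of_real s)) x =
      (LINT t|unit_lebesgue. of_real (max 0 (x - t) * ((s\<^sup>2 + s * \<beta> t) * yreal s t)))"
    unfolding volt_def by (intro Bochner_Integration.integral_cong) (simp_all add: qcoeff_0 ycoeff_of_real)
  then have v: "volt (qcoeff \<beta> 0 (of_real s)) x = of_real (LINT t|unit_lebesgue. max 0 (x - t) * ((s\<^sup>2 + s * \<beta> t) * yreal s t))"
    unfolding integral_complex_of_real .
  have "complex_of_real (yreal s x) = of_real (x + (LINT t|unit_lebesgue. max 0 (x - t) * ((s\<^sup>2 + s * \<beta> t) * yreal s t)))"
    using ycoeff_2[OF x, of "of_real s"] unfolding v ycoeff_of_real[OF x] by simp
  then show ?thesis by (simp only: of_real_eq_iff)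
qed

lemma bfun_pot: "bfun (\<lambda>t. s\<^sup>2 + s * \<beta> t)"
  by (intro bfun_add bfun_mult b) auto

lemma yreal_nonneg:
  assumes "\<And>t. t \<in> {0<..<1} \<Longrightarrow> 0 \<le> s\<^sup>2 + s * \<beta> t" "x \<in> {0..1}"
  shows "0 \<le> yreal s x"
  by (rule volterra_nonneg[OF bfun_yreal bfun_pot assms(1) _ yreal_eq assms(2)]) auto

text \<open>The difference of the two solutions solves a Volterra equation whose source
  \<open>w\<close> comes from the difference of the potentials acting on the nonnegative
  \<open>yreal s\<close>.\<close>

lemma yreal_mono:
  assumes s: "\<And>t. t \<in> {0<..<1} \<Longrightarrow> 0 \<le> s\<^sup>2 + s * \<beta> t"
    and r: "\<And>t. t \<in> {0<..<1} \<Longrightarrow> s\<^sup>2 + s * \<beta> t \<le> r\<^sup>2 + r * \<beta> t"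
    and x: "x \<in> {0..1}"
  shows "yreal s x \<le> yreal r x"
proof -
  let ?P = "\<lambda>s t. s\<^sup>2 + s * \<beta> t"
  define w where "w x = (LINT t|unit_lebesgue. max 0 (x - t) * ((?P r t - ?P s t) * yreal s t))" for x
  have "0 \<le> yreal r x - yreal s x"
  proof (rule volterra_nonneg[OF _ bfun_pot _ _ _ x])
    show "bfun (\<lambda>x. yreal r x - yreal s x)" by (intro bfun_diff bfun_yreal)
    show "0 \<le> ?P r t" if "t \<in> {0<..<1}" for t using s[OF that] r[OF that] by linarith
    show "0 \<le> w x" if "x \<in> {0..1}" for x
      unfolding w_def using r yreal_nonneg[OF s] by (intro integral_nonneg_AE AE_I2) (auto intro!: mult_nonneg_nonneg)
    fix x :: real assume x: "x \<in> {0..1}"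
    have "(LINT t|unit_lebesgue. max 0 (x - t) * (?P r t * yreal r t)) - (LINT t|unit_lebesgue. max 0 (x - t) * (?P s t * yreal s t))
        = (LINT t|unit_lebesgue. max 0 (x - t) * (?P r t * yreal r t) - max 0 (x - t) * (?P s t * yreal s t))"
      by (intro Bochner_Integration.integral_diff[symmetric] bfun_integrable bfun_mult bfun_max_diff bfun_pot bfun_yreal)
    also have "\<dots> = (LINT t|unit_lebesgue. max 0 (x - t) * ((?P r t - ?P s t) * yreal s t) + max 0 (x - t) * (?P r t * (yreal r t - yreal s t)))"
      by (intro Bochner_Integration.integral_cong) (simp_all add: algebra_simps)
    also have "\<dots> = w x + (LINT t|unit_lebesgue. max 0 (x - t) * (?P r t * (yreal r t - yreal s t)))"
      unfolding w_def
      by (intro Bochner_Integration.integral_add bfun_integrable bfun_mult bfun_diff bfun_max_diff bfun_pot bfun_yreal)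
    finally show "yreal r x - yreal s x = w x + (LINT t|unit_lebesgue. max 0 (x - t) * (?P r t * (yreal r t - yreal s t)))"
      using yreal_eq[OF x, of r] yreal_eq[OF x, of s] by simp
  qed
  then show ?thesis by simp
qed

definition chreal :: "real \<Rightarrow> real" where
  "chreal s = yreal s 1"

lemma chfun_of_real: "chfun (of_real s) = of_real (chreal s)"
  using ycoeff_of_real[of 1 s] by (simp add: ycoeff_2_1 chreal_def)

lemma pot_nonneg:
  assumes "s \<ge> 0 \<or> s \<le> - B" "t \<in> {0<..<1}"
  shows "0 \<le> s\<^sup>2 + s * \<beta> t"
proof -
  have "0 \<le> s * (s + \<beta> t)" using assms(1) \<beta>_bounds[OF assms(2)] by (auto intro: mult_nonneg_nonneg mult_nonpos_nonpos)
  then show ?thesis by (simp add: power2_eq_square algebra_simps)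
qed

text \<open>Comparison with parameter 0, where the potential vanishes and the solution is
  \<open>x\<close> itself; for these \<open>s\<close> the potential is nonnegative.\<close>

lemma chreal_ge_1:
  assumes "s \<ge> 0 \<or> s \<le> - B"
  shows "chreal s \<ge> 1"
proof -
  have "yreal 0 1 \<le> yreal s 1" by (rule yreal_mono) (use pot_nonneg[OF assms] in auto)
  moreover have "yreal 0 1 = 1" using yreal_eq[of 1 0] by simp
  ultimately show ?thesis by (simp add: chreal_def)
qed

text \<open>The potentials at \<open>- x\<close>, \<open>x\<close> and \<open>- x - B\<close> are
  ordered pointwise, with gaps \<open>2 * x * \<beta> t\<close> and
  \<open>(2 * x + B) * (B - \<beta> t)\<close>. The upper bound \<open>B\<close> of \<beta> is thus
  the shift that reverses the first inequality.\<close>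

lemma chreal_reflect:
  assumes x: "x \<ge> B"
  shows "chreal (- x) \<le> chreal x" "chreal x \<le> chreal (- x - B)"
proof -
  show "chreal (- x) \<le> chreal x" unfolding chreal_def
  proof (rule yreal_mono)
    show "0 \<le> (- x)\<^sup>2 + - x * \<beta> t" if "t \<in> {0<..<1}" for t by (rule pot_nonneg) (use x that in auto)
    show "(- x)\<^sup>2 + - x * \<beta> t \<le> x\<^sup>2 + x * \<beta> t" if "t \<in> {0<..<1}" for t
      using mult_nonneg_nonneg[of x "\<beta> t"] \<beta>_bounds[OF that] x B0 by simp
  qed simp
  show "chreal x \<le> chreal (- x - B)" unfolding chreal_def
  proof (rule yreal_mono)
    show "0 \<le> x\<^sup>2 + x * \<beta> t" if "t \<in> {0<..<1}" for t by (rule pot_nonneg) (use x B0 that in auto)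
    show "x\<^sup>2 + x * \<beta> t \<le> (- x - B)\<^sup>2 + (- x - B) * \<beta> t" if "t \<in> {0<..<1}" for t
    proof -
      have "0 \<le> (2 * x + B) * (B - \<beta> t)" using \<beta>_bounds[OF that] x B0 by (intro mult_nonneg_nonneg) auto
      then show ?thesis by (simp add: power2_eq_square algebra_simps)
    qed
  qed simp
qed

lemma chfun_zero_strip:
  assumes z: "chfun z = 0"
  shows "- B \<le> Re z \<and> Re z \<le> 0"
proof (cases "Im z = 0")
  case True
  then have "z = of_real (Re z)" by (simp add: complex_eq_iff)
  then have "chreal (Re z) = 0" using z chfun_of_real[of "Re z"] by simp
  then show ?thesis using chreal_ge_1[of "Re z"] by fastforce
qed (use chfun_zero_nonreal_Re[OF z] in blast)

end

section \<open>Reciprocal power sums of the zeros of an entire function\<close>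

text \<open>Zeros are divided out one by one. The quotient by the new factor is holomorphic off
  \<open>a\<close>; near \<open>a\<close> it is expressed by the local factorization of
  \<open>f\<close>, and the two expressions are glued.\<close>

lemma entire_divide_zeros:
  assumes f: "f holomorphic_on UNIV" and Z: "finite Z" "0 \<notin> Z"
    and m: "\<And>w i. w \<in> Z \<Longrightarrow> i < m w \<Longrightarrow> (deriv ^^ i) f w = 0" "\<And>w. w \<in> Z \<Longrightarrow> (deriv ^^ m w) f w \<noteq> 0"
  shows "\<exists>g. g holomorphic_on UNIV \<and> (\<forall>z. f z = g z * (\<Prod>w\<in>Z. (1 - z / w) ^ m w)) \<and> (\<forall>w\<in>Z. g w \<noteq> 0)"
  using Z m
proof (induction Z rule: finite_induct)
  case empty then show ?case using f by auto
next
  case (insert a Z)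
  obtain g where g: "g holomorphic_on UNIV" "\<And>z. f z = g z * (\<Prod>w\<in>Z. (1 - z / w) ^ m w)" "\<And>w. w \<in> Z \<Longrightarrow> g w \<noteq> 0"
    using insert by auto
  define P where "P z = (\<Prod>w\<in>Z. (1 - z / w) ^ m w)" for z
  have Pa: "P a \<noteq> 0" using insert by (auto simp: P_def)
  have P: "P holomorphic_on UNIV" unfolding P_def by (intro holomorphic_intros) (use insert in auto)
  have a0: "a \<noteq> 0" using insert.prems(1) by auto
  have zo: "zorder f a = int (m a)"
    by (rule zorder_zero_eqI[OF f]) (use insert.prems in auto)
  have nz: "\<exists>w\<in>UNIV. f w \<noteq> 0"
  proof (rule ccontr)
    assume "\<not> ?thesis"
    then have "f = (\<lambda>_. 0)" by auto
    then have "(deriv ^^ m a) f a = 0" by (simp add: higher_deriv_const)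
    with insert.prems(3) show False by auto
  qed
  obtain r where r: "r > 0" "zor_poly f a holomorphic_on cball a r"
    "\<And>w. w \<in> cball a r \<Longrightarrow> f w = zor_poly f a w * (w - a) ^ m a \<and> zor_poly f a w \<noteq> 0"
    using zorder_exist_zero[OF f open_UNIV connected_UNIV UNIV_I nz, of a] unfolding zo by auto
  obtain s where s: "s > 0" "s \<le> r" "\<And>w. w \<in> ball a s \<Longrightarrow> P w \<noteq> 0"
  proof -
    have "continuous (at a) P" using holomorphic_on_imp_continuous_on[OF P] by (simp add: continuous_on_eq_continuous_at)
    from continuous_at_avoid[OF this Pa] obtain e where e: "e > 0" "\<And>y. dist a y < e \<Longrightarrow> P y \<noteq> 0" by auto
    then show ?thesis using r(1) by (intro that[of "min e r"]) auto
  qed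
  \<comment> \<open>Since \<open>1 - z / a\<close> is \<open>(z - a) / (- a)\<close>, the powers of
    \<open>z - a\<close> cancel, and this formula continues the quotient across
    \<open>a\<close>.\<close>
  define v where "v z = zor_poly f a z * (- a) ^ m a / P z" for z
  define h where "h z = (if z = a then v a else g z / (1 - z / a) ^ m a)" for z
  have hv: "h z = v z" if z: "z \<in> ball a s" for z
  proof (cases "z = a")
    case False
    have fz: "f z = zor_poly f a z * (z - a) ^ m a" using r(3)[of z] z s(2) by auto
    have "(1 - z / a) ^ m a * (- a) ^ m a = (z - a) ^ m a"
      unfolding power_mult_distrib[symmetric] using a0 by (simp add: algebra_simps)
    then have "g z * P z = zor_poly f a z * (- a) ^ m a * (1 - z / a) ^ m a"
      using fz g(2)[of z] by (simp add: P_def mult_ac)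
    moreover have "1 - z / a \<noteq> 0" using False a0 by simp
    ultimately show ?thesis using s(3)[OF z] False unfolding h_def v_def by (simp add: divide_simps)
  qed (simp add: h_def)
  have "h holomorphic_on (UNIV - {a}) \<union> ball a s"
  proof (rule holomorphic_on_Un)
    show "h holomorphic_on UNIV - {a}"
    proof (rule holomorphic_transform)
      show "(\<lambda>z. g z / (1 - z / a) ^ m a) holomorphic_on UNIV - {a}"
        by (intro holomorphic_intros holomorphic_on_subset[OF g(1)]) (use a0 in auto)
    qed (simp add: h_def)
    show "h holomorphic_on ball a s"
    proof (rule holomorphic_transform)
      show "v holomorphic_on ball a s"
        unfolding v_def using s
        by (intro holomorphic_intros holomorphic_on_subset[OF r(2)] holomorphic_on_subset[OF P]) auto
    qed (simp add: hv)
  qed auto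
  moreover have "(UNIV - {a}) \<union> ball a s = UNIV" using s(1) by auto
  ultimately have "h holomorphic_on UNIV" by simp
  moreover have "f z = h z * (\<Prod>w\<in>insert a Z. (1 - z / w) ^ m w)" for z
  proof (cases "z = a")
    case True
    have "f a = 0 \<or> m a = 0" using insert.prems(2)[of a 0] by auto
    moreover have "f a = v a * P a" if "m a = 0" using r(3)[of a] r(1) Pa that by (simp add: v_def)
    ultimately show ?thesis using True a0 insert.hyps by (auto simp: h_def P_def)
  next
    case False
    then show ?thesis using g(2)[of z] insert.hyps a0 by (simp add: h_def)
  qed
  moreover have "h a \<noteq> 0" using r(3)[of a] r(1) Pa a0 by (simp add: h_def v_def)
  moreover have "h w \<noteq> 0" if "w \<in> Z" for w
    using g(3)[OF that] that insert.hyps a0 by (auto simp: h_def)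
  ultimately show ?case by (intro exI[of _ h]) auto
qed

text \<open>From Re h < M it follows that h / (2 M - h) maps the disc into the unit disc and the
  centre to 0. The Schwarz lemma at half the radius gives |h| \<le> (2 M + |h|) / 2.\<close>

lemma Borel_Caratheodory_log:
  assumes g: "g holomorphic_on ball 0 r" "g 0 = 1" and r: "r > 0" and M: "M > 0"
    and nz: "\<And>z. z \<in> ball 0 r \<Longrightarrow> g z \<noteq> 0" and gM: "\<And>z. z \<in> ball 0 r \<Longrightarrow> norm (g z) < exp M"
  obtains h where "h holomorphic_on ball 0 r" "h 0 = 0" "\<And>z. z \<in> ball 0 r \<Longrightarrow> g z = exp (h z)"
    "\<And>z. norm z \<le> r / 2 \<Longrightarrow> norm (h z) \<le> 2 * M"
proof -
  obtain k where k: "k holomorphic_on ball 0 r" "\<And>z. z \<in> ball 0 r \<Longrightarrow> g z = exp (k z)"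
    using contractible_imp_holomorphic_log[OF g(1) convex_imp_contractible[OF convex_ball] nz] by blast
  define h where "h z = k z - k 0" for z
  have h: "h holomorphic_on ball 0 r" unfolding h_def by (intro holomorphic_intros k)
  have k0: "exp (k 0) = 1" using k(2)[of 0] r g(2) by simp
  have gh: "g z = exp (h z)" if "z \<in> ball 0 r" for z using k(2)[OF that] k0 by (simp add: h_def exp_diff)
  have Re: "Re (h z) < M" if "z \<in> ball 0 r" for z using gM[OF that] gh[OF that] by simp
  define \<phi> where "\<phi> w = h (of_real r * w) / (of_real (2 * M) - h (of_real r * w))" for w
  have in_ball: "of_real r * w \<in> ball 0 r" if "norm w < 1" for w :: complex using that r by (simp add: norm_mult)
  have den: "of_real (2 * M) - h z \<noteq> 0" if "z \<in> ball 0 r" for z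
  proof
    assume "of_real (2 * M) - h z = 0"
    then have "h z = of_real (2 * M)" by simp
    then have "Re (h z) = 2 * M" by simp
    then show False using Re[OF that] M by simp
  qed
  have \<phi>: "\<phi> holomorphic_on ball 0 1"
    unfolding \<phi>_def
  proof (rule holomorphic_on_divide[OF _ holomorphic_on_diff[OF holomorphic_on_const]])
    have "(h \<circ> (\<lambda>w. of_real r * w)) holomorphic_on ball 0 1"
      by (rule holomorphic_on_compose_gen[OF _ h]) (use in_ball in \<open>auto intro: holomorphic_intros\<close>)
    then show "(\<lambda>w. h (of_real r * w)) holomorphic_on ball 0 1" "(\<lambda>w. h (of_real r * w)) holomorphic_on ball 0 1"
      by (simp_all add: o_def)
  qed (use den in_ball in auto)
  have \<phi>1: "norm (\<phi> w) < 1" if w: "norm w < 1" for w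
  proof -
    let ?h = "h (of_real r * w)"
    have "Re ?h < M" by (rule Re[OF in_ball[OF w]])
    then have "0 < M * (M - Re ?h)" using M by simp
    then have "(norm ?h)\<^sup>2 < (norm (of_real (2 * M) - ?h))\<^sup>2"
      unfolding cmod_power2 by simp (simp add: power2_eq_square algebra_simps)
    then have "norm ?h < norm (of_real (2 * M) - ?h)" by (rule power2_less_imp_less) simp
    then show ?thesis using den[OF in_ball[OF w]] by (simp add: \<phi>_def norm_divide)
  qed
  have "norm (h z) \<le> 2 * M" if z: "norm z \<le> r / 2" for z
  proof -
    define w where "w = z / of_real r"
    have zw: "z = of_real r * w" using r by (simp add: w_def)
    have w: "norm w \<le> 1 / 2" using z r by (simp add: w_def norm_divide field_simps)
    have "norm (\<phi> w) \<le> norm w" by (rule Schwarz_Lemma(1)[OF \<phi> _ \<phi>1]) (use w in \<open>auto simp: \<phi>_def h_def\<close>)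
    then have "norm (h z) \<le> norm w * norm (of_real (2 * M) - h z)"
      using den[OF in_ball[of w]] w by (simp add: \<phi>_def zw norm_divide divide_le_eq)
    also have "\<dots> \<le> 1 / 2 * (2 * M + norm (h z))"
      using w M norm_triangle_ineq4[of "of_real (2 * M)" "h z"] by (intro mult_mono) auto
    finally show ?thesis by simp
  qed
  then show thesis using that[OF h _ gh] by (simp add: h_def)
qed

text \<open>Each factor has the logarithmic derivative - c / (1 - c X), whose k-th coefficient is -
  c^(k+1).\<close>

lemma fps_deriv_prod_linear:
  fixes c :: "'i \<Rightarrow> complex"
  assumes "finite S"
  shows "fps_deriv (\<Prod>j\<in>S. 1 - fps_const (c j) * fps_X) =
    - (\<Prod>j\<in>S. 1 - fps_const (c j) * fps_X) * Abs_fps (\<lambda>k. \<Sum>j\<in>S. c j ^ Suc k)"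
  using assms
proof (induction S rule: finite_induct)
  case empty
  have "Abs_fps (\<lambda>k. 0) = (0 :: complex fps)" by (simp add: fps_eq_iff)
  then show ?case by simp
next
  case (insert a S)
  let ?L = "1 - fps_const (c a) * fps_X" and ?P = "\<Prod>j\<in>S. 1 - fps_const (c j) * fps_X"
  let ?A = "Abs_fps (\<lambda>k. \<Sum>j\<in>S. c j ^ Suc k)" and ?G = "Abs_fps (\<lambda>k. c a ^ Suc k)"
  have LG: "?L * ?G = fps_const (c a)"
  proof (rule fps_ext)
    show "(?L * ?G) $ n = fps_const (c a) $ n" for n
      by (cases n) (simp_all add: left_diff_distrib mult.assoc)
  qed
  have "Abs_fps (\<lambda>k. \<Sum>j\<in>insert a S. c j ^ Suc k) = ?G + ?A"
    using insert.hyps by (simp add: fps_eq_iff)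
  moreover have "- (L * P) * (G + A) = - (L * G) * P - L * P * A" for L P G A :: "complex fps"
    by (simp add: algebra_simps)
  ultimately have *: "- (?L * ?P) * Abs_fps (\<lambda>k. \<Sum>j\<in>insert a S. c j ^ Suc k) = - fps_const (c a) * ?P - ?L * ?P * ?A"
    using LG by presburger
  have "fps_deriv (?L * ?P) = - fps_const (c a) * ?P + ?L * fps_deriv ?P"
    by (simp add: fps_deriv_mult)
  then show ?case
    using insert.hyps * by (simp add: insert.IH mult.assoc)
qed

text \<open>Multiplicity is encoded by fibres: \<open>lam\<close> takes each zero as a value as
  often as its order says, so that sums over labels count zeros with multiplicity.\<close>

locale zero_enumeration =
  fixes D :: "complex \<Rightarrow> complex" and lam :: "'i \<Rightarrow> complex" and I :: "'i set" and K :: real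
  assumes hol: "D holomorphic_on UNIV" and D0: "D 0 = 1" and K: "K > 0"
    and growth: "\<And>z. norm (D z) \<le> exp (K * norm z)"
    and zeros: "lam ` I = {z. D z = 0}"
    and finite_fibre: "\<And>z. D z = 0 \<Longrightarrow> finite {j \<in> I. lam j = z}"
    and fibre_less: "\<And>z i. D z = 0 \<Longrightarrow> i < card {j \<in> I. lam j = z} \<Longrightarrow> (deriv ^^ i) D z = 0"
    and fibre_eq: "\<And>z. D z = 0 \<Longrightarrow> (deriv ^^ card {j \<in> I. lam j = z}) D z \<noteq> 0"
begin

definition zset :: "real \<Rightarrow> 'i set" where
  "zset r = {j \<in> I. norm (lam j) \<le> r}"

lemma lam_nonzero: "j \<in> I \<Longrightarrow> lam j \<noteq> 0"
  using zeros D0 by force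

lemma D_lam: "j \<in> I \<Longrightarrow> D (lam j) = 0"
  using zeros by blast

lemma finite_zeros: "finite {z \<in> cball 0 r. D z = 0}"
proof (cases "D constant_on UNIV")
  case True
  then have "D z = 1" for z using D0 unfolding constant_on_def by auto
  then show ?thesis by simp
next
  case False
  then show ?thesis by (intro holomorphic_compact_finite_zeros[OF hol]) auto
qed

lemma finite_zset: "finite (zset r)"
proof -
  have "zset r \<subseteq> (\<Union>z\<in>{z \<in> cball 0 r. D z = 0}. {j \<in> I. lam j = z})"
    by (auto simp: zset_def D_lam)
  then show ?thesis
    by (rule finite_subset) (use finite_zeros finite_fibre in auto)
qed

lemma zset_mono: "r \<le> s \<Longrightarrow> zset r \<subseteq> zset s"
  by (auto simp: zset_def)

text \<open>The product over the zeros up to radius \<open>2 * R\<close> is compared with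
  \<open>D\<close> on the larger circle of radius \<open>4 * R\<close>. There each factor has
  modulus at least 1, so the maximum principle hands the growth bound of \<open>D\<close> to the
  quotient without any count of zeros. \<open>Borel_Caratheodory_log\<close> then halves the
  radius.\<close>

lemma quotient:
  assumes R: "R > 0"
  obtains h where "h holomorphic_on ball 0 (2 * R)" "h 0 = 0"
    "\<And>z. z \<in> ball 0 (2 * R) \<Longrightarrow> D z = exp (h z) * (\<Prod>j\<in>zset (2 * R). 1 - z / lam j)"
    "\<And>z. norm z \<le> R \<Longrightarrow> norm (h z) \<le> 10 * K * R"
proof -
  define Z where "Z = {z \<in> cball 0 (2 * R). D z = 0}"
  define m where "m z = card {j \<in> I. lam j = z}" for z
  obtain g where g: "g holomorphic_on UNIV" "\<And>z. D z = g z * (\<Prod>w\<in>Z. (1 - z / w) ^ m w)" "\<And>w. w \<in> Z \<Longrightarrow> g w \<noteq> 0"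
  proof -
    have "\<exists>g. g holomorphic_on UNIV \<and> (\<forall>z. D z = g z * (\<Prod>w\<in>Z. (1 - z / w) ^ m w)) \<and> (\<forall>w\<in>Z. g w \<noteq> 0)"
      by (rule entire_divide_zeros[OF hol]) (use finite_zeros fibre_less fibre_eq D0 in \<open>auto simp: Z_def m_def\<close>)
    then show ?thesis using that by blast
  qed
  define P where "P z = (\<Prod>j\<in>zset (2 * R). 1 - z / lam j)" for z
  have P: "(\<Prod>w\<in>Z. (1 - z / w) ^ m w) = P z" for z
  proof -
    have "P z = (\<Prod>w\<in>lam ` zset (2 * R). \<Prod>j\<in>{j \<in> zset (2 * R). lam j = w}. 1 - z / lam j)"
      unfolding P_def by (rule prod.image_gen[OF finite_zset])
    also have "lam ` zset (2 * R) = Z"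
      using zeros by (auto simp: Z_def zset_def)
    also have "(\<Prod>w\<in>Z. \<Prod>j\<in>{j \<in> zset (2 * R). lam j = w}. 1 - z / lam j) = (\<Prod>w\<in>Z. (1 - z / w) ^ m w)"
    proof (rule prod.cong[OF refl])
      fix w assume w: "w \<in> Z"
      then have "{j \<in> zset (2 * R). lam j = w} = {j \<in> I. lam j = w}" by (auto simp: zset_def Z_def)
      then show "(\<Prod>j\<in>{j \<in> zset (2 * R). lam j = w}. 1 - z / lam j) = (1 - z / w) ^ m w"
        by (simp add: m_def)
    qed
    finally show ?thesis ..
  qed
  have Dg: "D z = g z * P z" for z using g(2)[of z] P by simp
  have g0: "g 0 = 1" using Dg[of 0] D0 by (simp add: P_def)
  have gnz: "g z \<noteq> 0" if "norm z \<le> 2 * R" for z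
  proof (cases "D z = 0")
    case True then show ?thesis using g(3)[of z] that by (simp add: Z_def)
  next
    case False then show ?thesis using Dg[of z] by auto
  qed
  have gb: "norm (g z) \<le> exp (4 * K * R)" if z: "norm z \<le> 4 * R" for z
  proof (rule maximum_modulus_frontier[of g "cball 0 (4 * R)"])
    fix z :: complex assume "z \<in> frontier (cball 0 (4 * R))"
    then have z: "norm z = 4 * R" using R by (simp add: frontier_cball)
    have "1 \<le> norm (P z)"
      unfolding P_def prod_norm[symmetric]
    proof (rule prod_ge_1)
      fix j assume j: "j \<in> zset (2 * R)"
      then have l: "norm (lam j) > 0" "norm (lam j) \<le> 2 * R" using lam_nonzero by (auto simp: zset_def)
      then have "2 \<le> norm (z / lam j)" using z by (simp add: norm_divide field_simps)
      then show "1 \<le> norm (1 - z / lam j)" using norm_triangle_ineq3[of "z / lam j" 1] by (simp add: norm_minus_commute)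
    qed
    then have "norm (g z) * 1 \<le> norm (g z) * norm (P z)" by (intro mult_left_mono) auto
    also have "\<dots> = norm (D z)" by (simp add: Dg norm_mult)
    also have "\<dots> \<le> exp (K * norm z)" by (rule growth)
    finally show "norm (g z) \<le> exp (4 * K * R)" using z by (simp add: mult_ac)
  qed (use z in \<open>auto intro: holomorphic_on_subset[OF g(1)] continuous_on_subset[OF holomorphic_on_imp_continuous_on[OF g(1)]]\<close>)
  \<comment> \<open>5 in place of 4 gives the strict bound that
    \<open>Borel_Caratheodory_log\<close> asks for; twice 5 is the constant 10 of the
    conclusion.\<close>
  have gs: "norm (g z) < exp (5 * K * R)" if "z \<in> ball 0 (2 * R)" for z
  proof -
    have "norm (g z) \<le> exp (4 * K * R)" by (rule gb) (use that R in auto)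
    also have "\<dots> < exp (5 * K * R)" using K R by simp
    finally show ?thesis .
  qed
  obtain h where h: "h holomorphic_on ball 0 (2 * R)" "h 0 = 0" "\<And>z. z \<in> ball 0 (2 * R) \<Longrightarrow> g z = exp (h z)"
    "\<And>z. norm z \<le> 2 * R / 2 \<Longrightarrow> norm (h z) \<le> 2 * (5 * K * R)"
  proof (rule Borel_Caratheodory_log[of g "2 * R" "5 * K * R"])
    show "g holomorphic_on ball 0 (2 * R)" by (rule holomorphic_on_subset[OF g(1)]) simp
    show "g z \<noteq> 0" if "z \<in> ball 0 (2 * R)" for z by (rule gnz) (use that in auto)
  qed (use g0 R K gs in auto)
  show thesis
    by (rule that[OF h(1,2)]) (use h(3,4) in \<open>auto simp: Dg P_def mult.assoc\<close>)
qed

context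
  fixes F T :: "complex fps"
  assumes F: "D has_fps_expansion F" and T: "F * T = - fps_deriv F"
begin

lemma F_nonzero: "F \<noteq> 0"
proof -
  have "F $ 0 = 1" using has_fps_expansion_imp_0_eq_fps_nth_0[OF F] D0 by simp
  then show ?thesis by auto
qed

text \<open>The logarithmic derivative of \<open>D\<close> is computed twice as a formal series: it
  is \<open>- T\<close> by assumption, and by the factorization it is the derivative of h minus the
  generating series of the power sums. The size of the coefficients is Cauchy's inequality at radius
  \<open>R\<close>.\<close>

lemma log_coefficients:
  assumes R: "R > 0"
  obtains c where "\<And>z. norm z < R \<Longrightarrow> \<exists>w. ((\<lambda>n. c n * z ^ n) sums w) \<and> D z = exp w * (\<Prod>j\<in>zset (2 * R). 1 - z / lam j)"
    "c 0 = 0" "\<And>n. norm (c n) \<le> 10 * K * R / R ^ n"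
    "\<And>k. of_nat (Suc k) * c (Suc k) = (\<Sum>j\<in>zset (2 * R). inverse (lam j) ^ Suc k) - T $ k"
proof -
  obtain h where h: "h holomorphic_on ball 0 (2 * R)" "h 0 = 0"
    "\<And>z. z \<in> ball 0 (2 * R) \<Longrightarrow> D z = exp (h z) * (\<Prod>j\<in>zset (2 * R). 1 - z / lam j)"
    "\<And>z. norm z \<le> R \<Longrightarrow> norm (h z) \<le> 10 * K * R"
    using quotient[OF R] by blast
  define c where "c n = (deriv ^^ n) h 0 / fact n" for n
  have hR: "h holomorphic_on ball 0 R" by (rule holomorphic_on_subset[OF h(1)]) (use R in auto)
  have sums: "(\<lambda>n. c n * z ^ n) sums h z" if "norm z < R" for z
    using holomorphic_power_series[OF hR, of z] that by (simp add: c_def)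
  have bound: "norm (c n) \<le> 10 * K * R / R ^ n" for n
  proof -
    have "norm ((deriv ^^ n) h 0) \<le> fact n * (10 * K * R) / R ^ n"
    proof (rule Cauchy_inequality[OF hR _ R])
      show "continuous_on (cball 0 R) h"
        by (rule continuous_on_subset[OF holomorphic_on_imp_continuous_on[OF h(1)]]) (use R in auto)
    qed (use h(4) in auto)
    then show ?thesis by (simp add: c_def norm_divide field_simps)
  qed
  define H where "H = fps_expansion h 0"
  have H: "h has_fps_expansion H"
    unfolding H_def by (rule has_fps_expansion_fps_expansion[OF open_ball _ hR]) (use R in auto)
  have Hn: "H $ n = c n" for n by (simp add: H_def fps_expansion_def c_def)
  define E where "E = fps_expansion (\<lambda>z. exp (h z)) 0"
  have E: "(\<lambda>z. exp (h z)) has_fps_expansion E"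
    unfolding E_def by (rule has_fps_expansion_fps_expansion[OF open_ball _ holomorphic_on_exp'[OF hR]]) (use R in auto)
  have Ed: "fps_deriv E = E * fps_deriv H"
  proof (rule fps_expansion_unique_complex)
    show "deriv (\<lambda>z. exp (h z)) has_fps_expansion fps_deriv E" by (intro has_fps_expansion_deriv E)
    have *: "(\<lambda>z. exp (h z) * deriv h z) has_fps_expansion E * fps_deriv H"
      by (intro has_fps_expansion_mult E has_fps_expansion_deriv H)
    have "eventually (\<lambda>z. exp (h z) * deriv h z = deriv (\<lambda>z. exp (h z)) z) (nhds 0)"
    proof -
      have "eventually (\<lambda>z. z \<in> ball 0 R) (nhds (0 :: complex))" using R by (intro eventually_nhds_in_open) auto
      then show ?thesis
      proof eventually_elim
        case (elim z)
        have "(h has_field_derivative deriv h z) (at z)" by (rule holomorphic_derivI[OF hR open_ball elim])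
        then have "((\<lambda>z. exp (h z)) has_field_derivative exp (h z) * deriv h z) (at z)" by (rule DERIV_chain2[OF DERIV_exp])
        then show ?case by (simp add: DERIV_imp_deriv)
      qed
    qed
    from has_fps_expansion_cong[OF this refl] * show "deriv (\<lambda>z. exp (h z)) has_fps_expansion E * fps_deriv H"
      by simp
  qed
  define P where "P = (\<Prod>j\<in>zset (2 * R). 1 - fps_const (inverse (lam j)) * fps_X)"
  have P: "(\<lambda>z. \<Prod>j\<in>zset (2 * R). 1 - z / lam j) has_fps_expansion P"
  proof -
    have "(\<lambda>z. \<Prod>j\<in>zset (2 * R). 1 - inverse (lam j) * z) has_fps_expansion P"
      unfolding P_def by (intro fps_expansion_intros)
    then show ?thesis by (simp add: divide_inverse mult.commute)
  qed
  have "F = E * P"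
  proof (rule fps_expansion_unique_complex[OF F])
    have *: "(\<lambda>z. exp (h z) * (\<Prod>j\<in>zset (2 * R). 1 - z / lam j)) has_fps_expansion E * P"
      by (intro has_fps_expansion_mult E P)
    have "eventually (\<lambda>z. z \<in> ball 0 (2 * R)) (nhds (0 :: complex))" using R by (intro eventually_nhds_in_open) auto
    then have "eventually (\<lambda>z. exp (h z) * (\<Prod>j\<in>zset (2 * R). 1 - z / lam j) = D z) (nhds 0)"
      by eventually_elim (simp add: h(3))
    from has_fps_expansion_cong[OF this refl] * show "D has_fps_expansion E * P" by simp
  qed
  define A where "A = Abs_fps (\<lambda>k. \<Sum>j\<in>zset (2 * R). inverse (lam j) ^ Suc k)"
  have "fps_deriv P = - P * A" unfolding P_def A_def by (rule fps_deriv_prod_linear[OF finite_zset])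
  then have "F * T = F * (A - fps_deriv H)"
    unfolding T unfolding \<open>F = E * P\<close> by (simp add: Ed fps_deriv_mult algebra_simps)
  then have "T = A - fps_deriv H" using F_nonzero by simp
  then have "T $ k = A $ k - of_nat (Suc k) * c (Suc k)" for k by (simp add: Hn)
  then have coeff: "of_nat (Suc k) * c (Suc k) = (\<Sum>j\<in>zset (2 * R). inverse (lam j) ^ Suc k) - T $ k" for k
    by (simp add: A_def)
  show thesis
  proof (rule that[of c])
    fix z :: complex assume z: "norm z < R"
    then show "\<exists>w. ((\<lambda>n. c n * z ^ n) sums w) \<and> D z = exp w * (\<Prod>j\<in>zset (2 * R). 1 - z / lam j)"
      using sums[OF z] h(3)[of z] R by (intro exI[of _ "h z"]) auto
  qed (use h(2) bound coeff in \<open>auto simp: c_def\<close>)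
qed

text \<open>
  The constant \<open>K\<close> does not depend on \<open>R\<close>, so for \<open>k \<ge> 1\<close> the power sums over discs converge, whereas for
  \<open>k = 0\<close> they are only bounded.
\<close>

lemma power_sum_bound:
  assumes R: "R > 0"
  shows "norm ((\<Sum>j\<in>zset (2 * R). inverse (lam j) ^ Suc k) - T $ k) \<le> real (Suc k) * (10 * K) / R ^ k"
proof -
  obtain c where "\<And>z. norm z < R \<Longrightarrow> \<exists>w. ((\<lambda>n. c n * z ^ n) sums w) \<and> D z = exp w * (\<Prod>j\<in>zset (2 * R). 1 - z / lam j)"
    "c 0 = 0" and c: "\<And>n. norm (c n) \<le> 10 * K * R / R ^ n"
    "\<And>k. of_nat (Suc k) * c (Suc k) = (\<Sum>j\<in>zset (2 * R). inverse (lam j) ^ Suc k) - T $ k"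
    by (rule log_coefficients[OF R]) (rule that; fast)
  have "norm ((\<Sum>j\<in>zset (2 * R). inverse (lam j) ^ Suc k) - T $ k) = real (Suc k) * norm (c (Suc k))"
    unfolding c(2)[symmetric] norm_mult norm_of_nat ..
  also have "\<dots> \<le> real (Suc k) * (10 * K * R / R ^ Suc k)" by (intro mult_left_mono c) auto
  finally show ?thesis using R by simp
qed

text \<open>Only the linear coefficient of the exponent is kept. The Taylor tail from degree 2 on is
  dominated by a geometric series of ratio at most 1/2 and, for fixed \<open>z\<close>, tends to 0
  as \<open>R\<close> grows; the estimate of the linear coefficient has no such decay.\<close>

lemma product_approximation:
  assumes R: "R > 0" and z: "norm z \<le> R / 2"
  shows "\<exists>w. norm w \<le> 20 * K * (norm z)\<^sup>2 / R \<and>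
    D z = exp (((\<Sum>j\<in>zset (2 * R). inverse (lam j)) - T $ 0) * z + w) * (\<Prod>j\<in>zset (2 * R). 1 - z / lam j)"
proof -
  obtain c where c: "\<And>z. norm z < R \<Longrightarrow> \<exists>w. ((\<lambda>n. c n * z ^ n) sums w) \<and> D z = exp w * (\<Prod>j\<in>zset (2 * R). 1 - z / lam j)"
    "c 0 = 0" "\<And>n. norm (c n) \<le> 10 * K * R / R ^ n"
    "\<And>k. of_nat (Suc k) * c (Suc k) = (\<Sum>j\<in>zset (2 * R). inverse (lam j) ^ Suc k) - T $ k"
    by (rule log_coefficients[OF R]) (rule that; fast)
  obtain v where v: "(\<lambda>n. c n * z ^ n) sums v" "D z = exp v * (\<Prod>j\<in>zset (2 * R). 1 - z / lam j)"
    using c(1)[of z] z R by auto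
  have c1: "c 1 = (\<Sum>j\<in>zset (2 * R). inverse (lam j)) - T $ 0" using c(4)[of 0] by simp
  define q where "q = norm z / R"
  have q: "0 \<le> q" "q \<le> 1 / 2" using z R by (auto simp: q_def field_simps)
  have s2: "(\<lambda>n. c (n + 2) * z ^ (n + 2)) sums (v - c 1 * z)"
    using sums_split_initial_segment[OF v(1), of 2] c(2) by (simp add: numeral_2_eq_2)
  have le: "norm (c (n + 2) * z ^ (n + 2)) \<le> 10 * K * R * q\<^sup>2 * q ^ n" for n
  proof -
    have "norm (c (n + 2) * z ^ (n + 2)) \<le> (10 * K * R / R ^ (n + 2)) * norm z ^ (n + 2)"
      unfolding norm_mult norm_power by (intro mult_right_mono c) auto
    also have "\<dots> = 10 * K * R * q ^ (n + 2)" by (simp add: q_def power_divide)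
    also have "\<dots> = 10 * K * R * q\<^sup>2 * q ^ n" by (simp add: power_add power2_eq_square)
    finally show ?thesis .
  qed
  have "summable (\<lambda>n. 10 * K * R * q\<^sup>2 * q ^ n)" using q by (intro summable_mult summable_geometric) auto
  then have "norm (\<Sum>n. c (n + 2) * z ^ (n + 2)) \<le> (\<Sum>n. 10 * K * R * q\<^sup>2 * q ^ n)"
    using le by (intro norm_suminf_le) auto
  also have "\<dots> = 10 * K * R * q\<^sup>2 * (1 / (1 - q))"
    using q by (subst suminf_mult) (auto simp: suminf_geometric)
  also have "\<dots> \<le> 10 * K * R * q\<^sup>2 * 2" using q K R by (intro mult_left_mono) (auto simp: divide_simps)
  also have "\<dots> = 20 * K * (norm z)\<^sup>2 / R" using R by (simp add: q_def power2_eq_square)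
  finally have "norm (v - c 1 * z) \<le> 20 * K * (norm z)\<^sup>2 / R" using sums_unique[OF s2] by simp
  then show ?thesis using v(2) unfolding c1[symmetric] by (intro exI[of _ "v - c 1 * z"]) simp
qed

end

end

text \<open>Unconditional sums may be evaluated along any exhaustion by finite sets; below these are
  discs and symmetric ranges of labels.\<close>

lemma has_sum_exhaustion:
  assumes f: "(f has_sum v) A" and S: "\<And>n. finite (S n)" "\<And>n. S n \<subseteq> A"
    and e: "\<And>x. x \<in> A \<Longrightarrow> eventually (\<lambda>n. x \<in> S n) F"
  shows "((\<lambda>n. sum f (S n)) \<longlongrightarrow> v) F"
proof (rule filterlim_compose[of "sum f" _ "finite_subsets_at_top A" S])
  show "(sum f \<longlongrightarrow> v) (finite_subsets_at_top A)" using f by (simp add: has_sum_def)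
  show "filterlim S (finite_subsets_at_top A) F"
    unfolding filterlim_iff eventually_finite_subsets_at_top
  proof (intro allI impI)
    fix P assume "\<exists>X. finite X \<and> X \<subseteq> A \<and> (\<forall>Y. finite Y \<and> X \<subseteq> Y \<and> Y \<subseteq> A \<longrightarrow> P Y)"
    then obtain X where X: "finite X" "X \<subseteq> A" "\<forall>Y. finite Y \<and> X \<subseteq> Y \<and> Y \<subseteq> A \<longrightarrow> P Y" by (elim exE conjE)
    have "eventually (\<lambda>n. \<forall>x\<in>X. x \<in> S n) F"
      by (rule eventually_ball_finite[OF X(1)]) (use e X(2) in blast)
    then show "eventually (\<lambda>n. P (S n)) F"
    proof eventually_elim
      case (elim n)
      then show ?case using X(3)[rule_format, of "S n"] S by auto
    qed
  qed
qed

lemma bounded_sums_summable_on: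
  fixes f :: "'a \<Rightarrow> complex"
  assumes "\<And>F. finite F \<Longrightarrow> F \<subseteq> A \<Longrightarrow> (\<Sum>x\<in>F. norm (f x)) \<le> C"
  shows "f summable_on A"
proof (rule abs_summable_summable)
  show "(\<lambda>x. norm (f x)) summable_on A"
    by (rule nonneg_bdd_above_summable_on) (use assms in \<open>auto intro!: bdd_aboveI[of _ C]\<close>)
qed

text \<open>Dominated convergence, uniform in \<open>S\<close>. With \<open>b j\<close> the inverse
  squared modulus of a zero, the denominator is \<open>x\<^sup>2 / 8\<close> plus half the squared
  modulus, a lower bound for the squared distance of that zero from a far real point.\<close>

lemma small_shifted_sums:
  fixes b :: "'i \<Rightarrow> real"
  assumes b: "b summable_on I" "\<And>j. j \<in> I \<Longrightarrow> b j > 0" and \<eta>: "\<eta> > 0"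
  shows "\<exists>X>0. \<forall>x\<ge>X. \<forall>S. finite S \<and> S \<subseteq> I \<longrightarrow> (\<Sum>j\<in>S. 1 / (x\<^sup>2 / 8 + 1 / (2 * b j))) \<le> \<eta>"
proof -
  have hs: "(b has_sum infsum b I) I" using b(1) by (rule has_sum_infsum)
  obtain F where F: "finite F" "F \<subseteq> I" "dist (sum b F) (infsum b I) < \<eta> / 4"
    using hs[unfolded has_sum_def, THEN tendstoD, of "\<eta> / 4"] \<eta> unfolding eventually_finite_subsets_at_top by auto
  \<comment> \<open>The terms in \<open>F\<close> are at most \<open>8 / x\<^sup>2\<close> each and
    together at most \<eta> / 2; the other terms are bounded by a tail of \<open>b\<close> and give
    the other half.\<close>
  define X where "X = max 1 (16 * real (card F) / \<eta>)"
  show ?thesis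
  proof (intro exI[of _ X] conjI allI impI)
    show "X > 0" by (simp add: X_def)
    fix x S assume x: "X \<le> x" and S: "finite S \<and> S \<subseteq> I"
    let ?q = "\<lambda>j. x\<^sup>2 / 8 + 1 / (2 * b j)"
    have x1: "x \<ge> 1" using x by (simp add: X_def)
    have pos: "?q j > 0" if "j \<in> I" for j using b(2)[OF that] x1 by (intro add_pos_pos) auto
    have "(\<Sum>j\<in>S. 1 / ?q j) = (\<Sum>j\<in>S \<inter> F. 1 / ?q j) + (\<Sum>j\<in>S - F. 1 / ?q j)"
      using S sum.Int_Diff by blast
    also have "(\<Sum>j\<in>S \<inter> F. 1 / ?q j) \<le> (\<Sum>j\<in>S \<inter> F. 8 / x\<^sup>2)"
    proof (rule sum_mono)
      fix j assume "j \<in> S \<inter> F"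
      then have "b j > 0" using b(2) S by auto
      then have "1 / ?q j \<le> 1 / (x\<^sup>2 / 8)" using x1 by (intro divide_left_mono) (auto intro!: mult_pos_pos add_pos_pos)
      then show "1 / ?q j \<le> 8 / x\<^sup>2" by simp
    qed
    also have "\<dots> = real (card (S \<inter> F)) * (8 / x\<^sup>2)" by simp
    also have "\<dots> \<le> real (card F) * (8 / x\<^sup>2)"
      by (intro mult_right_mono of_nat_mono card_mono F) auto
    also have "\<dots> \<le> \<eta> / 2"
    proof -
      have "16 * real (card F) \<le> \<eta> * x" using x \<eta> by (simp add: X_def field_simps)
      also have "\<dots> \<le> \<eta> * x\<^sup>2" using x1 \<eta> by (intro mult_left_mono) (auto simp: power2_eq_square)
      finally show ?thesis using x1 by (simp add: field_simps)
    qed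
    also have "(\<Sum>j\<in>S - F. 1 / ?q j) \<le> (\<Sum>j\<in>S - F. 2 * b j)"
    proof (rule sum_mono)
      fix j assume "j \<in> S - F"
      then have j: "b j > 0" using b(2) S by auto
      then have "0 < 1 / (2 * b j)" by simp
      then have "1 / ?q j \<le> 1 / (1 / (2 * b j))" by (intro divide_left_mono mult_pos_pos add_nonneg_pos) auto
      then show "1 / ?q j \<le> 2 * b j" by simp
    qed
    also have "\<dots> = 2 * sum b (S - F)" by (simp add: sum_distrib_left)
    also have "\<dots> \<le> \<eta> / 2"
    proof -
      have "sum b F + sum b (S - F) = sum b (F \<union> (S - F))"
        by (rule sum.union_disjoint[symmetric]) (use F S in auto)
      also have "\<dots> \<le> infsum b I"
        by (rule finite_sum_le_infsum[OF b(1)]) (use F S b(2) in \<open>auto intro: less_imp_le\<close>)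
      finally show ?thesis using F(3) unfolding dist_real_def by linarith
    qed
    finally show "(\<Sum>j\<in>S. 1 / ?q j) \<le> \<eta>" by simp
  qed
qed

text \<open>The quotient of the squares is at most 1 + 2 c / q, hence at most the exponential of 2 c
  / q. This compares one factor of the product over the zeros at two real points.\<close>

lemma le_mult_exp_half:
  fixes u v q c :: real
  assumes "u \<ge> 0" "v \<ge> 0" "c \<ge> 0" "q > 0" "q \<le> v\<^sup>2" "u\<^sup>2 \<le> v\<^sup>2 + 2 * c"
  shows "u \<le> v * exp (c * (1 / q))"
proof (rule power2_le_imp_le)
  have "u\<^sup>2 \<le> v\<^sup>2 + 2 * c / q * q" using assms by simp
  also have "\<dots> \<le> v\<^sup>2 + 2 * c / q * v\<^sup>2" using assms by (intro add_left_mono mult_left_mono) auto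
  also have "\<dots> = v\<^sup>2 * (1 + 2 * c / q)" by (simp add: algebra_simps)
  also have "\<dots> \<le> v\<^sup>2 * exp (2 * c / q)" by (intro mult_left_mono exp_ge_add_one_self) auto
  also have "\<dots> = (v * exp (c * (1 / q)))\<^sup>2"
    unfolding power_mult_distrib exp_double[symmetric] by (simp add: exp_double[symmetric])
  finally show "u\<^sup>2 \<le> (v * exp (c * (1 / q)))\<^sup>2" .
qed (use assms in auto)

locale strip_zero_enumeration = zero_enumeration +
  fixes B :: real and F T :: "complex fps"
  assumes B: "B \<ge> 0" and strip: "\<And>j. j \<in> I \<Longrightarrow> - B \<le> Re (lam j) \<and> Re (lam j) \<le> 0"
    and F: "D has_fps_expansion F" and T: "F * T = - fps_deriv F"
begin

text \<open>
  In the strip, \<open>Re \<lambda>\<^sup>-\<^sup>2 \<le> - \<bar>\<lambda>\<bar>\<^sup>-\<^sup>2 / 2\<close> for large \<open>\<lambda>\<close>, so that bounded sums over discs are enough.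
\<close>

lemma summable_inverse_square: "(\<lambda>j. 1 / (norm (lam j))\<^sup>2) summable_on I"
proof -
  let ?b = "\<lambda>j. 1 / (norm (lam j))\<^sup>2"
  \<comment> \<open>Beyond radius \<open>2 * B\<close> the real part is at most half the modulus,
    and \<open>j_le\<close> holds without correction. Each of the finitely many zeros inside is
    corrected by 3 times its term: 2 against the sign of the real part, 1 for the term
    itself.\<close>
  define M where "M = 2 * (norm (T $ 1) + 20 * K) + (\<Sum>j\<in>zset (2 * B). 3 * ?b j)"
  have j_le: "?b j \<le> - 2 * Re (inverse (lam j) ^ 2) + (if j \<in> zset (2 * B) then 3 * ?b j else 0)" if j: "j \<in> I" for j
  proof (cases "j \<in> zset (2 * B)")
    case True
    have "\<bar>Re (inverse (lam j) ^ 2)\<bar> \<le> norm (inverse (lam j) ^ 2)" by (rule abs_Re_le_cmod)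
    also have "\<dots> = ?b j" by (simp add: norm_power norm_inverse power_divide divide_inverse power_inverse)
    finally show ?thesis using True by auto
  next
    case False
    let ?a = "Re (lam j)" and ?t = "Im (lam j)"
    have n: "(norm (lam j))\<^sup>2 = ?a\<^sup>2 + ?t\<^sup>2" by (rule cmod_power2)
    have l: "norm (lam j) > 2 * B" using False j by (simp add: zset_def)
    have p: "?a\<^sup>2 + ?t\<^sup>2 > 0" using lam_nonzero[OF j] unfolding n[symmetric] by simp
    have "(2 * B)\<^sup>2 \<le> (norm (lam j))\<^sup>2" using l B by (intro power_mono) auto
    moreover have "?a\<^sup>2 \<le> B\<^sup>2" using strip[OF j] B by (intro power2_le_iff_abs_le[THEN iffD2]) auto
    ultimately have le: "4 * ?a\<^sup>2 \<le> ?a\<^sup>2 + ?t\<^sup>2" unfolding n by (simp add: power_mult_distrib)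
    have "Re (inverse (lam j) ^ 2) = (?a\<^sup>2 - ?t\<^sup>2) / (?a\<^sup>2 + ?t\<^sup>2)\<^sup>2"
      unfolding power2_eq_square[of "inverse (lam j)"] times_complex.sel inverse_complex.sel
      by (simp add: power2_eq_square diff_divide_distrib)
    then have "- 2 * Re (inverse (lam j) ^ 2) - ?b j = (2 * (?t\<^sup>2 - ?a\<^sup>2) - (?a\<^sup>2 + ?t\<^sup>2)) / (?a\<^sup>2 + ?t\<^sup>2)\<^sup>2"
    proof -
      have "- 2 * ((a - t) / s\<^sup>2) - 1 / s = (2 * (t - a) - s) / s\<^sup>2" if "s > 0" for a t s :: real
        using that by (simp add: field_simps power2_eq_square)
      from this[OF p] show ?thesis using \<open>Re (inverse (lam j) ^ 2) = _\<close> unfolding n by presburger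
    qed
    also have "\<dots> \<ge> 0" using le by (intro divide_nonneg_nonneg) auto
    finally show ?thesis using False by simp
  qed
  have "(\<Sum>j\<in>S. ?b j) \<le> M" if S: "finite S" "S \<subseteq> I" for S
  proof -
    define R where "R = Max (insert 1 (insert B ((\<lambda>j. norm (lam j)) ` S)))"
    have R: "R \<ge> 1" "R \<ge> B" "\<And>j. j \<in> S \<Longrightarrow> norm (lam j) \<le> R"
      unfolding R_def by (rule Max_ge; use S(1) in auto)+
    have SR: "S \<subseteq> zset (2 * R)"
    proof
      fix j assume "j \<in> S"
      then show "j \<in> zset (2 * R)" using R(1) R(3)[of j] S(2) unfolding zset_def by auto
    qed
    have "(\<Sum>j\<in>S. ?b j) \<le> (\<Sum>j\<in>zset (2 * R). ?b j)"
      by (rule sum_mono2[OF finite_zset SR]) simp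
    also have "\<dots> \<le> (\<Sum>j\<in>zset (2 * R). - 2 * Re (inverse (lam j) ^ 2) + (if j \<in> zset (2 * B) then 3 * ?b j else 0))"
      by (rule sum_mono, rule j_le) (simp add: zset_def)
    also have "\<dots> = - 2 * Re (\<Sum>j\<in>zset (2 * R). inverse (lam j) ^ 2) + (\<Sum>j\<in>zset (2 * R). if j \<in> zset (2 * B) then 3 * ?b j else 0)"
      unfolding sum.distrib Re_sum sum_distrib_left ..
    also have "(\<Sum>j\<in>zset (2 * R). if j \<in> zset (2 * B) then 3 * ?b j else 0) = (\<Sum>j\<in>zset (2 * B). 3 * ?b j)"
    proof -
      have "zset (2 * R) \<inter> zset (2 * B) = zset (2 * B)" using zset_mono[of "2 * B" "2 * R"] R(2) by auto
      then show ?thesis using sum.inter_restrict[OF finite_zset, of "\<lambda>j. 3 * ?b j" "2 * R" "zset (2 * B)"] by simp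
    qed
    also have "- 2 * Re (\<Sum>j\<in>zset (2 * R). inverse (lam j) ^ 2) \<le> 2 * (norm (T $ 1) + 20 * K)"
    proof -
      let ?s = "\<Sum>j\<in>zset (2 * R). inverse (lam j) ^ 2"
      have "norm (?s - T $ 1) \<le> 20 * K / R"
        using power_sum_bound[OF F T, of R 1] R(1) by (simp add: numeral_2_eq_2)
      also have "\<dots> \<le> 20 * K" using R(1) K by (simp add: field_simps)
      finally have "norm ?s \<le> norm (T $ 1) + 20 * K" using norm_triangle_ineq2[of ?s "T $ 1"] by simp
      moreover have "- Re ?s \<le> norm ?s" using abs_Re_le_cmod[of ?s] by simp
      ultimately show ?thesis by simp
    qed
    finally show ?thesis by (simp add: M_def)
  qed
  then show ?thesis
    by (intro nonneg_bdd_above_summable_on) (auto intro!: bdd_aboveI[of _ M])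
qed

lemma eventually_zset: "j \<in> I \<Longrightarrow> eventually (\<lambda>n. j \<in> zset (2 * real n)) sequentially"
proof -
  assume j: "j \<in> I"
  obtain N where N: "norm (lam j) \<le> real N" using real_arch_simple by blast
  show ?thesis
    by (rule eventually_sequentiallyI[of N]) (use N j in \<open>auto simp: zset_def\<close>)
qed

lemma zset_subset: "zset r \<subseteq> I"
  by (auto simp: zset_def)

lemma power_sum_limit:
  assumes k: "k \<ge> 1"
  shows "(\<lambda>n. \<Sum>j\<in>zset (2 * real n). inverse (lam j) ^ Suc k) \<longlonglongrightarrow> T $ k"
proof (rule LIM_zero_cancel, rule Lim_null_comparison)
  show "eventually (\<lambda>n. norm ((\<Sum>j\<in>zset (2 * real n). inverse (lam j) ^ Suc k) - T $ k) \<le> real (Suc k) * (10 * K) * (1 / real n ^ k)) sequentially"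
    by (rule eventually_sequentiallyI[of 1]) (use power_sum_bound[OF F T] in auto)
  have "(\<lambda>n. (1 / real n) ^ k) \<longlonglongrightarrow> 0"
    using tendsto_power[OF lim_1_over_n[where 'a = real], of k] k by (simp add: zero_power)
  then have "(\<lambda>n. 1 / real n ^ k) \<longlonglongrightarrow> 0" by (simp add: power_one_over)
  then show "(\<lambda>n. real (Suc k) * (10 * K) * (1 / real n ^ k)) \<longlonglongrightarrow> 0"
    by (rule tendsto_mult_right_zero)
qed

text \<open>The total \<open>C\<close> of the inverse squares bounds each of them, so higher powers
  are dominated by the squares. The value is then found along the discs.\<close>

theorem has_sum_inverse_power:
  assumes k: "k \<ge> 1"
  shows "((\<lambda>j. inverse (lam j) ^ Suc k) has_sum T $ k) I"
proof -
  let ?b = "\<lambda>j. 1 / (norm (lam j))\<^sup>2"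
  define C where "C = infsum ?b I"
  have C: "sum ?b S \<le> C" if "finite S" "S \<subseteq> I" for S
    unfolding C_def by (rule finite_sum_le_infsum[OF summable_inverse_square that]) simp
  have C0: "C \<ge> 0" using C[of "{}"] by simp
  obtain m where m: "k = Suc m" using k by (cases k) auto
  have "(\<lambda>j. inverse (lam j) ^ Suc k) summable_on I"
  proof (rule bounded_sums_summable_on[where C = "sqrt C ^ m * C"])
    fix S assume S: "finite S" "S \<subseteq> I"
    have "(\<Sum>j\<in>S. norm (inverse (lam j) ^ Suc k)) \<le> (\<Sum>j\<in>S. sqrt C ^ m * ?b j)"
    proof (rule sum_mono)
      fix j assume "j \<in> S"
      then have "?b j \<le> C" using C[of "{j}"] S by auto
      then have "norm (inverse (lam j)) \<le> sqrt C"
        by (intro real_le_rsqrt) (simp add: norm_inverse power_inverse divide_inverse)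
      then have "norm (inverse (lam j)) ^ m \<le> sqrt C ^ m" by (intro power_mono) auto
      then have "norm (inverse (lam j)) ^ m * ?b j \<le> sqrt C ^ m * ?b j" by (rule mult_right_mono) simp
      moreover have "norm (inverse (lam j) ^ Suc k) = norm (inverse (lam j)) ^ m * ?b j"
        unfolding norm_power m by (simp add: norm_inverse power_inverse divide_inverse power2_eq_square)
      ultimately show "norm (inverse (lam j) ^ Suc k) \<le> sqrt C ^ m * ?b j" by simp
    qed
    also have "\<dots> = sqrt C ^ m * sum ?b S" by (simp add: sum_distrib_left)
    also have "\<dots> \<le> sqrt C ^ m * C" using C[OF S] C0 by (intro mult_left_mono) auto
    finally show "(\<Sum>j\<in>S. norm (inverse (lam j) ^ Suc k)) \<le> sqrt C ^ m * C" .
  qed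
  then obtain v where v: "((\<lambda>j. inverse (lam j) ^ Suc k) has_sum v) I" by (auto simp: summable_on_def)
  have "(\<lambda>n. \<Sum>j\<in>zset (2 * real n). inverse (lam j) ^ Suc k) \<longlonglongrightarrow> v"
    by (rule has_sum_exhaustion[OF v finite_zset zset_subset eventually_zset])
  then have "v = T $ k" using power_sum_limit[OF k] LIMSEQ_unique by blast
  then show ?thesis using v by simp
qed

text \<open>The linear coefficient that the exponential factor keeps beside the product over the
  disc of radius \<open>2 * R\<close>; the case n = 1 amounts to its convergence to 0.\<close>

definition defect :: "real \<Rightarrow> complex" where
  "defect R = (\<Sum>j\<in>zset (2 * R). inverse (lam j)) - T $ 0"

text \<open>The factorization of \<open>D\<close> is compared at two real points. If the products
  over the zeros nearly agree, an inequality between values of \<open>D\<close> becomes one between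
  exponents, hence a one-sided bound for the real part of the defect; the sign of
  \<open>u - v\<close> decides on which side.\<close>

lemma Re_defect_bound:
  assumes R: "R > 0" and u: "\<bar>u\<bar> \<le> R / 2" and v: "\<bar>v\<bar> \<le> R / 2"
    and le: "norm (D (of_real u)) \<le> norm (D (of_real v))" and nz: "D (of_real u) \<noteq> 0"
    and fac: "\<And>j. j \<in> I \<Longrightarrow> norm (1 - of_real v / lam j) \<le> norm (1 - of_real u / lam j) * exp (c * e j)"
    and e: "(\<Sum>j\<in>zset (2 * R). e j) \<le> \<eta>" and c: "c \<ge> 0"
  shows "Re (defect R) * (u - v) \<le> c * \<eta> + 20 * K * (u\<^sup>2 + v\<^sup>2) / R"
proof -
  let ?P = "\<lambda>z. \<Prod>j\<in>zset (2 * R). 1 - z / lam j"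
  obtain w where w: "norm w \<le> 20 * K * (norm (complex_of_real u))\<^sup>2 / R"
    "D (of_real u) = exp (defect R * of_real u + w) * ?P (of_real u)"
    unfolding defect_def using product_approximation[OF F T R, of "of_real u"] u by auto
  obtain x where x: "norm x \<le> 20 * K * (norm (complex_of_real v))\<^sup>2 / R"
    "D (of_real v) = exp (defect R * of_real v + x) * ?P (of_real v)"
    unfolding defect_def using product_approximation[OF F T R, of "of_real v"] v by auto
  have "norm (?P (of_real v)) \<le> (\<Prod>j\<in>zset (2 * R). norm (1 - of_real u / lam j) * exp (c * e j))"
    unfolding prod_norm[symmetric] using fac by (intro prod_mono) (auto simp: zset_def)
  also have "\<dots> = norm (?P (of_real u)) * exp (c * (\<Sum>j\<in>zset (2 * R). e j))"
    by (simp add: prod.distrib prod_norm exp_sum[OF finite_zset] sum_distrib_left)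
  also have "\<dots> \<le> norm (?P (of_real u)) * exp (c * \<eta>)"
    using e c by (intro mult_left_mono) (auto intro: mult_left_mono)
  finally have P: "norm (?P (of_real v)) \<le> norm (?P (of_real u)) * exp (c * \<eta>)" .
  have P0: "norm (?P (of_real u)) > 0" using nz w(2) by auto
  have "exp (Re (defect R) * u + Re w) * norm (?P (of_real u)) = norm (D (of_real u))"
    unfolding w(2) by (simp add: norm_mult)
  also have "\<dots> \<le> norm (D (of_real v))" by (rule le)
  also have "\<dots> = exp (Re (defect R) * v + Re x) * norm (?P (of_real v))"
    unfolding x(2) by (simp add: norm_mult)
  also have "\<dots> \<le> exp (Re (defect R) * v + Re x) * (norm (?P (of_real u)) * exp (c * \<eta>))"
    using P by (intro mult_left_mono) auto
  also have "\<dots> = exp (Re (defect R) * v + Re x + c * \<eta>) * norm (?P (of_real u))"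
    by (simp add: exp_add)
  finally have "exp (Re (defect R) * u + Re w) \<le> exp (Re (defect R) * v + Re x + c * \<eta>)"
    using P0 by simp
  then have "Re (defect R) * (u - v) \<le> c * \<eta> + Re x - Re w" by (simp add: algebra_simps)
  also have "\<dots> \<le> c * \<eta> + norm x + norm w"
    using abs_Re_le_cmod[of x] abs_Re_le_cmod[of w] by linarith
  also have "\<dots> \<le> c * \<eta> + 20 * K * (u\<^sup>2 + v\<^sup>2) / R"
    using w(1) x(1) by (simp add: algebra_simps add_divide_distrib)
  finally show ?thesis .
qed

end

locale reflected_zero_enumeration = strip_zero_enumeration +
  assumes reflect: "\<And>x. x \<ge> B \<Longrightarrow> norm (D (of_real (- x))) \<le> norm (D (of_real x))"
      "\<And>x. x \<ge> B \<Longrightarrow> norm (D (of_real x)) \<le> norm (D (of_real (- x - B)))"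
    and nonzero: "\<And>x. x \<ge> B \<Longrightarrow> D (of_real x) \<noteq> 0" "\<And>x. x \<ge> B \<Longrightarrow> D (of_real (- x)) \<noteq> 0"
begin

text \<open>
  The two inequalities of \<open>reflect\<close> bound the defect from below and from above: a point \<open>x\<close> and its reflection
  have almost the same distances to the zeros in the strip.
\<close>

lemma Re_defect_limit: "(\<lambda>n. Re (defect (real n))) \<longlonglongrightarrow> 0"
proof (rule LIMSEQ_I)
  fix r :: real assume r: "r > 0"
  \<comment> \<open>Order of the choices: \<eta> from the target \<open>r\<close>, then
    \<open>x\<close> so far out that the sums of \<open>1 / ?q x j\<close> over the zeros stay below
    \<eta>, and at last \<open>N\<close>, beyond which the Taylor tails are small for this fixed
    \<open>x\<close>.\<close>
  define \<eta> where "\<eta> = r / (2 * (B + 1))"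
  have \<eta>: "\<eta> > 0" "B * \<eta> \<le> r / 2" using r B by (auto simp: \<eta>_def field_simps)
  let ?b = "\<lambda>j. 1 / (norm (lam j))\<^sup>2"
  let ?q = "\<lambda>x j. x\<^sup>2 / 8 + 1 / (2 * ?b j)"
  obtain X where X: "X > 0" "\<And>x S. x \<ge> X \<Longrightarrow> finite S \<Longrightarrow> S \<subseteq> I \<Longrightarrow> (\<Sum>j\<in>S. 1 / ?q x j) \<le> \<eta>"
    using small_shifted_sums[OF summable_inverse_square _ \<eta>(1)] lam_nonzero by auto
  define x where "x = max X (2 * B + 1)"
  have x: "x \<ge> X" "x > 2 * B" "x > 0" "x \<ge> B" using B by (auto simp: x_def)
  define y where "y = x + B"
  have y: "x \<le> y" "y > 0" using x B by (auto simp: y_def)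
  obtain N where N: "real N > max (2 * y) (160 * K * y\<^sup>2 / (x * r))" using reals_Archimedean2 by blast
  have q: "?q x j = x\<^sup>2 / 8 + ((Re (lam j))\<^sup>2 + (Im (lam j))\<^sup>2) / 2" for j by (simp add: cmod_power2)
  have q0: "?q x j > 0" for j unfolding q using x(3) by (intro add_pos_nonneg) auto
  have nrm: "norm (1 - of_real t / lam j) = norm (lam j - of_real t) / norm (lam j)" if "j \<in> I" for t j
    using lam_nonzero[OF that] by (simp add: norm_divide[symmetric] diff_divide_distrib)
  have sq: "(norm (lam j - of_real t))\<^sup>2 = (Re (lam j) - t)\<^sup>2 + (Im (lam j))\<^sup>2" for t j
    by (simp add: cmod_power2)
  have fac: "norm (1 - of_real v / lam j) \<le> norm (1 - of_real u / lam j) * exp (c * (1 / ?q x j))"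
    if j: "j \<in> I" and "c \<ge> 0" "?q x j \<le> (norm (lam j - of_real u))\<^sup>2"
      "(norm (lam j - of_real v))\<^sup>2 \<le> (norm (lam j - of_real u))\<^sup>2 + 2 * c" for u v c j
  proof -
    have "norm (lam j - of_real v) \<le> norm (lam j - of_real u) * exp (c * (1 / ?q x j))"
      by (rule le_mult_exp_half) (use that q0[of j] in auto)
    then have "norm (lam j - of_real v) / norm (lam j) \<le> norm (lam j - of_real u) * exp (c * (1 / ?q x j)) / norm (lam j)"
      by (rule divide_right_mono) simp
    then show ?thesis unfolding nrm[OF j] by simp
  qed
  have "norm (Re (defect (real n)) - 0) < r" if n: "n \<ge> N" for n
  proof -
    have R: "real n > 2 * y" "real n > 160 * K * y\<^sup>2 / (x * r)" using N n by linarith+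
    then have R0: "real n > 0" using y by linarith
    have small: "160 * K * y\<^sup>2 / real n < x * r"
      using R(2) R0 r x(3) by (simp add: field_simps)
    have e: "(\<Sum>j\<in>zset (2 * real n). 1 / ?q x j) \<le> \<eta>" by (rule X(2)[OF x(1) finite_zset zset_subset])
    have x2: "x\<^sup>2 \<le> y\<^sup>2" using y x by (intro power_mono) auto
    \<comment> \<open>The squared distances of \<open>lam j\<close> from \<open>x\<close> and from
      \<open>- x\<close> differ by \<open>- 4 * x * Re (lam j)\<close>, at most
      \<open>4 * B * x\<close>; half of that is the constant here.\<close>
    have l: "Re (defect (real n)) * (- x - x) \<le> 2 * B * x * \<eta> + 20 * K * ((- x)\<^sup>2 + x\<^sup>2) / real n"
    proof (rule Re_defect_bound[OF R0 _ _ _ _ fac e])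
      fix j assume j: "j \<in> I"
      let ?a = "Re (lam j)" and ?t = "Im (lam j)"
      have a: "- B \<le> ?a" "?a \<le> 0" using strip[OF j] by auto
      have 1: "x / 2 \<le> ?a + x" "- ?a \<le> ?a + x" using a x by auto
      have "(x / 2)\<^sup>2 \<le> (?a + x)\<^sup>2" "(- ?a)\<^sup>2 \<le> (?a + x)\<^sup>2"
        by (rule power_mono; use 1 x a in linarith)+
      then have "x\<^sup>2 / 4 \<le> (?a + x)\<^sup>2" "?a\<^sup>2 \<le> (?a + x)\<^sup>2" by (simp_all add: power_divide)
      moreover have "X / 8 + (A + V) / 2 \<le> U + V" if "X / 4 \<le> U" "A \<le> U" "0 \<le> V" for X A U V :: real
        using that by (simp add: field_simps)
      ultimately show "?q x j \<le> (norm (lam j - of_real (- x)))\<^sup>2"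
        unfolding q sq diff_minus_eq_add by (metis zero_le_power2)
      have "- ?a * x \<le> B * x" using a x by (intro mult_right_mono) auto
      then show "(norm (lam j - of_real x))\<^sup>2 \<le> (norm (lam j - of_real (- x)))\<^sup>2 + 2 * (2 * B * x)"
        unfolding sq by (simp add: power2_eq_square algebra_simps)
    qed (use R x y B reflect(1)[of x] nonzero(2)[of x] in auto)
    \<comment> \<open>Between \<open>- y\<close> and \<open>x\<close> the squared distances differ
      by \<open>(x + y) * (2 * Re (lam j) + B)\<close>, at most \<open>B * (x + y)\<close>, because
      \<open>y\<close> exceeds \<open>x\<close> by exactly \<open>B\<close>.\<close>
    have u: "Re (defect (real n)) * (x - - y) \<le> B * (x + y) / 2 * \<eta> + 20 * K * (x\<^sup>2 + (- y)\<^sup>2) / real n"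
    proof (rule Re_defect_bound[OF R0 _ _ _ _ fac e])
      fix j assume j: "j \<in> I"
      let ?a = "Re (lam j)" and ?t = "Im (lam j)"
      have a: "- B \<le> ?a" "?a \<le> 0" using strip[OF j] by auto
      have "(?a - x)\<^sup>2 + ?t\<^sup>2 = (x\<^sup>2 / 8 + (?a\<^sup>2 + ?t\<^sup>2) / 2) + (7 / 8 * x\<^sup>2 + ?a\<^sup>2 / 2 + ?t\<^sup>2 / 2 + 2 * (- ?a * x))"
        by (simp add: field_simps power2_eq_square)
      moreover have "0 \<le> 7 / 8 * x\<^sup>2 + ?a\<^sup>2 / 2 + ?t\<^sup>2 / 2 + 2 * (- ?a * x)"
        by (intro add_nonneg_nonneg mult_nonneg_nonneg) (use a x in auto)
      ultimately show "?q x j \<le> (norm (lam j - of_real x))\<^sup>2" unfolding q sq by linarith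
      have "0 \<le> (x + y) * (- 2 * ?a)" by (rule mult_nonneg_nonneg) (use a x y in auto)
      then show "(norm (lam j - of_real (- y)))\<^sup>2 \<le> (norm (lam j - of_real x))\<^sup>2 + 2 * (B * (x + y) / 2)"
        unfolding sq y_def by (simp add: power2_eq_square algebra_simps)
    qed (use R x y B reflect(2)[of x] nonzero(1)[of x] in \<open>auto simp: y_def\<close>)
    let ?d = "Re (defect (real n))" and ?E = "40 * K * y\<^sup>2 / real n"
    have E: "4 * ?E < x * r" using small by (simp add: mult_ac)
    have xB: "x * (B * \<eta>) \<le> x * (r / 2)" "(x + y) * (B * \<eta>) \<le> (x + y) * (r / 2)"
      using x(3) y \<eta>(2) by (intro mult_left_mono; simp)+
    have pos: "0 < x * r" "x * r < (x + y) * r" using x(3) y(2) r by (auto simp: distrib_right)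
    have "20 * K * ((- x)\<^sup>2 + x\<^sup>2) / real n \<le> ?E"
      using x2 K R0 by (intro divide_right_mono) auto
    moreover have "?d * (- x - x) = - 2 * (x * ?d)" "2 * B * x * \<eta> = 2 * (x * (B * \<eta>))" by simp_all
    ultimately have "- (x * ?d) < x * r" using l E xB(1) pos(1) by linarith
    then have "x * (- ?d) < x * r" by simp
    then have 1: "- ?d < r" using x(3) by (simp only: mult_less_cancel_left_pos)
    have "20 * K * (x\<^sup>2 + (- y)\<^sup>2) \<le> 40 * K * y\<^sup>2" using x2 K by (simp add: distrib_left)
    then have "20 * K * (x\<^sup>2 + (- y)\<^sup>2) / real n \<le> ?E" using R0 by (intro divide_right_mono) auto
    moreover have "?d * (x - - y) = (x + y) * ?d" "B * (x + y) / 2 * \<eta> = (x + y) * (B * \<eta>) / 2" by simp_all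
    ultimately have "(x + y) * ?d < (x + y) * r" using u E xB(2) pos by linarith
    then have "?d < r" using x(3) y(2) by (simp only: mult_less_cancel_left_pos add_pos_pos)
    with 1 show ?thesis by (simp add: abs_less_iff)
  qed
  then show "\<exists>N. \<forall>n\<ge>N. norm (Re (defect (real n)) - 0) < r" by blast
qed

end

locale paired_zero_enumeration = reflected_zero_enumeration D lam "UNIV - {0}" K B F T
  for D and lam :: "int \<Rightarrow> complex" and K B F T +
  assumes Im_neg: "\<And>j. j \<noteq> 0 \<Longrightarrow> Im (lam (- j)) = - Im (lam j)"
    and cnj_neg: "\<And>j. j \<noteq> 0 \<Longrightarrow> Im (lam j) \<noteq> 0 \<Longrightarrow> lam (- j) = cnj (lam j)"
    and T0_real: "Im (T $ 0) = 0"
begin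

text \<open>For a nonreal eigenvalue the pair is 2 Re \<lambda> / |\<lambda>|^2, which the strip
  makes comparable to the inverse square; the labels of real eigenvalues lie in the finite set
  \<open>zset B\<close>. So the pairs are absolutely summable, and their sum can be found along
  discs, where the defect is available.\<close>

theorem inverse_symmetric_limit:
  "(\<lambda>N. (\<Sum>j\<in>{- int N..-1}. inverse (lam j)) + (\<Sum>j\<in>{1..int N}. inverse (lam j))) \<longlonglongrightarrow> T $ 0"
proof -
  define p where "p j = inverse (lam j) + inverse (lam (- j))" for j
  let ?b = "\<lambda>j. 1 / (norm (lam j))\<^sup>2"
  have Im_inv: "Im (inverse (lam (- j))) = - Im (inverse (lam j))" if j: "j \<noteq> 0" for j
    using Im_neg[OF j] cnj_neg[OF j] by (cases "Im (lam j) = 0") (simp_all add: inverse_complex.simps)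
  have Imp: "Im (p j) = 0" if "j \<noteq> 0" for j using Im_inv[OF that] by (simp add: p_def)
  have refl_sum: "(\<Sum>j\<in>uminus ` S. inverse (lam j)) + (\<Sum>j\<in>S. inverse (lam j)) = sum p S" for S :: "int set"
    unfolding p_def by (simp add: sum.reindex sum.distrib add.commute)
  have p_bound: "norm (p j) \<le> 2 * B * ?b j + (if j \<in> zset B then norm (p j) else 0)" if j: "j \<noteq> 0" for j
  proof (cases "Im (lam j) = 0")
    case True
    then have "norm (lam j) = \<bar>Re (lam j)\<bar>" by (simp add: cmod_eq_Re)
    then have "j \<in> zset B" using strip[of j] j by (auto simp: zset_def)
    then show ?thesis using B by simp
  next
    case False
    have "p j = of_real (2 * Re (inverse (lam j)))"
      unfolding p_def cnj_neg[OF j False] complex_cnj_inverse[symmetric] by (simp add: complex_eq_iff)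
    then have "norm (p j) = \<bar>2 * Re (inverse (lam j))\<bar>" by (simp only: norm_of_real)
    also have "\<dots> = 2 * (\<bar>Re (lam j)\<bar> / (norm (lam j))\<^sup>2)"
      by (simp add: inverse_complex.simps cmod_power2 abs_divide abs_mult)
    also have "\<dots> \<le> 2 * (B / (norm (lam j))\<^sup>2)" using strip[of j] j by (intro mult_left_mono divide_right_mono) auto
    finally have "norm (p j) \<le> 2 * B * ?b j" by simp
    moreover have "0 \<le> (if j \<in> zset B then norm (p j) else 0)" by simp
    ultimately show ?thesis by linarith
  qed
  have "p summable_on {1..}"
  proof (rule bounded_sums_summable_on)
    fix S assume S: "finite S" "S \<subseteq> {1 :: int..}"
    have "(\<Sum>j\<in>S. norm (p j)) \<le> (\<Sum>j\<in>S. 2 * B * ?b j + (if j \<in> zset B then norm (p j) else 0))"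
      by (rule sum_mono, rule p_bound) (use S in auto)
    also have "\<dots> = 2 * B * sum ?b S + (\<Sum>j\<in>S \<inter> zset B. norm (p j))"
      by (simp add: sum.distrib sum_distrib_left sum.inter_restrict[OF S(1)])
    also have "\<dots> \<le> 2 * B * infsum ?b (UNIV - {0}) + (\<Sum>j\<in>zset B. norm (p j))"
      using B S by (intro add_mono mult_left_mono finite_sum_le_infsum[OF summable_inverse_square] sum_mono2[OF finite_zset]) auto
    finally show "(\<Sum>j\<in>S. norm (p j)) \<le> 2 * B * infsum ?b (UNIV - {0}) + (\<Sum>j\<in>zset B. norm (p j))" .
  qed
  then obtain P where P: "(p has_sum P) {1..}" by (auto simp: summable_on_def)
  have lim_p: "(\<lambda>n. sum p (zset (2 * real n) \<inter> {1..})) \<longlonglongrightarrow> P"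
  proof (rule has_sum_exhaustion[OF P])
    show "eventually (\<lambda>n. j \<in> zset (2 * real n) \<inter> {1..}) sequentially" if "j \<in> {1..}" for j
      using eventually_zset[of j] that by (auto elim: eventually_mono)
  qed (use finite_zset in auto)
  obtain N0 where N0: "real N0 \<ge> B" using real_arch_simple by blast
  \<comment> \<open>Real eigenvalues paired by \<open>j\<close> and \<open>- j\<close> may differ in
    modulus. Once the radius exceeds \<open>B\<close> the disc contains both, so its set of labels
    is symmetric.\<close>
  have zs: "(\<Sum>j\<in>zset (2 * real n). inverse (lam j)) = sum p (zset (2 * real n) \<inter> {1..})" if n: "n \<ge> N0" for n
  proof -
    let ?S = "zset (2 * real n) \<inter> {1..}"
    have sym: "- j \<in> zset (2 * real n)" if j: "j \<in> zset (2 * real n)" for j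
    proof (cases "Im (lam j) = 0")
      case True
      have j0: "j \<noteq> 0" using j by (simp add: zset_def)
      then have "Im (lam (- j)) = 0" using True Im_neg[of j] by simp
      then have "norm (lam (- j)) = \<bar>Re (lam (- j))\<bar>" by (simp add: cmod_eq_Re)
      also have "\<dots> \<le> B" using strip[of "- j"] j0 by auto
      also have "\<dots> \<le> 2 * real n" using N0 n B by linarith
      finally show ?thesis using j0 by (simp add: zset_def)
    next
      case False
      then show ?thesis using j cnj_neg[of j] by (auto simp: zset_def)
    qed
    have "zset (2 * real n) = uminus ` ?S \<union> ?S"
    proof
      show "uminus ` ?S \<union> ?S \<subseteq> zset (2 * real n)" using sym by auto
      show "zset (2 * real n) \<subseteq> uminus ` ?S \<union> ?S"
      proof
        fix j assume j: "j \<in> zset (2 * real n)"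
        then have "j \<noteq> 0" by (simp add: zset_def)
        then have "j \<ge> 1 \<or> - j \<ge> 1" by linarith
        then show "j \<in> uminus ` ?S \<union> ?S" using j sym[OF j] by (auto intro: rev_image_eqI[of "- j"])
      qed
    qed
    then have "(\<Sum>j\<in>zset (2 * real n). inverse (lam j)) = (\<Sum>j\<in>uminus ` ?S \<union> ?S. inverse (lam j))" by simp
    also have "\<dots> = (\<Sum>j\<in>uminus ` ?S. inverse (lam j)) + (\<Sum>j\<in>?S. inverse (lam j))"
      by (rule sum.union_disjoint) (use finite_zset in auto)
    finally show ?thesis by (simp only: refl_sum)
  qed
  \<comment> \<open>\<open>Re_defect_limit\<close> takes care of the real part; the imaginary part
    is 0 from some \<open>n\<close> on, because the pairs and \<open>T $ 0\<close> are real.\<close>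
  have "(\<lambda>n. defect (real n)) \<longlonglongrightarrow> 0"
  proof (rule Lim_transform_eventually)
    show "(\<lambda>n. complex_of_real (Re (defect (real n)))) \<longlonglongrightarrow> 0"
      using tendsto_of_real[OF Re_defect_limit, where 'a = complex] by simp
    show "eventually (\<lambda>n. complex_of_real (Re (defect (real n))) = defect (real n)) sequentially"
    proof (rule eventually_sequentiallyI[of N0])
      fix n assume "n \<ge> N0"
      then have "Im (defect (real n)) = 0"
        unfolding defect_def zs[OF \<open>n \<ge> N0\<close>] using T0_real Imp by (simp add: Im_sum)
      then show "complex_of_real (Re (defect (real n))) = defect (real n)" by (simp add: complex_eq_iff)
    qed
  qed
  then have "(\<lambda>n. defect (real n) + T $ 0) \<longlonglongrightarrow> 0 + T $ 0" by (intro tendsto_add tendsto_const)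
  then have "(\<lambda>n. \<Sum>j\<in>zset (2 * real n). inverse (lam j)) \<longlonglongrightarrow> T $ 0" by (simp add: defect_def)
  then have "(\<lambda>n. sum p (zset (2 * real n) \<inter> {1..})) \<longlonglongrightarrow> T $ 0"
    by (rule Lim_transform_eventually) (rule eventually_sequentiallyI[of N0], simp add: zs)
  then have PT: "P = T $ 0" using lim_p LIMSEQ_unique by blast
  have "(\<lambda>N. sum p {1..int N}) \<longlonglongrightarrow> P"
  proof (rule has_sum_exhaustion[OF P])
    show "eventually (\<lambda>N. j \<in> {1..int N}) sequentially" if "j \<in> {1..}" for j
      by (rule eventually_sequentiallyI[of "nat j"]) (use that in auto)
  qed auto
  moreover have "(\<Sum>j\<in>{- int N..-1}. inverse (lam j)) + (\<Sum>j\<in>{1..int N}. inverse (lam j)) = sum p {1..int N}" for N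
  proof -
    have "{- int N..-1} = uminus ` {1..int N}" by simp
    then show ?thesis using refl_sum[of "{1..int N}"] by simp
  qed
  ultimately show ?thesis using PT by simp
qed

end

section \<open>The trace formulas\<close>

lemma (in bounded_damping) exists_order:
  "\<exists>m. (\<forall>i<m. (deriv ^^ i) chfun z = 0) \<and> (deriv ^^ m) chfun z \<noteq> 0"
proof -
  have "\<exists>m. (deriv ^^ m) chfun z \<noteq> 0"
  proof (rule ccontr)
    assume "\<not> ?thesis"
    then have "chfun 0 = 0"
      by (intro holomorphic_fun_eq_0_on_connected[OF holomorphic_chfun open_UNIV connected_UNIV]) auto
    then show False by (simp add: chfun_0)
  qed
  then show ?thesis using exists_least_iff[of "\<lambda>m. (deriv ^^ m) chfun z \<noteq> 0"] by blast
qed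

text \<open>The order of a zero is the index of the first nonzero derivative, and
  \<open>algebraic_multiplicity_eq\<close> identifies it with the size of the fibre of the
  labelling.\<close>

lemma (in nonneg_damping) eigenvalue_enumeration:
  assumes am: "\<alpha> \<in> borel_measurable unit_lebesgue" and ab: "AE x in unit_lebesgue. \<alpha> x = \<beta> x"
    and lam: "eigenvalue_labelling \<alpha> lam"
  shows "paired_zero_enumeration chfun lam (B + 1) B (Abs_fps (\<lambda>n. of_real (chard \<beta> $ n)))
    (Abs_fps (\<lambda>n. of_real (tser \<beta> $ n)))"
proof -
  have ev: "damped_wave_eigenvalue \<alpha> z \<longleftrightarrow> chfun z = 0" for z by (rule damped_wave_eigenvalue_iff[OF am ab])
  have zeros: "lam ` (UNIV - {0}) = {z. chfun z = 0}"
    and fin: "\<And>z. chfun z = 0 \<Longrightarrow> finite {j. j \<noteq> 0 \<and> lam j = z}"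
    and mult: "\<And>z. chfun z = 0 \<Longrightarrow> enat (card {j. j \<noteq> 0 \<and> lam j = z}) = algebraic_multiplicity \<alpha> z"
    and neg: "\<And>j. j \<noteq> 0 \<Longrightarrow> Im (lam (- j)) = - Im (lam j)"
    and cnj: "\<And>j. j \<noteq> 0 \<Longrightarrow> lam j \<notin> \<real> \<Longrightarrow> lam (- j) = cnj (lam j)"
    using lam unfolding eigenvalue_labelling_def ev by simp_all
  have I: "{j \<in> UNIV - {0}. lam j = z} = {j. j \<noteq> 0 \<and> lam j = z}" for z by auto
  have order: "(\<forall>i<card {j. j \<noteq> 0 \<and> lam j = z}. (deriv ^^ i) chfun z = 0) \<and>
      (deriv ^^ card {j. j \<noteq> 0 \<and> lam j = z}) chfun z \<noteq> 0" if z: "chfun z = 0" for z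
  proof -
    obtain m where m: "\<forall>i<m. (deriv ^^ i) chfun z = 0" "(deriv ^^ m) chfun z \<noteq> 0" using exists_order by blast
    have "algebraic_multiplicity \<alpha> z = enat m" by (rule algebraic_multiplicity_eq[OF am ab]) (use m in auto)
    then show ?thesis using m mult[OF z] by simp
  qed
  have D0: "chfun z = 0" if "j \<noteq> 0" "z = lam j" for j z using zeros that by blast
  show ?thesis
  proof
    show "norm (chfun z) \<le> exp ((B + 1) * norm z)" for z by (rule norm_chfun_le)
    show "- B \<le> Re (lam j) \<and> Re (lam j) \<le> 0" if "j \<in> UNIV - {0}" for j
      by (rule chfun_zero_strip) (use D0 that in auto)
    show "chfun has_fps_expansion Abs_fps (\<lambda>n. of_real (chard \<beta> $ n))" by (rule chfun_fps)
    have "(chard \<beta> * tser \<beta>) $ n = - fps_deriv (chard \<beta>) $ n" for n by (simp add: chard_mult_tser[OF b])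
    then have "complex_of_real ((chard \<beta> * tser \<beta>) $ n) = complex_of_real (- fps_deriv (chard \<beta>) $ n)" for n by simp
    then show "Abs_fps (\<lambda>n. complex_of_real (chard \<beta> $ n)) * Abs_fps (\<lambda>n. of_real (tser \<beta> $ n)) =
        - fps_deriv (Abs_fps (\<lambda>n. of_real (chard \<beta> $ n)))"
      by (simp add: fps_eq_iff fps_mult_nth)
    fix x :: real assume x: "x \<ge> B"
    have r: "chreal (- x) \<ge> 1" "chreal x \<ge> 1" "chreal (- x - B) \<ge> 1"
      by (rule chreal_ge_1; use x B0 in linarith)+
    show "norm (chfun (of_real (- x))) \<le> norm (chfun (of_real x))"
      "norm (chfun (of_real x)) \<le> norm (chfun (of_real (- x - B)))"
      unfolding chfun_of_real norm_of_real using r chreal_reflect[OF x] by linarith+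
    show "chfun (of_real x) \<noteq> 0" "chfun (of_real (- x)) \<noteq> 0"
      unfolding chfun_of_real using r by auto
  next
    fix j :: int assume "j \<noteq> 0" "Im (lam j) \<noteq> 0"
    then show "lam (- j) = cnj (lam j)" using cnj[of j] complex_is_Real_iff by blast
  qed (use holomorphic_chfun chfun_0 B0 zeros fin order neg in \<open>simp_all add: I\<close>)
qed

theorem proposition4p1:
  fixes a b :: real and \<alpha> :: "real \<Rightarrow> real" and lam :: "int \<Rightarrow> complex" and n :: nat
  assumes "\<alpha> \<in> borel_measurable unit_lebesgue"
    and "0 \<le> 2 * a"
    and "AE x in unit_lebesgue. 2 * a \<le> \<alpha> x \<and> \<alpha> x \<le> 2 * b"
    and "eigenvalue_labelling \<alpha> lam"
    and "n \<ge> 1"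
  shows "\<exists>t. has_trace ell2_measure (matrix_operator (M_matrix \<alpha> n)) t \<and>
             has_trace unit_lebesgue (R_op \<alpha> (n - 1)) t \<and>
             (if n = 1
              then (\<lambda>N. (\<Sum>j\<in>{- int N..-1}. inverse (lam j)) + (\<Sum>j\<in>{1..int N}. inverse (lam j)))
                     \<longlonglongrightarrow> t
              else ((\<lambda>j. inverse (lam j) ^ n) has_sum t) (UNIV - {0}))"
proof -
  obtain m where n: "n = Suc m" using assms(5) by (cases n) auto
  \<comment> \<open>a version of \<open>\<alpha>\<close> that satisfies the bounds everywhere\<close>
  define \<beta> where "\<beta> x = max 0 (min (\<alpha> x) \<bar>2 * b\<bar>)" for x
  have ab: "AE x in unit_lebesgue. \<alpha> x = \<beta> x"
    using assms(3) by eventually_elim (use assms(2) in \<open>auto simp: \<beta>_def\<close>)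
  have \<beta>: "0 \<le> \<beta> x \<and> \<beta> x \<le> \<bar>2 * b\<bar>" for x by (simp add: \<beta>_def)
  have b\<beta>: "bfun \<beta>"
  proof (rule bfunI)
    show "\<beta> \<in> borel_measurable unit_lebesgue" unfolding \<beta>_def using assms(1) by measurable
    show "\<bar>\<beta> x\<bar> \<le> \<bar>2 * b\<bar>" if "x \<in> {0<..<1}" for x using \<beta>[of x] by simp
  qed
  \<comment> \<open>The absolute value makes the bound nonnegative by its form, as the locale
    requires.\<close>
  interpret nonneg_damping \<beta> "\<bar>2 * b\<bar>"
    by unfold_locales (use b\<beta> \<beta> in auto)
  interpret paired_zero_enumeration chfun lam "\<bar>2 * b\<bar> + 1" "\<bar>2 * b\<bar>"
    "Abs_fps (\<lambda>n. of_real (chard \<beta> $ n))" "Abs_fps (\<lambda>n. of_real (tser \<beta> $ n))"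
    by (rule eigenvalue_enumeration[OF assms(1) ab assms(4)])
  show ?thesis
  proof (intro exI[of _ "of_real (tser \<beta> $ m)"] conjI)
    show "has_trace ell2_measure (matrix_operator (M_matrix \<alpha> n)) (of_real (tser \<beta> $ m))"
      unfolding n by (rule has_trace_M_matrix[OF b\<beta> assms(1) ab])
    show "has_trace unit_lebesgue (R_op \<alpha> (n - 1)) (of_real (tser \<beta> $ m))"
      unfolding n diff_Suc_1 by (rule has_trace_R_op[OF b\<beta> assms(1) ab])
    show "if n = 1
      then (\<lambda>N. (\<Sum>j\<in>{- int N..-1}. inverse (lam j)) + (\<Sum>j\<in>{1..int N}. inverse (lam j)))
             \<longlonglongrightarrow> complex_of_real (tser \<beta> $ m)
      else ((\<lambda>j. inverse (lam j) ^ n) has_sum complex_of_real (tser \<beta> $ m)) (UNIV - {0})"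
      using inverse_symmetric_limit has_sum_inverse_power[of m] by (cases m) (simp_all add: n)
  qed
qed

end
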